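(* Let $\mathscr L_1,\mathscr L_2,\mathscr L_3$ be complex separable Hilbert spaces. For functions $\Upsilon_{12}:\mathbb D^2\to\mathcal B(\mathscr L_1,\mathscr L_2)$ and $\Upsilon_{32}:\mathbb D^2\to\mathcal B(\mathscr L_3,\mathscr L_2)$, the following are equivalent: (1) there exists $\Upsilon_{31}\in H^\infty(\mathbb D^2,\mathcal B(\mathscr L_3,\mathscr L_1))$ with $\|\Upsilon_{31}\|_{\infty,\mathbb D^2}\le1$ such that $\Upsilon_{12}(z)\Upsilon_{31}(z)=\Upsilon_{32}(z)$ for every $z\in\mathbb D^2$; (2) for every finite subset $F=\{z_1,\dots,z_n\}\subset\mathbb P$ and for every $\mathcal B(\mathscr L_2)$-valued admissible kernel $k$ on $\mathbb P$, $$\Big[\Big(\Upsilon_{12}(z_i^{(1)},z_i^{(3)})\Upsilon_{12}(z_j^{(1)},z_j^{(3)})^*-\Upsilon_{32}(z_i^{(1)},z_i^{(3)})\Upsilon_{32}(z_j^{(1)},z_j^{(3)})^*\Big)\otimes k(z_i,z_j)\Big]_{i,j=1}^n\ge0;$$ (3) there exist completely positive kernels $\xi,\nabla:\mathbb P\times\mathbb P\to\mathcal B(C(\overline{\mathbb D}),\mathcal B(\mathscr L_2))$ and a weak kernel $\delta:\mathbb P\times\mathbb P\to\mathcal B(\mathscr L_2)$ such that for all $z,w\in\mathbb P$, $$\Upsilon_{12}(z^{(1)},z^{(3)})\Upsilon_{12}(w^{(1)},w^{(3)})^*-\Upsilon_{32}(z^{(1)},z^{(3)})\Upsilon_{32}(w^{(1)},w^{(3)})^*$$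 $$=\xi(z,w)\big(1-\mathrm J(z)\overline{\mathrm J(w)}\big)+\nabla(z,w)\big(1-\mathrm j(z)\overline{\mathrm j(w)}\big)+\Big(1-\frac{z^{(2)}\overline{w}^{(2)}}{4}\Big)\delta(z,w).$$
   Context: All Hilbert spaces are complex and separable; operators are bounded and linear; $\mathcal B(\mathcal X,\mathcal Y)$ denotes bounded linear maps from $\mathcal X$ to $\mathcal Y$ and $\mathcal B(\mathcal X)=\mathcal B(\mathcal X,\mathcal X)$. $\mathbb D$ is the open unit disc in $\mathbb C$, $\overline{\mathbb D}$ its closure, $C(\overline{\mathbb D})$ the space of continuous complex functions on $\overline{\mathbb D}$. $H^\infty(\mathbb D^2,\mathcal B(\mathcal X,\mathcal Y))$ is the space of bounded $\mathcal B(\mathcal X,\mathcal Y)$-valued holomorphic functions on $\mathbb D^2$, with supremum norm $\|\cdot\|_{\infty,\mathbb D^2}$. The pentablock is $\mathbb P=\{(a_{21},\operatorname{tr}A,\det A)\in\mathbb C^3: A=[a_{ij}]\in M_2(\mathbb C),\ \|A\|<1\}$; points are written $z=(z^{(1)},z^{(2)},z^{(3)})$. If $z\in\mathbb P$ then $(z^{(1)},z^{(3)})\in\mathbb D^2$. For $\alpha\in\overline{\mathbb D}$ put $$\Phi_\alpha(z^{(2)},z^{(3)})=\frac{2\alpha z^{(3)}-z^{(2)}}{2-\alpha z^{(2)}},\qquad \psi_\alpha(z^{(1)},z^{(2)},z^{(3)})=\frac{(1-|\alpha|^2)z^{(1)}}{1-\alpha z^{(2)}+\alpha^2z^{(3)}}.$$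 For $z\in\mathbb P$ define the continuous functions $\mathrm J(z),\mathrm j(z)\in C(\overline{\mathbb D})$ by $\mathrm J(z)(\alpha)=\psi_\alpha(z)$ and $\mathrm j(z)(\alpha)=\Phi_\alpha(z^{(2)},z^{(3)})$; both have supremum norm $<1$. For a Hilbert space $\mathscr L$, a function $k:\mathbb P\times\mathbb P\to\mathcal B(\mathscr L)$ is positive semi-definite (a $\mathcal B(\mathscr L)$-valued weak kernel) if $\sum_{i,j=1}^n\langle k(z_i,z_j)v_j,v_i\rangle\ge0$ for all $n$, $z_1,\dots,z_n\in\mathbb P$, $v_1,\dots,v_n\in\mathscr L$; it is a $\mathcal B(\mathscr L)$-valued kernel if moreover $k(z,z)\ne0$ for all $z\in\mathbb P$. A $\mathcal B(\mathscr L)$-valued kernel $k$ is admissible if for all $\alpha\in\overline{\mathbb D}$ the functions $(1-\tfrac{z^{(2)}\overline{w}^{(2)}}{4})k(z,w)$, $(1-\Phi_\alpha(z^{(2)},z^{(3)})\overline{\Phi_\alpha(w^{(2)},w^{(3)})})k(z,w)$ and $(1-\psi_\alpha(z)\overline{\psi_\alpha(w)})k(z,w)$ are positive semi-definite in $(z,w)$. A map $\xi:\mathbb P\times\mathbb P\to\mathcal B(C(\overline{\mathbb D}),\mathcal B(\mathscr L))$ is a completely positive kernel if $\sum_{i,j=1}^n\langle\xi(z_i,z_j)(h_i\overline{h_j})v_j,v_i\rangle\ge0$ for all $n$, $z_i\in\mathbb P$, $h_i\in C(\overline{\mathbb D})$, $v_i\in\mathscr L$. *)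

theory Defs
  imports "HOL-Analysis.Analysis"
begin

section \<open>Complex vector spaces and complex Hilbert spaces\<close>

class complex_vector = real_vector +
  fixes scaleC :: "complex \<Rightarrow> 'a \<Rightarrow> 'a"  (infixr \<open>*\<^sub>C\<close> 75)
  assumes scaleC_add_right: "a *\<^sub>C (x + y) = a *\<^sub>C x + a *\<^sub>C y"
    and scaleC_add_left: "(a + b) *\<^sub>C x = a *\<^sub>C x + b *\<^sub>C x"
    and scaleC_scaleC: "a *\<^sub>C (b *\<^sub>C x) = (a * b) *\<^sub>C x"
    and scaleR_scaleC: "r *\<^sub>R x = complex_of_real r *\<^sub>C x"
lemma scaleC_one [simp]: "1 *\<^sub>C x = (x::'a::complex_vector)"
  using scaleR_scaleC[of 1 x, symmetric] by simp

lemma scaleC_zero_left [simp]: "0 *\<^sub>C x = (0::'a::complex_vector)"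
  using scaleR_scaleC[of 0 x, symmetric] by simp

lemma scaleC_zero_right [simp]: "a *\<^sub>C 0 = (0::'a::complex_vector)"
  using scaleC_add_right[of a 0 0] by simp

lemma scaleC_minus_right: "a *\<^sub>C (- x) = - (a *\<^sub>C (x::'a::complex_vector))"
  using scaleC_add_right[of a "- x" x] by (simp add: eq_neg_iff_add_eq_0)

lemma scaleC_minus_left: "(- a) *\<^sub>C x = - (a *\<^sub>C (x::'a::complex_vector))"
  using scaleC_add_left[of "- a" a x] by (simp add: eq_neg_iff_add_eq_0)

lemma scaleC_diff_right: "a *\<^sub>C (x - y) = a *\<^sub>C x - a *\<^sub>C (y::'a::complex_vector)"
  using scaleC_add_right[of a x "- y"] by (simp add: scaleC_minus_right)

lemma scaleC_scaleR_commute: "a *\<^sub>C (r *\<^sub>R x) = r *\<^sub>R (a *\<^sub>C (x::'a::complex_vector))"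
  by (simp add: scaleR_scaleC scaleC_scaleC mult.commute)

class complex_normed_vector = complex_vector + real_normed_vector +
  assumes norm_scaleC: "norm (a *\<^sub>C x) = cmod a * norm x"

lemma bounded_linear_scaleC: "bounded_linear (\<lambda>x :: 'a::complex_normed_vector. a *\<^sub>C x)"
  by (rule bounded_linear_intro[where K = "cmod a"])
    (simp_all add: scaleC_add_right scaleC_scaleR_commute norm_scaleC mult.commute)

text \<open>The inner product is linear in its first argument. Building on \<^class>\<open>real_inner\<close>, with
  \<open>inner\<close> the real part of \<open>cinner\<close>, makes \<open>norm x = sqrt (Re (cinner x x))\<close> and gives access to the
  library on real inner product spaces.\<close>

class complex_inner = complex_vector + real_inner +
  fixes cinner :: "'a \<Rightarrow> 'a \<Rightarrow> complex"
  assumes cinner_commute: "cinner x y = cnj (cinner y x)"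
    and cinner_add_left: "cinner (x + y) z = cinner x z + cinner y z"
    and cinner_scaleC_left: "cinner (a *\<^sub>C x) y = a * cinner x y"
    and inner_eq_Re_cinner: "inner x y = Re (cinner x y)"
begin

lemma cinner_add_right: "cinner x (y + z) = cinner x y + cinner x z"
  by (metis cinner_add_left cinner_commute complex_cnj_add)

lemma cinner_scaleC_right: "cinner x (a *\<^sub>C y) = cnj a * cinner x y"
  by (metis cinner_scaleC_left cinner_commute complex_cnj_mult)

lemma cinner_zero_left [simp]: "cinner 0 y = 0"
  using cinner_add_left[of 0 0 y] by simp

lemma cinner_zero_right [simp]: "cinner x 0 = 0"
  using cinner_add_right[of x 0 0] by simp

lemma cinner_minus_left: "cinner (- x) y = - cinner x y"
  by (rule group_add_class.minus_unique[symmetric]) (simp flip: cinner_add_left)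

lemma cinner_minus_right: "cinner x (- y) = - cinner x y"
  by (rule group_add_class.minus_unique[symmetric]) (simp flip: cinner_add_right)

lemma cinner_diff_left: "cinner (x - y) z = cinner x z - cinner y z"
  using cinner_add_left[of x "- y" z] by (simp add: cinner_minus_left)

lemma cinner_diff_right: "cinner x (y - z) = cinner x y - cinner x z"
  using cinner_add_right[of x y "- z"] by (simp add: cinner_minus_right)

lemma cinner_self: "cinner x x = complex_of_real ((norm x)\<^sup>2)"
proof -
  have "Im (cinner x x) = 0"
    using arg_cong[OF cinner_commute[of x x], of Im] by simp
  then show ?thesis
    by (simp add: complex_eq_iff norm_eq_sqrt_inner flip: inner_eq_Re_cinner)
qed

lemma cinner_norm_scaleC: "norm (a *\<^sub>C x) = cmod a * norm x"
proof -
  have "complex_of_real ((norm (a *\<^sub>C x))\<^sup>2) = (a * cnj a) * complex_of_real ((norm x)\<^sup>2)"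
    unfolding cinner_self[symmetric] cinner_scaleC_left cinner_scaleC_right
    by (simp add: mult.left_commute)
  also have "\<dots> = complex_of_real ((cmod a * norm x)\<^sup>2)"
    using complex_norm_square[of a] by (simp add: power_mult_distrib)
  finally have "(norm (a *\<^sub>C x))\<^sup>2 = (cmod a * norm x)\<^sup>2"
    using of_real_eq_iff by blast
  moreover have "0 \<le> norm (a *\<^sub>C x)" "0 \<le> norm x"
    by (simp_all add: norm_eq_sqrt_inner)
  ultimately show ?thesis
    by (simp add: power2_eq_iff_nonneg)
qed

end

subclass (in complex_inner) complex_normed_vector
  by unfold_locales (rule cinner_norm_scaleC)

class chilbert_space = complex_inner + complete_space

lemma cinner_eqI:
  fixes x y :: "'a::complex_inner"
  assumes "\<And>u. cinner x u = cinner y u"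
  shows "x = y"
proof -
  have "cinner (x - y) (x - y) = 0"
    using assms by (simp add: cinner_diff_left)
  then show ?thesis
    by (simp add: cinner_self)
qed

lemma Cauchy_Schwarz_cinner:
  fixes x y :: "'a::complex_inner"
  shows "cmod (cinner x y) \<le> norm x * norm y"
proof -
  define c where "c = cnj (sgn (cinner x y))"
  have c: "cmod c \<le> 1" by (simp add: c_def norm_sgn)
  have "complex_of_real (cmod (cinner x y)) = c * cinner x y"
    by (simp add: c_def sgn_eq complex_norm_square[symmetric] power2_eq_square field_simps)
  then have "cmod (cinner x y) = Re (cinner (c *\<^sub>C x) y)"
    by (metis Re_complex_of_real cinner_scaleC_left)
  also have "\<dots> \<le> norm (c *\<^sub>C x) * norm y"
    by (metis inner_eq_Re_cinner norm_cauchy_schwarz)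
  also have "\<dots> \<le> norm x * norm y"
    using c by (simp add: norm_scaleC mult_left_le_one_le mult_right_mono)
  finally show ?thesis .
qed

lemma bounded_linear_cinner_left:
  fixes y :: "'a::complex_inner"
  shows "bounded_linear (\<lambda>x. cinner x y)"
proof (rule bounded_linear_intro[where K = "norm y"])
  show "cinner (r *\<^sub>R x) y = r *\<^sub>R cinner x y" for r and x :: 'a
    by (simp only: scaleR_scaleC cinner_scaleC_left scaleR_conv_of_real)
qed (rule cinner_add_left Cauchy_Schwarz_cinner)+

instantiation complex :: complex_normed_vector
begin
definition scaleC_complex :: "complex \<Rightarrow> complex \<Rightarrow> complex"
  where "scaleC_complex a x = a * x"
instance
  by standard (auto simp: scaleC_complex_def algebra_simps norm_mult scaleR_conv_of_real)
end

instantiation prod :: (complex_normed_vector, complex_normed_vector) complex_normed_vector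
begin
definition scaleC_prod :: "complex \<Rightarrow> 'a \<times> 'b \<Rightarrow> 'a \<times> 'b"
  where "scaleC_prod a x = (a *\<^sub>C fst x, a *\<^sub>C snd x)"
instance
proof
  fix a b :: complex and x y :: "'a \<times> 'b" and r :: real
  show "a *\<^sub>C (x + y) = a *\<^sub>C x + a *\<^sub>C y" "(a + b) *\<^sub>C x = a *\<^sub>C x + b *\<^sub>C x"
    "a *\<^sub>C (b *\<^sub>C x) = (a * b) *\<^sub>C x" "r *\<^sub>R x = complex_of_real r *\<^sub>C x"
    by (auto simp: scaleC_prod_def scaleC_add_right scaleC_add_left scaleC_scaleC
        scaleR_prod_def scaleR_scaleC)
  show "norm (a *\<^sub>C x) = cmod a * norm x"
    by (simp add: scaleC_prod_def norm_prod_def norm_scaleC power_mult_distrib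
        real_sqrt_mult flip: distrib_left)
qed
end


section \<open>Bounded complex-linear operators\<close>

definition bounded_clinear :: "('a::complex_normed_vector \<Rightarrow> 'b::complex_normed_vector) \<Rightarrow> bool"
  where "bounded_clinear f \<longleftrightarrow> bounded_linear f \<and> (\<forall>a x. f (a *\<^sub>C x) = a *\<^sub>C f x)"

typedef (overloaded) ('a, 'b) cblinfun (\<open>(_ \<Rightarrow>\<^sub>C\<^sub>L /_)\<close> [22, 21] 21) =
  "{f :: 'a::complex_normed_vector \<Rightarrow> 'b::complex_normed_vector. bounded_clinear f}"
  morphisms cblinfun_apply CBlinfun
  by (rule exI[of _ "\<lambda>_. 0"]) (simp add: bounded_clinear_def)

notation cblinfun_apply (infixr \<open>*\<^sub>V\<close> 70)

setup_lifting type_definition_cblinfun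

lemma cblinfun_eqI: "(\<And>x. f *\<^sub>V x = g *\<^sub>V x) \<Longrightarrow> f = g"
  by transfer auto

instantiation cblinfun :: (complex_normed_vector, complex_normed_vector) complex_normed_vector
begin

lift_definition norm_cblinfun :: "'a \<Rightarrow>\<^sub>C\<^sub>L 'b \<Rightarrow> real" is onorm .

lift_definition zero_cblinfun :: "'a \<Rightarrow>\<^sub>C\<^sub>L 'b" is "\<lambda>x. 0"
  by (simp add: bounded_clinear_def)

lift_definition plus_cblinfun :: "'a \<Rightarrow>\<^sub>C\<^sub>L 'b \<Rightarrow> 'a \<Rightarrow>\<^sub>C\<^sub>L 'b \<Rightarrow> 'a \<Rightarrow>\<^sub>C\<^sub>L 'b"
  is "\<lambda>f g x. f x + g x"
  by (simp add: bounded_clinear_def bounded_linear_add scaleC_add_right)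

lift_definition minus_cblinfun :: "'a \<Rightarrow>\<^sub>C\<^sub>L 'b \<Rightarrow> 'a \<Rightarrow>\<^sub>C\<^sub>L 'b \<Rightarrow> 'a \<Rightarrow>\<^sub>C\<^sub>L 'b"
  is "\<lambda>f g x. f x - g x"
  by (simp add: bounded_clinear_def bounded_linear_sub scaleC_diff_right)

lift_definition uminus_cblinfun :: "'a \<Rightarrow>\<^sub>C\<^sub>L 'b \<Rightarrow> 'a \<Rightarrow>\<^sub>C\<^sub>L 'b" is "\<lambda>f x. - f x"
  by (simp add: bounded_clinear_def bounded_linear_minus scaleC_minus_right)

lift_definition scaleR_cblinfun :: "real \<Rightarrow> 'a \<Rightarrow>\<^sub>C\<^sub>L 'b \<Rightarrow> 'a \<Rightarrow>\<^sub>C\<^sub>L 'b" is "\<lambda>r f x. r *\<^sub>R f x"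
  by (simp add: bounded_clinear_def bounded_linear_const_scaleR scaleC_scaleR_commute)

lift_definition scaleC_cblinfun :: "complex \<Rightarrow> 'a \<Rightarrow>\<^sub>C\<^sub>L 'b \<Rightarrow> 'a \<Rightarrow>\<^sub>C\<^sub>L 'b" is "\<lambda>a f x. a *\<^sub>C f x"
  by (auto simp: bounded_clinear_def scaleC_scaleC mult.commute
      intro: bounded_linear_compose[OF bounded_linear_scaleC])

definition dist_cblinfun :: "'a \<Rightarrow>\<^sub>C\<^sub>L 'b \<Rightarrow> 'a \<Rightarrow>\<^sub>C\<^sub>L 'b \<Rightarrow> real"
  where "dist_cblinfun f g = norm (f - g)"

definition uniformity_cblinfun :: "(('a \<Rightarrow>\<^sub>C\<^sub>L 'b) \<times> ('a \<Rightarrow>\<^sub>C\<^sub>L 'b)) filter"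
  where "uniformity_cblinfun = (INF e\<in>{0 <..}. principal {(x, y). dist x y < e})"

definition open_cblinfun :: "('a \<Rightarrow>\<^sub>C\<^sub>L 'b) set \<Rightarrow> bool"
  where "open_cblinfun S = (\<forall>x\<in>S. \<forall>\<^sub>F (x', y) in uniformity. x' = x \<longrightarrow> y \<in> S)"

definition sgn_cblinfun :: "'a \<Rightarrow>\<^sub>C\<^sub>L 'b \<Rightarrow> 'a \<Rightarrow>\<^sub>C\<^sub>L 'b"
  where "sgn_cblinfun x = inverse (norm x) *\<^sub>R x"

instance
proof
  fix f g h :: "'a \<Rightarrow>\<^sub>C\<^sub>L 'b" and a b :: complex and r s :: real
  show "f + g + h = f + (g + h)" "f + g = g + f" "0 + f = f" "- f + f = 0" "f - g = f + - g"
    "r *\<^sub>R (f + g) = r *\<^sub>R f + r *\<^sub>R g" "(r + s) *\<^sub>R f = r *\<^sub>R f + s *\<^sub>R f"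
    "r *\<^sub>R s *\<^sub>R f = (r * s) *\<^sub>R f" "1 *\<^sub>R f = f"
    by (transfer, force simp: algebra_simps)+
  show "a *\<^sub>C (f + g) = a *\<^sub>C f + a *\<^sub>C g" "(a + b) *\<^sub>C f = a *\<^sub>C f + b *\<^sub>C f"
    "a *\<^sub>C b *\<^sub>C f = (a * b) *\<^sub>C f"
    by (transfer, simp add: scaleC_add_right scaleC_add_left scaleC_scaleC)+
  show "r *\<^sub>R f = complex_of_real r *\<^sub>C f"
    by transfer (simp add: scaleR_scaleC)
  show "norm f = 0 \<longleftrightarrow> f = 0"
    by transfer (auto simp: bounded_clinear_def onorm_eq_0)
  show "norm (f + g) \<le> norm f + norm g"
    by transfer (simp add: bounded_clinear_def onorm_triangle)
  show "norm (r *\<^sub>R f) = \<bar>r\<bar> * norm f"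
    by transfer (simp add: bounded_clinear_def onorm_scaleR)
  show "norm (a *\<^sub>C f) = cmod a * norm f"
  proof (cases "a = 0")
    case True
    then show ?thesis by transfer (simp add: onorm_zero)
  next
    case False
    have le: "norm (c *\<^sub>C k) \<le> cmod c * norm k" for c and k :: "'a \<Rightarrow>\<^sub>C\<^sub>L 'b"
    proof transfer
      fix c and k :: "'a \<Rightarrow> 'b"
      assume "bounded_clinear k"
      then have k: "bounded_linear k" by (simp add: bounded_clinear_def)
      show "onorm (\<lambda>x. c *\<^sub>C k x) \<le> cmod c * onorm k"
      proof (rule onorm_bound)
        fix x
        show "norm (c *\<^sub>C k x) \<le> cmod c * onorm k * norm x"
          using onorm[OF k, of x] by (simp add: norm_scaleC mult.assoc mult_left_mono)
      qed (simp add: onorm_pos_le[OF k])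
    qed
    have "inverse a *\<^sub>C (a *\<^sub>C f) = f"
      using False by transfer (simp add: scaleC_scaleC)
    then have "norm f \<le> cmod (inverse a) * norm (a *\<^sub>C f)"
      using le[of "inverse a" "a *\<^sub>C f"] by simp
    then have "cmod a * norm f \<le> norm (a *\<^sub>C f)"
      using False by (simp only: norm_inverse) (simp add: field_simps)
    with le[of a f] show ?thesis by simp
  qed
qed (simp_all add: dist_cblinfun_def open_cblinfun_def sgn_cblinfun_def uniformity_cblinfun_def)

end

lift_definition cblinfun_compose ::
  "'b::complex_normed_vector \<Rightarrow>\<^sub>C\<^sub>L 'c::complex_normed_vector \<Rightarrow> 'a::complex_normed_vector \<Rightarrow>\<^sub>C\<^sub>L 'b \<Rightarrow> 'a \<Rightarrow>\<^sub>C\<^sub>L 'c"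
  (infixl \<open>o\<^sub>C\<^sub>L\<close> 67) is "(\<circ>)"
  by (auto simp: bounded_clinear_def o_def bounded_linear_compose)

lemma cblinfun_bounded_clinear: "bounded_clinear ((*\<^sub>V) f)"
  using cblinfun_apply[of f] by simp

lemma cblinfun_bounded_linear: "bounded_linear ((*\<^sub>V) f)"
  using cblinfun_bounded_clinear by (auto simp: bounded_clinear_def)

lemma cblinfun_scaleC: "f *\<^sub>V (a *\<^sub>C x) = a *\<^sub>C (f *\<^sub>V x)"
  using cblinfun_bounded_clinear by (auto simp: bounded_clinear_def)

lemma cblinfun_add: "f *\<^sub>V (x + y) = (f *\<^sub>V x) + (f *\<^sub>V y)"
  by (rule linear_add[OF bounded_linear.linear[OF cblinfun_bounded_linear]])

lemma norm_cblinfun: "norm (f *\<^sub>V x) \<le> norm f * norm x"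
  by transfer (simp add: bounded_clinear_def onorm)


section \<open>Adjoints\<close>

lemma Riesz_real:
  fixes g :: "'a::{real_inner, complete_space} \<Rightarrow> real"
  assumes g: "bounded_linear g"
  shows "\<exists>y. \<forall>x. g x = inner y x"
proof -
  interpret g: bounded_linear g by (rule g)
  obtain K where K: "\<And>x. norm (g x) \<le> norm x * K"
    using g.bounded by blast
  define \<phi> where "\<phi> x = (norm x)\<^sup>2 / 2 - g x" for x
  have lower: "- (K\<^sup>2) / 2 \<le> \<phi> x" for x
  proof -
    have "g x \<le> norm x * K" using K[of x] by simp
    moreover have "0 \<le> (norm x - K)\<^sup>2" by simp
    ultimately show ?thesis by (simp add: \<phi>_def power2_diff field_simps)
  qed
  define m where "m = (INF x. \<phi> x)"
  have bdd: "bdd_below (range \<phi>)" using lower by (auto simp: bdd_below_def)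
  have m_le: "m \<le> \<phi> x" for x
    unfolding m_def by (rule cINF_lower[OF bdd]) simp
  have "\<exists>x. \<phi> x < m + 1 / Suc n" for n
  proof -
    have "Inf (range \<phi>) < m + 1 / Suc n" by (simp add: m_def)
    then show ?thesis using cInf_less_iff[OF _ bdd] by auto
  qed
  then obtain s where s: "\<And>n. \<phi> (s n) < m + 1 / Suc n" by metis
  have par: "(norm (x - y))\<^sup>2 = 4 * (\<phi> x + \<phi> y - 2 * \<phi> ((1/2) *\<^sub>R (x + y)))" for x y
    by (simp add: \<phi>_def g.add g.scaleR power2_norm_eq_inner inner_add_left inner_add_right
        inner_diff_left inner_diff_right inner_commute field_simps)
  have "Cauchy s"
  proof (rule metric_CauchyI)
    fix e :: real
    assume e: "0 < e"
    obtain N :: nat where N: "8 / e\<^sup>2 < N" using reals_Archimedean2 by blast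
    show "\<exists>M. \<forall>i\<ge>M. \<forall>j\<ge>M. dist (s i) (s j) < e"
    proof (intro exI allI impI)
      fix i j assume ij: "N \<le> i" "N \<le> j"
      have N0: "0 < real N" using N e by (smt (verit) divide_pos_pos zero_less_power)
      have b: "1 / real (Suc k) < 1 / N" if "N \<le> k" for k
        using that N0 by (intro divide_strict_left_mono) auto
      have "(norm (s i - s j))\<^sup>2 < 8 * (1 / N)"
        using par[of "s i" "s j"] s[of i] s[of j] m_le[of "(1/2) *\<^sub>R (s i + s j)"] b ij by smt
      also have "\<dots> < e\<^sup>2" using N N0 e by (simp add: field_simps)
      finally show "dist (s i) (s j) < e"
        using e by (simp add: dist_norm power2_less_imp_less)
    qed
  qed
  then obtain y where y: "s \<longlonglongrightarrow> y" using Cauchy_convergent convergent_def by blast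
  have "(\<lambda>n. \<phi> (s n)) \<longlonglongrightarrow> \<phi> y"
    unfolding \<phi>_def by (intro tendsto_intros g.tendsto y) simp_all
  moreover have "(\<lambda>n. m + 1 / Suc n) \<longlonglongrightarrow> m + 0"
    by (intro tendsto_add tendsto_const LIMSEQ_Suc[OF lim_1_over_n])
  ultimately have "\<phi> y \<le> m"
    using LIMSEQ_le s less_imp_le by (metis (no_types, lifting) add.right_neutral)
  then have min: "\<phi> y \<le> \<phi> x" for x using m_le[of x] by simp
  have "g h = inner y h" for h
  proof -
    define c where "c = inner y h - g h"
    define d where "d = (norm h)\<^sup>2 + 1"
    have d: "0 < d" "(norm h)\<^sup>2 \<le> d" by (simp_all add: d_def add_nonneg_pos)
    define t where "t = - (c / d)"
    have "(norm (y + t *\<^sub>R h))\<^sup>2 = (norm y)\<^sup>2 + 2 * t * inner y h + t\<^sup>2 * (norm h)\<^sup>2"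
      unfolding power2_norm_eq_inner
      by (simp add: inner_add_left inner_add_right inner_commute power2_eq_square)
    note exp = this
    have "0 \<le> \<phi> (y + t *\<^sub>R h) - \<phi> y" using min by simp
    also have "\<dots> = t * c + t\<^sup>2 * (norm h)\<^sup>2 / 2"
      by (simp add: \<phi>_def c_def g.add g.scaleR exp field_simps)
    also have "\<dots> \<le> t * c + t\<^sup>2 * d / 2"
      using d(2) by (simp add: mult_left_mono)
    also have "\<dots> = - (c\<^sup>2 / (2 * d))"
      using d(1) by (simp add: t_def field_simps power2_eq_square)
    finally have "c\<^sup>2 \<le> 0" using d(1) by (simp add: divide_le_0_iff)
    then show ?thesis by (simp add: c_def)
  qed
  then show ?thesis by blast
qed

lemma Riesz:
  fixes f :: "'a::chilbert_space \<Rightarrow> complex"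
  assumes f: "bounded_clinear f"
  shows "\<exists>y. \<forall>x. f x = cinner x y"
proof -
  have fl: "bounded_linear f" and fs: "\<And>a x. f (a *\<^sub>C x) = a * f x"
    using f by (auto simp: bounded_clinear_def scaleC_complex_def)
  have "bounded_linear (\<lambda>x. Re (f x))"
    by (rule bounded_linear_compose[OF bounded_linear_Re fl])
  then obtain y where y: "\<And>x. Re (f x) = inner y x" using Riesz_real by blast
  have R: "Re (f x) = Re (cinner x y)" for x
    using y[of x] by (metis inner_commute inner_eq_Re_cinner)
  have "f x = cinner x y" for x
    using R[of x] R[of "\<i> *\<^sub>C x"] by (simp add: complex_eq_iff fs cinner_scaleC_left)
  then show ?thesis by blast
qed

definition adj :: "'a::chilbert_space \<Rightarrow>\<^sub>C\<^sub>L 'b::chilbert_space \<Rightarrow> 'b \<Rightarrow>\<^sub>C\<^sub>L 'a"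
  where "adj f = (THE g. \<forall>x y. cinner (f *\<^sub>V x) y = cinner x (g *\<^sub>V y))"

lemma cinner_adj:
  fixes f :: "'a::chilbert_space \<Rightarrow>\<^sub>C\<^sub>L 'b::chilbert_space"
  shows "cinner (f *\<^sub>V x) y = cinner x (adj f *\<^sub>V y)"
proof -
  have "\<exists>z. \<forall>x. cinner (f *\<^sub>V x) y = cinner x z" for y
  proof (rule Riesz)
    show "bounded_clinear (\<lambda>x. cinner (f *\<^sub>V x) y)"
      by (auto simp: bounded_clinear_def cblinfun_scaleC cinner_scaleC_left scaleC_complex_def
          intro: bounded_linear_compose[OF bounded_linear_cinner_left] cblinfun_bounded_linear)
  qed
  then obtain h where h: "\<And>x y. cinner (f *\<^sub>V x) y = cinner x (h y)" by metis
  have eqI: "u = v" if "\<And>x. cinner x u = cinner x v" for u v :: 'a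
    using that by (metis cinner_commute cinner_eqI)
  have add: "h (y + z) = h y + h z" for y z
    by (rule eqI) (simp add: cinner_add_right flip: h)
  have scale: "h (a *\<^sub>C y) = a *\<^sub>C h y" for a y
    by (rule eqI) (simp add: cinner_scaleC_right flip: h)
  have "norm (h y) \<le> norm y * norm f" for y
  proof -
    have "(norm (h y))\<^sup>2 = cmod (cinner (f *\<^sub>V h y) y)"
      by (simp add: h cinner_self norm_power)
    also have "\<dots> \<le> norm (f *\<^sub>V h y) * norm y" by (rule Cauchy_Schwarz_cinner)
    also have "\<dots> \<le> (norm f * norm (h y)) * norm y"
      by (intro mult_right_mono norm_cblinfun) simp
    finally have "norm (h y) * norm (h y) \<le> (norm y * norm f) * norm (h y)"
      by (simp add: power2_eq_square ac_simps)
    then show ?thesis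
      by (cases "h y = 0") (auto simp: mult_le_cancel_right)
  qed
  then have "bounded_linear h"
    by (intro bounded_linear_intro[where K = "norm f"]) (simp_all add: add scale scaleR_scaleC)
  then have hc: "bounded_clinear h" by (simp add: bounded_clinear_def scale)
  let ?P = "\<lambda>g. \<forall>x y. cinner (f *\<^sub>V x) y = cinner x (g *\<^sub>V y)"
  have "?P (CBlinfun h)" by (simp add: CBlinfun_inverse hc h)
  moreover have "g = CBlinfun h" if "?P g" for g
    by (intro cblinfun_eqI eqI) (use that in \<open>simp add: CBlinfun_inverse hc flip: h\<close>)
  ultimately have "?P (adj f)" unfolding adj_def by (rule theI[of ?P])
  then show ?thesis by blast
qed


section \<open>Hilbert space completion\<close>

text \<open>The completion of \<open>'v\<close> is the norm closure, inside the (complete) space of bounded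
  functionals on \<open>'v\<close>, of the isometric conjugate-linear image of \<open>'v\<close> under \<open>v \<mapsto> cinner _ v\<close>.
  Scalars therefore act through their conjugates, and the inner product is recovered from
  the norm by polarization.\<close>

definition functional_of :: "'v::complex_inner \<Rightarrow> 'v \<Rightarrow>\<^sub>L complex"
  where "functional_of v = Blinfun (\<lambda>u. cinner u v)"

definition cnj_scale :: "complex \<Rightarrow> ('v::complex_inner \<Rightarrow>\<^sub>L complex) \<Rightarrow> 'v \<Rightarrow>\<^sub>L complex"
  where "cnj_scale a f = blinfun_compose (blinfun_mult_right (cnj a)) f"

lemma functional_of_apply: "blinfun_apply (functional_of v) u = cinner u v"
  by (simp add: functional_of_def bounded_linear_Blinfun_apply bounded_linear_cinner_left)

lemma cnj_scale_apply: "blinfun_apply (cnj_scale a f) u = cnj a * blinfun_apply f u"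
  by (simp add: cnj_scale_def)

lemma functional_of_add: "functional_of (v + w) = functional_of v + functional_of w"
  by (rule blinfun_eqI) (simp add: functional_of_apply blinfun.add_left cinner_add_right)

lemma functional_of_diff: "functional_of (v - w) = functional_of v - functional_of w"
  by (rule blinfun_eqI) (simp add: functional_of_apply blinfun.diff_left cinner_diff_right)

lemma functional_of_scale: "functional_of (a *\<^sub>C v) = cnj_scale a (functional_of v)"
  by (rule blinfun_eqI) (simp add: functional_of_apply cnj_scale_apply cinner_scaleC_right)

lemma norm_functional_of: "norm (functional_of v) = norm v"
proof (rule norm_blinfun_eqI[where x = v])
  show "norm v \<le> norm (blinfun_apply (functional_of v) v) / norm v"
    by (cases "v = 0") (simp_all add: functional_of_apply cinner_self norm_mult power2_eq_square)
  show "norm (blinfun_apply (functional_of v) u) \<le> norm v * norm u" for u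
    using Cauchy_Schwarz_cinner[of u v] by (simp add: functional_of_apply mult.commute)
qed simp

lemma tendsto_cnj_scale [tendsto_intros]:
  "(f \<longlongrightarrow> l) F \<Longrightarrow> ((\<lambda>n. cnj_scale a (f n)) \<longlongrightarrow> cnj_scale a l) F"
  unfolding cnj_scale_def by (intro tendsto_intros)

typedef (overloaded) 'v completion =
  "closure (range (functional_of :: 'v::complex_inner \<Rightarrow> 'v \<Rightarrow>\<^sub>L complex))"
  morphisms of_completion Completion
  using closure_subset[of "range functional_of"] by blast

setup_lifting type_definition_completion

lemma closure_functionals_eq:
  "f \<in> closure (range functional_of) \<longleftrightarrow> (\<exists>s. (\<lambda>n. functional_of (s n)) \<longlonglongrightarrow> f)"
proof
  assume "f \<in> closure (range functional_of)"
  then obtain x where x: "\<And>n. x n \<in> range functional_of" "x \<longlonglongrightarrow> f"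
    unfolding closure_sequential by blast
  then have "\<exists>s. \<forall>n. x n = functional_of (s n)"
    by (intro choice) blast
  then obtain s where "x = (\<lambda>n. functional_of (s n))" by blast
  with x show "\<exists>s. (\<lambda>n. functional_of (s n)) \<longlonglongrightarrow> f" by blast
next
  assume "\<exists>s. (\<lambda>n. functional_of (s n)) \<longlonglongrightarrow> f"
  then obtain s where "(\<lambda>n. functional_of (s n)) \<longlonglongrightarrow> f" ..
  then show "f \<in> closure (range functional_of)"
    unfolding closure_sequential by (intro exI[of _ "\<lambda>n. functional_of (s n)"]) simp
qed

lemma closure_functionals_scale:
  assumes "f \<in> closure (range functional_of)"
  shows "cnj_scale a f \<in> closure (range functional_of)"
proof -
  obtain s where "(\<lambda>n. functional_of (s n)) \<longlonglongrightarrow> f"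
    using assms unfolding closure_functionals_eq by blast
  from tendsto_cnj_scale[OF this, of a] show ?thesis
    unfolding closure_functionals_eq functional_of_scale[symmetric]
    by (rule exI[of _ "\<lambda>n. a *\<^sub>C s n"])
qed

lemma closure_functionals_add:
  assumes "f \<in> closure (range functional_of)" "g \<in> closure (range functional_of)"
  shows "f + g \<in> closure (range functional_of)"
proof -
  obtain s t where "(\<lambda>n. functional_of (s n)) \<longlonglongrightarrow> f" "(\<lambda>n. functional_of (t n)) \<longlonglongrightarrow> g"
    using assms unfolding closure_functionals_eq by blast
  from tendsto_add[OF this] show ?thesis
    unfolding closure_functionals_eq functional_of_add[symmetric]
    by (rule exI[of _ "\<lambda>n. s n + t n"])
qed

lemma closure_functionals_diff:
  assumes "f \<in> closure (range functional_of)" "g \<in> closure (range functional_of)"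
  shows "f - g \<in> closure (range functional_of)"
proof -
  obtain s t where "(\<lambda>n. functional_of (s n)) \<longlonglongrightarrow> f" "(\<lambda>n. functional_of (t n)) \<longlonglongrightarrow> g"
    using assms unfolding closure_functionals_eq by blast
  from tendsto_diff[OF this] show ?thesis
    unfolding closure_functionals_eq functional_of_diff[symmetric]
    by (rule exI[of _ "\<lambda>n. s n - t n"])
qed

lemma of_completion_limit: "\<exists>s. (\<lambda>n. functional_of (s n)) \<longlonglongrightarrow> of_completion x"
  using of_completion[of x] by (simp add: closure_functionals_eq)

instantiation completion :: (complex_inner) complex_vector
begin

lift_definition zero_completion :: "'a completion" is 0
proof -
  have "functional_of (0::'a) = 0"
    by (rule blinfun_eqI) (simp add: functional_of_apply)
  then show "(0 :: 'a \<Rightarrow>\<^sub>L complex) \<in> closure (range functional_of)"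
    by (metis closure_subset rangeI subsetD)
qed

lift_definition plus_completion :: "'a completion \<Rightarrow> 'a completion \<Rightarrow> 'a completion" is "(+)"
  by (rule closure_functionals_add)

lift_definition minus_completion :: "'a completion \<Rightarrow> 'a completion \<Rightarrow> 'a completion" is "(-)"
  by (rule closure_functionals_diff)

lift_definition scaleC_completion :: "complex \<Rightarrow> 'a completion \<Rightarrow> 'a completion" is cnj_scale
  by (rule closure_functionals_scale)

definition uminus_completion :: "'a completion \<Rightarrow> 'a completion"
  where "uminus_completion x = 0 - x"

definition scaleR_completion :: "real \<Rightarrow> 'a completion \<Rightarrow> 'a completion"
  where "scaleR_completion r x = complex_of_real r *\<^sub>C x"

instance
proof
  fix x y z :: "'a completion" and a b :: complex and r s :: real
  show "x + y + z = x + (y + z)" "x + y = y + x" "0 + x = x"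
    by (transfer, simp)+
  show "- x + x = 0" "x - y = x + - y"
    unfolding uminus_completion_def by (transfer, simp)+
  show add_right: "a *\<^sub>C (x + y) = a *\<^sub>C x + a *\<^sub>C y" for a
    by transfer (rule blinfun_eqI, simp add: cnj_scale_apply blinfun.add_left distrib_left)
  show add_left: "(a + b) *\<^sub>C x = a *\<^sub>C x + b *\<^sub>C x" for a b
    by transfer (rule blinfun_eqI, simp add: cnj_scale_apply blinfun.add_left distrib_right)
  show scale: "a *\<^sub>C (b *\<^sub>C x) = (a * b) *\<^sub>C x" for a b
    by transfer (rule blinfun_eqI, simp add: cnj_scale_apply)
  have one: "1 *\<^sub>C x = x"
    by transfer (rule blinfun_eqI, simp add: cnj_scale_apply)
  show "r *\<^sub>R x = complex_of_real r *\<^sub>C x"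
    by (rule scaleR_completion_def)
  show "r *\<^sub>R (x + y) = r *\<^sub>R x + r *\<^sub>R y" "(r + s) *\<^sub>R x = r *\<^sub>R x + s *\<^sub>R x"
    "r *\<^sub>R s *\<^sub>R x = (r * s) *\<^sub>R x" "1 *\<^sub>R x = x"
    by (simp_all add: scaleR_completion_def add_right add_left scale one)
qed

end

definition polar :: "('v::complex_inner \<Rightarrow>\<^sub>L complex) \<Rightarrow> ('v \<Rightarrow>\<^sub>L complex) \<Rightarrow> complex"
  where "polar f g =
    (complex_of_real ((norm (f + g))\<^sup>2 - (norm (f - g))\<^sup>2) +
     \<i> * complex_of_real ((norm (f + cnj_scale \<i> g))\<^sup>2 - (norm (f - cnj_scale \<i> g))\<^sup>2)) / 4"

lemma tendsto_polar:
  assumes "(f \<longlongrightarrow> l) F" "(g \<longlongrightarrow> m) F"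
  shows "((\<lambda>n. polar (f n) (g n)) \<longlongrightarrow> polar l m) F"
  unfolding polar_def by (intro tendsto_intros assms) simp

lemma polar_functional_of: "polar (functional_of v) (functional_of w) = cinner v w"
proof -
  have re: "(norm (v + w))\<^sup>2 - (norm (v - w))\<^sup>2 = 4 * Re (cinner v w)" for v w :: 'a
    unfolding power2_norm_eq_inner
    by (simp add: inner_add_left inner_add_right inner_diff_left inner_diff_right inner_commute
        flip: inner_eq_Re_cinner)
  show ?thesis
    unfolding polar_def functional_of_add[symmetric] functional_of_diff[symmetric]
      functional_of_scale[symmetric] norm_functional_of re
    by (simp add: complex_eq_iff cinner_scaleC_right)
qed

instantiation completion :: (complex_inner) complex_inner
begin

lift_definition norm_completion :: "'a completion \<Rightarrow> real" is norm .

lift_definition cinner_completion :: "'a completion \<Rightarrow> 'a completion \<Rightarrow> complex" is polar .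

definition inner_completion :: "'a completion \<Rightarrow> 'a completion \<Rightarrow> real"
  where "inner_completion x y = Re (cinner x y)"

definition dist_completion :: "'a completion \<Rightarrow> 'a completion \<Rightarrow> real"
  where "dist_completion x y = norm (x - y)"

definition uniformity_completion :: "('a completion \<times> 'a completion) filter"
  where "uniformity_completion = (INF e\<in>{0 <..}. principal {(x, y). dist x y < e})"

definition open_completion :: "'a completion set \<Rightarrow> bool"
  where "open_completion S = (\<forall>x\<in>S. \<forall>\<^sub>F (x', y) in uniformity. x' = x \<longrightarrow> y \<in> S)"

definition sgn_completion :: "'a completion \<Rightarrow> 'a completion"
  where "sgn_completion x = inverse (norm x) *\<^sub>R x"

instance
proof
  fix x y z :: "'a completion" and a :: complex and r :: real
  obtain s t u where
    s: "(\<lambda>n. functional_of (s n)) \<longlonglongrightarrow> of_completion x" and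
    t: "(\<lambda>n. functional_of (t n)) \<longlonglongrightarrow> of_completion y" and
    u: "(\<lambda>n. functional_of (u n)) \<longlonglongrightarrow> of_completion z"
    using of_completion_limit by metis
  show comm: "cinner x y = cnj (cinner y x)"
  proof -
    have "(\<lambda>n. cinner (s n) (t n)) \<longlonglongrightarrow> cnj (polar (of_completion y) (of_completion x))"
      using tendsto_cnj[OF tendsto_polar[OF t s]]
      unfolding polar_functional_of cinner_commute[of "s _" "t _", symmetric] .
    moreover have "(\<lambda>n. cinner (s n) (t n)) \<longlonglongrightarrow> polar (of_completion x) (of_completion y)"
      using tendsto_polar[OF s t] by (simp add: polar_functional_of)
    ultimately show ?thesis
      unfolding cinner_completion.rep_eq by (metis LIMSEQ_unique)
  qed
  show add: "cinner (x + y) z = cinner x z + cinner y z"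
  proof -
    have "(\<lambda>n. cinner (s n + t n) (u n)) \<longlonglongrightarrow>
        polar (of_completion x + of_completion y) (of_completion z)"
      using tendsto_polar[OF tendsto_add[OF s t] u]
      by (simp add: polar_functional_of flip: functional_of_add)
    moreover have "(\<lambda>n. cinner (s n) (u n) + cinner (t n) (u n)) \<longlonglongrightarrow>
        polar (of_completion x) (of_completion z) + polar (of_completion y) (of_completion z)"
      using tendsto_add[OF tendsto_polar[OF s u] tendsto_polar[OF t u]]
      by (simp add: polar_functional_of)
    ultimately show ?thesis
      unfolding cinner_completion.rep_eq plus_completion.rep_eq cinner_add_left
      by (rule LIMSEQ_unique)
  qed
  show scale: "cinner (a *\<^sub>C x) y = a * cinner x y" for a
  proof -
    have "(\<lambda>n. cinner (a *\<^sub>C s n) (t n)) \<longlonglongrightarrow>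
        polar (cnj_scale a (of_completion x)) (of_completion y)"
      using tendsto_polar[OF tendsto_cnj_scale[OF s] t]
      by (simp add: polar_functional_of flip: functional_of_scale)
    moreover have "(\<lambda>n. a * cinner (s n) (t n)) \<longlonglongrightarrow>
        a * polar (of_completion x) (of_completion y)"
      using tendsto_mult_left[OF tendsto_polar[OF s t]] by (simp add: polar_functional_of)
    ultimately show ?thesis
      unfolding cinner_completion.rep_eq scaleC_completion.rep_eq cinner_scaleC_left
      by (rule LIMSEQ_unique)
  qed
  have self: "cinner x x = complex_of_real ((norm x)\<^sup>2)"
  proof -
    have "(\<lambda>n. complex_of_real ((norm (s n))\<^sup>2)) \<longlonglongrightarrow> polar (of_completion x) (of_completion x)"
      using tendsto_polar[OF s s] by (simp add: polar_functional_of cinner_self)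
    moreover have "(\<lambda>n. complex_of_real ((norm (functional_of (s n)))\<^sup>2)) \<longlonglongrightarrow>
        complex_of_real ((norm (of_completion x))\<^sup>2)"
      by (intro tendsto_intros s)
    ultimately show ?thesis
      unfolding cinner_completion.rep_eq norm_completion.rep_eq norm_functional_of
      by (rule LIMSEQ_unique)
  qed
  have norm_ge: "0 \<le> norm x"
    by transfer simp
  show "inner x y = Re (cinner x y)"
    by (rule inner_completion_def)
  show "inner x y = inner y x"
    unfolding inner_completion_def by (subst comm) simp
  show "inner (x + y) z = inner x z + inner y z"
    by (simp add: inner_completion_def add)
  show "inner (r *\<^sub>R x) y = r * inner x y"
    by (simp add: inner_completion_def scaleR_scaleC scale)
  show "0 \<le> inner x x"
    by (simp add: inner_completion_def self)
  show "inner x x = 0 \<longleftrightarrow> x = 0"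
  proof -
    have "norm x = 0 \<longleftrightarrow> x = 0" by transfer simp
    then show ?thesis by (simp add: inner_completion_def self)
  qed
  show "norm x = sqrt (inner x x)"
    by (simp add: inner_completion_def self norm_ge)
qed (simp_all add: dist_completion_def open_completion_def sgn_completion_def
    uniformity_completion_def)

end

lemma dist_of_completion: "dist (of_completion x) (of_completion y) = dist x y"
  unfolding dist_completion_def by transfer (rule dist_norm)

instance completion :: (complex_inner) chilbert_space
proof
  fix X :: "nat \<Rightarrow> 'a completion"
  assume "Cauchy X"
  then have "Cauchy (\<lambda>n. of_completion (X n))"
    by (simp add: Cauchy_def dist_of_completion)
  then obtain l where l: "(\<lambda>n. of_completion (X n)) \<longlonglongrightarrow> l"
    using Cauchy_convergent convergent_def by blast
  then have "l \<in> closure (range functional_of)"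
    by (rule closed_sequentially[OF closed_closure of_completion])
  then have "l = of_completion (Completion l)"
    by (simp add: Completion_inverse)
  then have "(\<lambda>n. of_completion (X n)) \<longlonglongrightarrow> of_completion (Completion l)"
    using l by simp
  then have "X \<longlonglongrightarrow> Completion l"
    by (simp add: lim_sequentially dist_of_completion)
  then show "convergent X" by (rule convergentI)
qed

lift_definition to_completion :: "'v::complex_inner \<Rightarrow> 'v completion" is functional_of
  by (rule subsetD[OF closure_subset rangeI])

lemma to_completion_add: "to_completion (v + w) = to_completion v + to_completion w"
  by transfer (rule functional_of_add)

lemma to_completion_scaleC: "to_completion (a *\<^sub>C v) = a *\<^sub>C to_completion v"
  by transfer (rule functional_of_scale)

lemma cinner_to_completion: "cinner (to_completion v) (to_completion w) = cinner v w"
  by transfer (rule polar_functional_of)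

lemma dist_to_completion: "dist (to_completion v) (to_completion w) = dist v w"
  unfolding dist_of_completion[symmetric] to_completion.rep_eq dist_norm
    functional_of_diff[symmetric] by (rule norm_functional_of)

lemma norm_to_completion: "norm (to_completion v) = norm v"
  by transfer (rule norm_functional_of)

lemma to_completion_dense: "\<exists>s. (\<lambda>n. to_completion (s n)) \<longlonglongrightarrow> x"
proof -
  obtain s where "(\<lambda>n. functional_of (s n)) \<longlonglongrightarrow> of_completion x"
    using of_completion_limit by metis
  then have "(\<lambda>n. to_completion (s n)) \<longlonglongrightarrow> x"
    unfolding lim_sequentially dist_of_completion[symmetric] to_completion.rep_eq .
  then show ?thesis by blast
qed

lemma completion_extension:
  fixes f :: "'v::complex_inner \<Rightarrow> 'w::chilbert_space"
  assumes f: "bounded_clinear f"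
  shows "\<exists>g. \<forall>v. g *\<^sub>V to_completion v = f v"
proof -
  interpret f: bounded_linear f using f by (simp add: bounded_clinear_def)
  have fs: "f (a *\<^sub>C v) = a *\<^sub>C f v" for a v
    using f by (simp add: bounded_clinear_def)
  obtain K where K: "\<And>v. norm (f v) \<le> norm v * K" and K0: "0 < K"
    using f.pos_bounded by blast
  have distf: "dist (f v) (f w) \<le> dist (to_completion v) (to_completion w) * K" for v w
    using K[of "v - w"] unfolding dist_to_completion unfolding dist_norm f.diff .
  obtain s :: "'v completion \<Rightarrow> nat \<Rightarrow> 'v" where s: "\<And>x. (\<lambda>n. to_completion (s x n)) \<longlonglongrightarrow> x"
    using to_completion_dense by metis
  have "convergent (\<lambda>n. f (s x n))" for x
  proof (rule Cauchy_convergent, rule metric_CauchyI)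
    fix e :: real assume "0 < e"
    then have "0 < e / K" using K0 by simp
    then obtain M where M: "\<And>i j. i \<ge> M \<Longrightarrow> j \<ge> M \<Longrightarrow> dist (to_completion (s x i)) (to_completion (s x j)) < e / K"
      using LIMSEQ_imp_Cauchy[OF s] by (metis metric_CauchyD)
    show "\<exists>M. \<forall>i\<ge>M. \<forall>j\<ge>M. dist (f (s x i)) (f (s x j)) < e"
      using M K0 distf by (metis le_less_trans pos_less_divide_eq)
  qed
  then obtain g where g: "\<And>x. (\<lambda>n. f (s x n)) \<longlonglongrightarrow> g x"
    unfolding convergent_def by metis
  have lim: "(\<lambda>n. f (t n)) \<longlonglongrightarrow> g x" if t: "(\<lambda>n. to_completion (t n)) \<longlonglongrightarrow> x" for t x
  proof -
    have "(\<lambda>n. dist (to_completion (t n)) (to_completion (s x n)) * K) \<longlonglongrightarrow> dist x x * K"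
      by (intro tendsto_intros s t)
    then have null: "(\<lambda>n. dist (to_completion (t n)) (to_completion (s x n)) * K) \<longlonglongrightarrow> 0"
      by simp
    have "(\<lambda>n. f (t n) - f (s x n)) \<longlonglongrightarrow> 0"
      by (rule Lim_null_comparison[OF _ null])
        (rule always_eventually, rule allI, rule distf[unfolded dist_norm[of "f _"]])
    from tendsto_add[OF this g[of x]] show ?thesis by simp
  qed
  have g_to_completion: "g (to_completion v) = f v" for v
    by (rule LIMSEQ_unique[OF lim[of "\<lambda>_. v"] tendsto_const]) (rule tendsto_const)
  have add: "g (x + y) = g x + g y" for x y
  proof -
    have "(\<lambda>n. f (s x n + s y n)) \<longlonglongrightarrow> g (x + y)"
      by (rule lim) (unfold to_completion_add, intro tendsto_add s)
    moreover have "(\<lambda>n. f (s x n + s y n)) \<longlonglongrightarrow> g x + g y"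
      unfolding f.add by (intro tendsto_add g)
    ultimately show ?thesis by (rule LIMSEQ_unique)
  qed
  have scale: "g (a *\<^sub>C x) = a *\<^sub>C g x" for a x
  proof -
    have "(\<lambda>n. f (a *\<^sub>C s x n)) \<longlonglongrightarrow> g (a *\<^sub>C x)"
      by (rule lim) (unfold to_completion_scaleC, rule bounded_linear.tendsto[OF bounded_linear_scaleC s])
    moreover have "(\<lambda>n. f (a *\<^sub>C s x n)) \<longlonglongrightarrow> a *\<^sub>C g x"
      unfolding fs by (rule bounded_linear.tendsto[OF bounded_linear_scaleC g])
    ultimately show ?thesis by (rule LIMSEQ_unique)
  qed
  have "norm (g x) \<le> norm x * K" for x
  proof (rule LIMSEQ_le)
    show "(\<lambda>n. norm (f (s x n))) \<longlonglongrightarrow> norm (g x)" by (intro tendsto_intros g)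
    show "(\<lambda>n. norm (to_completion (s x n)) * K) \<longlonglongrightarrow> norm x * K" by (intro tendsto_intros s)
  qed (simp add: norm_to_completion K)
  then have "bounded_linear g"
    by (intro bounded_linear_intro[where K = K]) (simp_all add: add scale scaleR_scaleC)
  then have "bounded_clinear g" by (simp add: bounded_clinear_def scale)
  then have "\<forall>v. CBlinfun g *\<^sub>V to_completion v = f v" by (simp add: CBlinfun_inverse g_to_completion)
  then show ?thesis by blast
qed


section \<open>Hilbert space tensor product\<close>

text \<open>A formal sum \<open>\<Sum> x \<otimes> y\<close>, given as a list of pairs, is identified with the form
  \<open>(u, v) \<mapsto> \<Sum> cinner x u * cinner y v\<close>. Two formal sums induce the same form iff
  they represent the same element of the algebraic tensor product.\<close>

definition tensor_form ::
  "('a::complex_inner \<times> 'b::complex_inner) list \<Rightarrow> 'a \<Rightarrow> 'b \<Rightarrow> complex"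
  where "tensor_form xs u v = (\<Sum>(x, y)\<leftarrow>xs. cinner x u * cinner y v)"

lemma tensor_form_append: "tensor_form (xs @ ys) u v = tensor_form xs u v + tensor_form ys u v"
  by (simp add: tensor_form_def)

lemma tensor_form_scale:
  "tensor_form (map (\<lambda>(x, y). (a *\<^sub>C x, y)) xs) u v = a * tensor_form xs u v"
  by (induction xs) (auto simp: tensor_form_def cinner_scaleC_left algebra_simps)

typedef (overloaded) ('a, 'b) alg_tensor =
  "range (tensor_form :: ('a::complex_inner \<times> 'b::complex_inner) list \<Rightarrow> 'a \<Rightarrow> 'b \<Rightarrow> complex)"
  morphisms form_of Alg_tensor
  by blast

setup_lifting type_definition_alg_tensor

lemma ex_tensor_form: "\<exists>xs. form_of F = tensor_form xs"
  using form_of[of F] by blast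

lemma range_tensor_formI: "(\<And>u v. f u v = tensor_form xs u v) \<Longrightarrow> f \<in> range tensor_form"
  by (rule range_eqI[of _ _ xs]) (simp add: fun_eq_iff)

instantiation alg_tensor :: (complex_inner, complex_inner) complex_vector
begin

lift_definition zero_alg_tensor :: "('a, 'b) alg_tensor" is "\<lambda>u v. 0"
  by (rule range_tensor_formI[of _ "[]"]) (simp add: tensor_form_def)

lift_definition plus_alg_tensor :: "('a, 'b) alg_tensor \<Rightarrow> ('a, 'b) alg_tensor \<Rightarrow> ('a, 'b) alg_tensor"
  is "\<lambda>f g u v. f u v + g u v"
  by (elim rangeE, hypsubst, rule range_tensor_formI, rule tensor_form_append[symmetric])

lift_definition scaleC_alg_tensor :: "complex \<Rightarrow> ('a, 'b) alg_tensor \<Rightarrow> ('a, 'b) alg_tensor"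
  is "\<lambda>a f u v. a * f u v"
  by (elim rangeE, hypsubst, rule range_tensor_formI, rule tensor_form_scale[symmetric])

definition uminus_alg_tensor :: "('a, 'b) alg_tensor \<Rightarrow> ('a, 'b) alg_tensor"
  where "uminus_alg_tensor F = (- 1) *\<^sub>C F"

definition minus_alg_tensor :: "('a, 'b) alg_tensor \<Rightarrow> ('a, 'b) alg_tensor \<Rightarrow> ('a, 'b) alg_tensor"
  where "minus_alg_tensor F G = F + - G"

definition scaleR_alg_tensor :: "real \<Rightarrow> ('a, 'b) alg_tensor \<Rightarrow> ('a, 'b) alg_tensor"
  where "scaleR_alg_tensor r F = complex_of_real r *\<^sub>C F"

instance
  by standard
    (simp_all add: uminus_alg_tensor_def minus_alg_tensor_def scaleR_alg_tensor_def,
      (transfer, simp add: fun_eq_iff algebra_simps)+)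

end

text \<open>Evaluating \<open>form_of F\<close> along a representation \<open>\<Sum> x \<otimes> y\<close> of \<open>G\<close> gives the inner
  product determined by \<open>cinner (x \<otimes> y) (x' \<otimes> y') = cinner x x' * cinner y y'\<close>.\<close>

definition alg_cinner ::
  "('a::complex_inner, 'b::complex_inner) alg_tensor \<Rightarrow> ('a, 'b) alg_tensor \<Rightarrow> complex"
  where "alg_cinner F G = (\<Sum>(x, y)\<leftarrow>(SOME xs. form_of G = tensor_form xs). form_of F x y)"

lemma tensor_form_swap:
  "(\<Sum>(x, y)\<leftarrow>ys. tensor_form xs x y) = cnj (\<Sum>(x, y)\<leftarrow>xs. tensor_form ys x y)"
proof -
  have "(\<Sum>(x, y)\<leftarrow>ys. tensor_form xs x y)
      = (\<Sum>p\<leftarrow>ys. \<Sum>q\<leftarrow>xs. cinner (fst q) (fst p) * cinner (snd q) (snd p))"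
    by (simp add: tensor_form_def case_prod_unfold)
  also have "\<dots> = (\<Sum>q\<leftarrow>xs. \<Sum>p\<leftarrow>ys. cinner (fst q) (fst p) * cinner (snd q) (snd p))"
    by (induction xs) (simp_all add: sum_list_addf)
  also have "\<dots> = (\<Sum>q\<leftarrow>xs. \<Sum>p\<leftarrow>ys. cnj (cinner (fst p) (fst q) * cinner (snd p) (snd q)))"
  proof -
    have "cinner (fst q) (fst p) * cinner (snd q) (snd p)
        = cnj (cinner (fst p) (fst q) * cinner (snd p) (snd q))" for p q :: "'a \<times> 'b"
      unfolding complex_cnj_mult cinner_commute[of "fst q"] cinner_commute[of "snd q"] by (rule refl)
    then show ?thesis
      by (intro arg_cong[where f = sum_list] map_cong refl)
  qed
  also have "\<dots> = cnj (\<Sum>(x, y)\<leftarrow>xs. tensor_form ys x y)"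
  proof -
    have cnj_sum: "cnj (\<Sum>p\<leftarrow>zs. f p) = (\<Sum>p\<leftarrow>zs. cnj (f p))" for zs and f :: "'c \<Rightarrow> complex"
      by (induction zs) simp_all
    have cnj_sum': "cnj (\<Sum>p\<leftarrow>zs. f p) = (\<Sum>p\<leftarrow>zs. cnj (f p))" for zs and f :: "'d \<Rightarrow> complex"
      by (induction zs) simp_all
    show ?thesis
      by (simp add: tensor_form_def case_prod_unfold cnj_sum cnj_sum')
  qed
  finally show ?thesis .
qed

lemma alg_cinner_eq:
  assumes "form_of G = tensor_form ys"
  shows "alg_cinner F G = (\<Sum>(x, y)\<leftarrow>ys. form_of F x y)"
proof -
  obtain xs where xs: "form_of F = tensor_form xs"
    using ex_tensor_form by blast
  define zs where "zs = (SOME xs. form_of G = tensor_form xs)"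
  have zs: "form_of G = tensor_form zs"
    unfolding zs_def by (rule someI[where P = "\<lambda>xs. form_of G = tensor_form xs"], rule assms)
  have "alg_cinner F G = (\<Sum>(x, y)\<leftarrow>zs. tensor_form xs x y)"
    by (simp add: alg_cinner_def zs_def xs)
  also have "\<dots> = cnj (\<Sum>(x, y)\<leftarrow>xs. tensor_form zs x y)"
    by (rule tensor_form_swap)
  also have "\<dots> = cnj (\<Sum>(x, y)\<leftarrow>xs. tensor_form ys x y)"
    using zs assms by simp
  also have "\<dots> = (\<Sum>(x, y)\<leftarrow>ys. tensor_form xs x y)"
    by (rule tensor_form_swap[symmetric])
  finally show ?thesis by (simp add: xs)
qed

lemma alg_cinner_add: "alg_cinner (F + G) H = alg_cinner F H + alg_cinner G H"
  by (simp add: alg_cinner_def plus_alg_tensor.rep_eq case_prod_unfold sum_list_addf)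

lemma alg_cinner_scale: "alg_cinner (a *\<^sub>C F) H = a * alg_cinner F H"
  by (simp add: alg_cinner_def scaleC_alg_tensor.rep_eq case_prod_unfold sum_list_const_mult)

lemma alg_cinner_commute: "alg_cinner F G = cnj (alg_cinner G F)"
proof -
  obtain xs ys where "form_of F = tensor_form xs" "form_of G = tensor_form ys"
    using ex_tensor_form by metis
  then show ?thesis
    by (simp add: alg_cinner_eq tensor_form_swap[of xs ys])
qed

text \<open>Schur product theorem, for a Gram matrix as second factor.\<close>

lemma Schur_Gram:
  fixes a :: "'i \<Rightarrow> 'i \<Rightarrow> complex" and y :: "'i \<Rightarrow> 'b::complex_inner"
  assumes "finite I"
    and "\<And>c. 0 \<le> Re (\<Sum>i\<in>I. \<Sum>j\<in>I. a i j * (c i * cnj (c j)))"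
  shows "0 \<le> Re (\<Sum>i\<in>I. \<Sum>j\<in>I. a i j * cinner (y i) (y j))"
  using assms
proof (induction I arbitrary: y rule: finite_induct)
  case empty
  then show ?case by simp
next
  case (insert n I)
  have vanish: "(\<Sum>i\<in>insert n I. \<Sum>j\<in>insert n I. a i j * b i j) = (\<Sum>i\<in>I. \<Sum>j\<in>I. a i j * b i j)"
    if "\<And>i. b i n = 0" "\<And>j. b n j = 0" for b
    using insert.hyps that by simp
  have psd: "0 \<le> Re (\<Sum>i\<in>I. \<Sum>j\<in>I. a i j * (c i * cnj (c j)))" for c
  proof -
    have "(\<Sum>i\<in>I. \<Sum>j\<in>I. a i j * (c i * cnj (c j)))
        = (\<Sum>i\<in>I. \<Sum>j\<in>I. a i j * ((c(n := 0)) i * cnj ((c(n := 0)) j)))"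
      using insert.hyps by (intro sum.cong) auto
    also have "\<dots> = (\<Sum>i\<in>insert n I. \<Sum>j\<in>insert n I. a i j * ((c(n := 0)) i * cnj ((c(n := 0)) j)))"
      by (rule vanish[symmetric]) simp_all
    finally show ?thesis using insert.prems[of "c(n := 0)"] by simp
  qed
  define e where "e = inverse (norm (y n)) *\<^sub>R y n"
  define c where "c i = cinner (y i) e" for i
  define z where "z i = y i - c i *\<^sub>C e" for i
  have zn: "z n = 0"
  proof (cases "y n = 0")
    case False
    then have "c n = complex_of_real (norm (y n))"
      by (simp add: c_def e_def scaleR_scaleC cinner_scaleC_right cinner_self power2_eq_square)
    then have "c n *\<^sub>C e = y n"
      using False by (simp add: e_def scaleR_scaleC scaleC_scaleC)
    then show ?thesis by (simp add: z_def)
  qed (simp add: z_def c_def)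
  have ee: "c i * cinner e e = c i" for i
  proof (cases "y n = 0")
    case False
    then have "norm e = 1" by (simp add: e_def)
    then show ?thesis by (simp add: cinner_self)
  qed (simp add: c_def e_def)
  have split: "cinner (y i) (y j) = c i * cnj (c j) + cinner (z i) (z j)" for i j
  proof -
    have "cinner e (y j) = cnj (c j)" unfolding c_def by (rule cinner_commute)
    moreover have "c i * (cnj (c j) * cinner e e) = c i * cnj (c j)"
      using ee[of i] by auto
    ultimately show ?thesis
      by (simp add: z_def cinner_diff_left cinner_diff_right cinner_scaleC_left cinner_scaleC_right
          c_def[symmetric] algebra_simps)
  qed
  have "0 \<le> Re (\<Sum>i\<in>I. \<Sum>j\<in>I. a i j * cinner (z i) (z j))"
    by (rule insert.IH[OF psd])
  also have "(\<Sum>i\<in>I. \<Sum>j\<in>I. a i j * cinner (z i) (z j))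
      = (\<Sum>i\<in>insert n I. \<Sum>j\<in>insert n I. a i j * cinner (z i) (z j))"
    by (rule vanish[symmetric]) (simp_all add: zn)
  finally have 1: "0 \<le> Re (\<Sum>i\<in>insert n I. \<Sum>j\<in>insert n I. a i j * cinner (z i) (z j))" .
  have "(\<Sum>i\<in>insert n I. \<Sum>j\<in>insert n I. a i j * cinner (y i) (y j))
      = (\<Sum>i\<in>insert n I. \<Sum>j\<in>insert n I. a i j * (c i * cnj (c j)))
        + (\<Sum>i\<in>insert n I. \<Sum>j\<in>insert n I. a i j * cinner (z i) (z j))"
    unfolding split distrib_left sum.distrib by (rule refl)
  with 1 insert.prems[of c] show ?case by (simp only: plus_complex.sel)
qed

lemma sum_sum_Gram:
  fixes x :: "'i \<Rightarrow> 'a::complex_inner"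
  assumes "finite I"
  shows "(\<Sum>i\<in>I. \<Sum>j\<in>I. cinner (x i) (x j) * (c i * cnj (c j)))
    = complex_of_real ((norm (\<Sum>i\<in>I. c i *\<^sub>C x i))\<^sup>2)"
proof -
  have l: "cinner (\<Sum>i\<in>J. f i) v = (\<Sum>i\<in>J. cinner (f i) v)" if "finite J" for J f and v :: 'a
    using that by (induction J) (simp_all add: cinner_add_left)
  have r: "cinner v (\<Sum>i\<in>J. f i) = (\<Sum>i\<in>J. cinner v (f i))" if "finite J" for J f and v :: 'a
    using that by (induction J) (simp_all add: cinner_add_right)
  show ?thesis
    unfolding cinner_self[symmetric] l[OF assms] unfolding r[OF assms]
    by (simp add: cinner_scaleC_left cinner_scaleC_right algebra_simps)
qed

lemma tensor_form_nth:
  "(\<Sum>(x, y)\<leftarrow>xs. tensor_form xs x y)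
    = (\<Sum>i<length xs. \<Sum>j<length xs.
        cinner (fst (xs ! i)) (fst (xs ! j)) * cinner (snd (xs ! i)) (snd (xs ! j)))"
proof -
  have "(\<Sum>(x, y)\<leftarrow>xs. tensor_form xs x y)
      = (\<Sum>j<length xs. \<Sum>i<length xs.
          cinner (fst (xs ! i)) (fst (xs ! j)) * cinner (snd (xs ! i)) (snd (xs ! j)))"
    by (simp add: tensor_form_def case_prod_unfold sum_list_sum_nth atLeast0LessThan)
  also have "\<dots> = (\<Sum>i<length xs. \<Sum>j<length xs.
          cinner (fst (xs ! i)) (fst (xs ! j)) * cinner (snd (xs ! i)) (snd (xs ! j)))"
    by (rule sum.swap)
  finally show ?thesis .
qed

lemma alg_cinner_nonneg: "0 \<le> Re (alg_cinner F F)"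
proof -
  obtain xs where xs: "form_of F = tensor_form xs"
    using ex_tensor_form by blast
  have "0 \<le> Re (\<Sum>i<length xs. \<Sum>j<length xs.
      cinner (fst (xs ! i)) (fst (xs ! j)) * cinner (snd (xs ! i)) (snd (xs ! j)))"
  proof (rule Schur_Gram)
    fix c :: "nat \<Rightarrow> complex"
    show "0 \<le> Re (\<Sum>i<length xs. \<Sum>j<length xs.
        cinner (fst (xs ! i)) (fst (xs ! j)) * (c i * cnj (c j)))"
      by (subst sum_sum_Gram) (simp_all only: finite_lessThan Re_complex_of_real zero_le_power2)
  qed simp
  then show ?thesis
    unfolding alg_cinner_eq[OF xs] xs tensor_form_nth .
qed

lift_definition alg_tensor_vec :: "'a::complex_inner \<Rightarrow> 'b::complex_inner \<Rightarrow> ('a, 'b) alg_tensor"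
  is "\<lambda>x y. tensor_form [(x, y)]"
  by (rule rangeI)

lemma alg_cinner_vec: "alg_cinner F (alg_tensor_vec x y) = form_of F x y"
  using alg_cinner_eq[OF alg_tensor_vec.rep_eq[of x y], of F] by simp

lemma alg_cinner_definite:
  assumes "Re (alg_cinner F F) = 0"
  shows "F = 0"
proof -
  have "form_of F u v = 0" for u v
  proof (rule ccontr)
    assume nz: "form_of F u v \<noteq> 0"
    define G where "G = alg_tensor_vec u v"
    define w where "w = form_of F u v"
    have FG: "alg_cinner F G = w" by (simp add: G_def w_def alg_cinner_vec)
    define t where "t = (Re (alg_cinner G G) + 1) / (2 * (cmod w)\<^sup>2)"
    define c where "c = - complex_of_real t * cnj w"
    have addr: "alg_cinner A (B + C) = alg_cinner A B + alg_cinner A C" for A B C :: "('a, 'b) alg_tensor"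
      unfolding alg_cinner_commute[of A] by (simp add: alg_cinner_add)
    have scaler: "alg_cinner A (a *\<^sub>C B) = cnj a * alg_cinner A B" for a and A B :: "('a, 'b) alg_tensor"
      unfolding alg_cinner_commute[of A] by (simp add: alg_cinner_scale)
    have "alg_cinner (c *\<^sub>C F + G) (c *\<^sub>C F + G)
        = c * cnj c * alg_cinner F F + c * w + cnj (c * w) + alg_cinner G G"
      using FG alg_cinner_commute[of G F]
      by (simp add: alg_cinner_add alg_cinner_scale addr scaler algebra_simps)
    moreover have "Re (c * cnj c * alg_cinner F F) = 0"
      using assms by (simp flip: complex_norm_square of_real_power)
    moreover have "c * w = complex_of_real (- t * (cmod w)\<^sup>2)"
      using complex_norm_square[of w] by (simp add: c_def mult.commute)
    then have "Re (c * w) = - t * (cmod w)\<^sup>2"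
      by (simp only: Re_complex_of_real)
    ultimately have "Re (alg_cinner (c *\<^sub>C F + G) (c *\<^sub>C F + G))
        = - (2 * t * (cmod w)\<^sup>2) + Re (alg_cinner G G)"
      by simp
    also have "2 * t * (cmod w)\<^sup>2 = Re (alg_cinner G G) + 1"
      using nz by (simp add: t_def w_def)
    finally show False
      using alg_cinner_nonneg[of "c *\<^sub>C F + G"] by simp
  qed
  then show ?thesis
    by transfer (simp add: fun_eq_iff)
qed

instantiation alg_tensor :: (complex_inner, complex_inner) complex_inner
begin

definition cinner_alg_tensor :: "('a, 'b) alg_tensor \<Rightarrow> ('a, 'b) alg_tensor \<Rightarrow> complex"
  where "cinner_alg_tensor F G = alg_cinner F G"

definition inner_alg_tensor :: "('a, 'b) alg_tensor \<Rightarrow> ('a, 'b) alg_tensor \<Rightarrow> real"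
  where "inner_alg_tensor F G = Re (alg_cinner F G)"

definition norm_alg_tensor :: "('a, 'b) alg_tensor \<Rightarrow> real"
  where "norm_alg_tensor F = sqrt (inner F F)"

definition dist_alg_tensor :: "('a, 'b) alg_tensor \<Rightarrow> ('a, 'b) alg_tensor \<Rightarrow> real"
  where "dist_alg_tensor F G = norm (F - G)"

definition uniformity_alg_tensor :: "(('a, 'b) alg_tensor \<times> ('a, 'b) alg_tensor) filter"
  where "uniformity_alg_tensor = (INF e\<in>{0 <..}. principal {(x, y). dist x y < e})"

definition open_alg_tensor :: "('a, 'b) alg_tensor set \<Rightarrow> bool"
  where "open_alg_tensor S = (\<forall>x\<in>S. \<forall>\<^sub>F (x', y) in uniformity. x' = x \<longrightarrow> y \<in> S)"

definition sgn_alg_tensor :: "('a, 'b) alg_tensor \<Rightarrow> ('a, 'b) alg_tensor"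
  where "sgn_alg_tensor F = inverse (norm F) *\<^sub>R F"

instance
proof
  fix F G H :: "('a, 'b) alg_tensor" and a :: complex and r :: real
  show "cinner F G = cnj (cinner G F)"
    unfolding cinner_alg_tensor_def by (rule alg_cinner_commute)
  show "inner F G = inner G F"
    unfolding inner_alg_tensor_def by (subst alg_cinner_commute) simp
  show "inner F F = 0 \<longleftrightarrow> F = 0"
    unfolding inner_alg_tensor_def using alg_cinner_definite[of F] alg_cinner_scale[of 0 F F] by auto
qed (simp_all add: inner_alg_tensor_def cinner_alg_tensor_def alg_cinner_add alg_cinner_scale
    scaleR_scaleC alg_cinner_nonneg norm_alg_tensor_def dist_alg_tensor_def
    open_alg_tensor_def sgn_alg_tensor_def uniformity_alg_tensor_def)

end


type_synonym ('a, 'b) hilbert_tensor = "('a, 'b) alg_tensor completion"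

definition tensor_vec ::
  "'a::complex_inner \<Rightarrow> 'b::complex_inner \<Rightarrow> ('a, 'b) hilbert_tensor"  (infixr \<open>\<otimes>\<^sub>v\<close> 70)
  where "x \<otimes>\<^sub>v y = to_completion (alg_tensor_vec x y)"

lemma cinner_tensor_vec: "cinner (x \<otimes>\<^sub>v y) (x' \<otimes>\<^sub>v y') = cinner x x' * cinner y y'"
  by (simp add: tensor_vec_def cinner_to_completion cinner_alg_tensor_def alg_cinner_vec
      alg_tensor_vec.rep_eq tensor_form_def)

lemma alg_tensor_induct:
  assumes zero: "P 0"
    and add: "\<And>x y F. P F \<Longrightarrow> P (alg_tensor_vec x y + F)"
  shows "P F"
proof -
  have "P F" if "form_of F = tensor_form xs" for xs and F :: "('a, 'b) alg_tensor"
    using that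
  proof (induction xs arbitrary: F)
    case Nil
    then have "F = 0"
      by (simp add: form_of_inject[symmetric] zero_alg_tensor.rep_eq tensor_form_def fun_eq_iff)
    then show ?case using zero by simp
  next
    case (Cons p xs)
    define G where "G = Alg_tensor (tensor_form xs)"
    have G: "form_of G = tensor_form xs"
      by (simp add: G_def Alg_tensor_inverse)
    have "F = alg_tensor_vec (fst p) (snd p) + G"
      using Cons.prems G
      by (simp add: form_of_inject[symmetric] plus_alg_tensor.rep_eq alg_tensor_vec.rep_eq
          tensor_form_def fun_eq_iff case_prod_unfold)
    then show ?case using add[OF Cons.IH[OF G]] by simp
  qed
  then show ?thesis using ex_tensor_form by blast
qed

lemma hilbert_tensor_eqI:
  fixes S T :: "('a::complex_inner, 'b::complex_inner) hilbert_tensor \<Rightarrow>\<^sub>C\<^sub>L 'c::complex_normed_vector"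
  assumes "\<And>x y. S *\<^sub>V (x \<otimes>\<^sub>v y) = T *\<^sub>V (x \<otimes>\<^sub>v y)"
  shows "S = T"
proof (rule cblinfun_eqI)
  have zero: "S *\<^sub>V 0 = 0" for S :: "('a, 'b) hilbert_tensor \<Rightarrow>\<^sub>C\<^sub>L 'c"
    using cblinfun_scaleC[of S 0 0] by simp
  have alg: "S *\<^sub>V to_completion F = T *\<^sub>V to_completion F" for F
  proof (induction F rule: alg_tensor_induct)
    case 1
    have "to_completion (0 :: ('a, 'b) alg_tensor) = 0"
      using to_completion_scaleC[of 0 "0 :: ('a, 'b) alg_tensor"] by simp
    then show ?case by (simp add: zero)
  next
    case (2 x y F)
    then show ?case
      using assms[of x y] by (simp add: to_completion_add cblinfun_add tensor_vec_def)
  qed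
  fix x :: "('a, 'b) hilbert_tensor"
  obtain s where s: "(\<lambda>n. to_completion (s n)) \<longlonglongrightarrow> x"
    using to_completion_dense by blast
  have "(\<lambda>n. S *\<^sub>V to_completion (s n)) \<longlonglongrightarrow> S *\<^sub>V x"
    by (rule bounded_linear.tendsto[OF cblinfun_bounded_linear s])
  moreover have "(\<lambda>n. S *\<^sub>V to_completion (s n)) \<longlonglongrightarrow> T *\<^sub>V x"
    unfolding alg by (rule bounded_linear.tendsto[OF cblinfun_bounded_linear s])
  ultimately show "S *\<^sub>V x = T *\<^sub>V x"
    by (rule LIMSEQ_unique)
qed

lemma tensor_form_adj:
  "tensor_form (map (\<lambda>(x, y). (A *\<^sub>V x, B *\<^sub>V y)) xs) u v = tensor_form xs (adj A *\<^sub>V u) (adj B *\<^sub>V v)"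
  by (induction xs) (auto simp: tensor_form_def cinner_adj)

lift_definition alg_tensor_op ::
  "'a::chilbert_space \<Rightarrow>\<^sub>C\<^sub>L 'c::chilbert_space \<Rightarrow> 'b::chilbert_space \<Rightarrow>\<^sub>C\<^sub>L 'd::chilbert_space \<Rightarrow>
    ('a, 'b) alg_tensor \<Rightarrow> ('c, 'd) alg_tensor"
  is "\<lambda>A B f u v. f (adj A *\<^sub>V u) (adj B *\<^sub>V v)"
  by (elim rangeE, hypsubst, rule range_tensor_formI, rule tensor_form_adj[symmetric])

lemma norm_alg_tensor_eq:
  assumes "form_of F = tensor_form xs"
  shows "(norm F)\<^sup>2 = Re (\<Sum>i<length xs. \<Sum>j<length xs.
        cinner (fst (xs ! i)) (fst (xs ! j)) * cinner (snd (xs ! i)) (snd (xs ! j)))"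
  by (simp add: power2_norm_eq_inner inner_alg_tensor_def alg_cinner_eq[OF assms] assms
      tensor_form_nth del: Re_sum)

lemma operator_Gram_le:
  fixes A :: "'a::complex_inner \<Rightarrow>\<^sub>C\<^sub>L 'b::complex_inner" and y :: "'i \<Rightarrow> 'c::complex_inner"
  assumes I: "finite I"
  shows "Re (\<Sum>i\<in>I. \<Sum>j\<in>I. cinner (A *\<^sub>V x i) (A *\<^sub>V x j) * cinner (y i) (y j))
    \<le> (norm A)\<^sup>2 * Re (\<Sum>i\<in>I. \<Sum>j\<in>I. cinner (x i) (x j) * cinner (y i) (y j))"
proof -
  define a where "a i j = complex_of_real ((norm A)\<^sup>2) * cinner (x i) (x j)
    - cinner (A *\<^sub>V x i) (A *\<^sub>V x j)" for i j
  have expand: "(\<Sum>i\<in>I. \<Sum>j\<in>I. a i j * b i j)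
      = complex_of_real ((norm A)\<^sup>2) * (\<Sum>i\<in>I. \<Sum>j\<in>I. cinner (x i) (x j) * b i j)
        - (\<Sum>i\<in>I. \<Sum>j\<in>I. cinner (A *\<^sub>V x i) (A *\<^sub>V x j) * b i j)" for b
    by (simp add: a_def left_diff_distrib sum_subtractf sum_distrib_left mult.assoc)
  have A_sum: "A *\<^sub>V (\<Sum>i\<in>I. c i *\<^sub>C x i) = (\<Sum>i\<in>I. c i *\<^sub>C (A *\<^sub>V x i))" for c
    by (simp add: linear_sum[OF bounded_linear.linear[OF cblinfun_bounded_linear]] cblinfun_scaleC)
  have "0 \<le> Re (\<Sum>i\<in>I. \<Sum>j\<in>I. a i j * cinner (y i) (y j))"
  proof (rule Schur_Gram[OF I])
    fix c :: "'i \<Rightarrow> complex"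
    have "(norm (\<Sum>i\<in>I. c i *\<^sub>C (A *\<^sub>V x i)))\<^sup>2 \<le> (norm A * norm (\<Sum>i\<in>I. c i *\<^sub>C x i))\<^sup>2"
      unfolding A_sum[symmetric] by (intro power_mono norm_cblinfun norm_ge_zero)
    then show "0 \<le> Re (\<Sum>i\<in>I. \<Sum>j\<in>I. a i j * (c i * cnj (c j)))"
      unfolding expand sum_sum_Gram[OF I] of_real_mult[symmetric] of_real_diff[symmetric]
        Re_complex_of_real by (simp add: power_mult_distrib)
  qed
  then show ?thesis
    unfolding expand by simp
qed

lemma norm_alg_tensor_op: "norm (alg_tensor_op A B F) \<le> norm A * norm B * norm F"
proof -
  obtain xs where xs: "form_of F = tensor_form xs"
    using ex_tensor_form by blast
  let ?I = "{..<length xs}" and ?x = "\<lambda>i. fst (xs ! i)" and ?y = "\<lambda>i. snd (xs ! i)"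
  have "form_of (alg_tensor_op A B F) = tensor_form (map (\<lambda>(x, y). (A *\<^sub>V x, B *\<^sub>V y)) xs)"
    by (simp add: alg_tensor_op.rep_eq xs tensor_form_adj fun_eq_iff)
  from norm_alg_tensor_eq[OF this]
  have "(norm (alg_tensor_op A B F))\<^sup>2
      = Re (\<Sum>i\<in>?I. \<Sum>j\<in>?I. cinner (A *\<^sub>V ?x i) (A *\<^sub>V ?x j) * cinner (B *\<^sub>V ?y i) (B *\<^sub>V ?y j))"
    by (simp add: case_prod_unfold del: Re_sum)
  also have "\<dots> \<le> (norm A)\<^sup>2 *
      Re (\<Sum>i\<in>?I. \<Sum>j\<in>?I. cinner (?x i) (?x j) * cinner (B *\<^sub>V ?y i) (B *\<^sub>V ?y j))"
    by (rule operator_Gram_le) simp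
  also have "Re (\<Sum>i\<in>?I. \<Sum>j\<in>?I. cinner (?x i) (?x j) * cinner (B *\<^sub>V ?y i) (B *\<^sub>V ?y j))
      \<le> (norm B)\<^sup>2 * Re (\<Sum>i\<in>?I. \<Sum>j\<in>?I. cinner (?x i) (?x j) * cinner (?y i) (?y j))"
    using operator_Gram_le[of ?I B ?y ?x] by (simp add: mult.commute del: Re_sum)
  also have "Re (\<Sum>i\<in>?I. \<Sum>j\<in>?I. cinner (?x i) (?x j) * cinner (?y i) (?y j)) = (norm F)\<^sup>2"
    by (rule norm_alg_tensor_eq[OF xs, symmetric])
  finally have "(norm (alg_tensor_op A B F))\<^sup>2 \<le> (norm A * norm B * norm F)\<^sup>2"
    by (simp add: power_mult_distrib mult_left_mono mult.assoc)
  then show ?thesis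
    by (rule power2_le_imp_le) simp
qed

definition tensor_op ::
  "'a::chilbert_space \<Rightarrow>\<^sub>C\<^sub>L 'c::chilbert_space \<Rightarrow> 'b::chilbert_space \<Rightarrow>\<^sub>C\<^sub>L 'd::chilbert_space \<Rightarrow>
    ('a, 'b) hilbert_tensor \<Rightarrow>\<^sub>C\<^sub>L ('c, 'd) hilbert_tensor"  (infixr \<open>\<otimes>\<^sub>o\<close> 70)
  where "A \<otimes>\<^sub>o B = (THE T. \<forall>x y. T *\<^sub>V (x \<otimes>\<^sub>v y) = (A *\<^sub>V x) \<otimes>\<^sub>v (B *\<^sub>V y))"

lemma tensor_op_vec: "(A \<otimes>\<^sub>o B) *\<^sub>V (x \<otimes>\<^sub>v y) = (A *\<^sub>V x) \<otimes>\<^sub>v (B *\<^sub>V y)"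
proof -
  let ?P = "\<lambda>T. \<forall>x y. T *\<^sub>V (x \<otimes>\<^sub>v y) = (A *\<^sub>V x) \<otimes>\<^sub>v (B *\<^sub>V y)"
  define f where "f F = to_completion (alg_tensor_op A B F)" for F
  have add: "f (F + G) = f F + f G" for F G
    unfolding f_def to_completion_add[symmetric]
    by (rule arg_cong[where f = to_completion]) (transfer, simp)
  have scale: "f (a *\<^sub>C F) = a *\<^sub>C f F" for a F
    unfolding f_def to_completion_scaleC[symmetric]
    by (rule arg_cong[where f = to_completion]) (transfer, simp)
  have "bounded_linear f"
    by (rule bounded_linear_intro[where K = "norm A * norm B"])
      (simp_all add: add scale scaleR_scaleC,
        simp add: f_def norm_to_completion norm_alg_tensor_op mult.commute[of "norm _" "norm A * norm B"])
  then have "bounded_clinear f" by (simp add: bounded_clinear_def scale)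
  then obtain T where T: "\<And>F. T *\<^sub>V to_completion F = f F"
    using completion_extension by blast
  have "alg_tensor_op A B (alg_tensor_vec x y) = alg_tensor_vec (A *\<^sub>V x) (B *\<^sub>V y)" for x y
    by (simp add: form_of_inject[symmetric] alg_tensor_op.rep_eq alg_tensor_vec.rep_eq
        tensor_form_def fun_eq_iff cinner_adj)
  then have PT: "?P T" by (simp add: tensor_vec_def T f_def)
  moreover have "S = T" if "?P S" for S
    by (rule hilbert_tensor_eqI) (use that PT in simp)
  ultimately have "?P (A \<otimes>\<^sub>o B)" unfolding tensor_op_def by (rule theI[of ?P])
  then show ?thesis by blast
qed


section \<open>Positivity, and vector-valued holomorphic functions on the bidisc\<close>

text \<open>Positivity of the operator \<open>[M i j]\<close>, \<open>i, j \<in> I\<close>, on the direct sum of copies of \<open>'h\<close>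
  indexed by the finite set \<open>I\<close>.\<close>

definition op_matrix_nonneg ::
  "'i set \<Rightarrow> ('i \<Rightarrow> 'i \<Rightarrow> 'h::complex_inner \<Rightarrow>\<^sub>C\<^sub>L 'h) \<Rightarrow> bool"
  where "op_matrix_nonneg I M \<longleftrightarrow>
    (\<forall>v. (\<Sum>i\<in>I. \<Sum>j\<in>I. cinner (M i j *\<^sub>V v j) (v i)) \<in> \<real>\<^sub>\<ge>\<^sub>0)"

definition bidisc :: "(complex \<times> complex) set"
  where "bidisc = ball 0 1 \<times> ball 0 1"

text \<open>Holomorphy is Frechet differentiability with complex-linear derivative.\<close>

definition H_infty :: "(complex \<times> complex \<Rightarrow> 'b::complex_normed_vector) set"
  where "H_infty = {f.
    (\<forall>z\<in>bidisc. \<exists>D. (f has_derivative D) (at z) \<and> (\<forall>a h. D (a *\<^sub>C h) = a *\<^sub>C D h)) \<and>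
    bounded (f ` bidisc)}"

definition H_infty_norm :: "(complex \<times> complex \<Rightarrow> 'b::complex_normed_vector) \<Rightarrow> real"
  where "H_infty_norm f = (SUP z\<in>bidisc. norm (f z))"


section \<open>Continuous functions on the closed unit disc\<close>

typedef closed_disc = "cball (0 :: complex) 1"
  morphisms disc_val Closed_disc
  by (rule exI[of _ 0]) simp

instantiation closed_disc :: metric_space
begin

definition dist_closed_disc :: "closed_disc \<Rightarrow> closed_disc \<Rightarrow> real"
  where "dist_closed_disc a b = dist (disc_val a) (disc_val b)"

definition uniformity_closed_disc :: "(closed_disc \<times> closed_disc) filter"
  where "uniformity_closed_disc = (INF e\<in>{0 <..}. principal {(x, y). dist x y < e})"

definition open_closed_disc :: "closed_disc set \<Rightarrow> bool"
  where "open_closed_disc S = (\<forall>x\<in>S. \<forall>\<^sub>F (x', y) in uniformity. x' = x \<longrightarrow> y \<in> S)"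

instance
  by standard
    (auto simp: dist_closed_disc_def uniformity_closed_disc_def open_closed_disc_def
      disc_val_inject dist_triangle2)

end

lemma continuous_on_disc_val: "continuous_on S disc_val"
  unfolding continuous_on_iff dist_closed_disc_def by blast

lemma bcontfun_disc:
  fixes g :: "complex \<Rightarrow> 'b::metric_space"
  assumes "continuous_on (cball 0 1) g"
  shows "(\<lambda>a. g (disc_val a)) \<in> bcontfun"
proof -
  have "range disc_val = cball 0 1"
    by (rule type_definition.Rep_range[OF type_definition_closed_disc])
  then have "range (\<lambda>a. g (disc_val a)) = g ` cball 0 1"
    by (simp add: image_image[symmetric])
  moreover have "bounded (g ` cball 0 1)"
    by (intro compact_imp_bounded compact_continuous_image assms compact_cball)
  moreover have "continuous_on UNIV (\<lambda>a. g (disc_val a))"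
    by (rule continuous_on_compose2[OF assms continuous_on_disc_val]) (use disc_val in blast)
  ultimately show ?thesis by (simp add: bcontfun_def)
qed

text \<open>Since the disc is compact, \<open>closed_disc \<Rightarrow>\<^sub>C complex\<close> is the space of all continuous
  functions on it.\<close>

lemma bcontfun_closed_disc_iff:
  fixes f :: "closed_disc \<Rightarrow> 'b::metric_space"
  shows "f \<in> bcontfun \<longleftrightarrow> continuous_on UNIV f"
proof
  assume "continuous_on UNIV f"
  moreover have "continuous_on (cball 0 1) Closed_disc"
    by (auto simp: continuous_on_iff dist_closed_disc_def Closed_disc_inverse)
  ultimately have "continuous_on (cball 0 1) (\<lambda>z. f (Closed_disc z))"
    by (rule continuous_on_compose2) simp
  then show "f \<in> bcontfun"
    using bcontfun_disc[of "\<lambda>z. f (Closed_disc z)"] by (simp add: disc_val_inverse)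
qed (simp add: bcontfun_def)

setup_lifting type_definition_bcontfun

instantiation bcontfun :: (topological_space, complex_normed_vector) complex_normed_vector
begin

lift_definition scaleC_bcontfun :: "complex \<Rightarrow> ('a \<Rightarrow>\<^sub>C 'b) \<Rightarrow> 'a \<Rightarrow>\<^sub>C 'b"
  is "\<lambda>a f x. a *\<^sub>C f x"
  using bounded_linear_image[OF _ bounded_linear_scaleC]
  by (fastforce simp: bcontfun_def image_image
      intro: bounded_linear.continuous_on[OF bounded_linear_scaleC])

instance
proof
  fix a b :: complex and f g :: "'a \<Rightarrow>\<^sub>C 'b" and r :: real
  show "a *\<^sub>C (f + g) = a *\<^sub>C f + a *\<^sub>C g" "(a + b) *\<^sub>C f = a *\<^sub>C f + b *\<^sub>C f"
    "a *\<^sub>C b *\<^sub>C f = (a * b) *\<^sub>C f" "r *\<^sub>R f = complex_of_real r *\<^sub>C f"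
    by (rule bcontfun_eqI, simp add: scaleC_bcontfun.rep_eq scaleC_add_right scaleC_add_left
        scaleC_scaleC scaleR_scaleC)+
  have le: "norm (c *\<^sub>C k) \<le> cmod c * norm k" for c and k :: "'a \<Rightarrow>\<^sub>C 'b"
  proof (rule norm_bound)
    fix x
    show "norm (apply_bcontfun (c *\<^sub>C k) x) \<le> cmod c * norm k"
      by (simp add: scaleC_bcontfun.rep_eq norm_scaleC mult_left_mono norm_bounded)
  qed
  show "norm (a *\<^sub>C f) = cmod a * norm f"
  proof (cases "a = 0")
    case True
    then have "a *\<^sub>C f = 0"
      by (intro bcontfun_eqI) (simp add: scaleC_bcontfun.rep_eq)
    with True show ?thesis by simp
  next
    case False
    have "inverse a *\<^sub>C (a *\<^sub>C f) = f"
      using False by (intro bcontfun_eqI) (simp add: scaleC_bcontfun.rep_eq scaleC_scaleC)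
    then have "norm f \<le> cmod (inverse a) * norm (a *\<^sub>C f)"
      using le[of "inverse a" "a *\<^sub>C f"] by simp
    then have "cmod a * norm f \<le> norm (a *\<^sub>C f)"
      using False by (simp only: norm_inverse) (simp add: field_simps)
    with le[of a f] show ?thesis by simp
  qed
qed

end

lift_definition times_cnj ::
  "('a::topological_space \<Rightarrow>\<^sub>C complex) \<Rightarrow> ('a \<Rightarrow>\<^sub>C complex) \<Rightarrow> 'a \<Rightarrow>\<^sub>C complex"
  is "\<lambda>f g x. f x * cnj (g x)"
proof -
  fix f g :: "'a \<Rightarrow> complex"
  assume f: "f \<in> bcontfun" and g: "g \<in> bcontfun"
  obtain K L where K: "\<And>x. cmod (f x) \<le> K" and L: "\<And>x. cmod (g x) \<le> L"
    using f g unfolding bcontfun_def bounded_iff by blast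
  show "(\<lambda>x. f x * cnj (g x)) \<in> bcontfun"
  proof (rule bcontfun_normI)
    show "continuous_on UNIV (\<lambda>x. f x * cnj (g x))"
      using f g by (auto simp: bcontfun_def intro!: continuous_intros)
    show "cmod (f x * cnj (g x)) \<le> K * L" for x
      using K L by (simp add: norm_mult mult_mono' order_trans[OF norm_ge_zero K])
  qed
qed


section \<open>The pentablock\<close>

definition pentablock :: "(complex \<times> complex \<times> complex) set"
  where "pentablock = {(A $ 2 $ 1, trace A, det A) | A :: complex^2^2. onorm ((*v) A) < 1}"

abbreviation coord1 :: "complex \<times> complex \<times> complex \<Rightarrow> complex" where "coord1 z \<equiv> fst z"
abbreviation coord2 :: "complex \<times> complex \<times> complex \<Rightarrow> complex" where "coord2 z \<equiv> fst (snd z)"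
abbreviation coord3 :: "complex \<times> complex \<times> complex \<Rightarrow> complex" where "coord3 z \<equiv> snd (snd z)"

definition coord13 :: "complex \<times> complex \<times> complex \<Rightarrow> complex \<times> complex"
  where "coord13 z = (coord1 z, coord3 z)"

definition Phi :: "complex \<Rightarrow> complex \<Rightarrow> complex \<Rightarrow> complex"
  where "Phi \<alpha> s p = (2 * \<alpha> * p - s) / (2 - \<alpha> * s)"

definition psi :: "complex \<Rightarrow> complex \<times> complex \<times> complex \<Rightarrow> complex"
  where "psi \<alpha> z =
    (1 - complex_of_real ((cmod \<alpha>)\<^sup>2)) * coord1 z / (1 - \<alpha> * coord2 z + \<alpha>\<^sup>2 * coord3 z)"

text \<open>\<^const>\<open>Bcontfun\<close> is only meaningful on continuous functions; see the lemmas
  \<open>J_map_apply\<close> and \<open>j_map_apply\<close> below.\<close>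

definition J_map :: "complex \<times> complex \<times> complex \<Rightarrow> closed_disc \<Rightarrow>\<^sub>C complex"
  where "J_map z = Bcontfun (\<lambda>\<alpha>. psi (disc_val \<alpha>) z)"

definition j_map :: "complex \<times> complex \<times> complex \<Rightarrow> closed_disc \<Rightarrow>\<^sub>C complex"
  where "j_map z = Bcontfun (\<lambda>\<alpha>. Phi (disc_val \<alpha>) (coord2 z) (coord3 z))"

context
  fixes A :: "complex^2^2"
  assumes A: "onorm ((*v) A) < 1"
begin

lemma contraction_strict:
  assumes "x \<noteq> 0"
  shows "norm (A *v x) < norm x"
proof -
  have "linear ((*v) A)"
    by (rule linearI) (simp_all add: matrix_vector_mult_def vec_eq_iff algebra_simps sum.distrib
        scaleR_sum_right)
  then have "norm (A *v x) \<le> onorm ((*v) A) * norm x"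
    by (intro onorm) (simp add: linear_conv_bounded_linear)
  also have "\<dots> < norm x"
    using A assms by simp
  finally show ?thesis .
qed

lemma contraction_entry: "cmod (A $ i $ j) < 1"
proof -
  have "cmod (A $ i $ j) = cmod ((A *v axis j 1) $ i)"
    by (simp add: matrix_vector_mult_def axis_def if_distrib[of "\<lambda>x. _ * x"] cong: if_cong)
  also have "\<dots> \<le> norm (A *v axis j 1)" by (rule Finite_Cartesian_Product.norm_nth_le)
  also have "\<dots> < norm (axis j (1 :: complex) :: complex^2)"
    by (rule contraction_strict) (simp add: axis_eq_0_iff)
  finally show ?thesis by simp
qed

lemma contraction_resolvent:
  assumes "cmod \<alpha> \<le> 1"
  shows "1 - \<alpha> * trace A + \<alpha>\<^sup>2 * det A \<noteq> 0"
proof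
  assume 0: "1 - \<alpha> * trace A + \<alpha>\<^sup>2 * det A = 0"
  define B :: "complex^2^2" where "B = (\<chi> i j. (if i = j then 1 else 0) - \<alpha> * A $ i $ j)"
  have "det B = 1 - \<alpha> * trace A + \<alpha>\<^sup>2 * det A"
    by (simp add: B_def det_2 trace_def sum_2 algebra_simps power2_eq_square)
  then have "\<not> invertible B" using 0 by (simp add: invertible_det_nz)
  then obtain x where x: "B *v x = 0" "x \<noteq> 0"
    using invertible_left_inverse matrix_left_invertible_ker by metis
  have "B *v x = x - (\<chi> i. \<alpha> * (A *v x) $ i)"
    by (simp add: B_def matrix_vector_mult_def vec_eq_iff sum_2 forall_2 algebra_simps)
  with x have "x = (\<chi> i. \<alpha> * (A *v x) $ i)" by simp
  moreover have "norm (\<chi> i. \<alpha> * (A *v x) $ i) = cmod \<alpha> * norm (A *v x)"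
    by (simp add: norm_vec_def norm_mult L2_set_right_distrib)
  ultimately have "norm x = cmod \<alpha> * norm (A *v x)" by simp
  also have "\<dots> \<le> norm (A *v x)"
    using assms by (simp add: mult_left_le_one_le)
  finally show False using contraction_strict[OF x(2)] by simp
qed

lemma contraction_det: "cmod (det A) < 1"
proof -
  have col: "(cmod (A $ 1 $ j))\<^sup>2 + (cmod (A $ 2 $ j))\<^sup>2 < 1" for j
  proof -
    have "norm (A *v axis j 1) < norm (axis j (1 :: complex) :: complex^2)"
      by (rule contraction_strict) (simp add: axis_eq_0_iff)
    then have "(norm (A *v axis j 1))\<^sup>2 < 1"
      by (simp add: abs_square_less_1)
    moreover have "(A *v axis j 1) $ i = A $ i $ j" for i
      by (simp add: matrix_vector_mult_def axis_def if_distrib[of "\<lambda>x. _ * x"] cong: if_cong)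
    ultimately show ?thesis by (simp add: norm_vec_def L2_set_def sum_2)
  qed
  have ag: "2 * (u * v) \<le> u\<^sup>2 + v\<^sup>2" for u v :: real
    using sum_squares_bound[of u v] by simp
  have "cmod (det A) \<le> cmod (A $ 1 $ 1) * cmod (A $ 2 $ 2) + cmod (A $ 1 $ 2) * cmod (A $ 2 $ 1)"
    unfolding det_2 norm_mult[symmetric] by (rule norm_triangle_ineq4)
  then show ?thesis
    using col[of 1] col[of 2] ag[of "cmod (A $ 1 $ 1)" "cmod (A $ 2 $ 2)"]
      ag[of "cmod (A $ 1 $ 2)" "cmod (A $ 2 $ 1)"] by linarith
qed

lemma contraction_trace: "cmod (trace A) < 2"
  using norm_triangle_ineq[of "A $ 1 $ 1" "A $ 2 $ 2"] contraction_entry[of 1 1]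
    contraction_entry[of 2 2] by (simp add: trace_def sum_2)

end

lemma coord13_bidisc: "z \<in> pentablock \<Longrightarrow> coord13 z \<in> bidisc"
  by (auto simp: pentablock_def coord13_def bidisc_def contraction_entry contraction_det)

lemma J_map_apply:
  assumes "z \<in> pentablock"
  shows "apply_bcontfun (J_map z) \<alpha> = psi (disc_val \<alpha>) z"
proof -
  obtain A :: "complex^2^2" where A: "onorm ((*v) A) < 1" "z = (A $ 2 $ 1, trace A, det A)"
    using assms by (auto simp: pentablock_def)
  have "continuous_on (cball 0 1) (\<lambda>\<alpha>. psi \<alpha> z)"
    unfolding psi_def using A contraction_resolvent[OF A(1)]
    by (intro continuous_intros) auto
  from bcontfun_disc[OF this] show ?thesis
    by (simp add: J_map_def Bcontfun_inverse)
qed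

lemma j_map_apply:
  assumes "z \<in> pentablock"
  shows "apply_bcontfun (j_map z) \<alpha> = Phi (disc_val \<alpha>) (coord2 z) (coord3 z)"
proof -
  obtain A :: "complex^2^2" where A: "onorm ((*v) A) < 1" "z = (A $ 2 $ 1, trace A, det A)"
    using assms by (auto simp: pentablock_def)
  have nz: "2 - \<beta> * coord2 z \<noteq> 0" if "cmod \<beta> \<le> 1" for \<beta>
  proof
    assume "2 - \<beta> * coord2 z = 0"
    then have "\<beta> * coord2 z = 2" by simp
    then have "cmod \<beta> * cmod (coord2 z) = 2" by (metis norm_mult norm_numeral)
    moreover have "cmod \<beta> * cmod (coord2 z) \<le> cmod (coord2 z)"
      using that by (simp add: mult_left_le_one_le)
    ultimately show False using contraction_trace[OF A(1)] A(2) by simp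
  qed
  have "continuous_on (cball 0 1) (\<lambda>\<alpha>. Phi \<alpha> (coord2 z) (coord3 z))"
    unfolding Phi_def by (intro continuous_intros) (use nz in auto)
  from bcontfun_disc[OF this] show ?thesis
    by (simp add: j_map_def Bcontfun_inverse)
qed


section \<open>Kernels on the pentablock\<close>

definition weak_kernel ::
  "(complex \<times> complex \<times> complex \<Rightarrow> complex \<times> complex \<times> complex \<Rightarrow> 'l::complex_inner \<Rightarrow>\<^sub>C\<^sub>L 'l) \<Rightarrow> bool"
  where "weak_kernel k \<longleftrightarrow>
    (\<forall>(n::nat) z. (\<forall>i<n. z i \<in> pentablock) \<longrightarrow> op_matrix_nonneg {..<n} (\<lambda>i j. k (z i) (z j)))"

definition admissible_kernel ::
  "(complex \<times> complex \<times> complex \<Rightarrow> complex \<times> complex \<times> complex \<Rightarrow> 'l::complex_inner \<Rightarrow>\<^sub>C\<^sub>L 'l) \<Rightarrow> bool"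
  where "admissible_kernel k \<longleftrightarrow>
    weak_kernel k \<and> (\<forall>z\<in>pentablock. k z z \<noteq> 0) \<and>
    (\<forall>\<alpha>\<in>cball 0 1.
      weak_kernel (\<lambda>z w. (1 - coord2 z * cnj (coord2 w) / 4) *\<^sub>C k z w) \<and>
      weak_kernel (\<lambda>z w.
        (1 - Phi \<alpha> (coord2 z) (coord3 z) * cnj (Phi \<alpha> (coord2 w) (coord3 w))) *\<^sub>C k z w) \<and>
      weak_kernel (\<lambda>z w. (1 - psi \<alpha> z * cnj (psi \<alpha> w)) *\<^sub>C k z w))"

text \<open>The entry \<open>\<xi> (z i) (z j) (h i * cnj (h j))\<close> applied to \<open>v j\<close> is paired with \<open>v i\<close>, for all
  vectors \<open>v\<close>, inside \<^const>\<open>op_matrix_nonneg\<close>.\<close>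

definition cp_kernel ::
  "(complex \<times> complex \<times> complex \<Rightarrow> complex \<times> complex \<times> complex \<Rightarrow>
    (closed_disc \<Rightarrow>\<^sub>C complex) \<Rightarrow>\<^sub>C\<^sub>L ('l::complex_inner \<Rightarrow>\<^sub>C\<^sub>L 'l)) \<Rightarrow> bool"
  where "cp_kernel \<xi> \<longleftrightarrow>
    (\<forall>(n::nat) z h. (\<forall>i<n. z i \<in> pentablock) \<longrightarrow>
      op_matrix_nonneg {..<n} (\<lambda>i j. \<xi> (z i) (z j) *\<^sub>V times_cnj (h i) (h j)))"

end

theory Submission
  imports Defs "HOL-Complex_Analysis.Cauchy_Integral_Formula"
begin

text \<open>All three conditions are equivalent to a decomposition \<open>A(z) A(w)\<^sup>* - B(z) B(w)\<^sup>* = (1 - z\<^sub>1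
  w\<^sub>1\<^sup>*) K\<^sub>1(z, w) + (1 - z\<^sub>2 w\<^sub>2\<^sup>*) K\<^sub>2(z, w)\<close> with positive kernels on the bidisc.

  The matrices \<open>A\<close> with trace 0 embed the bidisc into the pentablock by \<open>(a, p) \<mapsto> (a, 0, p)\<close>,
  and there \<open>1 - \<psi>\<^sub>\<alpha> \<psi>\<^sub>\<alpha>\<^sup>*\<close> and \<open>1 - \<Phi>\<^sub>\<alpha> \<Phi>\<^sub>\<alpha>\<^sup>*\<close> are explicit positive combinations of \<open>1 - a a\<^sup>*\<close>, \<open>1
  - p p\<^sup>*\<close> and \<open>1\<close>. Conversely \<open>\<psi>\<^sub>0 z = z\<^sub>1\<close>, and on the whole pentablock \<open>1 - z\<^sub>3 w\<^sub>3\<^sup>*\<close> is an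
  average of the multiples of \<open>1 - \<Phi>\<^sub>\<alpha> \<Phi>\<^sub>\<alpha>\<^sup>*\<close> for \<open>\<alpha> = 1\<close> and \<open>\<alpha> = -1\<close>.

  A factorization \<open>B = A S\<close> gives the decomposition through the Agler decomposition \<open>1 - S(z)
  S(w)\<^sup>* = (1 - z\<^sub>1 w\<^sub>1\<^sup>*) L\<^sub>1 + (1 - z\<^sub>2 w\<^sub>2\<^sup>*) L\<^sub>2\<close> of a contractive function; for polynomials it is
  read off a Schur complement of \<open>1 - T T\<^sup>*\<close>, with \<open>T\<close> the multiplication operator on a
  half-plane of Fourier coefficients, and the general case follows by approximation and weak
  limits. For the converse, on finitely many points, cone duality against admissible kernels
  yields the decomposition, a lurking isometry realizes it as a transfer function \<open>S\<close>, and
  ultrafilter limits pass to the whole bidisc.\<close>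

section \<open>Hilbert space preliminaries\<close>

\<comment> \<open>Why a Schur complement yields two kernels: on the half-plane the first shift is
  unitary and commutes with the adjoint of \<open>T\<close>. Minimising the form of
  \<open>1 - T adj T\<close> over negative frequencies therefore gives a form on the Hardy space
  that the backward shift in the first variable contracts. The rest of the compressed form is a
  maximum over the same frequencies and is contracted by the backward shift in the second variable.
  Szego vectors are eigenvectors of both, so each contraction becomes positivity of a kernel. A norm
  strictly below 1 guarantees the minimisers, hence strictly contractive polynomials. The two given
  functions are arbitrary, so they enter only through the vectors \<open>adj (A z) v\<close> and
  \<open>adj (B z) v\<close> at single points. The converse is thus interpolation on finitely many
  pairs of a point and a vector, and only \<open>S\<close> passes to a limit. Admissibility demands
  \<open>k z z \<noteq> 0\<close> on the whole pentablock, while duality produces kernels supported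
  on finitely many points. A small multiple of the identity on the diagonal repairs this and is sent
  to 0 at the end.\<close>
subclass (in chilbert_space) banach ..

instantiation complex :: chilbert_space
begin
definition cinner_complex :: "complex \<Rightarrow> complex \<Rightarrow> complex"
  where "cinner_complex x y = x * cnj y"
instance
  by standard (auto simp: cinner_complex_def scaleC_complex_def inner_complex_def algebra_simps)
end

instantiation prod :: (complex_inner, complex_inner) complex_inner
begin
definition cinner_prod :: "'a \<times> 'b \<Rightarrow> 'a \<times> 'b \<Rightarrow> complex"
  where "cinner_prod x y = cinner (fst x) (fst y) + cinner (snd x) (snd y)"
instance
proof
  fix x y z :: "'a \<times> 'b" and a :: complex
  show "cinner x y = cnj (cinner y x)"
    by (simp add: cinner_prod_def cinner_commute[of "fst x"] cinner_commute[of "snd x"])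
qed (simp_all add: cinner_prod_def cinner_add_left cinner_scaleC_left scaleC_prod_def
    inner_prod_def inner_eq_Re_cinner algebra_simps)
end

instance prod :: (chilbert_space, chilbert_space) chilbert_space ..

lemma cinner_sum_left: "cinner (\<Sum>i\<in>I. f i) v = (\<Sum>i\<in>I. cinner (f i) (v::'a::complex_inner))"
  by (induction I rule: infinite_finite_induct) (simp_all add: cinner_add_left)

lemma cinner_sum_right: "cinner v (\<Sum>i\<in>I. f i) = (\<Sum>i\<in>I. cinner (v::'a::complex_inner) (f i))"
  by (induction I rule: infinite_finite_induct) (simp_all add: cinner_add_right)

lemma scaleC_sum_right: "a *\<^sub>C (\<Sum>i\<in>I. f i) = (\<Sum>i\<in>I. a *\<^sub>C (f i :: 'a::complex_vector))"
  by (induction I rule: infinite_finite_induct) (simp_all add: scaleC_add_right)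

lemma scaleC_sum_left: "(\<Sum>i\<in>I. f i) *\<^sub>C x = (\<Sum>i\<in>I. f i *\<^sub>C (x :: 'a::complex_vector))"
  by (induction I rule: infinite_finite_induct) (simp_all add: scaleC_add_left)

lemma cblinfun_zero [simp]: "f *\<^sub>V 0 = 0"
  using cblinfun_scaleC[of f 0 0] by simp

lemma cblinfun_diff: "f *\<^sub>V (x - y) = (f *\<^sub>V x) - (f *\<^sub>V y)"
  by (rule linear_diff[OF bounded_linear.linear[OF cblinfun_bounded_linear]])

lemma cblinfun_sum: "f *\<^sub>V (\<Sum>i\<in>I. g i) = (\<Sum>i\<in>I. f *\<^sub>V g i)"
  by (rule linear_sum[OF bounded_linear.linear[OF cblinfun_bounded_linear]])

lemma cblinfun_compose_apply [simp]: "(f o\<^sub>C\<^sub>L g) *\<^sub>V x = f *\<^sub>V (g *\<^sub>V x)"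
  by transfer simp

lemma cblinfun_add_left: "(f + g) *\<^sub>V x = (f *\<^sub>V x) + (g *\<^sub>V x)"
  by transfer simp

lemma cblinfun_diff_left: "(f - g) *\<^sub>V x = (f *\<^sub>V x) - (g *\<^sub>V x)"
  by transfer simp

lemma cblinfun_zero_left [simp]: "0 *\<^sub>V x = 0"
  by transfer simp

lemma cblinfun_scaleC_left: "(a *\<^sub>C f) *\<^sub>V x = a *\<^sub>C (f *\<^sub>V x)"
  by transfer simp

lemma cblinfun_sum_left: "(\<Sum>i\<in>I. f i) *\<^sub>V x = (\<Sum>i\<in>I. f i *\<^sub>V x)"
  by (induction I rule: infinite_finite_induct) (simp_all add: cblinfun_add_left)

lemma cinner_adj': "cinner x (f *\<^sub>V y) = cinner (adj f *\<^sub>V x) y"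
  by (metis cinner_adj cinner_commute)

lemma cinner_eqI_right:
  fixes x y :: "'a::complex_inner"
  assumes "\<And>u. cinner u x = cinner u y"
  shows "x = y"
  by (rule cinner_eqI) (metis assms cinner_commute)


lemma norm_cblinfun_le: "norm (f *\<^sub>V x) \<le> K * norm x"
  if "norm f \<le> K"
  using order_trans[OF norm_cblinfun mult_right_mono[OF that norm_ge_zero]] .

lemma norm_cblinfun_bound: "norm f \<le> K" if "0 \<le> K" "\<And>x. norm (f *\<^sub>V x) \<le> K * norm x"
  using that by transfer (rule onorm_bound)

lemma cblinfun_of_fun:
  fixes f :: "'a::complex_normed_vector \<Rightarrow> 'b::complex_normed_vector"
  assumes "\<And>x y. f (x + y) = f x + f y" "\<And>a x. f (a *\<^sub>C x) = a *\<^sub>C f x"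
    and "\<And>x. norm (f x) \<le> K * norm x" "0 \<le> K"
  obtains T :: "'a \<Rightarrow>\<^sub>C\<^sub>L 'b" where "\<And>x. T *\<^sub>V x = f x" "norm T \<le> K"
proof -
  have "bounded_linear f"
    by (rule bounded_linear_intro[where K = K]) (simp_all add: assms scaleR_scaleC mult.commute)
  then have "bounded_clinear f" by (simp add: bounded_clinear_def assms)
  then have T: "CBlinfun f *\<^sub>V x = f x" for x by (simp add: CBlinfun_inverse)
  show thesis
    by (rule that[OF T]) (rule norm_cblinfun_bound, simp_all add: T assms)
qed

text \<open>Riesz representation in the second argument; linearity in the first comes from
  uniqueness of the representing vector. Weak limits and operator kernels are obtained from their
  forms in this way.\<close>

lemma cblinfun_of_form:
  fixes B :: "'a::complex_normed_vector \<Rightarrow> 'b::chilbert_space \<Rightarrow> complex"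
  assumes add1: "\<And>x y v. B (x + y) v = B x v + B y v" and sc1: "\<And>a x v. B (a *\<^sub>C x) v = a * B x v"
    and add2: "\<And>x u v. B x (u + v) = B x u + B x v" and sc2: "\<And>a x v. B x (a *\<^sub>C v) = cnj a * B x v"
    and le: "\<And>x v. cmod (B x v) \<le> K * norm x * norm v" and K: "0 \<le> K"
  obtains T :: "'a \<Rightarrow>\<^sub>C\<^sub>L 'b" where "\<And>x v. cinner (T *\<^sub>V x) v = B x v" "norm T \<le> K"
proof -
  have "\<exists>y. \<forall>v. cnj (B x v) = cinner v y" for x
  proof (rule Riesz)
    have "bounded_linear (\<lambda>v. cnj (B x v))"
      by (rule bounded_linear_intro[where K = "K * norm x"])
        (use le in \<open>simp_all add: add2 sc2 scaleR_scaleC scaleC_complex_def mult.commute\<close>)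
    then show "bounded_clinear (\<lambda>v. cnj (B x v))"
      by (simp add: bounded_clinear_def sc2 scaleC_complex_def)
  qed
  then obtain t where t': "\<And>x v. cnj (B x v) = cinner v (t x)" by metis
  have t: "cinner (t x) v = B x v" for x v
    by (metis t' cinner_commute complex_cnj_cnj)
  obtain T :: "'a \<Rightarrow>\<^sub>C\<^sub>L 'b" where T: "\<And>x. T *\<^sub>V x = t x" "norm T \<le> K"
  proof (rule cblinfun_of_fun[of t K])
    show "t (x + y) = t x + t y" for x y
      by (rule cinner_eqI) (simp add: t add1 cinner_add_left)
    show "t (a *\<^sub>C x) = a *\<^sub>C t x" for a x
      by (rule cinner_eqI) (simp add: t sc1 cinner_scaleC_left)
    show "norm (t x) \<le> K * norm x" for x
    proof (cases "t x = 0")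
      case False
      have "norm (t x) * norm (t x) = cmod (B x (t x))"
        unfolding t[symmetric] by (simp add: cinner_self norm_power power2_eq_square norm_mult)
      also have "\<dots> \<le> (K * norm x) * norm (t x)" by (rule le)
      finally show ?thesis using False by simp
    qed (simp add: K)
  qed (use K in auto)
  show thesis by (rule that[of T]) (simp_all add: T t)
qed

text \<open>\<open>X\<close> is the inverse of \<open>1 - W\<close>, read off Banach's fixed point
  theorem for \<open>x \<mapsto> b + W x\<close>; uniqueness of the fixed point makes the solution
  linear in \<open>b\<close> and is reused later to identify vectors as values of
  \<open>X\<close>.\<close>

lemma Neumann_inverse:
  fixes W :: "'a::chilbert_space \<Rightarrow>\<^sub>C\<^sub>L 'a"
  assumes W: "norm W \<le> c" and c: "c < 1"
  obtains X :: "'a \<Rightarrow>\<^sub>C\<^sub>L 'a" where "\<And>b. X *\<^sub>V b = b + (W *\<^sub>V (X *\<^sub>V b))"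
    "\<And>b x. x = b + (W *\<^sub>V x) \<Longrightarrow> x = X *\<^sub>V b" "norm X \<le> 1 / (1 - c)"
proof -
  have c0: "0 \<le> c" using W norm_ge_zero order_trans by blast
  have le: "norm (W *\<^sub>V x) \<le> c * norm x" for x
    using W by (rule norm_cblinfun_le)
  have "\<exists>!x. b + (W *\<^sub>V x) = x" for b
    by (rule banach_fix_type[OF c0 c]) (use le in \<open>simp add: dist_norm flip: cblinfun_diff\<close>)
  then obtain s where s: "\<And>b. b + (W *\<^sub>V s b) = s b" and uniq: "\<And>b x. b + (W *\<^sub>V x) = x \<Longrightarrow> x = s b"
    by metis
  obtain X :: "'a \<Rightarrow>\<^sub>C\<^sub>L 'a" where X: "\<And>x. X *\<^sub>V x = s x" "norm X \<le> 1 / (1 - c)"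
  proof (rule cblinfun_of_fun[of s "1 / (1 - c)"])
    show "s (x + y) = s x + s y" for x y
    proof (rule uniq[symmetric])
      have "x + y + (W *\<^sub>V (s x + s y)) = (x + (W *\<^sub>V s x)) + (y + (W *\<^sub>V s y))"
        by (simp add: cblinfun_add algebra_simps)
      then show "x + y + (W *\<^sub>V (s x + s y)) = s x + s y" by (simp only: s)
    qed
    show "s (a *\<^sub>C x) = a *\<^sub>C s x" for a x
      by (rule uniq[symmetric]) (simp add: cblinfun_scaleC s flip: scaleC_add_right)
    show "norm (s x) \<le> 1 / (1 - c) * norm x" for x
    proof -
      have "norm (s x) \<le> norm x + c * norm (s x)"
        using norm_triangle_ineq[of x "W *\<^sub>V s x"] le[of "s x"] s[of x] by simp
      then show ?thesis using c by (simp add: field_simps)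
    qed
  qed (use c in auto)
  show thesis
  proof (rule that[of X])
    show "X *\<^sub>V b = b + (W *\<^sub>V (X *\<^sub>V b))" for b by (simp add: X s)
    show "x = X *\<^sub>V b" if "x = b + (W *\<^sub>V x)" for b x
      unfolding X by (rule uniq) (rule that[symmetric])
  qed (rule X(2))
qed

section \<open>Orthonormal systems and maps between families with equal Gram matrices\<close>

definition orthonormal :: "nat \<Rightarrow> (nat \<Rightarrow> 'a::complex_inner) \<Rightarrow> bool"
  where "orthonormal n e \<longleftrightarrow> (\<forall>k<n. \<forall>l<n. cinner (e k) (e l) = (if k = l then 1 else 0))"

lemma cinner_orthonormal_sums:
  assumes "orthonormal n e"
  shows "cinner (\<Sum>k<n. c k *\<^sub>C e k) (\<Sum>k<n. d k *\<^sub>C e k) = (\<Sum>k<n. c k * cnj (d k))"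
proof -
  have "cinner (\<Sum>k<n. c k *\<^sub>C e k) (\<Sum>k<n. d k *\<^sub>C e k)
      = (\<Sum>k<n. \<Sum>l<n. c k * (cnj (d l) * cinner (e k) (e l)))"
    unfolding cinner_sum_left unfolding cinner_sum_right
    by (simp add: cinner_scaleC_left cinner_scaleC_right mult.left_commute)
  also have "\<dots> = (\<Sum>k<n. \<Sum>l<n. if k = l then c k * cnj (d l) else 0)"
    using assms by (intro sum.cong refl) (auto simp: orthonormal_def)
  also have "\<dots> = (\<Sum>k<n. c k * cnj (d k))" by simp
  finally show ?thesis .
qed

lemma cinner_orthonormal_sum_left:
  assumes "orthonormal n e" "l < n"
  shows "cinner (\<Sum>k<n. c k *\<^sub>C e k) (e l) = c l"
proof -
  have "cinner (\<Sum>k<n. c k *\<^sub>C e k) (e l) = (\<Sum>k<n. if k = l then c k else 0)"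
    unfolding cinner_sum_left cinner_scaleC_left
    using assms by (intro sum.cong refl) (auto simp: orthonormal_def)
  then show ?thesis using assms(2) by simp
qed

lemma norm_orthonormal_sum:
  assumes "orthonormal n e"
  shows "(norm (\<Sum>k<n. c k *\<^sub>C e k))\<^sup>2 = (\<Sum>k<n. (cmod (c k))\<^sup>2)"
proof -
  have "complex_of_real ((norm (\<Sum>k<n. c k *\<^sub>C e k))\<^sup>2) = complex_of_real (\<Sum>k<n. (cmod (c k))\<^sup>2)"
    unfolding cinner_self[symmetric] cinner_orthonormal_sums[OF assms]
    unfolding of_real_sum complex_norm_square ..
  then show ?thesis by (simp only: of_real_eq_iff)
qed

lemma Bessel:
  assumes "orthonormal n e"
  shows "(\<Sum>k<n. (cmod (cinner y (e k)))\<^sup>2) \<le> (norm y)\<^sup>2"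
proof -
  define u where "u = (\<Sum>k<n. cinner y (e k) *\<^sub>C e k)"
  have "cinner y u = (\<Sum>k<n. cnj (cinner y (e k)) * cinner y (e k))"
    by (simp add: u_def cinner_sum_right cinner_scaleC_right)
  also have "\<dots> = complex_of_real (\<Sum>k<n. (cmod (cinner y (e k)))\<^sup>2)"
    unfolding of_real_sum complex_norm_square by (simp add: mult.commute)
  finally have yu: "cinner y u = complex_of_real ((norm u)\<^sup>2)"
    by (simp add: u_def norm_orthonormal_sum[OF assms])
  have "complex_of_real ((norm (y - u))\<^sup>2) = cinner y y - cinner y u - cnj (cinner y u) + cinner u u"
    unfolding cinner_self[symmetric] cinner_commute[of y u, symmetric]
    by (simp add: cinner_diff_left cinner_diff_right flip: cinner_commute)
  also have "\<dots> = complex_of_real ((norm y)\<^sup>2 - (norm u)\<^sup>2)"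
    unfolding yu cinner_self by simp
  finally have "(norm (y - u))\<^sup>2 = (norm y)\<^sup>2 - (norm u)\<^sup>2" by (simp only: of_real_eq_iff)
  then have "(norm u)\<^sup>2 \<le> (norm y)\<^sup>2" by (metis diff_ge_0_iff_ge zero_le_power2)
  then show ?thesis by (simp add: u_def norm_orthonormal_sum[OF assms])
qed

text \<open>The \<open>e k\<close> are recorded as explicit combinations of the \<open>q i\<close>
  because \<open>Gram_isometry\<close> applies the same coefficients to another family with the same
  Gram matrix, which is then orthonormalised as well. Dependent families are allowed:
  \<open>n\<close> is the rank.\<close>

lemma Gram_Schmidt:
  fixes q :: "'i \<Rightarrow> 'a::complex_inner"
  assumes "finite I"
  shows "\<exists>n e. orthonormal n e \<and> (\<forall>k<n. \<exists>\<alpha>. e k = (\<Sum>i\<in>I. \<alpha> i *\<^sub>C q i)) \<and>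
    (\<forall>i\<in>I. q i = (\<Sum>k<n. cinner (q i) (e k) *\<^sub>C e k))"
  using assms
proof (induction I rule: finite_induct)
  case empty
  show ?case by (rule exI[of _ 0]) (simp add: orthonormal_def)
next
  case (insert a I)
  then obtain n e where e: "orthonormal n e"
    and span: "\<And>k. k < n \<Longrightarrow> \<exists>\<alpha>. e k = (\<Sum>i\<in>I. \<alpha> i *\<^sub>C q i)"
    and q: "\<And>i. i \<in> I \<Longrightarrow> q i = (\<Sum>k<n. cinner (q i) (e k) *\<^sub>C e k)"
    by blast
  from span obtain \<alpha> where \<alpha>: "\<And>k. k < n \<Longrightarrow> e k = (\<Sum>i\<in>I. \<alpha> k i *\<^sub>C q i)" by metis
  \<comment> \<open>Projection of the new vector onto the span found so far; if it equals
    \<open>q a\<close>, nothing is added.\<close>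
  define u where "u = (\<Sum>k<n. cinner (q a) (e k) *\<^sub>C e k)"
  have span': "\<exists>\<alpha>. e k = (\<Sum>i\<in>insert a I. \<alpha> i *\<^sub>C q i)" if "k < n" for k
  proof (rule exI[of _ "(\<alpha> k)(a := 0)"])
    have "(\<Sum>i\<in>I. ((\<alpha> k)(a := 0)) i *\<^sub>C q i) = (\<Sum>i\<in>I. \<alpha> k i *\<^sub>C q i)"
      using insert.hyps by (intro sum.cong) auto
    then show "e k = (\<Sum>i\<in>insert a I. ((\<alpha> k)(a := 0)) i *\<^sub>C q i)"
      using insert.hyps \<alpha>[OF that] by simp
  qed
  show ?case
  proof (cases "q a = u")
    case True
    with e span' q show ?thesis unfolding u_def by blast
  next
    case False
    define t where "t = complex_of_real (inverse (norm (q a - u)))"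
    define f where "f = t *\<^sub>C (q a - u)"
    define e' where "e' = e(n := f)"
    have e'[simp]: "e' n = f" "\<And>k. k < n \<Longrightarrow> e' k = e k" by (simp_all add: e'_def)
    have orth: "cinner (q a - u) (e k) = 0" if "k < n" for k
      by (simp add: cinner_diff_left u_def cinner_orthonormal_sum_left[OF e that])
    have fe: "cinner f (e k) = 0" "cinner (e k) f = 0" if "k < n" for k
    proof -
      show "cinner f (e k) = 0"
        by (simp add: f_def cinner_scaleC_left orth that)
      then show "cinner (e k) f = 0" by (metis cinner_commute complex_cnj_zero)
    qed
    have "norm f = 1" using False by (simp add: f_def t_def norm_scaleC norm_inverse)
    then have ff: "cinner f f = 1" by (simp add: cinner_self)
    have "orthonormal (Suc n) e'"
      using e fe ff unfolding orthonormal_def less_Suc_eq by auto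
    moreover have "\<exists>\<alpha>. e' k = (\<Sum>i\<in>insert a I. \<alpha> i *\<^sub>C q i)" if "k < Suc n" for k
    proof (cases "k = n")
      case True
      \<comment> \<open>Coefficients of \<open>t (q a - u)\<close>, with \<open>u\<close> expanded
        through the \<open>\<alpha> k\<close>.\<close>
      define \<beta> where "\<beta> i = (if i = a then t else - t * (\<Sum>k<n. cinner (q a) (e k) * \<alpha> k i))" for i
      have "u = (\<Sum>k<n. \<Sum>i\<in>I. (cinner (q a) (e k) * \<alpha> k i) *\<^sub>C q i)"
        unfolding u_def by (intro sum.cong refl) (simp add: \<alpha> scaleC_sum_right scaleC_scaleC)
      also have "\<dots> = (\<Sum>i\<in>I. (\<Sum>k<n. cinner (q a) (e k) * \<alpha> k i) *\<^sub>C q i)"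
        by (subst sum.swap) (simp add: scaleC_sum_left)
      finally have "(\<Sum>i\<in>I. \<beta> i *\<^sub>C q i) = (- t) *\<^sub>C u"
        using insert.hyps unfolding scaleC_sum_right scaleC_scaleC
        by (simp add: scaleC_sum_right scaleC_scaleC) (intro sum.cong refl, auto simp: \<beta>_def)
      moreover have "\<beta> a = t" by (simp add: \<beta>_def)
      ultimately have "e' k = (\<Sum>i\<in>insert a I. \<beta> i *\<^sub>C q i)"
        using insert.hyps True by (simp add: f_def scaleC_diff_right scaleC_minus_left)
      then show ?thesis by blast
    next
      case False
      then show ?thesis using that span'[of k] by simp
    qed
    moreover have "q i = (\<Sum>k<Suc n. cinner (q i) (e' k) *\<^sub>C e' k)" if "i \<in> insert a I" for i
    proof -
      have S: "(\<Sum>k<Suc n. cinner (q i) (e' k) *\<^sub>C e' k) = (\<Sum>k<n. cinner (q i) (e k) *\<^sub>C e k) + cinner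
          (q i) f *\<^sub>C f"
        by simp
      show ?thesis
      proof (cases "i \<in> I")
        case True
        have "cinner (q i) f = 0"
          by (subst q[OF True]) (simp add: cinner_sum_left cinner_scaleC_left fe)
        then show ?thesis unfolding S using q[OF True] by simp
      next
        case False
        then have i: "i = a" using that by simp
        have "cinner u f = 0" by (simp add: u_def cinner_sum_left cinner_scaleC_left fe)
        then have "cinner (q a) f = cinner (q a - u) f" by (simp add: cinner_diff_left)
        also have "\<dots> = cnj t * cinner (q a - u) (q a - u)" by (simp add: f_def cinner_scaleC_right)
        also have "\<dots> = complex_of_real (norm (q a - u))"
          using \<open>q a \<noteq> u\<close> by (simp add: t_def cinner_self power2_eq_square)
        finally have "cinner (q a) f *\<^sub>C f = (complex_of_real (norm (q a - u)) * t) *\<^sub>C (q a - u)"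
          by (simp add: f_def scaleC_scaleC)
        also have "\<dots> = q a - u" using \<open>q a \<noteq> u\<close> by (simp add: t_def)
        finally show ?thesis unfolding S i by (simp add: u_def)
      qed
    qed
    ultimately show ?thesis by blast
  qed
qed

text \<open>The adjoint of the partial isometry taking each \<open>p i\<close> to \<open>q i\<close>.\<close>

lemma Gram_isometry:
  fixes p :: "'i \<Rightarrow> 'a::complex_inner" and q :: "'i \<Rightarrow> 'b::complex_inner"
  assumes I: "finite I" and Gram: "\<And>i j. i \<in> I \<Longrightarrow> j \<in> I \<Longrightarrow> cinner (p i) (p j) = cinner (q i) (q j)"
  obtains W :: "'b \<Rightarrow>\<^sub>C\<^sub>L 'a" where "norm W \<le> 1" "\<And>y j. j \<in> I \<Longrightarrow> cinner (W *\<^sub>V y) (p j) = cinner y (q j)"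
proof -
  obtain n e where e: "orthonormal n e"
    and span: "\<And>k. k < n \<Longrightarrow> \<exists>\<alpha>. e k = (\<Sum>i\<in>I. \<alpha> i *\<^sub>C q i)"
    and q: "\<And>i. i \<in> I \<Longrightarrow> q i = (\<Sum>k<n. cinner (q i) (e k) *\<^sub>C e k)"
    using Gram_Schmidt[OF I, of q] by blast
  from span obtain \<alpha> where \<alpha>: "\<And>k. k < n \<Longrightarrow> e k = (\<Sum>i\<in>I. \<alpha> k i *\<^sub>C q i)" by metis
  define f where "f k = (\<Sum>i\<in>I. \<alpha> k i *\<^sub>C p i)" for k
  have "orthonormal n f"
    using e \<alpha> Gram by (simp add: orthonormal_def f_def cinner_sum_left cinner_sum_right
        cinner_scaleC_left cinner_scaleC_right)
  have fp: "cinner (f k) (p j) = cinner (e k) (q j)" if "k < n" "j \<in> I" for k j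
    using that Gram by (simp add: f_def \<alpha> cinner_sum_left cinner_scaleC_left)
  \<comment> \<open>Project onto the span of the \<open>q i\<close> and carry \<open>e k\<close> to
    \<open>f k\<close>. The orthogonal complement goes to 0, so Bessel's inequality makes this a
    contraction.\<close>
  define w where "w y = (\<Sum>k<n. cinner y (e k) *\<^sub>C f k)" for y
  obtain W :: "'b \<Rightarrow>\<^sub>C\<^sub>L 'a" where W: "\<And>x. W *\<^sub>V x = w x" "norm W \<le> 1"
  proof (rule cblinfun_of_fun[of w 1])
    show "w (x + y) = w x + w y" for x y
      by (simp add: w_def cinner_add_left scaleC_add_left sum.distrib)
    show "w (a *\<^sub>C x) = a *\<^sub>C w x" for a x
      by (simp add: w_def cinner_scaleC_left scaleC_sum_right scaleC_scaleC)
    have "(norm (w x))\<^sup>2 \<le> (norm x)\<^sup>2" for x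
      unfolding w_def norm_orthonormal_sum[OF \<open>orthonormal n f\<close>] by (rule Bessel[OF e])
    then show "norm (w x) \<le> 1 * norm x" for x by (auto intro: power2_le_imp_le)
  qed auto
  show thesis
  proof (rule that[OF W(2)])
    fix y j assume j: "j \<in> I"
    have "cinner (W *\<^sub>V y) (p j) = (\<Sum>k<n. cinner y (e k) * cinner (e k) (q j))"
      by (simp add: W w_def cinner_sum_left cinner_scaleC_left fp j)
    also have "\<dots> = cinner y (\<Sum>k<n. cinner (q j) (e k) *\<^sub>C e k)"
      unfolding cinner_sum_right cinner_scaleC_right cinner_commute[of "e _" "q j"]
      by (simp add: mult.commute)
    finally show "cinner (W *\<^sub>V y) (p j) = cinner y (q j)" using q[OF j] by simp
  qed
qed

section \<open>Limits along ultrafilters\<close>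

text \<open>Along such a filter every eventually bounded complex function converges, so uncountably
  many matrix coefficients have limits at once. A diagonal subsequence would not serve for the net
  of finite sets of interpolation conditions.\<close>

definition ultrafilter_of :: "'x filter \<Rightarrow> 'x filter"
  where "ultrafilter_of F = (SOME U. U \<le> F \<and> U \<noteq> bot \<and> (\<forall>P. eventually P U \<or> eventually (\<lambda>x. \<not> P x) U))"

text \<open>Zorn's lemma downwards: the infimum of a chain of proper filters is proper, since
  \<open>False\<close> holds eventually in it only if it does in some member. A minimal proper
  filter decides every \<open>P\<close>, because intersecting it with \<open>P\<close> either
  changes nothing or destroys properness.\<close>

lemma ultrafilter_exists:
  assumes F: "F \<noteq> (bot :: 'x filter)"
  shows "\<exists>U. U \<le> F \<and> U \<noteq> bot \<and> (\<forall>P. eventually P U \<or> eventually (\<lambda>x. \<not> P x) U)"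
proof -
  define A where "A = {U. U \<le> F \<and> U \<noteq> bot}"
  have po: "partial_order_on A (relation_of (\<ge>) A)"
    by (rule partial_order_on_relation_ofI) auto
  have "\<exists>u\<in>A. \<forall>c\<in>C. u \<le> c" if C: "C \<in> Chains (relation_of (\<ge>) A)" for C
  proof (cases "C = {}")
    case True
    then show ?thesis using F by (auto simp: A_def)
  next
    case False
    have CA: "C \<subseteq> A" and tot: "\<And>x y. x \<in> C \<Longrightarrow> y \<in> C \<Longrightarrow> x \<le> y \<or> y \<le> x"
      using C by (auto simp: Chains_def relation_of_def)
    have "Inf C \<noteq> bot"
    proof
      assume "Inf C = bot"
      then have "eventually (\<lambda>_. False) (Inf C)" by simp
      moreover have "eventually (\<lambda>_. False) (Inf C) \<longleftrightarrow> (\<exists>b\<in>C. eventually (\<lambda>_. False) b)"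
        by (rule eventually_Inf_base[OF False]) (use tot in \<open>metis inf.absorb1 inf.absorb2 order_refl\<close>)
      ultimately obtain b where "b \<in> C" "eventually (\<lambda>_. False) b" by blast
      then show False using CA by (auto simp: A_def trivial_limit_def)
    qed
    moreover have "Inf C \<le> F"
      using False CA by (metis (no_types, lifting) A_def Inf_lower2 ex_in_conv mem_Collect_eq subsetD)
    ultimately show ?thesis
      by (intro bexI[of _ "Inf C"]) (auto simp: A_def Inf_lower)
  qed
  then have "\<exists>m\<in>A. \<forall>a\<in>A. m \<ge> a \<longrightarrow> a = m"
    by (intro predicate_Zorn[OF po]) blast
  then obtain U where U: "U \<le> F" "U \<noteq> bot" and max: "\<And>V. V \<le> F \<Longrightarrow> V \<noteq> bot \<Longrightarrow> V \<le> U \<Longrightarrow> V = U"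
    by (auto simp: A_def)
  have "eventually P U \<or> eventually (\<lambda>x. \<not> P x) U" for P
  proof (rule disjCI)
    assume n: "\<not> eventually (\<lambda>x. \<not> P x) U"
    define V where "V = inf U (principal {x. P x})"
    have "V \<noteq> bot"
      using n unfolding V_def trivial_limit_def by (simp add: eventually_inf_principal)
    moreover have "V \<le> U" by (simp add: V_def)
    ultimately have "V = U" using max U by (meson order_trans)
    moreover have "eventually P V" by (simp add: V_def eventually_inf_principal)
    ultimately show "eventually P U" by simp
  qed
  with U show ?thesis by blast
qed

lemma
  assumes "F \<noteq> bot"
  shows ultrafilter_of_le: "ultrafilter_of F \<le> F"
    and ultrafilter_of_neq_bot: "ultrafilter_of F \<noteq> bot"
    and ultrafilter_of_ultra: "eventually P (ultrafilter_of F) \<or> eventually (\<lambda>x. \<not> P x)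
        (ultrafilter_of F)"
  using someI_ex[OF ultrafilter_exists[OF assms]] unfolding ultrafilter_of_def by blast+

text \<open>Compactness of the closed disc gives the image filter a cluster point, and an
  ultrafilter converges to any cluster point.\<close>

lemma tendsto_ultrafilter:
  fixes f :: "'x \<Rightarrow> complex"
  assumes F: "F \<noteq> bot" and K: "\<forall>\<^sub>F x in F. cmod (f x) \<le> K"
  shows "(f \<longlongrightarrow> Lim (ultrafilter_of F) f) (ultrafilter_of F)"
proof -
  let ?U = "ultrafilter_of F"
  have nb: "filtermap f ?U \<noteq> bot"
    using ultrafilter_of_neq_bot[OF F] by (simp add: filtermap_bot_iff)
  have "eventually (\<lambda>x. x \<in> cball 0 K) (filtermap f ?U)"
    using filter_leD[OF ultrafilter_of_le[OF F] K] by (simp add: eventually_filtermap)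
  then obtain l where l: "inf (nhds l) (filtermap f ?U) \<noteq> bot"
    using compact_cball[of "0::complex" K] nb unfolding compact_filter by blast
  have "(f \<longlongrightarrow> l) ?U"
  proof (rule topological_tendstoI, rule ccontr)
    fix S assume S: "open S" "l \<in> S" and n: "\<not> eventually (\<lambda>x. f x \<in> S) ?U"
    then have "eventually (\<lambda>x. f x \<notin> S) ?U"
      using ultrafilter_of_ultra[OF F] by blast
    then have "eventually (\<lambda>y. y \<notin> S) (filtermap f ?U)" by (simp add: eventually_filtermap)
    moreover have "eventually (\<lambda>y. y \<in> S) (nhds l)" using S eventually_nhds by blast
    ultimately have "eventually (\<lambda>_. False) (inf (nhds l) (filtermap f ?U))"
      unfolding eventually_inf by (metis (no_types, lifting))
    then show False using l by (simp add: trivial_limit_def)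
  qed
  then show ?thesis using tendsto_Lim ultrafilter_of_neq_bot[OF F] by blast
qed

section \<open>Square-summable families\<close>

text \<open>Serves several purposes: Gram vectors of scalar matrices, Fourier coefficients indexed
  by \<open>int \<times> nat\<close>, and orthogonal copies of a space indexed by points.\<close>

typedef (overloaded) ('i, 'l) ell2 =
  "{f :: 'i \<Rightarrow> 'l::complex_inner. (\<lambda>i. (norm (f i))\<^sup>2) summable_on UNIV}"
  morphisms ell2_nth Ell2
  by (rule exI[of _ "\<lambda>_. 0"]) simp

setup_lifting type_definition_ell2

lemma ell2_eqI: "(\<And>i. ell2_nth f i = ell2_nth g i) \<Longrightarrow> f = g"
  by transfer auto

lemma norm_add_square_le:
  fixes x y :: "'a::real_normed_vector"
  shows "(norm (x + y))\<^sup>2 \<le> 2 * (norm x)\<^sup>2 + 2 * (norm y)\<^sup>2"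
proof -
  have "(norm (x + y))\<^sup>2 \<le> (norm x + norm y)\<^sup>2"
    by (simp add: norm_triangle_ineq power_mono)
  also have "\<dots> \<le> 2 * (norm x)\<^sup>2 + 2 * (norm y)\<^sup>2"
    using sum_squares_bound[of "norm x" "norm y"] by (simp add: power2_sum)
  finally show ?thesis .
qed

lemma summable_on_le:
  fixes f g :: "'i \<Rightarrow> real"
  assumes "g summable_on A" "\<And>i. 0 \<le> f i" "\<And>i. f i \<le> g i"
  shows "f summable_on A"
  using summable_on_comparison_test[OF assms(1), of f] assms(2,3) by auto

lemma infsum_complex_of_real:
  fixes f :: "'i \<Rightarrow> real"
  assumes "f summable_on A"
  shows "(\<Sum>\<^sub>\<infinity>i\<in>A. complex_of_real (f i)) = complex_of_real (\<Sum>\<^sub>\<infinity>i\<in>A. f i)"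
  using has_sum_infsum[OF assms] by (intro infsumI) (simp add: has_sum_of_real_iff)

lemma ell2_add_summable:
  fixes f g :: "'i \<Rightarrow> 'l::real_normed_vector"
  assumes "(\<lambda>i. (norm (f i))\<^sup>2) summable_on UNIV" "(\<lambda>i. (norm (g i))\<^sup>2) summable_on UNIV"
  shows "(\<lambda>i. (norm (f i + g i))\<^sup>2) summable_on UNIV"
proof (rule summable_on_le)
  show "(\<lambda>i. 2 * (norm (f i))\<^sup>2 + 2 * (norm (g i))\<^sup>2) summable_on UNIV"
    by (intro summable_on_add summable_on_cmult_right assms)
qed (simp_all add: norm_add_square_le)

instantiation ell2 :: (type, complex_inner) complex_vector
begin

lift_definition zero_ell2 :: "('a, 'b) ell2" is "\<lambda>_. 0" by simp

lift_definition plus_ell2 :: "('a, 'b) ell2 \<Rightarrow> ('a, 'b) ell2 \<Rightarrow> ('a, 'b) ell2" is "\<lambda>f g i. f i + g i"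
  by (rule ell2_add_summable)

lift_definition uminus_ell2 :: "('a, 'b) ell2 \<Rightarrow> ('a, 'b) ell2" is "\<lambda>f i. - f i" by simp

lift_definition minus_ell2 :: "('a, 'b) ell2 \<Rightarrow> ('a, 'b) ell2 \<Rightarrow> ('a, 'b) ell2" is "\<lambda>f g i. f i - g i"
  subgoal for f g using ell2_add_summable[of f "\<lambda>i. - g i"] by simp
  done

lift_definition scaleC_ell2 :: "complex \<Rightarrow> ('a, 'b) ell2 \<Rightarrow> ('a, 'b) ell2" is "\<lambda>a f i. a *\<^sub>C f i"
  by (simp add: norm_scaleC power_mult_distrib summable_on_cmult_right)

lift_definition scaleR_ell2 :: "real \<Rightarrow> ('a, 'b) ell2 \<Rightarrow> ('a, 'b) ell2" is "\<lambda>a f i. a *\<^sub>R f i"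
  by (simp add: power_mult_distrib summable_on_cmult_right)

instance
  by standard (transfer, simp add: fun_eq_iff scaleC_add_right scaleC_add_left scaleC_scaleC
    scaleR_add_right scaleR_add_left scaleR_scaleC)+

end

lemma ell2_cinner_summable:
  fixes f g :: "('i, 'l::complex_inner) ell2"
  shows "(\<lambda>i. cinner (ell2_nth f i) (ell2_nth g i)) summable_on UNIV"
proof (rule abs_summable_summable, rule summable_on_le)
  show "(\<lambda>i. (norm (ell2_nth f i))\<^sup>2 + (norm (ell2_nth g i))\<^sup>2) summable_on UNIV"
    using ell2_nth[of f] ell2_nth[of g] by (intro summable_on_add) simp_all
  show "norm (cinner (ell2_nth f i) (ell2_nth g i)) \<le> (norm (ell2_nth f i))\<^sup>2 + (norm (ell2_nth g
      i))\<^sup>2" for i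
  proof -
    have "2 * (norm (ell2_nth f i) * norm (ell2_nth g i)) \<le> (norm (ell2_nth f i))\<^sup>2 + (norm (ell2_nth
        g i))\<^sup>2"
      using sum_squares_bound[of "norm (ell2_nth f i)" "norm (ell2_nth g i)"] by simp
    moreover have "0 \<le> norm (ell2_nth f i) * norm (ell2_nth g i)" by simp
    ultimately show ?thesis
      using Cauchy_Schwarz_cinner[of "ell2_nth f i" "ell2_nth g i"] by linarith
  qed
qed simp

instantiation ell2 :: (type, complex_inner) complex_inner
begin

definition cinner_ell2 :: "('a, 'b) ell2 \<Rightarrow> ('a, 'b) ell2 \<Rightarrow> complex"
  where "cinner_ell2 f g = (\<Sum>\<^sub>\<infinity>i. cinner (ell2_nth f i) (ell2_nth g i))"

definition inner_ell2 :: "('a, 'b) ell2 \<Rightarrow> ('a, 'b) ell2 \<Rightarrow> real"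
  where "inner_ell2 f g = Re (cinner f g)"

definition norm_ell2 :: "('a, 'b) ell2 \<Rightarrow> real"
  where "norm_ell2 f = sqrt (inner f f)"

definition dist_ell2 :: "('a, 'b) ell2 \<Rightarrow> ('a, 'b) ell2 \<Rightarrow> real"
  where "dist_ell2 f g = norm (f - g)"

definition uniformity_ell2 :: "(('a, 'b) ell2 \<times> ('a, 'b) ell2) filter"
  where "uniformity_ell2 = (INF e\<in>{0 <..}. principal {(x, y). dist x y < e})"

definition open_ell2 :: "('a, 'b) ell2 set \<Rightarrow> bool"
  where "open_ell2 S = (\<forall>x\<in>S. \<forall>\<^sub>F (x', y) in uniformity. x' = x \<longrightarrow> y \<in> S)"

definition sgn_ell2 :: "('a, 'b) ell2 \<Rightarrow> ('a, 'b) ell2"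
  where "sgn_ell2 f = inverse (norm f) *\<^sub>R f"

instance
proof
  fix f g h :: "('a, 'b) ell2" and a :: complex and r :: real
  show comm: "cinner f g = cnj (cinner g f)"
    unfolding cinner_ell2_def infsum_cnj[symmetric]
    by (intro infsum_cong) (rule cinner_commute)
  show add: "cinner (f + g) h = cinner f h + cinner g h"
    by (simp add: cinner_ell2_def plus_ell2.rep_eq cinner_add_left infsum_add ell2_cinner_summable)
  show scale: "cinner (a *\<^sub>C f) g = a * cinner f g" for a
    by (simp add: cinner_ell2_def scaleC_ell2.rep_eq cinner_scaleC_left infsum_cmult_right')
  have self: "cinner f f = complex_of_real (\<Sum>\<^sub>\<infinity>i. (norm (ell2_nth f i))\<^sup>2)"
    unfolding cinner_ell2_def cinner_self
    by (rule infsum_complex_of_real) (use ell2_nth[of f] in simp)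
  show "inner f g = Re (cinner f g)"
    by (rule inner_ell2_def)
  show "inner f g = inner g f"
    unfolding inner_ell2_def by (subst comm) simp
  show "inner (f + g) h = inner f h + inner g h"
    by (simp add: inner_ell2_def add)
  show "inner (r *\<^sub>R f) g = r * inner f g"
    by (simp add: inner_ell2_def scaleR_scaleC scale)
  show "0 \<le> inner f f"
    by (simp add: inner_ell2_def self infsum_nonneg)
  show "inner f f = 0 \<longleftrightarrow> f = 0"
  proof
    assume "inner f f = 0"
    then have "(\<Sum>\<^sub>\<infinity>i. (norm (ell2_nth f i))\<^sup>2) = 0" by (simp add: inner_ell2_def self)
    then have "(norm (ell2_nth f i))\<^sup>2 = 0" for i
      using ell2_nth[of f] by (intro nonneg_infsum_le_0D[of _ UNIV]) simp_all
    then show "f = 0" by (intro ell2_eqI) (simp add: zero_ell2.rep_eq)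
  next
    assume "f = 0"
    then show "inner f f = 0" by (simp add: inner_ell2_def cinner_ell2_def zero_ell2.rep_eq)
  qed
qed (rule norm_ell2_def dist_ell2_def open_ell2_def sgn_ell2_def uniformity_ell2_def)+

end

lemma norm_ell2_square: "(norm f)\<^sup>2 = (\<Sum>\<^sub>\<infinity>i. (norm (ell2_nth f i))\<^sup>2)"
proof -
  have "complex_of_real ((norm f)\<^sup>2) = complex_of_real (\<Sum>\<^sub>\<infinity>i. (norm (ell2_nth f i))\<^sup>2)"
    unfolding cinner_self[symmetric] unfolding cinner_ell2_def unfolding cinner_self
    by (rule infsum_complex_of_real) (use ell2_nth[of f] in simp)
  then show ?thesis by (simp only: of_real_eq_iff)
qed

lemma ell2_nth_summable: "(\<lambda>i. (norm (ell2_nth f i))\<^sup>2) summable_on UNIV"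
  using ell2_nth[of f] by simp

lemma ell2_finite_sum_le: "finite F \<Longrightarrow> (\<Sum>i\<in>F. (norm (ell2_nth f i))\<^sup>2) \<le> (norm f)\<^sup>2"
  unfolding norm_ell2_square by (rule finite_sum_le_infsum[OF ell2_nth_summable]) auto

lemma ell2_nth_le: "norm (ell2_nth f i) \<le> norm f"
  using ell2_finite_sum_le[of "{i}" f] by (auto intro: power2_le_imp_le)

text \<open>One bound on finite sums yields both membership and the norm estimate, so that operators
  on these spaces can be estimated on finite index sets only.\<close>

lemma ell2_of_finite_sums:
  fixes f :: "'i \<Rightarrow> 'l::complex_inner"
  assumes "\<And>F. finite F \<Longrightarrow> (\<Sum>i\<in>F. (norm (f i))\<^sup>2) \<le> K\<^sup>2" "0 \<le> K"
  obtains g where "ell2_nth g = f" "norm g \<le> K"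
proof -
  have s: "(\<lambda>i. (norm (f i))\<^sup>2) summable_on UNIV"
    by (rule nonneg_bdd_above_summable_on) (auto simp: bdd_above_def intro!: exI[of _ "K\<^sup>2"] assms)
  then have g: "ell2_nth (Ell2 f) = f" by (simp add: Ell2_inverse)
  have "(norm (Ell2 f))\<^sup>2 \<le> K\<^sup>2"
    unfolding norm_ell2_square g by (rule infsum_le_finite_sums[OF s]) (simp add: assms)
  then have "norm (Ell2 f) \<le> K" using assms(2) by (rule power2_le_imp_le)
  with g show thesis by (rule that)
qed

text \<open>The limit is taken coordinatewise. Each finite partial sum of squared differences
  inherits the Cauchy bound, which gives at once membership of the limit and convergence in
  norm.\<close>

instance ell2 :: (type, chilbert_space) chilbert_space
proof
  fix X :: "nat \<Rightarrow> ('a, 'b) ell2"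
  assume X: "Cauchy X"
  have "Cauchy (\<lambda>n. ell2_nth (X n) i)" for i
  proof (rule metric_CauchyI)
    fix e :: real assume "0 < e"
    then obtain M where M: "\<And>m n. m \<ge> M \<Longrightarrow> n \<ge> M \<Longrightarrow> dist (X m) (X n) < e"
      using X by (metis metric_CauchyD)
    have "dist (ell2_nth (X m) i) (ell2_nth (X n) i) \<le> dist (X m) (X n)" for m n
      using ell2_nth_le[of "X m - X n" i] by (simp add: dist_norm minus_ell2.rep_eq)
    with M show "\<exists>M. \<forall>m\<ge>M. \<forall>n\<ge>M. dist (ell2_nth (X m) i) (ell2_nth (X n) i) < e"
      by (meson le_less_trans)
  qed
  then have "\<exists>l. (\<lambda>n. ell2_nth (X n) i) \<longlonglongrightarrow> l" for i
    using Cauchy_convergent convergent_def by blast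
  then obtain f where f: "\<And>i. (\<lambda>n. ell2_nth (X n) i) \<longlonglongrightarrow> f i" by metis
  have close: "\<exists>M. \<forall>m\<ge>M. \<exists>g. ell2_nth g = (\<lambda>i. f i - ell2_nth (X m) i) \<and> norm g \<le> e" if e: "0 < e" for e
  proof -
    obtain M where M: "\<And>m n. m \<ge> M \<Longrightarrow> n \<ge> M \<Longrightarrow> dist (X n) (X m) < e"
      using X e by (metis metric_CauchyD)
    have "\<exists>g. ell2_nth g = (\<lambda>i. f i - ell2_nth (X m) i) \<and> norm g \<le> e" if m: "M \<le> m" for m
    proof -
      have "(\<Sum>i\<in>F. (norm (f i - ell2_nth (X m) i))\<^sup>2) \<le> e\<^sup>2" if F: "finite F" for F
      proof (rule LIMSEQ_le_const2)
        show "(\<lambda>n. \<Sum>i\<in>F. (norm (ell2_nth (X n) i - ell2_nth (X m) i))\<^sup>2)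
            \<longlonglongrightarrow> (\<Sum>i\<in>F. (norm (f i - ell2_nth (X m) i))\<^sup>2)"
          by (intro tendsto_intros f)
        have "(\<Sum>i\<in>F. (norm (ell2_nth (X n) i - ell2_nth (X m) i))\<^sup>2) \<le> e\<^sup>2" if "M \<le> n" for n
        proof -
          have "(\<Sum>i\<in>F. (norm (ell2_nth (X n) i - ell2_nth (X m) i))\<^sup>2) \<le> (norm (X n - X m))\<^sup>2"
            using ell2_finite_sum_le[OF F, of "X n - X m"] by (simp add: minus_ell2.rep_eq)
          also have "\<dots> \<le> e\<^sup>2"
            using M[OF m that] by (intro power_mono) (simp_all add: dist_norm)
          finally show ?thesis .
        qed
        then show "\<exists>N. \<forall>n\<ge>N. (\<Sum>i\<in>F. (norm (ell2_nth (X n) i - ell2_nth (X m) i))\<^sup>2) \<le> e\<^sup>2" by blast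
      qed
      then show ?thesis using e ell2_of_finite_sums[of "\<lambda>i. f i - ell2_nth (X m) i" e]
        by (metis less_imp_le)
    qed
    then show ?thesis by blast
  qed
  \<comment> \<open>The limit differs from some member of the sequence by a square-summable family,
    hence is itself an element of the space.\<close>
  obtain m g where g: "ell2_nth g = (\<lambda>i. f i - ell2_nth (X m) i)"
    using close[of 1] by auto
  define L where "L = g + X m"
  have L: "ell2_nth L = f" by (simp add: L_def plus_ell2.rep_eq g)
  have "X \<longlonglongrightarrow> L"
  proof (rule metric_LIMSEQ_I)
    fix e :: real assume "0 < e"
    then obtain M where M: "\<And>m. m \<ge> M \<Longrightarrow> \<exists>g. ell2_nth g = (\<lambda>i. f i - ell2_nth (X m) i) \<and> norm g \<le> e / 2"
      using close[of "e / 2"] by auto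
    have "dist (X m) L < e" if m: "M \<le> m" for m
    proof -
      obtain g where "ell2_nth g = (\<lambda>i. f i - ell2_nth (X m) i)" "norm g \<le> e / 2"
        using M[OF m] by blast
      moreover from this have "g = L - X m" by (intro ell2_eqI) (simp add: minus_ell2.rep_eq L)
      ultimately show ?thesis using \<open>0 < e\<close> by (simp add: dist_norm norm_minus_commute)
    qed
    then show "\<exists>M. \<forall>m\<ge>M. dist (X m) L < e" by blast
  qed
  then show "convergent X" by (rule convergentI)
qed

lift_definition ell2_single :: "'i \<Rightarrow> 'l::complex_inner \<Rightarrow> ('i, 'l) ell2"
  is "\<lambda>k x i. if i = k then x else 0"
proof -
  fix k :: 'i and x :: 'l
  have "(\<lambda>i. (norm (if i = k then x else 0))\<^sup>2) = (\<lambda>i. if i \<in> {k} then (norm x)\<^sup>2 else 0)"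
    by auto
  then show "(\<lambda>i. (norm (if i = k then x else 0))\<^sup>2) summable_on UNIV"
    by (auto intro!: finite_nonzero_values_imp_summable_on)
qed

lemma ell2_nth_sum: "ell2_nth (\<Sum>k\<in>I. f k) i = (\<Sum>k\<in>I. ell2_nth (f k) i)"
  by (induction I rule: infinite_finite_induct) (simp_all add: plus_ell2.rep_eq zero_ell2.rep_eq)

lemma cinner_ell2_single: "cinner f (ell2_single k x) = cinner (ell2_nth f k) x"
proof -
  have "cinner f (ell2_single k x) = (\<Sum>\<^sub>\<infinity>i\<in>{k}. cinner (ell2_nth f i) (ell2_nth (ell2_single k x) i))"
    unfolding cinner_ell2_def by (rule infsum_cong_neutral) (auto simp: ell2_single.rep_eq)
  then show ?thesis by (simp add: ell2_single.rep_eq)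
qed

section \<open>Positive semidefinite matrices\<close>

text \<open>The convention is that of a Gram matrix \<open>K i j = cinner (g i) (g j)\<close>;
  relative to \<open>op_matrix_nonneg\<close> the two indices are exchanged. Membership in the
  nonnegative reals includes that the form is real, from which Hermitian symmetry follows.\<close>

definition psd :: "'i set \<Rightarrow> ('i \<Rightarrow> 'i \<Rightarrow> complex) \<Rightarrow> bool"
  where "psd I K \<longleftrightarrow> (\<forall>c. (\<Sum>i\<in>I. \<Sum>j\<in>I. K i j * (c i * cnj (c j))) \<in> \<real>\<^sub>\<ge>\<^sub>0)"

lemma nonneg_Reals_sum: "(\<And>i. i \<in> I \<Longrightarrow> f i \<in> \<real>\<^sub>\<ge>\<^sub>0) \<Longrightarrow> (\<Sum>i\<in>I. f i :: complex) \<in> \<real>\<^sub>\<ge>\<^sub>0"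
  by (induction I rule: infinite_finite_induct) auto

lemma psd_cong: "(\<And>i j. i \<in> I \<Longrightarrow> j \<in> I \<Longrightarrow> K i j = L i j) \<Longrightarrow> psd I K \<longleftrightarrow> psd I L"
  unfolding psd_def by (simp cong: sum.cong)

lemma psd_subset:
  assumes "psd I K" "J \<subseteq> I" "finite I"
  shows "psd J K"
  unfolding psd_def
proof
  fix c :: "'a \<Rightarrow> complex"
  let ?d = "\<lambda>i. if i \<in> J then c i else 0"
  have "(\<Sum>i\<in>I. \<Sum>j\<in>I. K i j * (?d i * cnj (?d j))) = (\<Sum>i\<in>J. \<Sum>j\<in>J. K i j * (c i * cnj (c j)))"
  proof (rule sum.mono_neutral_cong_right)
    show "(\<Sum>j\<in>I. K i j * (?d i * cnj (?d j))) = (\<Sum>j\<in>J. K i j * (c i * cnj (c j)))" if "i \<in> J" for i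
      using that assms by (intro sum.mono_neutral_cong_right) auto
  qed (use assms in auto)
  then show "(\<Sum>i\<in>J. \<Sum>j\<in>J. K i j * (c i * cnj (c j))) \<in> \<real>\<^sub>\<ge>\<^sub>0"
    using assms(1)[unfolded psd_def, rule_format, of ?d] by (simp only:)
qed

lemma psd_diag:
  assumes "psd I K" "i \<in> I" "finite I"
  shows "K i i \<in> \<real>\<^sub>\<ge>\<^sub>0"
proof -
  have "psd {i} K" using assms by (intro psd_subset[OF assms(1)]) auto
  from this[unfolded psd_def, rule_format, of "\<lambda>_. 1"] show ?thesis by simp
qed

lemma psd_pair:
  assumes "psd I K" "i \<in> I" "j \<in> I" "i \<noteq> j" "finite I"
  shows "K i i * (a * cnj a) + K i j * (a * cnj b) + K j i * (b * cnj a) + K j j * (b * cnj b) \<in> \<real>\<^sub>\<ge>\<^sub>0"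
proof -
  have "psd {i, j} K" using psd_subset[OF assms(1)] assms by auto
  then have "(\<Sum>k\<in>{i, j}. \<Sum>l\<in>{i, j}. K k l * ((if k = i then a else b) * cnj (if l = i then a else
      b))) \<in> \<real>\<^sub>\<ge>\<^sub>0"
    unfolding psd_def by (rule spec)
  then show ?thesis using assms(4) by (simp add: algebra_simps)
qed

text \<open>Reality of the 2 by 2 form at the coefficients \<open>(1, 1)\<close> and
  \<open>(1, \<i>)\<close> compares the imaginary and the real parts.\<close>

lemma psd_hermitian:
  assumes "psd I K" "i \<in> I" "j \<in> I" "finite I"
  shows "K j i = cnj (K i j)"
proof (cases "i = j")
  case True
  then show ?thesis using psd_diag[OF assms(1,2,4)] by (auto elim: nonneg_Reals_cases)
next
  case False
  have re: "Im (K i i) = 0" "Im (K j j) = 0"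
    using psd_diag[OF assms(1,2,4)] psd_diag[OF assms(1,3,4)]
    by (simp_all add: complex_nonneg_Reals_iff)
  have "Im (K i j + K j i) = 0"
    using psd_pair[OF assms(1-3) False assms(4), of 1 1] re by (auto simp: complex_nonneg_Reals_iff)
  moreover have "Re (K i j - K j i) = 0"
    using psd_pair[OF assms(1-3) False assms(4), of 1 \<i>] re by (auto simp: complex_nonneg_Reals_iff)
  ultimately show ?thesis by (simp add: complex_eq_iff)
qed

lemma psd_zero_row:
  assumes "psd I K" "i \<in> I" "a \<in> I" "finite I" "K a a = 0"
  shows "K i a = 0"
proof (rule ccontr)
  assume nz: "K i a \<noteq> 0"
  then have "i \<noteq> a" using assms by auto
  \<comment> \<open>With \<open>s = - t K i a\<close> the 2 by 2 form at \<open>(1, s)\<close>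
    equals \<open>K i i - 2 t |K i a|^2\<close>, and this \<open>t\<close> makes its real part
    -1.\<close>
  define t where "t = (Re (K i i) + 1) / (2 * (cmod (K i a))\<^sup>2)"
  define s where "s = - (complex_of_real t * K i a)"
  have h: "K a i = cnj (K i a)" by (rule psd_hermitian) (use assms in auto)
  have "K i i + K i a * cnj s + K a i * s \<in> \<real>\<^sub>\<ge>\<^sub>0"
    using psd_pair[OF assms(1-3) \<open>i \<noteq> a\<close> assms(4), of 1 s] assms(5) by simp
  then have "0 \<le> Re (K i i + K i a * cnj s + K a i * s)" by (simp add: complex_nonneg_Reals_iff)
  also have "K i i + K i a * cnj s + K a i * s = K i i - 2 * t * (K i a * cnj (K i a))"
    unfolding h s_def by (simp add: algebra_simps)
  also have "Re \<dots> = Re (K i i) - 2 * t * (cmod (K i a))\<^sup>2"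
    by (simp flip: complex_norm_square of_real_power)
  also have "\<dots> = -1" using nz by (simp add: t_def field_simps)
  finally show False by simp
qed

text \<open>Induction by the Schur complement at the pivot \<open>a\<close>. A zero pivot is covered
  by the convention \<open>x / 0 = 0\<close>, since its row and column vanish by
  \<open>psd_zero_row\<close>.\<close>

lemma psd_Cholesky:
  assumes "finite I" "psd I K"
  shows "\<exists>g. \<forall>i\<in>I. \<forall>j\<in>I. K i j = (\<Sum>k\<in>I. g i k * cnj (g j k))"
  using assms
proof (induction I arbitrary: K rule: finite_induct)
  case (insert a I)
  have fin: "finite (insert a I)" using insert.hyps by simp
  have aa: "K a a \<in> \<real>\<^sub>\<ge>\<^sub>0" by (rule psd_diag[OF insert.prems _ fin]) simp
  have herm: "K a i = cnj (K i a)" if "i \<in> I" for i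
    by (rule psd_hermitian[OF insert.prems]) (use that fin in auto)
  define s where "s = complex_of_real (sqrt (Re (K a a)))"
  have ss: "s * s = K a a" and cs: "cnj s = s"
    using aa by (auto simp: s_def elim!: nonneg_Reals_cases simp flip: of_real_mult)
  have zero: "K i a = 0" if "K a a = 0" "i \<in> I" for i
    by (rule psd_zero_row[OF insert.prems]) (use that fin in auto)
  define L where "L i j = K i j - K i a * K a j / K a a" for i j
  have "psd I L"
    unfolding psd_def
  proof
    fix c
    define T where "T = (\<Sum>i\<in>I. K i a * c i)"
    have T': "cnj T = (\<Sum>j\<in>I. K a j * cnj (c j))"
      unfolding T_def cnj_sum by (intro sum.cong refl) (simp add: herm)
    \<comment> \<open>The value at \<open>a\<close> minimises the form in that coordinate, so the
      full form at \<open>d\<close> is the form of the Schur complement \<open>L\<close> at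
      \<open>c\<close>.\<close>
    define d where "d = c(a := - T / K a a)"
    have da: "d a = - T / K a a" by (simp add: d_def)
    have dI: "d i = c i" if "i \<in> I" for i
      using that insert.hyps by (auto simp: d_def)
    have ca: "cnj (K a a) = K a a" using aa by (auto elim: nonneg_Reals_cases)
    have T0: "T = 0" if "K a a = 0" using zero[OF that] by (simp add: T_def)
    have "(\<Sum>i\<in>insert a I. \<Sum>j\<in>insert a I. K i j * (d i * cnj (d j)))
      = (\<Sum>i\<in>I. \<Sum>j\<in>I. K i j * (d i * cnj (d j))) + (\<Sum>i\<in>I. K i a * (d i * cnj (d a)))
        + (\<Sum>j\<in>I. K a j * (d a * cnj (d j))) + K a a * (d a * cnj (d a))"
      using insert.hyps by (simp add: sum.distrib algebra_simps)
    also have "(\<Sum>i\<in>I. \<Sum>j\<in>I. K i j * (d i * cnj (d j))) = (\<Sum>i\<in>I. \<Sum>j\<in>I. K i j * (c i * cnj (c j)))"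
      by (intro sum.cong refl) (simp add: dI)
    also have "(\<Sum>i\<in>I. K i a * (d i * cnj (d a))) = T * cnj (d a)"
      unfolding T_def sum_distrib_right by (intro sum.cong refl) (simp add: dI)
    also have "(\<Sum>j\<in>I. K a j * (d a * cnj (d j))) = d a * cnj T"
      unfolding T' sum_distrib_left by (intro sum.cong refl) (simp add: dI)
    also have "(\<Sum>i\<in>I. \<Sum>j\<in>I. K i j * (c i * cnj (c j))) + T * cnj (d a) + d a * cnj T + K a a * (d a
        * cnj (d a))
      = (\<Sum>i\<in>I. \<Sum>j\<in>I. K i j * (c i * cnj (c j))) - T * cnj T / K a a"
      using T0 by (cases "K a a = 0") (simp_all add: da ca field_simps)
    also have "T * cnj T / K a a = (\<Sum>i\<in>I. \<Sum>j\<in>I. K i a * K a j / K a a * (c i * cnj (c j)))"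
      unfolding T' unfolding T_def sum_product sum_divide_distrib
          by (intro sum.cong refl) (simp add: field_simps)
    also have "(\<Sum>i\<in>I. \<Sum>j\<in>I. K i j * (c i * cnj (c j))) - (\<Sum>i\<in>I. \<Sum>j\<in>I. K i a * K a j / K a a * (c i *
        cnj (c j)))
      = (\<Sum>i\<in>I. \<Sum>j\<in>I. L i j * (c i * cnj (c j)))"
      by (simp add: L_def sum_subtractf left_diff_distrib)
    finally show "(\<Sum>i\<in>I. \<Sum>j\<in>I. L i j * (c i * cnj (c j))) \<in> \<real>\<^sub>\<ge>\<^sub>0"
      using insert.prems[unfolded psd_def, rule_format, of d] by (simp only:)
  qed
  from insert.IH[OF this] obtain g where g: "\<And>i j. i \<in> I \<Longrightarrow> j \<in> I \<Longrightarrow> L i j = (\<Sum>k\<in>I. g i k * cnj (g j k))"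
    by blast
  define h where "h i k = (if k = a then K i a / s else if i = a then 0 else g i k)" for i k
  have "K i j = (\<Sum>k\<in>insert a I. h i k * cnj (h j k))" if ij: "i \<in> insert a I" "j \<in> insert a I" for i j
  proof -
    have "(\<Sum>k\<in>insert a I. h i k * cnj (h j k)) = K i a * cnj (K j a) / K a a + (\<Sum>k\<in>I. h i k * cnj (h
        j k))"
      using insert.hyps by (simp add: h_def cs ss)
    also have "cnj (K j a) = K a j"
      using herm[of j] ij aa by (auto elim: nonneg_Reals_cases)
    also have "(\<Sum>k\<in>I. h i k * cnj (h j k)) = (if i = a \<or> j = a then 0 else L i j)"
    proof (cases "i = a \<or> j = a")
      case True
      then show ?thesis using insert.hyps by (auto simp: h_def intro!: sum.neutral)
    next
      case False
      then have "(\<Sum>k\<in>I. h i k * cnj (h j k)) = (\<Sum>k\<in>I. g i k * cnj (g j k))"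
        using insert.hyps by (intro sum.cong) (auto simp: h_def)
      then show ?thesis using False ij g[of i j] by auto
    qed
    also have "K i a * K a j / K a a + (if i = a \<or> j = a then 0 else L i j) = K i j"
      using zero[of i] zero[of j] herm[of j] ij by (auto simp: L_def)
    finally show ?thesis ..
  qed
  then show ?case by blast
qed simp

lemma psd_Gram:
  assumes "finite I" "psd I K"
  obtains g :: "'i \<Rightarrow> ('i, complex) ell2" where "\<And>i j. i \<in> I \<Longrightarrow> j \<in> I \<Longrightarrow> cinner (g i) (g j) = K i j"
proof -
  from psd_Cholesky[OF assms] obtain h
    where h: "\<And>i j. i \<in> I \<Longrightarrow> j \<in> I \<Longrightarrow> K i j = (\<Sum>k\<in>I. h i k * cnj (h j k))" by blast
  define g where "g i = (\<Sum>k\<in>I. ell2_single k (h i k))" for i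
  have nth: "ell2_nth (g i) k = h i k" if "k \<in> I" for i k
    using that assms(1) by (simp add: g_def ell2_nth_sum ell2_single.rep_eq)
  show thesis
  proof (rule that)
    fix i j assume "i \<in> I" "j \<in> I"
    then show "cinner (g i) (g j) = K i j"
      unfolding g_def[of j] cinner_sum_right cinner_ell2_single
      by (simp add: h nth cinner_complex_def cong: sum.cong)
  qed
qed

lemma psd_Gram_matrix: "psd I (\<lambda>i j. cinner (g i) (g j :: 'a::complex_inner))"
  unfolding psd_def
proof
  fix c :: "'b \<Rightarrow> complex"
  have "(\<Sum>i\<in>I. \<Sum>j\<in>I. cinner (g i) (g j) * (c i * cnj (c j))) = cinner (\<Sum>i\<in>I. c i *\<^sub>C g i) (\<Sum>j\<in>I. c j
      *\<^sub>C g j)"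
    unfolding cinner_sum_left unfolding cinner_sum_right
    by (simp add: cinner_scaleC_left cinner_scaleC_right ac_simps)
  then show "(\<Sum>i\<in>I. \<Sum>j\<in>I. cinner (g i) (g j) * (c i * cnj (c j))) \<in> \<real>\<^sub>\<ge>\<^sub>0"
    by (simp add: cinner_self)
qed

text \<open>Schur's product theorem as a pairing: a factorization of \<open>B\<close> splits the sum
  into one value of the form of \<open>A\<close> per column.\<close>

lemma psd_sum_mult:
  assumes I: "finite I" and A: "psd I A" and B: "psd I B"
  shows "(\<Sum>i\<in>I. \<Sum>j\<in>I. A i j * B i j) \<in> \<real>\<^sub>\<ge>\<^sub>0"
proof -
  obtain b where b: "\<And>i j. i \<in> I \<Longrightarrow> j \<in> I \<Longrightarrow> B i j = (\<Sum>k\<in>I. b i k * cnj (b j k))"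
    using psd_Cholesky[OF I B] by blast
  have "(\<Sum>i\<in>I. \<Sum>j\<in>I. A i j * B i j) = (\<Sum>i\<in>I. \<Sum>j\<in>I. \<Sum>k\<in>I. A i j * (b i k * cnj (b j k)))"
    by (intro sum.cong refl) (simp add: b sum_distrib_left)
  also have "\<dots> = (\<Sum>i\<in>I. \<Sum>k\<in>I. \<Sum>j\<in>I. A i j * (b i k * cnj (b j k)))"
    by (intro sum.cong refl sum.swap)
  also have "\<dots> = (\<Sum>k\<in>I. \<Sum>i\<in>I. \<Sum>j\<in>I. A i j * (b i k * cnj (b j k)))"
    by (rule sum.swap)
  finally show ?thesis
    using A by (simp only: psd_def nonneg_Reals_sum)
qed

lemma psd_scale: "psd I K \<Longrightarrow> psd I (\<lambda>i j. f i * cnj (f j) * K i j)"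
  unfolding psd_def
proof
  fix c :: "'a \<Rightarrow> complex"
  assume "\<forall>c. (\<Sum>i\<in>I. \<Sum>j\<in>I. K i j * (c i * cnj (c j))) \<in> \<real>\<^sub>\<ge>\<^sub>0"
  from this[rule_format, of "\<lambda>i. c i * f i"]
  show "(\<Sum>i\<in>I. \<Sum>j\<in>I. f i * cnj (f j) * K i j * (c i * cnj (c j))) \<in> \<real>\<^sub>\<ge>\<^sub>0"
    by (simp add: ac_simps)
qed

lemma psd_add: "psd I K \<Longrightarrow> psd I L \<Longrightarrow> psd I (\<lambda>i j. K i j + L i j)"
  unfolding psd_def distrib_right sum.distrib by (blast intro: nonneg_Reals_add_I)

text \<open>Cauchy-Schwarz for Gram vectors. Diagonal bounds thus control all entries, which is what
  makes limits of positive matrices available.\<close>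

lemma psd_entry_le:
  assumes "psd I K" "i \<in> I" "j \<in> I" "finite I"
  shows "cmod (K i j) \<le> sqrt (Re (K i i)) * sqrt (Re (K j j))"
proof -
  obtain g :: "'a \<Rightarrow> ('a, complex) ell2" where g: "\<And>i j. i \<in> I \<Longrightarrow> j \<in> I \<Longrightarrow> cinner (g i) (g j) = K i j"
    using psd_Gram[OF assms(4,1)] by blast
  have "sqrt (Re (K i i)) = norm (g i)" if "i \<in> I" for i
    using g[OF that that, symmetric] by (simp add: cinner_self)
  then show ?thesis
    using Cauchy_Schwarz_cinner[of "g i" "g j"] g[OF assms(2,3)] assms(2,3) by simp
qed

lemma psdI:
  assumes herm: "\<And>i j. i \<in> I \<Longrightarrow> j \<in> I \<Longrightarrow> K j i = cnj (K i j)"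
    and nonneg: "\<And>c. 0 \<le> Re (\<Sum>i\<in>I. \<Sum>j\<in>I. K i j * (c i * cnj (c j)))"
  shows "psd I K"
  unfolding psd_def
proof
  fix c
  let ?S = "\<Sum>i\<in>I. \<Sum>j\<in>I. K i j * (c i * cnj (c j))"
  have real: "Im z = 0" if "cnj z = z" for z using arg_cong[OF that, of Im] by simp
  have "cnj ?S = (\<Sum>i\<in>I. \<Sum>j\<in>I. K j i * (c j * cnj (c i)))"
    unfolding cnj_sum by (intro sum.cong refl) (simp flip: herm)
  also have "\<dots> = ?S" by (rule sum.swap)
  finally have "Im ?S = 0" by (rule real)
  then show "?S \<in> \<real>\<^sub>\<ge>\<^sub>0" using nonneg[of c] by (simp add: complex_nonneg_Reals_iff)
qed

lemma psd_rank_one: "psd I (\<lambda>i j. c i * cnj (c j))"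
  using psd_Gram_matrix[of I c] by (simp add: cinner_complex_def)

lemma psd_real_scale:
  assumes "psd I K" "0 \<le> r"
  shows "psd I (\<lambda>i j. complex_of_real r * K i j)"
  using psd_scale[OF assms(1), of "\<lambda>_. complex_of_real (sqrt r)"] assms(2) by (simp flip: of_real_mult)

lemma psd_tendsto:
  assumes "U \<noteq> bot" "\<And>n. psd I (K n)" "\<And>i j. i \<in> I \<Longrightarrow> j \<in> I \<Longrightarrow> ((\<lambda>n. K n i j) \<longlongrightarrow> L i j) U"
  shows "psd I L"
  unfolding psd_def
proof
  fix c
  have lim: "((\<lambda>n. \<Sum>i\<in>I. \<Sum>j\<in>I. K n i j * (c i * cnj (c j))) \<longlongrightarrow> (\<Sum>i\<in>I. \<Sum>j\<in>I. L i j * (c i * cnj (c j)))) U"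
    by (intro tendsto_sum tendsto_mult tendsto_const assms(3))
  show "(\<Sum>i\<in>I. \<Sum>j\<in>I. L i j * (c i * cnj (c j))) \<in> \<real>\<^sub>\<ge>\<^sub>0"
    by (rule Lim_in_closed_set[OF closed_nonneg_Reals_complex _ assms(1) lim])
      (use assms(2) in \<open>simp add: psd_def\<close>)
qed

text \<open>First variation at a minimum: divide by \<open>s\<close> and let it tend to 0. The range
  \<open>s \<le> 1\<close> is all that is available when a direction points back towards the apex of
  a cone.\<close>

lemma nonneg_of_quadratic:
  fixes A B :: real
  assumes "\<And>s. 0 < s \<Longrightarrow> s \<le> 1 \<Longrightarrow> 0 \<le> 2 * s * A + s\<^sup>2 * B"
  shows "0 \<le> A"
proof (rule ccontr)
  assume A: "\<not> 0 \<le> A"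
  define s where "s = min 1 (- A / (\<bar>B\<bar> + 1))"
  have s: "0 < s" "s \<le> 1" using A by (auto simp: s_def divide_neg_pos)
  have "s * (\<bar>B\<bar> + 1) \<le> - A"
  proof -
    have "s \<le> - A / (\<bar>B\<bar> + 1)" by (simp add: s_def)
    moreover have "0 < \<bar>B\<bar> + 1" by simp
    ultimately show ?thesis by (simp only: pos_le_divide_eq)
  qed
  moreover have "s * B \<le> s * (\<bar>B\<bar> + 1)" using s by (intro mult_left_mono) auto
  ultimately have "2 * A + s * B < 0" using A by linarith
  then have "s * (2 * A + s * B) < 0" using s(1) by (simp add: mult_pos_neg)
  also have "s * (2 * A + s * B) = 2 * s * A + s\<^sup>2 * B" by (simp add: power2_eq_square algebra_simps)
  finally show False using assms[OF s] by simp
qed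

text \<open>Bipolar theorem for the cone of all \<open>\<Sum>t. w t \<circ> K t\<close> with \<open>K t\<close> positive semidefinite. The
  minimiser of the distance from \<open>M\<close> to this cone exists by compactness, and the first variation
  at the minimiser says that the difference lies in the dual cone.\<close>

lemma psd_cone_duality:
  fixes M :: "'i \<Rightarrow> 'i \<Rightarrow> complex" and w :: "'t \<Rightarrow> 'i \<Rightarrow> 'i \<Rightarrow> complex"
  assumes I: "finite I" and T: "finite T"
    and M: "\<And>i j. M j i = cnj (M i j)"
    and w: "\<And>t i j. w t j i = cnj (w t i j)" and wpos: "\<And>t i. t \<in> T \<Longrightarrow> i \<in> I \<Longrightarrow> 0 < Re (w t i i)"
    and dual: "\<And>k. (\<And>t. t \<in> T \<Longrightarrow> psd I (\<lambda>i j. w t i j * k i j)) \<Longrightarrow>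
      0 \<le> Re (\<Sum>i\<in>I. \<Sum>j\<in>I. M i j * k i j)"
  obtains K where "\<And>t. psd I (K t)" "\<And>i j. i \<in> I \<Longrightarrow> j \<in> I \<Longrightarrow> M i j = (\<Sum>t\<in>T. w t i j * K t i j)"
proof -
  define X where "X K i j = (\<Sum>t\<in>T. w t i j * K t i j)" for K i j
  define E where "E Y = (\<Sum>i\<in>I. \<Sum>j\<in>I. (cmod (Y i j - M i j))\<^sup>2)" for Y
  define P where "P = {K :: 't \<Rightarrow> 'i \<Rightarrow> 'i \<Rightarrow> complex. \<forall>t. psd I (K t)}"
  define m where "m = (INF K\<in>P. E (X K))"
  have E0: "0 \<le> E Y" for Y by (simp add: E_def sum_nonneg)
  have bdd: "bdd_below ((\<lambda>K. E (X K)) ` P)" using E0 by (auto simp: bdd_below_def)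
  have "(\<lambda>_ _ _. 0) \<in> P" by (simp add: P_def psd_def)
  then have ne: "(\<lambda>K. E (X K)) ` P \<noteq> {}" by blast
  have m_le: "m \<le> E (X K)" if "K \<in> P" for K
    unfolding m_def by (rule cINF_lower[OF bdd that])
  have "\<exists>K\<in>P. E (X K) < m + 1 / real (Suc n)" for n
  proof -
    have "Inf ((\<lambda>K. E (X K)) ` P) < m + 1 / real (Suc n)" by (simp add: m_def)
    then show ?thesis using cInf_less_iff[OF ne bdd] by auto
  qed
  then obtain K where K: "\<And>n. K n \<in> P" and EK: "\<And>n. E (X (K n)) < m + 1 / real (Suc n)" by metis
  have Kpsd: "psd I (K n t)" for n t using K by (auto simp: P_def)
  \<comment> \<open>Bounds the diagonal of \<open>X (K n)\<close> along the minimising sequence. As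
    the weights have positive diagonal, the diagonal terms of the summands are nonnegative and
    cannot cancel, so every \<open>K n t\<close> is bounded, not only their weighted sum.\<close>
  define R where "R = sqrt (m + 1) + (\<Sum>i\<in>I. cmod (M i i))"
  have diag: "Re (K n t i i) \<le> R / Re (w t i i)" if "i \<in> I" "t \<in> T" for n t i
  proof -
    have KR: "0 \<le> Re (K n t i i)" "Im (K n t i i) = 0" for t
      using psd_diag[OF Kpsd \<open>i \<in> I\<close> I, of n t] by (auto simp: complex_nonneg_Reals_iff)
    have wI: "Im (w t i i) = 0" for t
      using arg_cong[OF w[of t i i], of Im] by simp
    have "Re (w t i i) * Re (K n t i i) \<le> (\<Sum>t\<in>T. Re (w t i i) * Re (K n t i i))"
      using that KR wpos[OF _ \<open>i \<in> I\<close>] by (intro member_le_sum T) (auto intro!: mult_nonneg_nonneg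
          less_imp_le[OF wpos])
    also have "\<dots> = Re (X (K n) i i)" by (simp add: X_def wI)
    also have "\<dots> \<le> cmod (X (K n) i i - M i i) + cmod (M i i)"
      using complex_Re_le_cmod[of "X (K n) i i"] norm_triangle_ineq[of "X (K n) i i - M i i" "M i
          i"] by simp
    also have "cmod (M i i) \<le> (\<Sum>i\<in>I. cmod (M i i))"
      using that I by (intro member_le_sum) auto
    also have "cmod (X (K n) i i - M i i) \<le> sqrt (m + 1)"
    proof (rule real_le_rsqrt)
      have "(cmod (X (K n) i i - M i i))\<^sup>2 \<le> (\<Sum>j\<in>I. (cmod (X (K n) i j - M i j))\<^sup>2)"
        using that I by (intro member_le_sum) auto
      also have "\<dots> \<le> E (X (K n))"
        unfolding E_def using that I by (intro member_le_sum) (auto intro: sum_nonneg)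
      also have "\<dots> \<le> m + 1 / real (Suc n)" using EK[of n] by simp
      also have "\<dots> \<le> m + 1" by simp
      finally show "(cmod (X (K n) i i - M i i))\<^sup>2 \<le> m + 1" .
    qed
    finally have "Re (w t i i) * Re (K n t i i) \<le> R" by (simp add: R_def)
    then show ?thesis using wpos[OF \<open>t \<in> T\<close> \<open>i \<in> I\<close>] by (simp add: field_simps)
  qed
  define U where "U = ultrafilter_of (sequentially :: nat filter)"
  have U: "U \<noteq> bot" "U \<le> sequentially"
    unfolding U_def by (simp_all add: ultrafilter_of_neq_bot ultrafilter_of_le)
  \<comment> \<open>The default 0 outside \<open>T\<close> keeps \<open>L t\<close> positive for
    every \<open>t\<close>.\<close>
  define L where "L t i j = (if t \<in> T then Lim U (\<lambda>n. K n t i j) else 0)" for t i j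
  have L: "((\<lambda>n. K n t i j) \<longlongrightarrow> L t i j) U" if "i \<in> I" "j \<in> I" "t \<in> T" for i j t
  proof -
    have "cmod (K n t i j) \<le> sqrt (R / Re (w t i i)) * sqrt (R / Re (w t j j))" for n
      by (rule order_trans[OF psd_entry_le[OF Kpsd that(1,2) I]])
        (use diag that psd_diag[OF Kpsd _ I] in \<open>auto intro!: mult_mono' simp: complex_nonneg_Reals_iff\<close>)
    then show ?thesis
      unfolding U_def L_def using that
      by (auto intro!: tendsto_ultrafilter[where K = "sqrt (R / Re (w t i i)) * sqrt (R / Re (w t j
          j))"])
  qed
  have LP: "psd I (L t)" for t
  proof (cases "t \<in> T")
    case True
    then show ?thesis using psd_tendsto[OF U(1) Kpsd L] by blast
  qed (simp add: L_def psd_def)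
  have limE: "((\<lambda>n. E (X (K n))) \<longlongrightarrow> E (X L)) U"
    unfolding E_def X_def by (intro tendsto_intros L)
  have limm: "((\<lambda>n. m + 1 / real (Suc n)) \<longlongrightarrow> m + 0) U"
    by (intro tendsto_add tendsto_const filterlim_mono[OF LIMSEQ_Suc[OF lim_1_over_n] order_refl U(2)])
  have "E (X L) \<le> m + 0"
    by (rule tendsto_le[OF U(1) limm limE]) (intro always_eventually allI less_imp_le EK)
  then have min: "E (X L) \<le> E (X K)" if "K \<in> P" for K using m_le[OF that] by simp
  define N where "N i j = X L i j - M i j" for i j
  \<comment> \<open>First-order condition at the minimiser in a direction \<open>Y\<close> along
    which the cone can be followed from \<open>X L\<close>.\<close>
  have variation: "0 \<le> Re (\<Sum>i\<in>I. \<Sum>j\<in>I. cnj (N i j) * Y i j)"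
    if Y: "\<And>s. 0 < s \<Longrightarrow> s \<le> 1 \<Longrightarrow> \<exists>K\<in>P. \<forall>i\<in>I. \<forall>j\<in>I. X K i j = X L i j + complex_of_real s * Y i j" for Y
  proof (rule nonneg_of_quadratic)
    fix s :: real assume s: "0 < s" "s \<le> 1"
    from Y[OF this] obtain K where K: "K \<in> P"
      and XK: "\<And>i j. i \<in> I \<Longrightarrow> j \<in> I \<Longrightarrow> X K i j = X L i j + complex_of_real s * Y i j" by blast
    have sq: "(cmod (u + complex_of_real s * y))\<^sup>2 = (cmod u)\<^sup>2 + 2 * s * Re (cnj u * y) + s\<^sup>2 * (cmod
        y)\<^sup>2" for u y
      by (simp only: cmod_power2) (simp add: power2_eq_square algebra_simps)
    have "E (X K) = (\<Sum>i\<in>I. \<Sum>j\<in>I. (cmod (N i j + complex_of_real s * Y i j))\<^sup>2)"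
      unfolding E_def by (intro sum.cong refl) (simp add: XK N_def algebra_simps)
    also have "\<dots> = E (X L) + 2 * s * (\<Sum>i\<in>I. \<Sum>j\<in>I. Re (cnj (N i j) * Y i j)) + s\<^sup>2 * (\<Sum>i\<in>I. \<Sum>j\<in>I.
        (cmod (Y i j))\<^sup>2)"
      unfolding sq by (simp only: sum.distrib sum_distrib_left E_def N_def)
    finally show "0 \<le> 2 * s * Re (\<Sum>i\<in>I. \<Sum>j\<in>I. cnj (N i j) * Y i j) + s\<^sup>2 * (\<Sum>i\<in>I. \<Sum>j\<in>I. (cmod (Y i j))\<^sup>2)"
      using min[OF K] by simp
  qed
  have hermX: "X L j i = cnj (X L i j)" if "i \<in> I" "j \<in> I" for i j
    unfolding X_def cnj_sum
    by (intro sum.cong refl) (simp add: w[of _ j i] psd_hermitian[OF LP that I])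
  have hermN: "N j i = cnj (N i j)" if "i \<in> I" "j \<in> I" for i j
    using hermX[OF that] M[of j i] by (simp add: N_def)
  \<comment> \<open>Moving along \<open>w t\<close> times a rank-one matrix stays in the cone, so
    the conjugate of \<open>N\<close> lies in the dual cone and the hypothesis \<open>dual\<close>
    applies to it.\<close>
  have "0 \<le> Re (\<Sum>i\<in>I. \<Sum>j\<in>I. M i j * cnj (N i j))"
  proof (rule dual)
    fix t assume t: "t \<in> T"
    show "psd I (\<lambda>i j. w t i j * cnj (N i j))"
    proof (rule psdI)
      fix c
      have "0 \<le> Re (\<Sum>i\<in>I. \<Sum>j\<in>I. cnj (N i j) * (w t i j * (c i * cnj (c j))))"
      proof (rule variation)
        fix s :: real assume s: "0 < s" "s \<le> 1"
        define K' where "K' = L(t := \<lambda>i j. L t i j + complex_of_real s * (c i * cnj (c j)))"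
        have "K' \<in> P"
          unfolding P_def K'_def using s
          by (auto intro!: LP psd_add psd_real_scale psd_rank_one)
        moreover have "X K' i j = X L i j + complex_of_real s * (w t i j * (c i * cnj (c j)))" for i j
        proof -
          have "X K' i j = (\<Sum>u\<in>T. w u i j * L u i j + (if u = t then complex_of_real s * (w t i j *
              (c i * cnj (c j))) else 0))"
            unfolding X_def by (intro sum.cong refl) (simp add: K'_def algebra_simps)
          then show ?thesis using t T by (simp add: sum.distrib X_def)
        qed
        ultimately show "\<exists>K\<in>P. \<forall>i\<in>I. \<forall>j\<in>I. X K i j = X L i j + complex_of_real s * (w t i j * (c i *
            cnj (c j)))"
          by blast
      qed
      then show "0 \<le> Re (\<Sum>i\<in>I. \<Sum>j\<in>I. w t i j * cnj (N i j) * (c i * cnj (c j)))"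
        by (simp add: ac_simps)
    qed (simp flip: hermN w)
  qed
  \<comment> \<open>Shrinking \<open>L\<close> also stays in the cone, so the pairing of
    \<open>N\<close> with \<open>X L\<close> is at most 0. Together with the preceding inequality
    this gives that minus the squared norm of \<open>N\<close> is nonnegative.\<close>
  moreover have "0 \<le> Re (\<Sum>i\<in>I. \<Sum>j\<in>I. cnj (N i j) * - X L i j)"
  proof (rule variation)
    fix s :: real assume s: "0 < s" "s \<le> 1"
    have "(\<lambda>t i j. complex_of_real (1 - s) * L t i j) \<in> P"
      using s by (auto simp: P_def intro!: psd_real_scale LP simp del: of_real_diff)
    moreover have "X (\<lambda>t i j. complex_of_real (1 - s) * L t i j) i j = X L i j + complex_of_real s *
        - X L i j" for i j
      unfolding X_def by (simp add: algebra_simps sum_subtractf sum_distrib_left)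
    ultimately show "\<exists>K\<in>P. \<forall>i\<in>I. \<forall>j\<in>I. X K i j = X L i j + complex_of_real s * - X L i j"
      by blast
  qed
  ultimately have "0 \<le> Re (\<Sum>i\<in>I. \<Sum>j\<in>I. M i j * cnj (N i j)) + Re (\<Sum>i\<in>I. \<Sum>j\<in>I. cnj (N i j) * - X L i j)"
    by simp
  also have "\<dots> = Re (\<Sum>i\<in>I. \<Sum>j\<in>I. - (N i j * cnj (N i j)))"
    unfolding plus_complex.sel(1)[symmetric] sum.distrib[symmetric]
    by (intro arg_cong[where f = Re] sum.cong refl) (simp add: N_def algebra_simps)
  also have "(\<Sum>i\<in>I. \<Sum>j\<in>I. - (N i j * cnj (N i j))) = complex_of_real (- (\<Sum>i\<in>I. \<Sum>j\<in>I. (cmod (N i j))\<^sup>2))"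
    by (simp only: complex_norm_square[symmetric] sum_negf of_real_minus of_real_sum)
  finally have le: "(\<Sum>i\<in>I. \<Sum>j\<in>I. (cmod (N i j))\<^sup>2) \<le> 0"
    unfolding Re_complex_of_real by linarith
  have "N i j = 0" if "i \<in> I" "j \<in> I" for i j
  proof -
    have "(cmod (N i j))\<^sup>2 \<le> (\<Sum>j\<in>I. (cmod (N i j))\<^sup>2)" using that I by (intro member_le_sum) auto
    also have "\<dots> \<le> (\<Sum>i\<in>I. \<Sum>j\<in>I. (cmod (N i j))\<^sup>2)"
      using that I by (intro member_le_sum) (auto intro: sum_nonneg)
    finally have "(cmod (N i j))\<^sup>2 \<le> 0" using le by linarith
    then show ?thesis by simp
  qed
  then have eq: "M i j = (\<Sum>t\<in>T. w t i j * L t i j)" if "i \<in> I" "j \<in> I" for i j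
    using that by (simp add: N_def X_def)
  show thesis by (rule that[of L, OF LP eq])
qed

section \<open>Transfer functions and interpolation on the bidisc\<close>

text \<open>The product type carries the Euclidean norm, whose unit ball is not the bidisc; distance
  to the boundary is measured with this one.\<close>

definition maxnorm :: "complex \<times> complex \<Rightarrow> real"
  where "maxnorm z = max (cmod (fst z)) (cmod (snd z))"

text \<open>The block operator \<open>Z\<close> with entries \<open>z_1\<close>, \<open>z_2\<close>
  in the realization formula \<open>S z = a + b Z (1 - d Z)^-1 c\<close>.\<close>

definition diag_mult :: "complex \<times> complex \<Rightarrow> 'a::complex_inner \<times> 'b::complex_inner \<Rightarrow> 'a \<times> 'b"
  where "diag_mult z g = (fst z *\<^sub>C fst g, snd z *\<^sub>C snd g)"

lemma bidisc_iff: "z \<in> bidisc \<longleftrightarrow> maxnorm z < 1"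
  by (cases z) (auto simp: bidisc_def maxnorm_def)

lemma maxnorm_le_norm: "maxnorm z \<le> norm z"
  using norm_fst_le[of "fst z" "snd z"] norm_snd_le[of "snd z" "fst z"] by (simp add: maxnorm_def)

lemma maxnorm_nonneg: "0 \<le> maxnorm z"
  by (simp add: maxnorm_def le_max_iff_disj)

lemma maxnorm_add: "maxnorm (z + h) \<le> maxnorm z + norm h"
proof -
  have "cmod (fst z + fst h) \<le> cmod (fst z) + cmod (fst h)" "cmod (snd z + snd h) \<le> cmod (snd z) +
      cmod (snd h)"
    by (rule norm_triangle_ineq)+
  then show ?thesis using maxnorm_le_norm[of h] by (simp add: maxnorm_def max_def split: if_splits)
qed

lemma norm_diag_mult: "norm (diag_mult z g) \<le> maxnorm z * norm g"
proof -
  have "(cmod (fst z))\<^sup>2 \<le> (maxnorm z)\<^sup>2" "(cmod (snd z))\<^sup>2 \<le> (maxnorm z)\<^sup>2"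
    by (simp_all add: maxnorm_def power_mono)
  then have "(cmod (fst z))\<^sup>2 * (norm (fst g))\<^sup>2 + (cmod (snd z))\<^sup>2 * (norm (snd g))\<^sup>2
      \<le> (maxnorm z)\<^sup>2 * (norm (fst g))\<^sup>2 + (maxnorm z)\<^sup>2 * (norm (snd g))\<^sup>2"
    by (intro add_mono mult_right_mono) auto
  also have "\<dots> = (maxnorm z * norm g)\<^sup>2"
    by (simp add: norm_prod_def power_mult_distrib algebra_simps)
  finally have "(norm (diag_mult z g))\<^sup>2 \<le> (maxnorm z * norm g)\<^sup>2"
    by (simp add: diag_mult_def norm_prod_def norm_scaleC power_mult_distrib)
  then show ?thesis by (rule power2_le_imp_le) (simp add: maxnorm_nonneg)
qed

lemma norm_diag_mult': "norm (diag_mult z g) \<le> norm z * norm g"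
  using norm_diag_mult[of z g] maxnorm_le_norm[of z] by (meson mult_right_mono norm_ge_zero order_trans)

lemma diag_mult_add_right: "diag_mult z (g + h) = diag_mult z g + diag_mult z h"
  and diag_mult_diff_right: "diag_mult z (g - h) = diag_mult z g - diag_mult z h"
  and diag_mult_scale_right: "diag_mult z (a *\<^sub>C g) = a *\<^sub>C diag_mult z g"
  and diag_mult_add_left: "diag_mult (z + w) g = diag_mult z g + diag_mult w g"
  and diag_mult_scale_left: "diag_mult (a *\<^sub>C z) g = a *\<^sub>C diag_mult z g"
  by (simp_all add: diag_mult_def scaleC_add_right scaleC_add_left scaleC_diff_right scaleC_prod_def
      scaleC_scaleC mult.commute scaleC_complex_def)

text \<open>Contractive functions on the bidisc with a derivative whose error is controlled by a bound
  depending on \<open>R\<close> only: unlike holomorphy, this passes to weak limits directly.\<close>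

definition schur_pair :: "(complex \<times> complex \<Rightarrow> 'a::complex_normed_vector) \<Rightarrow>
    (complex \<times> complex \<Rightarrow> complex \<times> complex \<Rightarrow> 'a) \<Rightarrow> bool"
  where "schur_pair S D \<longleftrightarrow> (\<forall>z\<in>bidisc. norm (S z) \<le> 1) \<and>
    (\<forall>z\<in>bidisc. \<forall>h k a. D z (h + k) = D z h + D z k \<and> D z (a *\<^sub>C h) = a *\<^sub>C D z h) \<and>
    (\<forall>R<1. \<forall>z h. maxnorm z \<le> R \<longrightarrow> norm (D z h) \<le> 2 / (1 - R) ^ 3 * norm h \<and>
      (maxnorm (z + h) \<le> R \<longrightarrow> norm (S (z + h) - S z - D z h) \<le> 2 / (1 - R) ^ 3 * (norm h)\<^sup>2))"

lemma schur_pairD: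
  assumes "schur_pair S D"
  shows "z \<in> bidisc \<Longrightarrow> norm (S z) \<le> 1"
    and "z \<in> bidisc \<Longrightarrow> D z (h + k) = D z h + D z k"
    and "z \<in> bidisc \<Longrightarrow> D z (a *\<^sub>C h) = a *\<^sub>C D z h"
    and "R < 1 \<Longrightarrow> maxnorm z \<le> R \<Longrightarrow> norm (D z h) \<le> 2 / (1 - R) ^ 3 * norm h"
    and "R < 1 \<Longrightarrow> maxnorm z \<le> R \<Longrightarrow> maxnorm (z + h) \<le> R \<Longrightarrow>
      norm (S (z + h) - S z - D z h) \<le> 2 / (1 - R) ^ 3 * (norm h)\<^sup>2"
  using assms unfolding schur_pair_def by blast+

lemma schur_pair_H_infty:
  assumes "schur_pair S D"
  shows "S \<in> H_infty" "H_infty_norm S \<le> 1"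
proof -
  have le: "norm (S z) \<le> 1" if "z \<in> bidisc" for z
    by (rule schur_pairD(1)[OF assms that])
  have 0: "0 \<in> bidisc" by (simp add: bidisc_def zero_prod_def)
  show "H_infty_norm S \<le> 1"
    unfolding H_infty_norm_def by (rule cSUP_least) (use 0 le in auto)
  have "(S has_derivative D z) (at z) \<and> (\<forall>a h. D z (a *\<^sub>C h) = a *\<^sub>C D z h)" if z: "z \<in> bidisc" for z
  proof
    \<comment> \<open>Halfway between \<open>maxnorm z\<close> and 1, so that a whole neighbourhood
      of \<open>z\<close> obeys the same error bound.\<close>
    define R where "R = (1 + maxnorm z) / 2"
    define C where "C = 2 / (1 - R) ^ 3"
    have R: "R < 1" "maxnorm z \<le> R" using z by (auto simp: R_def bidisc_iff)
    have lin: "D z (h + k) = D z h + D z k" "D z (a *\<^sub>C h) = a *\<^sub>C D z h" for h k a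
      by (rule schur_pairD(2,3)[OF assms z])+
    have bd: "norm (D z h) \<le> norm h * C" for h
      using schur_pairD(4)[OF assms R] by (simp add: C_def mult.commute)
    have err: "norm (S (z + h) - S z - D z h) \<le> C * (norm h)\<^sup>2" if "maxnorm (z + h) \<le> R" for h
      unfolding C_def by (rule schur_pairD(5)[OF assms R that])
    show "\<forall>a h. D z (a *\<^sub>C h) = a *\<^sub>C D z h" using lin by blast
    have "bounded_linear (D z)"
      by (rule bounded_linear_intro[where K = C]) (simp_all add: lin bd scaleR_scaleC)
    moreover have "((\<lambda>y. norm ((S y - S z) - D z (y - z)) / norm (y - z)) \<longlongrightarrow> 0) (at z)"
    proof (rule Lim_null_comparison)
      have "eventually (\<lambda>y. dist y z < (1 - maxnorm z) / 2) (at z)"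
        using z by (intro eventually_at_ball[THEN eventually_mono, of "(1 - maxnorm z) / 2" z])
          (auto simp: bidisc_iff dist_commute)
      then show "\<forall>\<^sub>F y in at z. norm (norm ((S y - S z) - D z (y - z)) / norm (y - z)) \<le> C * norm (y - z)"
      proof eventually_elim
        case (elim y)
        have "maxnorm (z + (y - z)) \<le> maxnorm z + norm (y - z)" by (rule maxnorm_add)
        also have "\<dots> \<le> R" using elim by (simp add: R_def dist_norm field_simps)
        finally have "norm ((S y - S z) - D z (y - z)) \<le> C * norm (y - z) * norm (y - z)"
          using err[of "y - z"] by (simp add: power2_eq_square mult.assoc)
        then show ?case by (cases "y = z") (simp_all add: divide_le_eq)
      qed
      have "((\<lambda>y. C * norm (y - z)) \<longlongrightarrow> C * norm (z - z)) (at z)"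
        by (intro tendsto_intros)
      then show "((\<lambda>y. C * norm (y - z)) \<longlongrightarrow> 0) (at z)" by simp
    qed
    ultimately show "(S has_derivative D z) (at z)" by (simp add: has_derivative_iff_norm)
  qed
  moreover have "bounded (S ` bidisc)" unfolding bounded_iff using le by blast
  ultimately show "S \<in> H_infty" unfolding H_infty_def by blast
qed

lemma fst_scaleC: "fst (a *\<^sub>C x) = a *\<^sub>C fst x" and snd_scaleC: "snd (a *\<^sub>C x) = a *\<^sub>C snd x"
  by (simp_all add: scaleC_prod_def)

lemma norm_snd_W:
  fixes W :: "('y::complex_inner \<times> 'z::complex_inner) \<Rightarrow>\<^sub>C\<^sub>L ('x::complex_inner \<times> 'v::complex_inner)"
  assumes "norm W \<le> 1"
  shows "(norm (fst (W *\<^sub>V (y, g))))\<^sup>2 + (norm (snd (W *\<^sub>V (y, g))))\<^sup>2 \<le> (norm y)\<^sup>2 + (norm g)\<^sup>2"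
proof -
  have "(norm (W *\<^sub>V (y, g)))\<^sup>2 \<le> (norm (y, g))\<^sup>2"
    using norm_cblinfun_le[OF assms, of "(y, g)"] by (simp add: power_mono)
  then show ?thesis by (simp add: norm_prod_def)
qed

lemma norm_W0:
  fixes W :: "('y::complex_inner \<times> 'z::complex_inner) \<Rightarrow>\<^sub>C\<^sub>L ('x::complex_inner \<times> 'v::complex_inner)"
  assumes "norm W \<le> 1"
  shows "norm (fst (W *\<^sub>V (0, g))) \<le> norm g" "norm (snd (W *\<^sub>V (0, g))) \<le> norm g"
    "norm (snd (W *\<^sub>V (y, 0))) \<le> norm y"
proof -
  have le: "a \<le> c" "b \<le> c" if "a\<^sup>2 + b\<^sup>2 \<le> c\<^sup>2" "0 \<le> c" for a b c :: real
    using that by (smt (verit) power2_le_imp_le zero_le_power2)+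
  show "norm (fst (W *\<^sub>V (0, g))) \<le> norm g" "norm (snd (W *\<^sub>V (0, g))) \<le> norm g"
    "norm (snd (W *\<^sub>V (y, 0))) \<le> norm y"
    using le[OF norm_snd_W[OF assms, of 0 g, unfolded norm_zero power_zero_numeral add_0_left]
        norm_ge_zero]
      le[OF norm_snd_W[OF assms, of y 0, unfolded norm_zero power_zero_numeral add_0_right] norm_ge_zero]
    by simp_all
qed

text \<open>The state solves \<open>s = B y + d (Z s)\<close>, which is possible on the bidisc
  because \<open>Z\<close> is a strict contraction there. Contractivity of \<open>S z\<close> is the
  energy balance of \<open>W\<close>: \<open>|S y|^2 + |s|^2 \<le> |y|^2 + |Z s|^2\<close>, while
  \<open>|Z s| \<le> |s|\<close>.\<close>

lemma transfer_function:
  fixes W :: "('y::chilbert_space \<times> ('z1::chilbert_space \<times> 'z2::chilbert_space)) \<Rightarrow>\<^sub>C\<^sub>L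
      ('x::chilbert_space \<times> ('z1 \<times> 'z2))"
  assumes W: "norm W \<le> 1"
  obtains S :: "complex \<times> complex \<Rightarrow> 'y \<Rightarrow>\<^sub>C\<^sub>L 'x" and D where "schur_pair S D"
    "\<And>z y. z \<in> bidisc \<Longrightarrow> \<exists>s. W *\<^sub>V (y, diag_mult z s) = (S z *\<^sub>V y, s)"
proof -
  have pair: "W *\<^sub>V (y + y', g + g') = (W *\<^sub>V (y, g)) + (W *\<^sub>V (y', g'))"
    "W *\<^sub>V (y - y', g - g') = (W *\<^sub>V (y, g)) - (W *\<^sub>V (y', g'))"
    "W *\<^sub>V (a *\<^sub>C y, a *\<^sub>C g) = a *\<^sub>C (W *\<^sub>V (y, g))" for y y' g g' a
    using cblinfun_add[of W "(y, g)" "(y', g')"] cblinfun_diff[of W "(y, g)" "(y', g')"]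
      cblinfun_scaleC[of W a "(y, g)"] by (simp_all add: scaleC_prod_def)
  define d where "d g = snd (W *\<^sub>V (0, g))" for g
  define B where "B y = snd (W *\<^sub>V (y, 0))" for y
  have d_lin: "d (g + h) = d g + d h" "d (g - h) = d g - d h" "d (a *\<^sub>C g) = a *\<^sub>C d g" for g h a
    using pair(1)[of 0 0 g h] pair(2)[of 0 0 g h] pair(3)[of a 0 g] by (simp_all add: d_def snd_scaleC)
  have B_lin: "B (y + y') = B y + B y'" "B (a *\<^sub>C y) = a *\<^sub>C B y" for y y' a
    using pair(1)[of y y' 0 0] pair(3)[of a y 0] by (simp_all add: B_def snd_scaleC)
  have d_le: "norm (d g) \<le> norm g" and B_le: "norm (B y) \<le> norm y" for g y
    by (simp_all add: d_def B_def norm_W0[OF W])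
  have split: "snd (W *\<^sub>V (y, g)) = B y + d g" for y g
    using pair(1)[of y 0 0 g] by (simp add: d_def B_def)
  have "\<exists>X :: ('z1 \<times> 'z2) \<Rightarrow>\<^sub>C\<^sub>L ('z1 \<times> 'z2). (\<forall>b. X *\<^sub>V b = b + d (diag_mult z (X *\<^sub>V b))) \<and>
      (\<forall>b x. x = b + d (diag_mult z x) \<longrightarrow> x = X *\<^sub>V b) \<and> norm X \<le> 1 / (1 - maxnorm z)"
    if z: "z \<in> bidisc" for z
  proof -
    obtain T :: "('z1 \<times> 'z2) \<Rightarrow>\<^sub>C\<^sub>L ('z1 \<times> 'z2)" where T: "\<And>g. T *\<^sub>V g = d (diag_mult z g)" "norm T \<le>
        maxnorm z"
    proof (rule cblinfun_of_fun[of "\<lambda>g. d (diag_mult z g)" "maxnorm z"])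
      show "norm (d (diag_mult z x)) \<le> maxnorm z * norm x" for x
        by (rule order_trans[OF d_le norm_diag_mult])
    qed ((simp add: diag_mult_add_right diag_mult_scale_right d_lin maxnorm_nonneg; fail) | meson)+
    obtain X where "\<And>b. X *\<^sub>V b = b + (T *\<^sub>V (X *\<^sub>V b))"
      "\<And>b x. x = b + (T *\<^sub>V x) \<Longrightarrow> x = X *\<^sub>V b" "norm X \<le> 1 / (1 - maxnorm z)"
      using Neumann_inverse[OF T(2)] z by (auto simp: bidisc_iff)
    then show ?thesis unfolding T by blast
  qed
  then obtain X :: "complex \<times> complex \<Rightarrow> ('z1 \<times> 'z2) \<Rightarrow>\<^sub>C\<^sub>L ('z1 \<times> 'z2)"
    where X: "\<And>z b. z \<in> bidisc \<Longrightarrow> X z *\<^sub>V b = b + d (diag_mult z (X z *\<^sub>V b))"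
      and Xuniq: "\<And>z b x. z \<in> bidisc \<Longrightarrow> x = b + d (diag_mult z x) \<Longrightarrow> x = X z *\<^sub>V b"
      and Xnorm: "\<And>z. z \<in> bidisc \<Longrightarrow> norm (X z) \<le> 1 / (1 - maxnorm z)"
    by metis
  define s where "s z y = X z *\<^sub>V B y" for z y
  \<comment> \<open>The derivative of the state in direction \<open>h\<close>, found by
    differentiating its fixed point equation; \<open>f'\<close> is the resulting derivative of the
    output.\<close>
  define \<delta> where "\<delta> z h y = X z *\<^sub>V d (diag_mult h (s z y))" for z h y
  define f where "f z y = fst (W *\<^sub>V (y, diag_mult z (s z y)))" for z y
  define f' where "f' z h y = fst (W *\<^sub>V (0, diag_mult h (s z y) + diag_mult z (\<delta> z h y)))" for z h y
  have s_lin: "s z (y + y') = s z y + s z y'" "s z (a *\<^sub>C y) = a *\<^sub>C s z y" for z y y' a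
    by (simp_all add: s_def B_lin cblinfun_add cblinfun_scaleC)
  have \<delta>_lin: "\<delta> z h (y + y') = \<delta> z h y + \<delta> z h y'" "\<delta> z h (a *\<^sub>C y) = a *\<^sub>C \<delta> z h y"
    "\<delta> z (h + k) y = \<delta> z h y + \<delta> z k y" "\<delta> z (a *\<^sub>C h) y = a *\<^sub>C \<delta> z h y" for z h k y y' a
    by (simp_all add: \<delta>_def s_lin d_lin diag_mult_add_right diag_mult_scale_right diag_mult_add_left
        diag_mult_scale_left cblinfun_add cblinfun_scaleC)
  have W_s: "W *\<^sub>V (y, diag_mult z (s z y)) = (f z y, s z y)" if "z \<in> bidisc" for z y
  proof -
    have "snd (W *\<^sub>V (y, diag_mult z (s z y))) = s z y"
      unfolding split s_def by (rule X[OF that, symmetric])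
    then show ?thesis unfolding f_def by (metis prod.collapse)
  qed
  have f_lin: "f z (y + y') = f z y + f z y'" "f z (a *\<^sub>C y) = a *\<^sub>C f z y" for z y y' a
    by (simp_all add: f_def s_lin diag_mult_add_right diag_mult_scale_right pair fst_scaleC)
  have f_le: "norm (f z y) \<le> norm y" if "z \<in> bidisc" for z y
  proof -
    have "(norm (f z y))\<^sup>2 + (norm (s z y))\<^sup>2 \<le> (norm y)\<^sup>2 + (norm (diag_mult z (s z y)))\<^sup>2"
      using norm_snd_W[OF W, of y "diag_mult z (s z y)"] by (simp add: W_s[OF that])
    moreover have "norm (diag_mult z (s z y)) \<le> norm (s z y)"
      using norm_diag_mult[of z "s z y"] that mult_right_mono[of "maxnorm z" 1 "norm (s z y)"]
      by (simp add: bidisc_iff)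
    then have "(norm (diag_mult z (s z y)))\<^sup>2 \<le> (norm (s z y))\<^sup>2" by (simp add: power_mono)
    ultimately have "(norm (f z y))\<^sup>2 \<le> (norm y)\<^sup>2" by linarith
    then show ?thesis by (rule power2_le_imp_le[OF _ norm_ge_zero])
  qed
  have f'_lin: "f' z h (y + y') = f' z h y + f' z h y'" "f' z h (a *\<^sub>C y) = a *\<^sub>C f' z h y"
    "f' z (h + k) y = f' z h y + f' z k y" "f' z (a *\<^sub>C h) y = a *\<^sub>C f' z h y" for z h k y y' a
    using pair(1)[of 0 0 "diag_mult h (s z y) + diag_mult z (\<delta> z h y)" "diag_mult h (s z y') +
        diag_mult z (\<delta> z h y')"]
      pair(1)[of 0 0 "diag_mult h (s z y) + diag_mult z (\<delta> z h y)" "diag_mult k (s z y) + diag_mult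
          z (\<delta> z k y)"]
      pair(3)[of a 0 "diag_mult h (s z y) + diag_mult z (\<delta> z h y)"]
    by (simp_all add: f'_def s_lin \<delta>_lin diag_mult_add_right diag_mult_scale_right diag_mult_add_left
        diag_mult_scale_left scaleC_add_right fst_scaleC algebra_simps)
  have X_le: "norm (X z *\<^sub>V b) \<le> norm b / (1 - R)" if "maxnorm z \<le> R" "R < 1" for z b R
  proof -
    have "z \<in> bidisc" using that by (simp add: bidisc_iff)
    then have "norm (X z *\<^sub>V b) \<le> 1 / (1 - maxnorm z) * norm b" by (intro norm_cblinfun_le Xnorm)
    also have "\<dots> \<le> 1 / (1 - R) * norm b"
      using that by (intro mult_right_mono divide_left_mono) auto
    finally show ?thesis by simp
  qed
  have s_le: "norm (s z y) \<le> norm y / (1 - R)" if "maxnorm z \<le> R" "R < 1" for z y R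
    unfolding s_def by (rule order_trans[OF X_le[OF that]]) (use B_le that in \<open>simp add:
        divide_right_mono\<close>)
  have \<delta>_le: "norm (\<delta> z h y) \<le> norm h * norm y / (1 - R)\<^sup>2" if "maxnorm z \<le> R" "R < 1" for z h y R
  proof -
    have "norm (\<delta> z h y) \<le> norm (d (diag_mult h (s z y))) / (1 - R)"
      unfolding \<delta>_def by (rule X_le[OF that])
    also have "\<dots> \<le> (norm h * (norm y / (1 - R))) / (1 - R)"
      using order_trans[OF d_le norm_diag_mult'] that
      by (intro divide_right_mono order_trans[OF order_trans[OF d_le norm_diag_mult']]
          mult_left_mono s_le[OF that]) auto
    finally show ?thesis by (simp add: power2_eq_square)
  qed
  \<comment> \<open>All estimates are raised to the worst power that occurs, three resolvents in the
    second-order error of the state. Two such terms give the constant \<open>2 / (1 - R) ^ 3\<close>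
    of \<open>schur_pair\<close>.\<close>
  have pw: "c / (1 - R) \<le> c / (1 - R) ^ 3" "c / (1 - R)\<^sup>2 \<le> c / (1 - R) ^ 3"
    if "0 \<le> c" "0 \<le> R" "R < 1" for c R :: real
    using that power_decreasing[of 1 3 "1 - R"] power_decreasing[of 2 3 "1 - R"]
    by (intro divide_left_mono; simp)+
  have f'_le: "norm (f' z h y) \<le> 2 / (1 - R) ^ 3 * norm h * norm y" if zR: "maxnorm z \<le> R" "R < 1"
      for z h y R
  proof -
    have R0: "0 \<le> R" using maxnorm_nonneg[of z] zR by linarith
    have "norm (f' z h y) \<le> norm (diag_mult h (s z y) + diag_mult z (\<delta> z h y))"
      unfolding f'_def by (rule norm_W0(1)[OF W])
    also have "\<dots> \<le> norm h * norm (s z y) + maxnorm z * norm (\<delta> z h y)"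
      by (rule norm_triangle_le) (intro add_mono norm_diag_mult norm_diag_mult')
    also have "\<dots> \<le> norm h * (norm y / (1 - R)) + 1 * (norm h * norm y / (1 - R)\<^sup>2)"
      using zR by (intro add_mono mult_mono s_le \<delta>_le) auto
    also have "\<dots> \<le> norm h * norm y / (1 - R) ^ 3 + norm h * norm y / (1 - R) ^ 3"
      using pw[of "norm h * norm y" R] R0 zR by (intro add_mono) auto
    finally show ?thesis by (simp add: ac_simps)
  qed
  have err: "norm (f (z + h) y - f z y - f' z h y) \<le> 2 / (1 - R) ^ 3 * (norm h)\<^sup>2 * norm y"
    if zR: "maxnorm z \<le> R" "R < 1" "maxnorm (z + h) \<le> R" for z h y R
  proof -
    have R0: "0 \<le> R" using maxnorm_nonneg[of z] zR by linarith
    have z: "z \<in> bidisc" "z + h \<in> bidisc" using zR by (auto simp: bidisc_iff)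
    define e where "e = s (z + h) y - s z y"
    have s_eq: "s w y = B y + d (diag_mult w (s w y))" if "w \<in> bidisc" for w
      unfolding s_def by (rule X[OF that])
    \<comment> \<open>The increment of the state satisfies a fixed point equation at
      \<open>z\<close> as well; uniqueness then expresses it by the resolvent \<open>X z\<close>,
      and one further step of this kind gives an error quadratic in \<open>h\<close>.\<close>
    have e_eq: "e = d (diag_mult h (s (z + h) y)) + d (diag_mult z e)"
    proof -
      have 1: "s (z + h) y = B y + (d (diag_mult h (s (z + h) y)) + d (diag_mult z (s (z + h) y)))"
        using s_eq[OF z(2)] by (simp add: diag_mult_add_left d_lin add.commute)
      have "e = (B y + (d (diag_mult h (s (z + h) y)) + d (diag_mult z (s (z + h) y))))
          - (B y + d (diag_mult z (s z y)))"
        unfolding e_def by (rule arg_cong2[where f = minus, OF 1 s_eq[OF z(1)]])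
      also have "\<dots> = d (diag_mult h (s (z + h) y)) + d (diag_mult z e)"
        unfolding e_def diag_mult_diff_right d_lin by simp
      finally show ?thesis .
    qed
    then have e: "e = X z *\<^sub>V d (diag_mult h (s (z + h) y))" by (rule Xuniq[OF z(1)])
    have e_le: "norm e \<le> norm h * norm y / (1 - R)\<^sup>2"
    proof -
      have "norm e \<le> norm (d (diag_mult h (s (z + h) y))) / (1 - R)"
        unfolding e by (rule X_le[OF zR(1,2)])
      also have "\<dots> \<le> (norm h * (norm y / (1 - R))) / (1 - R)"
        using zR by (intro divide_right_mono order_trans[OF order_trans[OF d_le norm_diag_mult']]
            mult_left_mono s_le) auto
      finally show ?thesis by (simp add: power2_eq_square)
    qed
    have "e - \<delta> z h y = X z *\<^sub>V d (diag_mult h e)"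
      unfolding e \<delta>_def cblinfun_diff[symmetric] d_lin[symmetric] diag_mult_diff_right[symmetric]
      unfolding e[symmetric] by (simp add: e_def)
    then have "norm (e - \<delta> z h y) \<le> norm (d (diag_mult h e)) / (1 - R)"
      using X_le[OF zR(1,2)] by simp
    also have "\<dots> \<le> (norm h * (norm h * norm y / (1 - R)\<^sup>2)) / (1 - R)"
      using zR by (intro divide_right_mono order_trans[OF order_trans[OF d_le norm_diag_mult']]
            mult_left_mono e_le) auto
    also have "\<dots> = (norm h)\<^sup>2 * norm y / (1 - R) ^ 3"
      by (simp add: power2_eq_square power3_eq_cube)
    finally have ed_le: "norm (e - \<delta> z h y) \<le> (norm h)\<^sup>2 * norm y / (1 - R) ^ 3" .
    have "f (z + h) y - f z y - f' z h y
        = fst (W *\<^sub>V (y - y - 0, diag_mult (z + h) (s (z + h) y) - diag_mult z (s z y)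
          - (diag_mult h (s z y) + diag_mult z (\<delta> z h y))))"
      unfolding f_def f'_def pair by simp
    also have "diag_mult (z + h) (s (z + h) y) - diag_mult z (s z y) - (diag_mult h (s z y) +
        diag_mult z (\<delta> z h y))
        = diag_mult h e + diag_mult z (e - \<delta> z h y)"
      by (simp add: e_def diag_mult_add_left diag_mult_add_right diag_mult_diff_right algebra_simps)
    finally have "norm (f (z + h) y - f z y - f' z h y) \<le> norm (diag_mult h e + diag_mult z (e - \<delta> z
        h y))"
      using norm_W0(1)[OF W] by simp
    also have "\<dots> \<le> norm h * norm e + maxnorm z * norm (e - \<delta> z h y)"
      by (rule norm_triangle_le) (intro add_mono norm_diag_mult norm_diag_mult')
    also have "\<dots> \<le> norm h * (norm h * norm y / (1 - R)\<^sup>2) + 1 * ((norm h)\<^sup>2 * norm y / (1 - R) ^ 3)"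
      using zR e_le ed_le by (intro add_mono mult_mono) auto
    also have "norm h * (norm h * norm y / (1 - R)\<^sup>2) = (norm h)\<^sup>2 * norm y / (1 - R)\<^sup>2"
      by (simp add: power2_eq_square)
    also have "\<dots> \<le> (norm h)\<^sup>2 * norm y / (1 - R) ^ 3"
      using pw[of "(norm h)\<^sup>2 * norm y" R] R0 zR by simp
    finally show ?thesis by (simp add: ac_simps)
  qed
  have "\<exists>T :: 'y \<Rightarrow>\<^sub>C\<^sub>L 'x. (\<forall>y. T *\<^sub>V y = f z y)" if "z \<in> bidisc" for z
    by (rule cblinfun_of_fun[of "f z" 1]) (use f_lin f_le[OF that] in auto)
  then obtain S :: "complex \<times> complex \<Rightarrow> 'y \<Rightarrow>\<^sub>C\<^sub>L 'x" where S: "\<And>z y. z \<in> bidisc \<Longrightarrow> S z *\<^sub>V y = f z y"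
    by metis
  have "\<exists>T :: 'y \<Rightarrow>\<^sub>C\<^sub>L 'x. (\<forall>y. T *\<^sub>V y = f' z h y)" if "z \<in> bidisc" for z h
    by (rule cblinfun_of_fun[of "f' z h" "2 / (1 - maxnorm z) ^ 3 * norm h"])
      (use f'_lin f'_le[of z "maxnorm z" h] that in \<open>auto simp: bidisc_iff\<close>)
  then obtain D :: "complex \<times> complex \<Rightarrow> complex \<times> complex \<Rightarrow> 'y \<Rightarrow>\<^sub>C\<^sub>L 'x"
    where D: "\<And>z h y. z \<in> bidisc \<Longrightarrow> D z h *\<^sub>V y = f' z h y"
    by metis
  show thesis
  proof (rule that[of S D])
    show "\<exists>t. W *\<^sub>V (y, diag_mult z t) = (S z *\<^sub>V y, t)" if "z \<in> bidisc" for z y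
      by (rule exI[of _ "s z y"]) (simp only: W_s[OF that] S[OF that])
    show "schur_pair S D"
      unfolding schur_pair_def
    proof (intro conjI ballI allI impI)
      show "norm (S z) \<le> 1" if "z \<in> bidisc" for z
        by (rule norm_cblinfun_bound) (use f_le[OF that] S[OF that] in auto)
      show "D z (h + k) = D z h + D z k" if "z \<in> bidisc" for z h k
        by (rule cblinfun_eqI) (simp add: D[OF that] cblinfun_add_left f'_lin)
      show "D z (a *\<^sub>C h) = a *\<^sub>C D z h" if "z \<in> bidisc" for z h a
        by (rule cblinfun_eqI) (simp add: D[OF that] cblinfun_scaleC_left f'_lin)
      fix R z h assume R: "R < 1" "maxnorm z \<le> R"
      then have z: "z \<in> bidisc" by (simp add: bidisc_iff)
      show "norm (D z h) \<le> 2 / (1 - R) ^ 3 * norm h"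
        by (rule norm_cblinfun_bound) (use R f'_le[OF R(2,1)] in \<open>auto simp: D[OF z]\<close>)
      assume h: "maxnorm (z + h) \<le> R"
      then have zh: "z + h \<in> bidisc" using R by (simp add: bidisc_iff)
      show "norm (S (z + h) - S z - D z h) \<le> 2 / (1 - R) ^ 3 * (norm h)\<^sup>2"
        by (rule norm_cblinfun_bound)
          (use R err[OF R(2,1) h] in \<open>auto simp: cblinfun_diff_left D[OF z] S[OF z] S[OF zh]\<close>)
    qed
  qed
qed

text \<open>Lurking isometry: with the negative terms moved to the other side, the identity says
  that \<open>p\<close> and \<open>q\<close> have the same Gram matrix. The slack \<open>K3\<close>
  becomes an extra component \<open>g3\<close> on the input side, and feeding 0 into it leaves a
  contraction \<open>W\<close> of the shape required by \<open>transfer_function\<close>.\<close>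

lemma schur_interpolation:
  fixes x :: "'i \<Rightarrow> 'x::chilbert_space" and y :: "'i \<Rightarrow> 'y::chilbert_space"
      and z :: "'i \<Rightarrow> complex \<times> complex"
  assumes I: "finite I" and z: "\<And>i. i \<in> I \<Longrightarrow> z i \<in> bidisc"
    and K: "psd I K1" "psd I K2" "psd I K3"
    and eq: "\<And>i j. i \<in> I \<Longrightarrow> j \<in> I \<Longrightarrow> cinner (x i) (x j) - cinner (y i) (y j) =
      (1 - cnj (fst (z i)) * fst (z j)) * K1 i j + (1 - cnj (snd (z i)) * snd (z j)) * K2 i j + K3 i j"
  obtains S :: "complex \<times> complex \<Rightarrow> 'y \<Rightarrow>\<^sub>C\<^sub>L 'x" and D where "schur_pair S D"
    "\<And>i u. i \<in> I \<Longrightarrow> cinner (S (z i) *\<^sub>V u) (x i) = cinner u (y i)"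
proof -
  obtain g1 g2 g3 :: "'i \<Rightarrow> ('i, complex) ell2"
    where g: "\<And>i j. i \<in> I \<Longrightarrow> j \<in> I \<Longrightarrow> cinner (g1 i) (g1 j) = K1 i j"
      "\<And>i j. i \<in> I \<Longrightarrow> j \<in> I \<Longrightarrow> cinner (g2 i) (g2 j) = K2 i j"
      "\<And>i j. i \<in> I \<Longrightarrow> j \<in> I \<Longrightarrow> cinner (g3 i) (g3 j) = K3 i j"
    using psd_Gram[OF I K(1)] psd_Gram[OF I K(2)] psd_Gram[OF I K(3)] by metis
  define p where "p i = (x i, (cnj (fst (z i)) *\<^sub>C g1 i, cnj (snd (z i)) *\<^sub>C g2 i))" for i
  define q where "q i = ((y i, (g1 i, g2 i)), g3 i)" for i
  have "cinner (p i) (p j) = cinner (q i) (q j)" if "i \<in> I" "j \<in> I" for i j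
    using eq[OF that] that
    by (simp add: p_def q_def cinner_prod_def cinner_scaleC_left cinner_scaleC_right g algebra_simps)
  then obtain V :: "(('y \<times> ('i, complex) ell2 \<times> ('i, complex) ell2) \<times> ('i, complex) ell2) \<Rightarrow>\<^sub>C\<^sub>L
      ('x \<times> ('i, complex) ell2 \<times> ('i, complex) ell2)"
    where V: "norm V \<le> 1" "\<And>u j. j \<in> I \<Longrightarrow> cinner (V *\<^sub>V u) (p j) = cinner u (q j)"
    using Gram_isometry[OF I, of p q] by blast
  have incl: "V *\<^sub>V (u + v, 0) = (V *\<^sub>V (u, 0)) + (V *\<^sub>V (v, 0))" "V *\<^sub>V (a *\<^sub>C u, 0) = a *\<^sub>C (V *\<^sub>V (u,
      0))" for u v a
    using cblinfun_add[of V "(u, 0)" "(v, 0)"] cblinfun_scaleC[of V a "(u, 0)"]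
        by (simp_all add: scaleC_prod_def[of a "(u, 0)"])
  obtain W :: "('y \<times> ('i, complex) ell2 \<times> ('i, complex) ell2) \<Rightarrow>\<^sub>C\<^sub>L
      ('x \<times> ('i, complex) ell2 \<times> ('i, complex) ell2)" where W: "\<And>u. W *\<^sub>V u = V *\<^sub>V (u, 0)" "norm W \<le> 1"
  proof (rule cblinfun_of_fun[of "\<lambda>u. V *\<^sub>V (u, 0)" 1])
    show "norm (V *\<^sub>V (u, 0)) \<le> 1 * norm u" for u
      using norm_cblinfun_le[OF V(1), of "(u, 0)"] by (simp add: norm_Pair)
  qed ((simp add: incl; fail) | meson)+
  obtain S :: "complex \<times> complex \<Rightarrow> 'y \<Rightarrow>\<^sub>C\<^sub>L 'x" and D where S: "schur_pair S D"
    "\<And>z y. z \<in> bidisc \<Longrightarrow> \<exists>s. W *\<^sub>V (y, diag_mult z s) = (S z *\<^sub>V y, s)"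
    by (rule transfer_function[OF W(2)]) (rule that, assumption+)
  show thesis
  proof (rule that[OF S(1)])
    fix i u assume i: "i \<in> I"
    obtain s where s: "W *\<^sub>V (u, diag_mult (z i) s) = (S (z i) *\<^sub>V u, s)" using S(2)[OF z[OF i]] by blast
    \<comment> \<open>The conjugate coordinates in \<open>p i\<close> match the factors in
      \<open>diag_mult\<close>, so the state terms on the two sides cancel and the interpolation
      condition is left.\<close>
    have "cinner (S (z i) *\<^sub>V u, s) (p i) = cinner ((u, diag_mult (z i) s), 0) (q i)"
      using V(2)[OF i, of "((u, diag_mult (z i) s), 0)"] s by (simp add: W)
    then show "cinner (S (z i) *\<^sub>V u) (x i) = cinner u (y i)"
      by (simp add: p_def q_def cinner_prod_def diag_mult_def cinner_scaleC_left cinner_scaleC_right)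
  qed
qed

section \<open>Weak operator limits\<close>

lemma norm_cblinfun_le_of_form:
  fixes L :: "'a::complex_normed_vector \<Rightarrow>\<^sub>C\<^sub>L 'b::complex_inner"
  assumes *: "\<And>u v. cmod (cinner (L *\<^sub>V u) v) \<le> c * norm u * norm v" and c: "0 \<le> c"
  shows "norm L \<le> c"
proof (rule norm_cblinfun_bound[OF c])
  fix u
  show "norm (L *\<^sub>V u) \<le> c * norm u"
  proof (cases "L *\<^sub>V u = 0")
    case False
    have "norm (L *\<^sub>V u) * norm (L *\<^sub>V u) \<le> c * norm u * norm (L *\<^sub>V u)"
      using *[of u "L *\<^sub>V u"] by (simp add: cinner_self norm_mult power2_eq_square)
    then show ?thesis using False by simp
  qed (simp add: c)
qed

lemma weak_limit_norm_le:
  fixes T :: "'x \<Rightarrow> 'a::complex_normed_vector \<Rightarrow>\<^sub>C\<^sub>L 'b::chilbert_space"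
  assumes U: "U \<noteq> bot" and lim: "\<And>u v. ((\<lambda>i. cinner (T i *\<^sub>V u) v) \<longlongrightarrow> cinner (L *\<^sub>V u) v) U"
    and le: "\<forall>\<^sub>F i in U. norm (T i) \<le> c"
  shows "norm L \<le> c"
proof -
  have c: "0 \<le> c"
    using eventually_happens[OF le] U norm_ge_zero order_trans by blast
  have *: "cmod (cinner (L *\<^sub>V u) v) \<le> c * norm u * norm v" for u v
  proof (rule tendsto_upperbound[OF tendsto_norm[OF lim] _ U])
    show "\<forall>\<^sub>F i in U. norm (cinner (T i *\<^sub>V u) v) \<le> c * norm u * norm v"
      using le
    proof eventually_elim
      case (elim i)
      show ?case
        by (rule order_trans[OF Cauchy_Schwarz_cinner]) (intro mult_right_mono norm_cblinfun_le elim
            norm_ge_zero)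
    qed
  qed
  show ?thesis by (rule norm_cblinfun_le_of_form[OF * c])
qed

text \<open>Weak compactness of balls of operators: the limits of all matrix coefficients along one
  ultrafilter form a bounded sesquilinear form.\<close>

lemma weak_limit_exists:
  fixes T :: "'x \<Rightarrow> 'a::complex_normed_vector \<Rightarrow>\<^sub>C\<^sub>L 'b::chilbert_space"
  assumes F: "F \<noteq> bot" and le: "\<And>i. norm (T i) \<le> c"
  shows "\<exists>L. \<forall>u v. ((\<lambda>i. cinner (T i *\<^sub>V u) v) \<longlongrightarrow> cinner (L *\<^sub>V u) v) (ultrafilter_of F)"
proof -
  let ?U = "ultrafilter_of F"
  have U: "?U \<noteq> bot" by (rule ultrafilter_of_neq_bot[OF F])
  define B where "B u v = Lim ?U (\<lambda>i. cinner (T i *\<^sub>V u) v)" for u v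
  have bd: "cmod (cinner (T i *\<^sub>V u) v) \<le> c * norm u * norm v" for i u v
    by (rule order_trans[OF Cauchy_Schwarz_cinner]) (intro mult_right_mono norm_cblinfun_le le
        norm_ge_zero)
  have lim: "((\<lambda>i. cinner (T i *\<^sub>V u) v) \<longlongrightarrow> B u v) ?U" for u v
    unfolding B_def by (rule tendsto_ultrafilter[OF F]) (rule always_eventually, use bd in blast)
  have c: "0 \<le> c" using le norm_ge_zero order_trans by blast
  obtain L :: "'a \<Rightarrow>\<^sub>C\<^sub>L 'b" where L: "\<And>u v. cinner (L *\<^sub>V u) v = B u v"
  proof (rule cblinfun_of_form[of B c])
    show "B (u + u') v = B u v + B u' v" for u u' v
      by (rule tendsto_unique[OF U lim]) (simp add: cblinfun_add cinner_add_left tendsto_add lim)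
    show "B u (v + v') = B u v + B u v'" for u v v'
      by (rule tendsto_unique[OF U lim]) (simp add: cinner_add_right tendsto_add lim)
    show "B (a *\<^sub>C u) v = a * B u v" for a u v
      by (rule tendsto_unique[OF U lim]) (simp add: cblinfun_scaleC cinner_scaleC_left
          tendsto_mult_left lim)
    show "B u (a *\<^sub>C v) = cnj a * B u v" for a u v
      by (rule tendsto_unique[OF U lim]) (simp add: cinner_scaleC_right tendsto_mult_left lim)
    show "cmod (B u v) \<le> c * norm u * norm v" for u v
      by (rule tendsto_upperbound[OF tendsto_norm[OF lim] _ U]) (rule always_eventually, use bd in blast)
  qed (use c in blast)+
  then have "((\<lambda>i. cinner (T i *\<^sub>V u) v) \<longlongrightarrow> cinner (L *\<^sub>V u) v) ?U" for u v
    using lim by simp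
  then show ?thesis by blast
qed

text \<open>The net is indexed by the finite subsets of \<open>J\<close>; each single condition
  holds eventually along it. Values and derivatives have weak limits that satisfy the same uniform
  estimates of \<open>schur_pair\<close>, so holomorphy survives the limit.\<close>

lemma interpolation_compactness:
  fixes x :: "'i \<Rightarrow> 'x::chilbert_space" and y :: "'i \<Rightarrow> 'y::chilbert_space"
      and z :: "'i \<Rightarrow> complex \<times> complex"
  assumes z: "\<And>i. i \<in> J \<Longrightarrow> z i \<in> bidisc"
    and fin: "\<And>I. finite I \<Longrightarrow> I \<subseteq> J \<Longrightarrow> \<exists>(S :: complex \<times> complex \<Rightarrow> 'y \<Rightarrow>\<^sub>C\<^sub>L 'x) D. schur_pair S D \<and>
      (\<forall>i\<in>I. \<forall>u. cinner (S (z i) *\<^sub>V u) (x i) = cinner u (y i))"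
  obtains S :: "complex \<times> complex \<Rightarrow> 'y \<Rightarrow>\<^sub>C\<^sub>L 'x" where "S \<in> H_infty" "H_infty_norm S \<le> 1"
    "\<And>i u. i \<in> J \<Longrightarrow> cinner (S (z i) *\<^sub>V u) (x i) = cinner u (y i)"
proof -
  define F where "F = finite_subsets_at_top J"
  have F: "F \<noteq> bot" by (simp add: F_def)
  define U where "U = ultrafilter_of F"
  have U: "U \<noteq> bot" "U \<le> F" unfolding U_def by (simp_all add: ultrafilter_of_neq_bot ultrafilter_of_le F)
  \<comment> \<open>Index sets outside the net receive the pair belonging to the empty set, so that
    the choice is total.\<close>
  have "\<exists>S D. schur_pair (S :: complex \<times> complex \<Rightarrow> 'y \<Rightarrow>\<^sub>C\<^sub>L 'x) D \<and>
      (finite I \<longrightarrow> I \<subseteq> J \<longrightarrow> (\<forall>i\<in>I. \<forall>u. cinner (S (z i) *\<^sub>V u) (x i) = cinner u (y i)))" for I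
    using fin[of I] fin[of "{}"] by blast
  then obtain S D where SD: "\<And>I. schur_pair (S I :: complex \<times> complex \<Rightarrow> 'y \<Rightarrow>\<^sub>C\<^sub>L 'x) (D I)"
    and S: "\<And>I i u. finite I \<Longrightarrow> I \<subseteq> J \<Longrightarrow> i \<in> I \<Longrightarrow> cinner (S I (z i) *\<^sub>V u) (x i) = cinner u (y i)"
    by metis
  have "\<exists>L. \<forall>u v. ((\<lambda>I. cinner (S I w *\<^sub>V u) v) \<longlongrightarrow> cinner (L *\<^sub>V u) v) U" if w: "w \<in> bidisc" for w
    unfolding U_def by (rule weak_limit_exists[OF F]) (rule schur_pairD(1)[OF SD w])
  then obtain S' where S': "\<And>w u v. w \<in> bidisc \<Longrightarrow> ((\<lambda>I. cinner (S I w *\<^sub>V u) v) \<longlongrightarrow> cinner (S' w *\<^sub>V u) v) U"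
    by metis
  have "\<exists>L. \<forall>u v. ((\<lambda>I. cinner (D I w h *\<^sub>V u) v) \<longlongrightarrow> cinner (L *\<^sub>V u) v) U" if w: "w \<in> bidisc" for w h
    unfolding U_def by (rule weak_limit_exists[OF F], rule schur_pairD(4)[OF SD, of "maxnorm w"])
      (use w in \<open>auto simp: bidisc_iff\<close>)
  then obtain D' where D': "\<And>w h u v. w \<in> bidisc \<Longrightarrow> ((\<lambda>I. cinner (D I w h *\<^sub>V u) v) \<longlongrightarrow> cinner (D' w h
      *\<^sub>V u) v) U"
    by metis
  have pair: "schur_pair S' D'"
    unfolding schur_pair_def
  proof (intro conjI ballI allI impI)
    show "norm (S' w) \<le> 1" if w: "w \<in> bidisc" for w
      by (rule weak_limit_norm_le[OF U(1) S'[OF w]]) (rule always_eventually, use schur_pairD(1)[OF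
          SD w] in blast)
    fix w h k a assume w: "w \<in> bidisc"
    show "D' w (h + k) = D' w h + D' w k"
    proof (rule cblinfun_eqI, rule cinner_eqI)
      fix u v
      have "((\<lambda>I. cinner (D I w (h + k) *\<^sub>V u) v) \<longlongrightarrow> cinner ((D' w h + D' w k) *\<^sub>V u) v) U"
        unfolding schur_pairD(2)[OF SD w] cblinfun_add_left cinner_add_left by (intro tendsto_add D' w)
      then show "cinner (D' w (h + k) *\<^sub>V u) v = cinner ((D' w h + D' w k) *\<^sub>V u) v"
        by (rule tendsto_unique[OF U(1) D'[OF w]])
    qed
    show "D' w (a *\<^sub>C h) = a *\<^sub>C D' w h"
    proof (rule cblinfun_eqI, rule cinner_eqI)
      fix u v
      have "((\<lambda>I. cinner (D I w (a *\<^sub>C h) *\<^sub>V u) v) \<longlongrightarrow> cinner ((a *\<^sub>C D' w h) *\<^sub>V u) v) U"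
        unfolding schur_pairD(3)[OF SD w] cblinfun_scaleC_left cinner_scaleC_left
            by (intro tendsto_mult_left D' w)
      then show "cinner (D' w (a *\<^sub>C h) *\<^sub>V u) v = cinner ((a *\<^sub>C D' w h) *\<^sub>V u) v"
        by (rule tendsto_unique[OF U(1) D'[OF w]])
    qed
  next
    fix R w h assume R: "R < 1" "maxnorm w \<le> R"
    then have w: "w \<in> bidisc" by (simp add: bidisc_iff)
    show "norm (D' w h) \<le> 2 / (1 - R) ^ 3 * norm h"
      by (rule weak_limit_norm_le[OF U(1) D'[OF w]]) (rule always_eventually, use schur_pairD(4)[OF
          SD R] in blast)
    assume h: "maxnorm (w + h) \<le> R"
    then have wh: "w + h \<in> bidisc" using R by (simp add: bidisc_iff)
    show "norm (S' (w + h) - S' w - D' w h) \<le> 2 / (1 - R) ^ 3 * (norm h)\<^sup>2"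
    proof (rule weak_limit_norm_le[OF U(1), of "\<lambda>I. S I (w + h) - S I w - D I w h"])
      show "((\<lambda>I. cinner ((S I (w + h) - S I w - D I w h) *\<^sub>V u) v) \<longlongrightarrow>
          cinner ((S' (w + h) - S' w - D' w h) *\<^sub>V u) v) U" for u v
        unfolding cblinfun_diff_left cinner_diff_left by (intro tendsto_diff S' D' w wh)
    qed (rule always_eventually, use schur_pairD(5)[OF SD R h] in blast)
  qed
  show thesis
  proof (rule that[OF schur_pair_H_infty[OF pair]])
    fix i u assume i: "i \<in> J"
    have "\<forall>\<^sub>F I in F. finite I \<and> {i} \<subseteq> I \<and> I \<subseteq> J"
      unfolding F_def eventually_finite_subsets_at_top using i by (intro exI[of _ "{i}"]) auto
    then have "\<forall>\<^sub>F I in U. finite I \<and> {i} \<subseteq> I \<and> I \<subseteq> J" using U(2) filter_leD by blast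
    then have "\<forall>\<^sub>F I in U. cinner (S I (z i) *\<^sub>V u) (x i) = cinner u (y i)"
      by eventually_elim (use S in blast)
    then have "((\<lambda>I. cinner (S I (z i) *\<^sub>V u) (x i)) \<longlongrightarrow> cinner u (y i)) U"
      by (rule tendsto_eventually)
    then show "cinner (S' (z i) *\<^sub>V u) (x i) = cinner u (y i)"
      by (rule tendsto_unique[OF U(1) S'[OF z[OF i]]])
  qed
qed

section \<open>Polynomial approximation on the bidisc\<close>

definition root1 :: "nat \<Rightarrow> nat \<Rightarrow> complex"
  where "root1 N a = exp (2 * of_real pi * \<i> * of_nat a / of_nat N)"

lemma norm_root1 [simp]: "cmod (root1 N a) = 1"
proof -
  have "root1 N a = exp (\<i> * of_real (2 * pi * real a / real N))"
    by (simp add: root1_def mult_ac)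
  then show ?thesis by (simp only: norm_exp_i_times)
qed

lemma root1_mult_cnj [simp]: "root1 N a * cnj (root1 N a) = 1"
  using complex_norm_square[of "root1 N a"] by simp

lemma root1_power: "root1 N a ^ k = root1 N k ^ a"
  unfolding root1_def exp_of_nat_mult[symmetric] by (simp add: mult_ac)

lemma root1_eq_iff: "m < N \<Longrightarrow> k < N \<Longrightarrow> root1 N m = root1 N k \<longleftrightarrow> m = k"
  unfolding root1_def by (subst complex_root_unity_eq) auto

lemma root1_orthogonal:
  assumes "m < N" "k < N"
  shows "(\<Sum>a<N. root1 N a ^ m * cnj (root1 N a ^ k)) = (if m = k then of_nat N else 0)"
proof -
  define u where "u = root1 N m * cnj (root1 N k)"
  have "(\<Sum>a<N. root1 N a ^ m * cnj (root1 N a ^ k)) = (\<Sum>a<N. u ^ a)"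
    unfolding u_def by (intro sum.cong refl) (metis root1_power power_mult_distrib complex_cnj_power)
  also have "\<dots> = (if m = k then of_nat N else 0)"
  proof (cases "m = k")
    case True
    then show ?thesis by (simp add: u_def)
  next
    case False
    have "u \<noteq> 1"
    proof
      assume "u = 1"
      then have "root1 N m * (cnj (root1 N k) * root1 N k) = root1 N k"
          by (simp add: u_def flip: mult.assoc)
      then have "root1 N m = root1 N k" using root1_mult_cnj[of N k] by (simp add: mult.commute)
      then show False using False root1_eq_iff[OF assms] by simp
    qed
    have N: "N \<noteq> 0" using assms by simp
    have "root1 N j ^ N = 1" for j
      unfolding root1_def by (rule complex_root_unity[OF N])
    then have "u ^ N = 1" by (simp add: u_def power_mult_distrib flip: complex_cnj_power)
    then show ?thesis using False \<open>u \<noteq> 1\<close> by (simp add: geometric_sum)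
  qed
  finally show ?thesis .
qed

text \<open>Takes the place of integration over the circle: the finite average is exact because all
  degrees stay below \<open>N\<close>.\<close>

lemma Parseval_roots:
  fixes h :: "nat \<Rightarrow> 'a::complex_inner"
  shows "(\<Sum>a<N. (norm (\<Sum>i<N. root1 N a ^ i *\<^sub>C h i))\<^sup>2) = real N * (\<Sum>i<N. (norm (h i))\<^sup>2)"
proof -
  have "complex_of_real (\<Sum>a<N. (norm (\<Sum>i<N. root1 N a ^ i *\<^sub>C h i))\<^sup>2)
      = (\<Sum>a<N. \<Sum>i<N. \<Sum>j<N. (root1 N a ^ i * cnj (root1 N a ^ j)) * cinner (h i) (h j))"
    unfolding of_real_sum cinner_self[symmetric] unfolding cinner_sum_left unfolding cinner_sum_right
    by (simp add: cinner_scaleC_left cinner_scaleC_right ac_simps)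
  also have "\<dots> = (\<Sum>i<N. \<Sum>j<N. \<Sum>a<N. (root1 N a ^ i * cnj (root1 N a ^ j)) * cinner (h i) (h j))"
  proof -
    have "(\<Sum>a<N. \<Sum>i<N. \<Sum>j<N. (root1 N a ^ i * cnj (root1 N a ^ j)) * cinner (h i) (h j))
      = (\<Sum>i<N. \<Sum>a<N. \<Sum>j<N. (root1 N a ^ i * cnj (root1 N a ^ j)) * cinner (h i) (h j))"
      by (rule sum.swap)
    also have "\<dots> = (\<Sum>i<N. \<Sum>j<N. \<Sum>a<N. (root1 N a ^ i * cnj (root1 N a ^ j)) * cinner (h i) (h j))"
      by (intro sum.cong refl sum.swap)
    finally show ?thesis .
  qed
  also have "\<dots> = (\<Sum>i<N. \<Sum>j<N. if i = j then of_nat N * cinner (h i) (h j) else 0)"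
    by (intro sum.cong refl) (simp add: root1_orthogonal del: complex_cnj_power flip: sum_distrib_right)
  also have "\<dots> = complex_of_real (real N * (\<Sum>i<N. (norm (h i))\<^sup>2))"
    by (simp add: cinner_self sum_distrib_left)
  finally show ?thesis by (simp only: of_real_eq_iff)
qed

lemma Parseval_roots2:
  fixes h :: "nat \<Rightarrow> nat \<Rightarrow> 'a::complex_inner"
  shows "(\<Sum>a<N. \<Sum>b<N. (norm (\<Sum>i<N. \<Sum>j<N. (root1 N a ^ i * root1 N b ^ j) *\<^sub>C h i j))\<^sup>2)
    = (real N)\<^sup>2 * (\<Sum>i<N. \<Sum>j<N. (norm (h i j))\<^sup>2)"
proof -
  have "(\<Sum>a<N. \<Sum>b<N. (norm (\<Sum>i<N. \<Sum>j<N. (root1 N a ^ i * root1 N b ^ j) *\<^sub>C h i j))\<^sup>2)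
      = (\<Sum>b<N. \<Sum>a<N. (norm (\<Sum>i<N. root1 N a ^ i *\<^sub>C (\<Sum>j<N. root1 N b ^ j *\<^sub>C h i j)))\<^sup>2)"
    by (subst sum.swap) (simp add: scaleC_sum_right scaleC_scaleC)
  also have "\<dots> = (\<Sum>b<N. real N * (\<Sum>i<N. (norm (\<Sum>j<N. root1 N b ^ j *\<^sub>C h i j))\<^sup>2))"
    by (intro sum.cong refl Parseval_roots)
  also have "\<dots> = real N * (\<Sum>i<N. \<Sum>b<N. (norm (\<Sum>j<N. root1 N b ^ j *\<^sub>C h i j))\<^sup>2)"
    unfolding sum_distrib_left[symmetric] by (rule arg_cong[OF sum.swap])
  also have "\<dots> = real N * (\<Sum>i<N. real N * (\<Sum>j<N. (norm (h i j))\<^sup>2))"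
    by (simp only: Parseval_roots)
  also have "\<dots> = (real N)\<^sup>2 * (\<Sum>i<N. \<Sum>j<N. (norm (h i j))\<^sup>2)"
    by (simp add: power2_eq_square sum_distrib_left mult.assoc)
  finally show ?thesis .
qed

text \<open>The polynomial of degree less than \<open>N\<close> interpolating \<open>g\<close> at the \<open>N\<close>-th roots of unity.\<close>

definition root_interp :: "nat \<Rightarrow> (complex \<Rightarrow> complex) \<Rightarrow> complex \<Rightarrow> complex"
  where "root_interp N g z = (\<Sum>a<N. g (root1 N a) * (\<Sum>k<N. (z * cnj (root1 N a)) ^ k)) / of_nat N"

lemma root_interp_le:
  assumes z: "cmod z \<le> 1" and g: "\<And>t. cmod t = 1 \<Longrightarrow> cmod (g t) \<le> C" and N: "0 < N"
  shows "cmod (root_interp N g z) \<le> real N * C"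
proof -
  have C: "0 \<le> C" using g[of 1] norm_ge_zero order_trans by (metis norm_one)
  have "cmod (\<Sum>k<N. (z * cnj (root1 N a)) ^ k) \<le> real N" for a
  proof -
    have "cmod (\<Sum>k<N. (z * cnj (root1 N a)) ^ k) \<le> (\<Sum>k<N. 1)"
      by (rule sum_norm_le) (simp add: norm_mult norm_power power_le_one z)
    then show ?thesis by simp
  qed
  then have "cmod (\<Sum>a<N. g (root1 N a) * (\<Sum>k<N. (z * cnj (root1 N a)) ^ k)) \<le> (\<Sum>a<N. C * real N)"
    by (intro sum_norm_le) (auto simp: norm_mult intro!: mult_mono g C)
  then show ?thesis using N by (simp add: root_interp_def norm_divide field_simps)
qed

lemma root_interp_monom:
  assumes "m < N"
  shows "root_interp N (\<lambda>t. t ^ m) z = z ^ m"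
proof -
  have "(\<Sum>a<N. root1 N a ^ m * (\<Sum>k<N. (z * cnj (root1 N a)) ^ k))
      = (\<Sum>a<N. \<Sum>k<N. z ^ k * (root1 N a ^ m * cnj (root1 N a ^ k)))"
    by (simp add: sum_distrib_left power_mult_distrib ac_simps)
  also have "\<dots> = (\<Sum>k<N. z ^ k * (\<Sum>a<N. root1 N a ^ m * cnj (root1 N a ^ k)))"
    by (subst sum.swap) (simp add: sum_distrib_left)
  also have "\<dots> = (\<Sum>k<N. if k = m then z ^ k * of_nat N else 0)"
    using assms by (intro sum.cong refl) (auto simp: root1_orthogonal simp del: complex_cnj_power)
  also have "\<dots> = z ^ m * of_nat N" using assms by simp
  finally show ?thesis using assms by (simp add: root_interp_def)
qed

lemma root_interp_linear:
  "root_interp N (\<lambda>t. f t + g t) z = root_interp N f z + root_interp N g z"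
  "root_interp N (\<lambda>t. f t - g t) z = root_interp N f z - root_interp N g z"
  "root_interp N (\<lambda>t. c * f t) z = c * root_interp N f z"
  "root_interp N (\<lambda>t. \<Sum>i\<in>I. F i t) z = (\<Sum>i\<in>I. root_interp N (F i) z)"
proof -
  show "root_interp N (\<lambda>t. \<Sum>i\<in>I. F i t) z = (\<Sum>i\<in>I. root_interp N (F i) z)"
    unfolding root_interp_def sum_divide_distrib[symmetric] sum_distrib_right
    by (subst sum.swap) (rule refl)
qed (simp_all add: root_interp_def distrib_right left_diff_distrib sum.distrib sum_subtractf
    add_divide_distrib diff_divide_distrib mult.assoc flip: sum_distrib_left)

text \<open>Interpolation reproduces the first \<open>N\<close> Taylor terms, so the error is that
  of the tail. Cauchy estimates on radius \<open>q\<close> against the dilation by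
  \<open>q^2\<close> leave coefficients of size \<open>C q^m\<close>, whose decay beats the crude
  bound \<open>N\<close> on the norm of the interpolation map.\<close>

lemma root_interp_error:
  assumes f: "f holomorphic_on ball 0 1" and C: "\<And>t. cmod t < 1 \<Longrightarrow> cmod (f t) \<le> C"
    and q: "0 < q" "q < 1" and z: "cmod z \<le> 1" and N: "0 < N"
  shows "cmod (root_interp N (\<lambda>t. f (of_real (q\<^sup>2) * t)) z - f (of_real (q\<^sup>2) * z))
    \<le> (real N + 1) * (C * q ^ N / (1 - q))"
proof -
  have C0: "0 \<le> C" using C[of 0] norm_ge_zero order_trans by (metis norm_zero zero_less_one)
  define a where "a m = (deriv ^^ m) f 0 / fact m * of_real (q\<^sup>2) ^ m" for m
  have a_le: "cmod (a m) \<le> C * q ^ m" for m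
  proof -
    have "cmod ((deriv ^^ m) f 0) \<le> fact m * C / q ^ m"
    proof (rule Cauchy_inequality)
      show "f holomorphic_on ball 0 q" using f q by (auto intro: holomorphic_on_subset)
      show "continuous_on (cball 0 q) f"
        by (rule holomorphic_on_imp_continuous_on, rule holomorphic_on_subset[OF f]) (use q in auto)
      show "cmod (f x) \<le> C" if "cmod (0 - x) = q" for x
        using that q by (intro C) simp
    qed (use q in auto)
    then have "cmod ((deriv ^^ m) f 0) / fact m * (q\<^sup>2) ^ m \<le> (fact m * C / q ^ m) / fact m * (q\<^sup>2) ^ m"
      using q by (intro mult_right_mono divide_right_mono) auto
    also have "\<dots> = C * q ^ m" using q by (simp add: power2_eq_square power_mult_distrib)
    finally show ?thesis by (simp add: a_def norm_mult norm_divide norm_power power_abs)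
  qed
  have sums: "(\<lambda>m. a m * t ^ m) sums f (of_real (q\<^sup>2) * t)" if "cmod t \<le> 1" for t
  proof -
    have "q\<^sup>2 * cmod t \<le> q\<^sup>2 * 1" using that by (intro mult_left_mono) auto
    also have "\<dots> < 1" using q by (simp add: power_less_one_iff)
    finally have "of_real (q\<^sup>2) * t \<in> ball 0 1"
      by (simp add: norm_mult norm_power)
    from holomorphic_power_series[OF f this] show ?thesis
      by (simp add: a_def power_mult_distrib mult.assoc)
  qed
  define tail where "tail t = f (of_real (q\<^sup>2) * t) - (\<Sum>m<N. a m * t ^ m)" for t
  have tail_le: "cmod (tail t) \<le> C * q ^ N / (1 - q)" if t: "cmod t \<le> 1" for t
  proof -
    have "(\<lambda>m. a (m + N) * t ^ (m + N)) sums tail t"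
      unfolding tail_def using sums[OF t] by (rule sums_split_initial_segment)
    moreover have "(\<lambda>m. C * q ^ N * q ^ m) sums (C * q ^ N * (1 / (1 - q)))"
      using q by (intro sums_mult geometric_sums) auto
    moreover have "cmod (a (m + N) * t ^ (m + N)) \<le> C * q ^ N * q ^ m" for m
    proof -
      have "cmod (a (m + N) * t ^ (m + N)) \<le> cmod (a (m + N)) * 1"
        unfolding norm_mult norm_power by (intro mult_left_mono power_le_one t) auto
      also have "\<dots> \<le> C * q ^ (m + N)" using a_le by simp
      finally show ?thesis by (simp add: power_add ac_simps)
    qed
    ultimately show ?thesis
      using norm_suminf_le[of "\<lambda>m. a (m + N) * t ^ (m + N)" "\<lambda>m. C * q ^ N * q ^ m"]
      by (simp add: sums_iff)
  qed
  have f_eq: "f (of_real (q\<^sup>2) * t) = (\<Sum>m<N. a m * t ^ m) + tail t" for t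
    by (simp add: tail_def)
  have "root_interp N (\<lambda>t. f (of_real (q\<^sup>2) * t)) z - f (of_real (q\<^sup>2) * z) = root_interp N tail z -
      tail z"
    unfolding f_eq by (simp add: root_interp_linear root_interp_monom)
  also have "cmod \<dots> \<le> cmod (root_interp N tail z) + cmod (tail z)"
    by (rule norm_triangle_ineq4)
  also have "\<dots> \<le> real N * (C * q ^ N / (1 - q)) + C * q ^ N / (1 - q)"
    using tail_le z N by (intro add_mono root_interp_le) auto
  finally show ?thesis by (simp add: algebra_simps add_divide_distrib)
qed

section \<open>Operator-valued polynomials close to a dilated bounded function\<close>

definition bipoly :: "nat \<Rightarrow> (nat \<Rightarrow> nat \<Rightarrow> 'a::complex_vector) \<Rightarrow> complex \<times> complex \<Rightarrow> 'a"
  where "bipoly N c z = (\<Sum>k<N. \<Sum>l<N. (fst z ^ k * snd z ^ l) *\<^sub>C c k l)"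

lemma H_infty_slices_holomorphic:
  fixes S :: "complex \<times> complex \<Rightarrow> 'y::chilbert_space \<Rightarrow>\<^sub>C\<^sub>L 'x::chilbert_space"
  assumes S: "S \<in> H_infty"
  shows "cmod w < 1 \<Longrightarrow> (\<lambda>t. cinner (S (t, w) *\<^sub>V u) v) holomorphic_on ball 0 1"
    and "cmod w < 1 \<Longrightarrow> (\<lambda>t. cinner (S (w, t) *\<^sub>V u) v) holomorphic_on ball 0 1"
proof -
  have ev: "bounded_linear (\<lambda>T :: 'y \<Rightarrow>\<^sub>C\<^sub>L 'x. cinner (T *\<^sub>V u) v)"
  proof (rule bounded_linear_intro[where K = "norm u * norm v"])
    show "cmod (cinner (T *\<^sub>V u) v) \<le> norm T * (norm u * norm v)" for T
    proof -
      have "cmod (cinner (T *\<^sub>V u) v) \<le> (norm T * norm u) * norm v"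
        by (rule order_trans[OF Cauchy_Schwarz_cinner]) (intro mult_right_mono norm_cblinfun
            norm_ge_zero)
      then show ?thesis by (simp add: mult.assoc)
    qed
  qed (simp_all add: cblinfun_add_left cinner_add_left scaleR_scaleC cblinfun_scaleC_left
      cinner_scaleC_left scaleC_complex_def)
  have gen: "(\<lambda>t. cinner (S (e t) *\<^sub>V u) v) holomorphic_on ball 0 1"
    if e: "\<And>t. cmod t < 1 \<Longrightarrow> e t \<in> bidisc" "\<And>t. (e has_derivative L) (at t)" "\<And>h. L h = h *\<^sub>C L 1" for e L
    unfolding holomorphic_on_def
  proof
    fix t :: complex assume "t \<in> ball 0 1"
    then have "e t \<in> bidisc" using e(1) by simp
    then obtain D where D: "(S has_derivative D) (at (e t))" "\<And>a h. D (a *\<^sub>C h) = a *\<^sub>C D h"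
      using S unfolding H_infty_def by blast
    have "((\<lambda>t. S (e t)) has_derivative (\<lambda>h. D (L h))) (at t)"
      using has_derivative_compose[OF e(2) D(1)] .
    from bounded_linear.has_derivative[OF ev this]
    have "((\<lambda>t. cinner (S (e t) *\<^sub>V u) v) has_derivative (\<lambda>h. cinner (D (L h) *\<^sub>V u) v)) (at t)" .
    moreover have "(\<lambda>h. cinner (D (L h) *\<^sub>V u) v) = (*) (cinner (D (L 1) *\<^sub>V u) v)"
    proof
      fix h
      show "cinner (D (L h) *\<^sub>V u) v = cinner (D (L 1) *\<^sub>V u) v * h"
        by (subst e(3)) (simp add: D(2) cblinfun_scaleC_left cinner_scaleC_left)
    qed
    ultimately show "(\<lambda>t. cinner (S (e t) *\<^sub>V u) v) field_differentiable at t within ball 0 1"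
      unfolding field_differentiable_def has_field_derivative_def
      by (metis has_derivative_at_withinI)
  qed
  show "(\<lambda>t. cinner (S (t, w) *\<^sub>V u) v) holomorphic_on ball 0 1" if "cmod w < 1"
  proof (rule gen[where L = "\<lambda>h. (h, 0)"])
    show "((\<lambda>t. (t, w)) has_derivative (\<lambda>h. (h, 0))) (at t)" for t
      by (intro has_derivative_Pair has_derivative_ident has_derivative_const)
  qed (use that in \<open>auto simp: bidisc_def scaleC_prod_def scaleC_complex_def\<close>)
  show "(\<lambda>t. cinner (S (w, t) *\<^sub>V u) v) holomorphic_on ball 0 1" if "cmod w < 1"
  proof (rule gen[where L = "\<lambda>h. (0, h)"])
    show "((\<lambda>t. (w, t)) has_derivative (\<lambda>h. (0, h))) (at t)" for t
      by (intro has_derivative_Pair has_derivative_ident has_derivative_const)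
  qed (use that in \<open>auto simp: bidisc_def scaleC_prod_def scaleC_complex_def\<close>)
qed

lemma H_infty_norm_le:
  assumes "S \<in> H_infty" "H_infty_norm S \<le> 1" "z \<in> bidisc"
  shows "norm (S z) \<le> 1"
proof -
  have "bdd_above ((\<lambda>z. norm (S z)) ` bidisc)"
    using assms(1) unfolding H_infty_def bounded_iff bdd_above_def by blast
  then have "norm (S z) \<le> H_infty_norm S"
    unfolding H_infty_norm_def by (rule cSUP_upper[OF assms(3)])
  then show ?thesis using assms(2) by simp
qed

text \<open>Interpolation in each variable in turn, applied to the scalar functions
  \<open>cinner (S z u) v\<close>. The error bounds are proportional to
  \<open>norm u * norm v\<close>, hence give an estimate in operator norm that is uniform on the
  closed bidisc.\<close>

lemma H_infty_bipoly_approx: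
  fixes S :: "complex \<times> complex \<Rightarrow> 'y::chilbert_space \<Rightarrow>\<^sub>C\<^sub>L 'x::chilbert_space"
  assumes S: "S \<in> H_infty" "H_infty_norm S \<le> 1" and q: "0 < q" "q < 1" and \<epsilon>: "0 < \<epsilon>"
  obtains N c where "\<And>z. cmod (fst z) \<le> 1 \<Longrightarrow> cmod (snd z) \<le> 1 \<Longrightarrow>
    norm (bipoly N c z - S (of_real (q\<^sup>2) * fst z, of_real (q\<^sup>2) * snd z)) \<le> \<epsilon>"
proof -
  \<comment> \<open>The square equals \<open>4 n^2 q^n / (1 - q)\<close>. It dominates the total
    error factor \<open>(n + 1)^2 q^n / (1 - q)\<close> for positive \<open>n\<close> and reduces
    the limit to that of \<open>n x^n\<close> with \<open>x = sqrt q\<close>.\<close>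
  have "(\<lambda>n. ((of_nat n * sqrt q ^ n) * 2 / sqrt (1 - q)) ^ 2) \<longlonglongrightarrow> (0 * 2 / sqrt (1 - q)) ^ 2"
    using q by (intro tendsto_intros powser_times_n_limit_0) (auto simp: real_less_lsqrt)
  then have "\<forall>\<^sub>F n in sequentially. ((of_nat n * sqrt q ^ n) * 2 / sqrt (1 - q)) ^ 2 < \<epsilon>"
    using \<epsilon> by (intro order_tendstoD(2)[of _ 0]) simp_all
  then obtain N0 where N0: "\<And>n. n \<ge> N0 \<Longrightarrow> ((of_nat n * sqrt q ^ n) * 2 / sqrt (1 - q)) ^ 2 < \<epsilon>"
    unfolding eventually_sequentially by blast
  define N where "N = Suc N0"
  have N: "0 < N" by (simp add: N_def)
  have small: "(real N + 1)\<^sup>2 * (q ^ N / (1 - q)) \<le> \<epsilon>"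
  proof -
    have "(real N + 1)\<^sup>2 \<le> (2 * real N)\<^sup>2" using N by (intro power_mono) auto
    then have "(real N + 1)\<^sup>2 * (q ^ N / (1 - q)) \<le> (2 * real N)\<^sup>2 * (q ^ N / (1 - q))"
      using q by (intro mult_right_mono) auto
    also have "\<dots> = ((of_nat N * sqrt q ^ N) * 2 / sqrt (1 - q)) ^ 2"
    proof -
      have "(sqrt q ^ N)\<^sup>2 = q ^ N" using q by (simp flip: power_mult power_even_eq add:
          power2_eq_square power_mult_distrib[symmetric])
      then show ?thesis using q by (simp add: power_mult_distrib power_divide)
    qed
    also have "\<dots> < \<epsilon>" by (rule N0) (simp add: N_def)
    finally show ?thesis by simp
  qed
  define r where "r = complex_of_real (q\<^sup>2)"
  have r: "cmod (r * t) < 1" if "cmod t \<le> 1" for t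
  proof -
    have "q\<^sup>2 * cmod t \<le> q\<^sup>2 * 1" using that by (intro mult_left_mono) auto
    also have "\<dots> < 1" using q by (simp add: power_less_one_iff)
    finally show ?thesis by (simp add: r_def norm_mult norm_power)
  qed
  \<comment> \<open>Discrete Fourier coefficients of the dilated function on the grid of pairs of
    roots of unity.\<close>
  define c where "c k l = (\<Sum>a<N. \<Sum>b<N. (cnj (root1 N a) ^ k * cnj (root1 N b) ^ l / (of_nat N *
      of_nat N)) *\<^sub>C
    S (r * root1 N a, r * root1 N b))" for k l
  have main: "cmod (cinner ((bipoly N c z - S (r * fst z, r * snd z)) *\<^sub>V u) v) \<le> \<epsilon> * norm u * norm v"
    if z: "cmod (fst z) \<le> 1" "cmod (snd z) \<le> 1" for z u v
  proof -
    define f where "f s t = cinner (S (r * s, r * t) *\<^sub>V u) v" for s t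
    define C where "C = norm u * norm v"
    have f_le: "cmod (cinner (S w *\<^sub>V u) v) \<le> C" if "w \<in> bidisc" for w
      using order_trans[OF Cauchy_Schwarz_cinner mult_right_mono[OF norm_cblinfun_le[OF
          H_infty_norm_le[OF S that]] norm_ge_zero]]
      by (simp add: C_def)
    define g where "g s = root_interp N (f s) (snd z)" for s
    have "cinner (bipoly N c z *\<^sub>V u) v
        = (\<Sum>k<N. \<Sum>l<N. fst z ^ k * snd z ^ l * (\<Sum>a<N. \<Sum>b<N.
            cnj (root1 N a) ^ k * cnj (root1 N b) ^ l / (of_nat N * of_nat N) * f (root1 N a) (root1
                N b)))"
      by (simp add: bipoly_def c_def f_def cblinfun_sum_left cblinfun_scaleC_left cinner_sum_left
          cinner_scaleC_left)
    also have "\<dots> = (\<Sum>k<N. \<Sum>l<N. \<Sum>a<N. \<Sum>b<N. f (root1 N a) (root1 N b) *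
        (fst z * cnj (root1 N a)) ^ k * (snd z * cnj (root1 N b)) ^ l / (of_nat N * of_nat N))"
      by (simp add: sum_distrib_left power_mult_distrib ac_simps)
    also have "\<dots> = (\<Sum>a<N. \<Sum>b<N. \<Sum>k<N. \<Sum>l<N. f (root1 N a) (root1 N b) *
        (fst z * cnj (root1 N a)) ^ k * (snd z * cnj (root1 N b)) ^ l / (of_nat N * of_nat N))"
    proof -
      have sw: "(\<Sum>k<N. \<Sum>l<N. \<Sum>a<N. \<Sum>b<N. F k l a b) = (\<Sum>a<N. \<Sum>b<N. \<Sum>k<N. \<Sum>l<N. F k l a b)"
        for F :: "nat \<Rightarrow> nat \<Rightarrow> nat \<Rightarrow> nat \<Rightarrow> complex"
      proof -
        have "(\<Sum>k<N. \<Sum>l<N. \<Sum>a<N. \<Sum>b<N. F k l a b) = (\<Sum>k<N. \<Sum>a<N. \<Sum>l<N. \<Sum>b<N. F k l a b)"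
          by (intro sum.cong refl sum.swap)
        also have "\<dots> = (\<Sum>a<N. \<Sum>k<N. \<Sum>l<N. \<Sum>b<N. F k l a b)" by (rule sum.swap)
        also have "\<dots> = (\<Sum>a<N. \<Sum>k<N. \<Sum>b<N. \<Sum>l<N. F k l a b)"
          by (intro sum.cong refl sum.swap)
        also have "\<dots> = (\<Sum>a<N. \<Sum>b<N. \<Sum>k<N. \<Sum>l<N. F k l a b)"
          by (intro sum.cong refl sum.swap)
        finally show ?thesis .
      qed
      show ?thesis by (rule sw)
    qed
    also have "\<dots> = root_interp N g (fst z)"
      unfolding root_interp_def g_def
      by (simp add: sum_distrib_left sum_distrib_right sum_divide_distrib ac_simps)
        (intro sum.cong refl sum.swap)
    finally have bp: "cinner (bipoly N c z *\<^sub>V u) v = root_interp N g (fst z)" .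
    define E where "E = (real N + 1) * (C * q ^ N / (1 - q))"
    have E0: "0 \<le> E" using q by (simp add: E_def C_def)
    have err2: "cmod (g s - f s (snd z)) \<le> E" if s: "cmod s \<le> 1" for s
      unfolding g_def f_def E_def r_def
    proof (rule root_interp_error[OF H_infty_slices_holomorphic(2)[OF S(1)] _ q z(2) N])
      show "cmod (of_real (q\<^sup>2) * s) < 1" using r[OF s] by (simp add: r_def)
      then show "cmod (cinner (S (of_real (q\<^sup>2) * s, t) *\<^sub>V u) v) \<le> C" if "cmod t < 1" for t
        using that by (intro f_le) (simp add: bidisc_def)
    qed
    have err1: "cmod (root_interp N (\<lambda>s. f s (snd z)) (fst z) - f (fst z) (snd z)) \<le> E"
      unfolding f_def E_def r_def
    proof (rule root_interp_error[OF H_infty_slices_holomorphic(1)[OF S(1)] _ q z(1) N])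
      show "cmod (of_real (q\<^sup>2) * snd z) < 1" using r[OF z(2)] by (simp add: r_def)
      then show "cmod (cinner (S (t, of_real (q\<^sup>2) * snd z) *\<^sub>V u) v) \<le> C" if "cmod t < 1" for t
        using that by (intro f_le) (simp add: bidisc_def)
    qed
    \<comment> \<open>The error made in the second variable is amplified by at most \<open>N\<close>
      when the first variable is interpolated; this is the origin of the square of
      \<open>N + 1\<close>.\<close>
    have "root_interp N g (fst z) - f (fst z) (snd z)
        = root_interp N (\<lambda>s. g s - f s (snd z)) (fst z) + (root_interp N (\<lambda>s. f s (snd z)) (fst z) -
            f (fst z) (snd z))"
      by (simp add: root_interp_linear)
    also have "cmod \<dots> \<le> real N * E + E"
      by (intro norm_triangle_le add_mono root_interp_le err1 z N) (use err2 in auto)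
    also have "\<dots> = (real N + 1) * E" by (simp add: distrib_right)
    also have "\<dots> = ((real N + 1)\<^sup>2 * (q ^ N / (1 - q))) * C"
      by (simp add: E_def power2_eq_square)
    also have "\<dots> \<le> \<epsilon> * C" by (intro mult_right_mono small) (simp add: C_def)
    finally show ?thesis
      by (simp add: cblinfun_diff_left cinner_diff_left bp f_def C_def mult.assoc)
  qed
  show thesis
  proof (rule that[of N c])
    fix z assume z: "cmod (fst z) \<le> 1" "cmod (snd z) \<le> 1"
    have "norm (bipoly N c z - S (r * fst z, r * snd z)) \<le> \<epsilon>"
      by (rule norm_cblinfun_le_of_form[OF main[OF z]]) (use \<epsilon> in simp)
    then show "norm (bipoly N c z - S (of_real (q\<^sup>2) * fst z, of_real (q\<^sup>2) * snd z)) \<le> \<epsilon>"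
      by (simp add: r_def)
  qed
qed

section \<open>Shifts on square-summable families\<close>

text \<open>One construction for shifts and coordinate projections alike: reindexing along a map
  injective on \<open>A\<close>, with zeros elsewhere.\<close>

definition ell2_pull :: "'j set \<Rightarrow> ('j \<Rightarrow> 'i) \<Rightarrow> ('i, 'l::complex_inner) ell2 \<Rightarrow> ('j, 'l) ell2"
  where "ell2_pull A \<pi> f = Ell2 (\<lambda>j. if j \<in> A then ell2_nth f (\<pi> j) else 0)"

lemma
  fixes f :: "('i, 'l::complex_inner) ell2" and A :: "'j set"
  assumes "inj_on \<pi> A"
  shows ell2_pull_nth: "ell2_nth (ell2_pull A \<pi> f) j = (if j \<in> A then ell2_nth f (\<pi> j) else 0)"
    and ell2_pull_norm: "norm (ell2_pull A \<pi> f) \<le> norm f"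
proof -
  obtain g where g: "ell2_nth g = (\<lambda>j. if j \<in> A then ell2_nth f (\<pi> j) else 0)" "norm g \<le> norm f"
  proof (rule ell2_of_finite_sums[of "\<lambda>j. if j \<in> A then ell2_nth f (\<pi> j) else 0" "norm f"])
    fix F :: "'j set" assume F: "finite F"
    have "(\<Sum>j\<in>F. (norm (if j \<in> A then ell2_nth f (\<pi> j) else 0))\<^sup>2) = (\<Sum>j\<in>F \<inter> A. (norm (ell2_nth f (\<pi>
        j)))\<^sup>2)"
      using F by (simp add: sum.inter_restrict if_distrib[of "\<lambda>x. (norm x)\<^sup>2"] cong: if_cong)
    also have "\<dots> = (\<Sum>i\<in>\<pi> ` (F \<inter> A). (norm (ell2_nth f i))\<^sup>2)"
      using inj_on_subset[OF assms, of "F \<inter> A"] by (simp add: sum.reindex)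
    also have "\<dots> \<le> (norm f)\<^sup>2" using F by (intro ell2_finite_sum_le) simp
    finally show "(\<Sum>j\<in>F. (norm (if j \<in> A then ell2_nth f (\<pi> j) else 0))\<^sup>2) \<le> (norm f)\<^sup>2" .
  qed auto
  then have "ell2_pull A \<pi> f = g"
    unfolding ell2_pull_def by (metis ell2_nth_inverse)
  with g show "ell2_nth (ell2_pull A \<pi> f) j = (if j \<in> A then ell2_nth f (\<pi> j) else 0)"
    "norm (ell2_pull A \<pi> f) \<le> norm f" by simp_all
qed

lemma cinner_ell2_pull:
  fixes f g :: "('i, 'l::complex_inner) ell2"
  assumes "inj_on \<pi> A" "\<pi> ` A = UNIV"
  shows "cinner (ell2_pull A \<pi> f) (ell2_pull A \<pi> g) = cinner f g"
proof -
  have "cinner (ell2_pull A \<pi> f) (ell2_pull A \<pi> g)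
      = (\<Sum>\<^sub>\<infinity>j\<in>A. cinner (ell2_nth f (\<pi> j)) (ell2_nth g (\<pi> j)))"
    unfolding cinner_ell2_def by (rule infsum_cong_neutral) (auto simp: ell2_pull_nth[OF assms(1)])
  also have "\<dots> = (\<Sum>\<^sub>\<infinity>i\<in>\<pi> ` A. cinner (ell2_nth f i) (ell2_nth g i))"
    by (subst infsum_reindex[OF assms(1)]) (simp add: o_def)
  finally show ?thesis by (simp add: assms(2) cinner_ell2_def)
qed

lemma ell2_pull_linear:
  assumes "inj_on \<pi> A"
  shows "ell2_pull A \<pi> (f + g) = ell2_pull A \<pi> f + ell2_pull A \<pi> g"
    "ell2_pull A \<pi> (f - g) = ell2_pull A \<pi> f - ell2_pull A \<pi> g"
    "ell2_pull A \<pi> (c *\<^sub>C f) = c *\<^sub>C ell2_pull A \<pi> f"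
  by (auto intro!: ell2_eqI simp: ell2_pull_nth[OF assms] plus_ell2.rep_eq minus_ell2.rep_eq
      scaleC_ell2.rep_eq)

lemma cinner_ell2_orthogonal:
  assumes "\<And>i. ell2_nth f i = 0 \<or> ell2_nth g i = 0"
  shows "cinner f g = 0"
  unfolding cinner_ell2_def by (rule infsum_0) (use assms in \<open>metis cinner_zero_left cinner_zero_right\<close>)

lemma norm_square_add_orthogonal:
  assumes "cinner f g = 0"
  shows "(norm (f + g))\<^sup>2 = (norm f)\<^sup>2 + (norm g)\<^sup>2"
proof -
  have "cinner g f = 0" using assms by (metis cinner_commute complex_cnj_zero)
  then have "complex_of_real ((norm (f + g))\<^sup>2) = complex_of_real ((norm f)\<^sup>2 + (norm g)\<^sup>2)"
    using assms by (simp only: cinner_self[symmetric] of_real_add cinner_add_left cinner_add_right)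
      simp
  then show ?thesis by (simp only: of_real_eq_iff)
qed

text \<open>Families indexed by \<open>int \<times> nat\<close> are Fourier coefficients of functions on the torus that are
  analytic in the second variable; \<open>down1\<close> and \<open>down2\<close> multiply by the conjugate variables.\<close>

type_synonym 'l half_plane = "(int \<times> nat, 'l) ell2"

definition neg_part :: "'l half_plane \<Rightarrow> 'l::complex_inner half_plane"
  where "neg_part = ell2_pull {m. fst m < 0} (\<lambda>m. m)"

definition pos_part :: "'l half_plane \<Rightarrow> 'l::complex_inner half_plane"
  where "pos_part = ell2_pull {m. 0 \<le> fst m} (\<lambda>m. m)"

definition down1 :: "'l half_plane \<Rightarrow> 'l::complex_inner half_plane"
  where "down1 = ell2_pull UNIV (\<lambda>m. (fst m + 1, snd m))"

definition down2 :: "'l half_plane \<Rightarrow> 'l::complex_inner half_plane"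
  where "down2 = ell2_pull UNIV (\<lambda>m. (fst m, Suc (snd m)))"

definition up2 :: "'l half_plane \<Rightarrow> 'l::complex_inner half_plane"
  where "up2 = ell2_pull {m. 0 < snd m} (\<lambda>m. (fst m, snd m - 1))"

lemma shift_inj:
  "inj_on (\<lambda>m. m) A" "inj_on (\<lambda>m :: int \<times> nat. (fst m + 1, snd m)) UNIV"
  "inj_on (\<lambda>m :: int \<times> nat. (fst m, Suc (snd m))) UNIV"
  "inj_on (\<lambda>m :: int \<times> nat. (fst m, snd m - 1)) {m. 0 < snd m}"
  by (auto simp: inj_on_def)

lemma shift_nth:
  "ell2_nth (neg_part f) m = (if fst m < 0 then ell2_nth f m else 0)"
  "ell2_nth (pos_part f) m = (if 0 \<le> fst m then ell2_nth f m else 0)"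
  "ell2_nth (down1 f) m = ell2_nth f (fst m + 1, snd m)"
  "ell2_nth (down2 f) m = ell2_nth f (fst m, Suc (snd m))"
  "ell2_nth (up2 f) m = (if 0 < snd m then ell2_nth f (fst m, snd m - 1) else 0)"
  unfolding neg_part_def pos_part_def down1_def down2_def up2_def
  by (simp_all only: ell2_pull_nth[OF shift_inj(1)] ell2_pull_nth[OF shift_inj(2)]
      ell2_pull_nth[OF shift_inj(3)] ell2_pull_nth[OF shift_inj(4)] mem_Collect_eq UNIV_I if_True)

lemma shift_norm_le:
  "norm (neg_part f) \<le> norm f" "norm (pos_part f) \<le> norm f" "norm (down2 f) \<le> norm f"
  by (simp_all add: neg_part_def pos_part_def down2_def ell2_pull_norm shift_inj)

lemma cinner_down1: "cinner (down1 f) (down1 g) = cinner f g"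
proof -
  have "m \<in> range (\<lambda>m :: int \<times> nat. (fst m + 1, snd m))" for m
    by (rule range_eqI[of _ _ "(fst m - 1, snd m)"]) simp
  then show ?thesis unfolding down1_def by (intro cinner_ell2_pull shift_inj) blast
qed

lemma cinner_up2: "cinner (up2 f) (up2 g) = cinner f g"
proof -
  have "m \<in> (\<lambda>m :: int \<times> nat. (fst m, snd m - 1)) ` {m. 0 < snd m}" for m
    by (rule image_eqI[of _ _ "(fst m, Suc (snd m))"]) auto
  then show ?thesis unfolding up2_def by (intro cinner_ell2_pull shift_inj) blast
qed

lemma norm_eq_of_cinner: "cinner f f = cinner g g \<Longrightarrow> norm f = norm g"
  by (simp add: norm_eq_sqrt_inner inner_eq_Re_cinner)

text \<open>In the first variable the downward shift is itself norm preserving, whereas in the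
  second only \<open>up2\<close> is: \<open>down2\<close> discards the coefficients of index 0. This
  asymmetry is what tells the two Agler kernels apart.\<close>

lemma norm_shift: "norm (down1 f) = norm f" "norm (up2 f) = norm f"
  by (rule norm_eq_of_cinner, rule cinner_down1 cinner_up2)+

lemma shift_linear:
  "neg_part (f + g) = neg_part f + neg_part g" "neg_part (f - g) = neg_part f - neg_part g"
  "neg_part (a *\<^sub>C f) = a *\<^sub>C neg_part f"
  "pos_part (f + g) = pos_part f + pos_part g" "pos_part (a *\<^sub>C f) = a *\<^sub>C pos_part f"
  "down1 (f + g) = down1 f + down1 g" "down1 (a *\<^sub>C f) = a *\<^sub>C down1 f"
  "down2 (f + g) = down2 f + down2 g" "down2 (a *\<^sub>C f) = a *\<^sub>C down2 f"
  by (simp_all add: neg_part_def pos_part_def down1_def down2_def ell2_pull_linear shift_inj)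

lemma pos_neg_split: "pos_part f + neg_part f = f"
  by (rule ell2_eqI) (simp add: plus_ell2.rep_eq shift_nth)

lemma cinner_pos_neg: "cinner (pos_part f) (neg_part g) = 0" "cinner (neg_part g) (pos_part f) = 0"
  by (rule cinner_ell2_orthogonal, simp add: shift_nth)+

lemma norm_square_split: "(norm f)\<^sup>2 = (norm (pos_part f))\<^sup>2 + (norm (neg_part f))\<^sup>2"
  using norm_square_add_orthogonal[OF cinner_pos_neg(1)[of f f]] by (simp add: pos_neg_split)

lemma neg_part_neg_part [simp]: "neg_part (neg_part f) = neg_part f"
  by (rule ell2_eqI) (simp add: shift_nth)

lemma neg_part_cinner: "cinner (neg_part f) g = cinner f (neg_part g)"
  using cinner_pos_neg(2)[of f g] cinner_pos_neg(1)[of f g]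
  by (metis add.right_neutral add_0 cinner_add_left cinner_add_right pos_neg_split)

text \<open>Adjoint of multiplication by the polynomial with coefficients \<open>c\<close>.\<close>

definition conv_at :: "nat \<Rightarrow> (nat \<Rightarrow> nat \<Rightarrow> 'y::chilbert_space \<Rightarrow>\<^sub>C\<^sub>L 'x::chilbert_space) \<Rightarrow>
    (int \<times> nat \<Rightarrow> 'x) \<Rightarrow> int \<times> nat \<Rightarrow> 'y"
  where "conv_at N c g m = (\<Sum>k<N. \<Sum>l<N. adj (c k l) *\<^sub>V g (fst m + int k, snd m + l))"

section \<open>Contractivity of the adjoint multiplication operator\<close>

lemma norm_bipoly_adj_le:
  fixes c :: "nat \<Rightarrow> nat \<Rightarrow> 'y::chilbert_space \<Rightarrow>\<^sub>C\<^sub>L 'x::chilbert_space"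
  assumes "norm (bipoly N c z) \<le> \<rho>"
  shows "norm (\<Sum>k<N. \<Sum>l<N. cnj (fst z ^ k * snd z ^ l) *\<^sub>C (adj (c k l) *\<^sub>V y)) \<le> \<rho> * norm y"
proof -
  define w where "w = (\<Sum>k<N. \<Sum>l<N. cnj (fst z ^ k * snd z ^ l) *\<^sub>C (adj (c k l) *\<^sub>V y))"
  have "cinner u w = cinner (bipoly N c z *\<^sub>V u) y" for u
    by (simp add: w_def bipoly_def cinner_sum_right cinner_sum_left cinner_scaleC_right
        cinner_scaleC_left
        cblinfun_sum_left cblinfun_scaleC_left cinner_adj)
  then have "complex_of_real ((norm w)\<^sup>2) = cinner (bipoly N c z *\<^sub>V w) y"
    by (simp only: cinner_self[symmetric])
  then have "(norm w)\<^sup>2 = cmod (cinner (bipoly N c z *\<^sub>V w) y)"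
    by (metis norm_of_real abs_of_nonneg zero_le_power2)
  also have "\<dots> \<le> (\<rho> * norm w) * norm y"
    by (rule order_trans[OF Cauchy_Schwarz_cinner]) (intro mult_right_mono norm_cblinfun_le assms
        norm_ge_zero)
  finally have "norm w * norm w \<le> (\<rho> * norm y) * norm w" by (simp add: power2_eq_square ac_simps)
  moreover have "0 \<le> \<rho>" using assms norm_ge_zero order_trans by blast
  ultimately have "norm w \<le> \<rho> * norm y" by (cases "w = 0") auto
  then show ?thesis by (simp add: w_def)
qed

lemma sum_shift_supported:
  fixes F :: "nat \<Rightarrow> 'a::comm_monoid_add"
  assumes F: "\<And>i. i < k \<or> M \<le> i \<Longrightarrow> F i = 0"
  shows "(\<Sum>i<M. F i) = (\<Sum>n<M. F (n + k))"
proof -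
  have "(\<Sum>n<M. F (n + k)) = (\<Sum>i\<in>{k..<M + k}. F i)"
    using sum.shift_bounds_nat_ivl[of F 0 k M] by (simp add: atLeast0LessThan)
  also have "\<dots> = (\<Sum>i<M. F i)"
    by (rule sum.mono_neutral_cong) (use F in auto)
  finally show ?thesis ..
qed

text \<open>The transform over pairs of \<open>M\<close>-th roots of unity turns the convolution
  into the adjoint of the polynomial at points of the torus, where its norm is at most
  \<open>\<rho>\<close>; Parseval applies on both sides. The zero margin of \<open>h\<close> keeps
  the cyclic transform from wrapping around.\<close>

lemma box_contraction:
  fixes c :: "nat \<Rightarrow> nat \<Rightarrow> 'y::chilbert_space \<Rightarrow>\<^sub>C\<^sub>L 'x::chilbert_space"
  assumes P: "\<And>z. cmod (fst z) \<le> 1 \<Longrightarrow> cmod (snd z) \<le> 1 \<Longrightarrow> norm (bipoly N c z) \<le> \<rho>"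
    and h: "\<And>i j. i < N \<or> M \<le> i \<or> j < N \<or> M \<le> j \<Longrightarrow> h i j = 0" and M: "0 < M"
  shows "(\<Sum>m<M. \<Sum>n<M. (norm (\<Sum>k<N. \<Sum>l<N. adj (c k l) *\<^sub>V h (m + k) (n + l)))\<^sup>2)
    \<le> \<rho>\<^sup>2 * (\<Sum>i<M. \<Sum>j<M. (norm (h i j))\<^sup>2)"
proof -
  define H where "H a b = (\<Sum>i<M. \<Sum>j<M. (root1 M a ^ i * root1 M b ^ j) *\<^sub>C h i j)" for a b
  define out where "out m n = (\<Sum>k<N. \<Sum>l<N. adj (c k l) *\<^sub>V h (m + k) (n + l))" for m n
  have cancel: "cnj (u ^ k) * u ^ (m + k) = u ^ m" if "cmod u = 1" for u :: complex and k m
  proof -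
    have "u * cnj u = 1" using that complex_norm_square[of u] by simp
    then have "(u * cnj u) ^ k = 1" by simp
    then show ?thesis by (simp add: power_add power_mult_distrib ac_simps)
  qed
  have key: "(\<Sum>k<N. \<Sum>l<N. cnj (root1 M a ^ k * root1 M b ^ l) *\<^sub>C (adj (c k l) *\<^sub>V H a b))
      = (\<Sum>m<M. \<Sum>n<M. (root1 M a ^ m * root1 M b ^ n) *\<^sub>C out m n)" for a b
  proof -
    have one: "cnj (root1 M a ^ k * root1 M b ^ l) *\<^sub>C (adj (c k l) *\<^sub>V H a b)
        = (\<Sum>m<M. \<Sum>n<M. (root1 M a ^ m * root1 M b ^ n) *\<^sub>C (adj (c k l) *\<^sub>V h (m + k) (n + l)))"
      if "k < N" "l < N" for k l
    proof -
      define G where "G i j = (cnj (root1 M a ^ k * root1 M b ^ l) * (root1 M a ^ i * root1 M b ^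
          j)) *\<^sub>C (adj (c k l) *\<^sub>V h i j)" for i j
      have "cnj (root1 M a ^ k * root1 M b ^ l) *\<^sub>C (adj (c k l) *\<^sub>V H a b) = (\<Sum>i<M. \<Sum>j<M. G i j)"
        by (simp add: H_def G_def cblinfun_sum cblinfun_scaleC scaleC_sum_right scaleC_scaleC)
      also have "\<dots> = (\<Sum>m<M. \<Sum>j<M. G (m + k) j)"
        by (rule sum_shift_supported) (use h that in \<open>auto simp: G_def intro!: sum.neutral\<close>)
      also have "\<dots> = (\<Sum>m<M. \<Sum>n<M. G (m + k) (n + l))"
        by (intro sum.cong refl sum_shift_supported) (use h that in \<open>auto simp: G_def\<close>)
      also have "\<dots> = (\<Sum>m<M. \<Sum>n<M. (root1 M a ^ m * root1 M b ^ n) *\<^sub>C (adj (c k l) *\<^sub>V h (m + k) (n + l)))"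
      proof (intro sum.cong refl)
        fix m n
        have "cnj (root1 M a ^ k * root1 M b ^ l) * (root1 M a ^ (m + k) * root1 M b ^ (n + l))
            = (cnj (root1 M a ^ k) * root1 M a ^ (m + k)) * (cnj (root1 M b ^ l) * root1 M b ^ (n + l))"
          by simp
        then show "G (m + k) (n + l) = (root1 M a ^ m * root1 M b ^ n) *\<^sub>C (adj (c k l) *\<^sub>V h (m + k)
            (n + l))"
          by (simp only: G_def cancel norm_root1)
      qed
      finally show ?thesis .
    qed
    have "(\<Sum>k<N. \<Sum>l<N. cnj (root1 M a ^ k * root1 M b ^ l) *\<^sub>C (adj (c k l) *\<^sub>V H a b))
        = (\<Sum>k<N. \<Sum>l<N. \<Sum>m<M. \<Sum>n<M. (root1 M a ^ m * root1 M b ^ n) *\<^sub>C (adj (c k l) *\<^sub>V h (m + k) (n +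
            l)))"
      by (intro sum.cong refl) (simp only: one lessThan_iff)
    also have "\<dots> = (\<Sum>k<N. \<Sum>m<M. \<Sum>l<N. \<Sum>n<M. (root1 M a ^ m * root1 M b ^ n) *\<^sub>C (adj (c k l) *\<^sub>V h (m
        + k) (n + l)))"
      by (intro sum.cong refl sum.swap)
    also have "\<dots> = (\<Sum>m<M. \<Sum>k<N. \<Sum>l<N. \<Sum>n<M. (root1 M a ^ m * root1 M b ^ n) *\<^sub>C (adj (c k l) *\<^sub>V h (m
        + k) (n + l)))"
      by (rule sum.swap)
    also have "\<dots> = (\<Sum>m<M. \<Sum>k<N. \<Sum>n<M. \<Sum>l<N. (root1 M a ^ m * root1 M b ^ n) *\<^sub>C (adj (c k l) *\<^sub>V h (m
        + k) (n + l)))"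
      by (intro sum.cong refl sum.swap)
    also have "\<dots> = (\<Sum>m<M. \<Sum>n<M. \<Sum>k<N. \<Sum>l<N. (root1 M a ^ m * root1 M b ^ n) *\<^sub>C (adj (c k l) *\<^sub>V h (m
        + k) (n + l)))"
      by (intro sum.cong refl sum.swap)
    finally show ?thesis by (simp add: out_def scaleC_sum_right)
  qed
  have "(real M)\<^sup>2 * (\<Sum>m<M. \<Sum>n<M. (norm (out m n))\<^sup>2)
      = (\<Sum>a<M. \<Sum>b<M. (norm (\<Sum>k<N. \<Sum>l<N. cnj (root1 M a ^ k * root1 M b ^ l) *\<^sub>C (adj (c k l) *\<^sub>V H a
          b)))\<^sup>2)"
    by (simp only: key Parseval_roots2)
  also have "\<dots> \<le> (\<Sum>a<M. \<Sum>b<M. (\<rho> * norm (H a b))\<^sup>2)"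
  proof (intro sum_mono power_mono norm_ge_zero)
    fix a b
    have "norm (bipoly N c (root1 M a, root1 M b)) \<le> \<rho>" by (rule P) simp_all
    from norm_bipoly_adj_le[OF this, of "H a b"]
    show "norm (\<Sum>k<N. \<Sum>l<N. cnj (root1 M a ^ k * root1 M b ^ l) *\<^sub>C (adj (c k l) *\<^sub>V H a b)) \<le> \<rho> *
        norm (H a b)"
      by simp
  qed
  also have "\<dots> = (real M)\<^sup>2 * (\<rho>\<^sup>2 * (\<Sum>i<M. \<Sum>j<M. (norm (h i j))\<^sup>2))"
    using Parseval_roots2[of M h] by (simp add: power_mult_distrib H_def flip: sum_distrib_left)
  finally have "(\<Sum>m<M. \<Sum>n<M. (norm (out m n))\<^sup>2) \<le> \<rho>\<^sup>2 * (\<Sum>i<M. \<Sum>j<M. (norm (h i j))\<^sup>2)"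
    using M by simp
  then show ?thesis by (simp add: out_def)
qed

text \<open>Finitely many outputs depend on finitely many coefficients of \<open>g\<close> only, and
  these can be moved into a box of natural indices with a zero margin.\<close>

lemma conv_at_contraction:
  fixes c :: "nat \<Rightarrow> nat \<Rightarrow> 'y::chilbert_space \<Rightarrow>\<^sub>C\<^sub>L 'x::chilbert_space" and g :: "'x half_plane"
  assumes P: "\<And>z. cmod (fst z) \<le> 1 \<Longrightarrow> cmod (snd z) \<le> 1 \<Longrightarrow> norm (bipoly N c z) \<le> \<rho>"
    and F: "finite F"
  shows "(\<Sum>m\<in>F. (norm (conv_at N c (ell2_nth g) m))\<^sup>2) \<le> (\<rho> * norm g)\<^sup>2"
proof -
  define L where "L = (\<Sum>m\<in>F. nat \<bar>fst m\<bar> + snd m) + 1"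
  have L: "- int L < fst m" "fst m < int L" "snd m < L" if "m \<in> F" for m
  proof -
    have "nat \<bar>fst m\<bar> + snd m \<le> (\<Sum>m\<in>F. nat \<bar>fst m\<bar> + snd m)"
      using that F by (intro member_le_sum) auto
    then have "nat \<bar>fst m\<bar> + snd m < L" by (simp add: L_def)
    then show "- int L < fst m" "fst m < int L" "snd m < L" by linarith+
  qed
  \<comment> \<open>\<open>L\<close> bounds the indices in \<open>F\<close>. After translation the
    outputs need up to \<open>2 L\<close> places, preceded by a margin of \<open>N\<close> and
    followed by up to \<open>N\<close> further inputs.\<close>
  define M where "M = 2 * L + 2 * N + 1"
  define h where "h i j = (if N \<le> i \<and> i < M \<and> N \<le> j \<and> j < M
    then ell2_nth g (int i - int L - int N, j - N) else 0)" for i j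
  define out where "out m n = (\<Sum>k<N. \<Sum>l<N. adj (c k l) *\<^sub>V h (m + k) (n + l))" for m n
  define e where "e m = (nat (fst m + int L + int N), snd m + N)" for m :: "int \<times> nat"
  have e_inj: "inj_on e F"
  proof (rule inj_onI)
    fix x y assume xy: "x \<in> F" "y \<in> F" "e x = e y"
    have "nat (fst x + int L + int N) = nat (fst y + int L + int N)" "snd x = snd y"
      using xy(3) by (simp_all add: e_def)
    moreover from this(1) have "fst x = fst y" using L(1)[OF xy(1)] L(1)[OF xy(2)] by arith
    ultimately show "x = y" by (simp add: prod_eq_iff)
  qed
  have e_sub: "e ` F \<subseteq> {..<M} \<times> {..<M}"
  proof (rule image_subsetI)
    fix x assume x: "x \<in> F"
    have "nat (fst x + int L + int N) < M" "snd x + N < M"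
      using L[OF x] unfolding M_def by arith+
    then show "e x \<in> {..<M} \<times> {..<M}" by (simp add: e_def)
  qed
  have out: "out (fst (e m)) (snd (e m)) = conv_at N c (ell2_nth g) m" if m: "m \<in> F" for m
    unfolding out_def conv_at_def
  proof (intro sum.cong refl)
    fix k l assume "k \<in> {..<N}" "l \<in> {..<N}"
    then have kl: "k < N" "l < N" by auto
    have "N \<le> fst (e m) + k" "fst (e m) + k < M" "N \<le> snd (e m) + l" "snd (e m) + l < M"
      using L[OF m] kl by (auto simp: e_def M_def)
    moreover have "int (fst (e m) + k) - int L - int N = fst m + int k" "snd (e m) + l - N = snd m + l"
      using L[OF m] by (auto simp: e_def)
    ultimately show "adj (c k l) *\<^sub>V h (fst (e m) + k) (snd (e m) + l) = adj (c k l) *\<^sub>V ell2_nth g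
        (fst m + int k, snd m + l)"
      by (simp only: h_def simp_thms if_True)
  qed
  have "(\<Sum>m\<in>F. (norm (conv_at N c (ell2_nth g) m))\<^sup>2) = (\<Sum>m\<in>F. (norm (out (fst (e m)) (snd (e m))))\<^sup>2)"
    by (intro sum.cong refl) (simp add: out)
  also have "\<dots> = (\<Sum>p\<in>e ` F. (norm (out (fst p) (snd p)))\<^sup>2)"
    by (simp add: sum.reindex[OF e_inj])
  also have "\<dots> \<le> (\<Sum>p\<in>{..<M} \<times> {..<M}. (norm (out (fst p) (snd p)))\<^sup>2)"
    by (rule sum_mono2) (use e_sub in auto)
  also have "\<dots> = (\<Sum>m<M. \<Sum>n<M. (norm (out m n))\<^sup>2)"
    by (simp add: sum.cartesian_product case_prod_unfold)
  also have "\<dots> \<le> \<rho>\<^sup>2 * (\<Sum>i<M. \<Sum>j<M. (norm (h i j))\<^sup>2)"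
    unfolding out_def by (rule box_contraction[OF P]) (auto simp: h_def M_def)
  also have "(\<Sum>i<M. \<Sum>j<M. (norm (h i j))\<^sup>2) \<le> (norm g)\<^sup>2"
  proof -
    define B where "B = {N..<M} \<times> {N..<M}"
    define d where "d p = (int (fst p) - int L - int N, snd p - N)" for p :: "nat \<times> nat"
    have "(\<Sum>i<M. \<Sum>j<M. (norm (h i j))\<^sup>2) = (\<Sum>p\<in>{..<M} \<times> {..<M}. (norm (h (fst p) (snd p)))\<^sup>2)"
      by (simp add: sum.cartesian_product case_prod_unfold)
    also have "\<dots> = (\<Sum>p\<in>B. (norm (ell2_nth g (d p)))\<^sup>2)"
      by (rule sum.mono_neutral_cong_right) (auto simp: B_def h_def d_def)
    also have "\<dots> = (\<Sum>m\<in>d ` B. (norm (ell2_nth g m))\<^sup>2)"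
      by (subst sum.reindex) (auto simp: inj_on_def d_def B_def)
    also have "\<dots> \<le> (norm g)\<^sup>2" by (rule ell2_finite_sum_le) (simp add: B_def)
    finally show ?thesis .
  qed
  finally show ?thesis by (simp add: power_mult_distrib mult_left_mono)
qed

section \<open>Agler decompositions\<close>

definition sesq :: "('a::complex_vector \<Rightarrow> 'a \<Rightarrow> complex) \<Rightarrow> bool"
  where "sesq B \<longleftrightarrow> (\<forall>x y z. B (x + y) z = B x z + B y z) \<and> (\<forall>x y z. B x (y + z) = B x y + B x z) \<and>
    (\<forall>a x y. B (a *\<^sub>C x) y = a * B x y) \<and> (\<forall>a x y. B x (a *\<^sub>C y) = cnj a * B x y)"

lemma sesqD:
  assumes "sesq B"
  shows "B (x + y) z = B x z + B y z" "B x (y + z) = B x y + B x z"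
    "B (a *\<^sub>C x) y = a * B x y" "B x (a *\<^sub>C y) = cnj a * B x y" "B 0 y = 0" "B x 0 = 0"
proof -
  show add: "B (x + y) z = B x z + B y z" "B x (y + z) = B x y + B x z"
    "B (a *\<^sub>C x) y = a * B x y" "B x (a *\<^sub>C y) = cnj a * B x y" for x y z a
    using assms unfolding sesq_def by blast+
  show "B 0 y = 0" "B x 0 = 0" using add(3)[of 0 0] add(4)[of x 0 0] by simp_all
qed

lemma sesq_sum:
  assumes "sesq B"
  shows "B (\<Sum>i\<in>I. c i *\<^sub>C f i) (\<Sum>j\<in>J. d j *\<^sub>C g j) = (\<Sum>i\<in>I. \<Sum>j\<in>J. B (f i) (g j) * (c i * cnj (d j)))"
proof -
  have 1: "B x (\<Sum>j\<in>J. d j *\<^sub>C g j) = (\<Sum>j\<in>J. B x (g j) * cnj (d j))" for x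
    by (induction J rule: infinite_finite_induct) (simp_all add: sesqD[OF assms] mult.commute)
  have 2: "B (\<Sum>i\<in>I. c i *\<^sub>C f i) y = (\<Sum>i\<in>I. c i * B (f i) y)" for y
    by (induction I rule: infinite_finite_induct) (simp_all add: sesqD[OF assms])
  show ?thesis unfolding 2 unfolding 1 by (simp add: sum_distrib_left ac_simps)
qed

lemma linear_scaleC_sum:
  assumes "\<And>x y. f (x + y) = f x + f y" "\<And>a x. f (a *\<^sub>C x) = a *\<^sub>C f x"
  shows "f (\<Sum>i\<in>I. c i *\<^sub>C (g i :: 'a::complex_vector)) = (\<Sum>i\<in>I. c i *\<^sub>C (f (g i) :: 'b::complex_vector))"
proof -
  have "f 0 = 0" using assms(2)[of 0 0] by simp
  then show ?thesis
    by (induction I rule: infinite_finite_induct) (simp_all add: assms)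
qed

text \<open>The weighted double sum is the form at a combination of the \<open>k i\<close> minus the
  form at its image under \<open>k i \<mapsto> s i k i\<close>. For Szego vectors that map is a
  backward shift, which turns an inequality between forms into positivity of a kernel.\<close>

lemma psd_of_form_contraction:
  assumes B: "sesq B" and herm: "\<And>x y. B y x = cnj (B x y)"
    and le: "\<And>c. Re (B (\<Sum>i\<in>I. c i *\<^sub>C (s i *\<^sub>C k i)) (\<Sum>i\<in>I. c i *\<^sub>C (s i *\<^sub>C k i)))
      \<le> Re (B (\<Sum>i\<in>I. c i *\<^sub>C k i) (\<Sum>i\<in>I. c i *\<^sub>C k i))"
  shows "psd I (\<lambda>i j. (1 - s i * cnj (s j)) * B (k i) (k j))"
proof (rule psdI)
  fix i j
  show "(1 - s j * cnj (s i)) * B (k j) (k i) = cnj ((1 - s i * cnj (s j)) * B (k i) (k j))"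
    by (subst herm) (simp add: mult.commute)
next
  fix c
  have "(\<Sum>i\<in>I. \<Sum>j\<in>I. (1 - s i * cnj (s j)) * B (k i) (k j) * (c i * cnj (c j)))
      = B (\<Sum>i\<in>I. c i *\<^sub>C k i) (\<Sum>i\<in>I. c i *\<^sub>C k i)
        - B (\<Sum>i\<in>I. c i *\<^sub>C (s i *\<^sub>C k i)) (\<Sum>i\<in>I. c i *\<^sub>C (s i *\<^sub>C k i))"
    unfolding sesq_sum[OF B] sesqD[OF B] sum_subtractf[symmetric]
    by (intro sum.cong refl) (simp add: algebra_simps)
  then show "0 \<le> Re (\<Sum>i\<in>I. \<Sum>j\<in>I. (1 - s i * cnj (s j)) * B (k i) (k j) * (c i * cnj (c j)))"
    using le[of c] by simp
qed

text \<open>\<open>\<kappa> w z x y\<close> plays the role of \<open>cinner (K z w x) y\<close> for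
  an operator kernel \<open>K\<close>, with positivity tested on finite sets of pairs of a point and
  a vector. Bounds come from the Agler identity, in \<open>agler_pair_bound\<close>.\<close>

definition pos_kernel :: "(complex \<times> complex \<Rightarrow> complex \<times> complex \<Rightarrow> 'a::complex_vector \<Rightarrow> 'a \<Rightarrow>
    complex) \<Rightarrow> bool"
  where "pos_kernel \<kappa> \<longleftrightarrow> (\<forall>w z. sesq (\<kappa> w z)) \<and>
    (\<forall>I. finite I \<longrightarrow> fst ` I \<subseteq> bidisc \<longrightarrow> psd I (\<lambda>i j. \<kappa> (fst i) (fst j) (snd i) (snd j)))"

definition agler_pair :: "(complex \<times> complex \<Rightarrow> 'y::chilbert_space \<Rightarrow>\<^sub>C\<^sub>L 'x::chilbert_space) \<Rightarrow>
    (complex \<times> complex \<Rightarrow> complex \<times> complex \<Rightarrow> 'x \<Rightarrow> 'x \<Rightarrow> complex) \<Rightarrow>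
    (complex \<times> complex \<Rightarrow> complex \<times> complex \<Rightarrow> 'x \<Rightarrow> 'x \<Rightarrow> complex) \<Rightarrow> bool"
  where "agler_pair S \<kappa>1 \<kappa>2 \<longleftrightarrow> pos_kernel \<kappa>1 \<and> pos_kernel \<kappa>2 \<and>
    (\<forall>w\<in>bidisc. \<forall>z\<in>bidisc. \<forall>x y. cinner x y - cinner (adj (S w) *\<^sub>V x) (adj (S z) *\<^sub>V y) =
      (1 - cnj (fst w) * fst z) * \<kappa>1 w z x y + (1 - cnj (snd w) * snd z) * \<kappa>2 w z x y)"

lemma norm_adj_le: "norm (adj f *\<^sub>V y) \<le> norm f * norm y"
proof -
  have "norm (adj f *\<^sub>V y) * norm (adj f *\<^sub>V y) = cmod (cinner (f *\<^sub>V (adj f *\<^sub>V y)) y)"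
    by (simp add: cinner_adj cinner_self norm_mult power2_eq_square)
  also have "\<dots> \<le> (norm f * norm (adj f *\<^sub>V y)) * norm y"
    by (rule order_trans[OF Cauchy_Schwarz_cinner]) (intro mult_right_mono norm_cblinfun norm_ge_zero)
  finally have "norm (adj f *\<^sub>V y) * norm (adj f *\<^sub>V y) \<le> (norm f * norm y) * norm (adj f *\<^sub>V y)"
    by (simp add: ac_simps)
  then show ?thesis by (cases "adj f *\<^sub>V y = 0") (auto simp: mult_le_cancel_right)
qed

section \<open>Szego vectors of the bidisc\<close>

lemma Szego_vectors:
  fixes w :: "complex \<times> complex"
  assumes w: "w \<in> bidisc"
  shows "\<exists>f :: 'x::complex_inner half_plane. \<forall>m. ell2_nth f m =
    (if 0 \<le> fst m then (cnj (fst w) ^ nat (fst m) * cnj (snd w) ^ snd m) *\<^sub>C x else 0)"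
proof -
  define r where "r = (maxnorm w)\<^sup>2"
  have r: "0 \<le> r" "r < 1" using w maxnorm_nonneg[of w] by (auto simp: r_def bidisc_iff abs_square_less_1)
  have le: "(cmod (fst w))\<^sup>2 \<le> r" "(cmod (snd w))\<^sup>2 \<le> r" by (simp_all add: r_def maxnorm_def power_mono)
  have geo: "(\<Sum>m<L. r ^ m) \<le> 1 / (1 - r)" for L
  proof -
    have "(\<Sum>m<L. r ^ m) * (1 - r) = 1 - r ^ L" using one_diff_power_eq[of r L]
        by (simp add: mult.commute)
    also have "\<dots> \<le> 1" using r by simp
    finally show ?thesis using r by (simp add: pos_le_divide_eq)
  qed
  define K where "K = norm x / (1 - r)"
  define f where "f m = (if 0 \<le> fst m then (cnj (fst w) ^ nat (fst m) * cnj (snd w) ^ snd m) *\<^sub>C x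
      else 0)"
    for m :: "int \<times> nat"
  obtain g where "ell2_nth g = f" "norm g \<le> K"
  proof (rule ell2_of_finite_sums[of f K])
    fix F :: "(int \<times> nat) set" assume F: "finite F"
    define L where "L = (\<Sum>m\<in>F. nat \<bar>fst m\<bar> + snd m) + 1"
    have L: "nat (fst m) < L" "snd m < L" if "m \<in> F" for m
    proof -
      have "nat \<bar>fst m\<bar> + snd m \<le> (\<Sum>m\<in>F. nat \<bar>fst m\<bar> + snd m)"
        using that F by (intro member_le_sum) auto
      then have "nat \<bar>fst m\<bar> + snd m < L" by (simp add: L_def)
      then show "nat (fst m) < L" "snd m < L" by arith+
    qed
    let ?e = "\<lambda>m :: int \<times> nat. (nat (fst m), snd m)" and ?F = "F \<inter> {m. 0 \<le> fst m}"
    have term_le: "(norm (f m))\<^sup>2 \<le> (norm x)\<^sup>2 * (r ^ nat (fst m) * r ^ snd m)" if "0 \<le> fst m" for m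
    proof -
      have "(norm (f m))\<^sup>2 = (((cmod (fst w))\<^sup>2) ^ nat (fst m) * ((cmod (snd w))\<^sup>2) ^ snd m) * (norm x)\<^sup>2"
        using that by (simp add: f_def norm_scaleC norm_mult norm_power power_mult_distrib
            power2_eq_square)
      also have "\<dots> \<le> (r ^ nat (fst m) * r ^ snd m) * (norm x)\<^sup>2"
        by (intro mult_right_mono mult_mono power_mono le) (auto simp: r)
      finally show ?thesis by (simp add: mult.commute)
    qed
    have "(\<Sum>m\<in>F. (norm (f m))\<^sup>2) = (\<Sum>m\<in>?F. (norm (f m))\<^sup>2)"
      by (rule sum.mono_neutral_right) (auto simp: F f_def)
    also have "\<dots> \<le> (\<Sum>m\<in>?F. (norm x)\<^sup>2 * (r ^ nat (fst m) * r ^ snd m))"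
      by (intro sum_mono term_le) simp
    also have "\<dots> = (norm x)\<^sup>2 * (\<Sum>p\<in>?e ` ?F. r ^ fst p * r ^ snd p)"
      by (subst sum.reindex) (auto simp: inj_on_def sum_distrib_left prod_eq_iff)
    also have "(\<Sum>p\<in>?e ` ?F. r ^ fst p * r ^ snd p) \<le> (\<Sum>p\<in>{..<L} \<times> {..<L}. r ^ fst p * r ^ snd p)"
      by (rule sum_mono2) (use L r in auto)
    also have "\<dots> = (\<Sum>m<L. r ^ m) * (\<Sum>n<L. r ^ n)"
      by (simp add: sum_product sum.cartesian_product case_prod_unfold)
    also have "\<dots> \<le> (1 / (1 - r)) * (1 / (1 - r))"
      using geo[of L] r by (intro mult_mono) (auto intro: sum_nonneg)
    finally show "(\<Sum>m\<in>F. (norm (f m))\<^sup>2) \<le> K\<^sup>2"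
      by (simp add: K_def power_divide power2_eq_square mult_left_mono)
  qed (use r in \<open>auto simp: K_def\<close>)
  then show ?thesis unfolding f_def by metis
qed

text \<open>Reproducing vectors of the Hardy space of the bidisc, seen inside the half-plane. The
  value 0 off the bidisc keeps linearity in \<open>x\<close> valid at every point.\<close>

definition szego :: "complex \<times> complex \<Rightarrow> 'x::complex_inner \<Rightarrow> 'x half_plane"
  where "szego w x = (if w \<in> bidisc then Ell2 (\<lambda>m. if 0 \<le> fst m then (cnj (fst w) ^ nat (fst m) *
      cnj (snd w) ^ snd m) *\<^sub>C x else 0) else 0)"

lemma szego_nth: "ell2_nth (szego w x) m =
    (if w \<in> bidisc \<and> 0 \<le> fst m then (cnj (fst w) ^ nat (fst m) * cnj (snd w) ^ snd m) *\<^sub>C x else 0)"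
proof (cases "w \<in> bidisc")
  case True
  from Szego_vectors[OF True, of x] obtain f :: "'a half_plane" where
    f: "ell2_nth f = (\<lambda>m. if 0 \<le> fst m then (cnj (fst w) ^ nat (fst m) * cnj (snd w) ^ snd m) *\<^sub>C x
        else 0)" by blast
  then have "szego w x = f" using True unfolding szego_def by (metis ell2_nth_inverse)
  then show ?thesis using True by (simp add: f)
qed (simp add: szego_def zero_ell2.rep_eq)

lemma szego_linear: "szego w (x + x') = szego w x + szego w x'" "szego w (r *\<^sub>C x) = r *\<^sub>C szego w x"
  by (rule ell2_eqI, simp add: szego_nth plus_ell2.rep_eq scaleC_ell2.rep_eq scaleC_add_right
      scaleC_scaleC mult.commute)+

lemma szego_down1: "pos_part (down1 (szego w x)) = cnj (fst w) *\<^sub>C szego w x"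
  by (rule ell2_eqI) (auto simp: szego_nth shift_nth scaleC_ell2.rep_eq scaleC_scaleC
      nat_add_distrib mult.assoc)

text \<open>The two geometric series are summed by self-similarity. The unitary \<open>down1\<close>
  reproduces the vector up to the factor \<open>cnj (fst w)\<close> and an orthogonal boundary part
  \<open>l\<close> at first index -1; \<open>l\<close> in turn is its term of second index 0 plus
  \<open>cnj (snd w)\<close> times its own shift.\<close>

lemma szego_cinner:
  fixes x x' :: "'x::complex_inner"
  assumes wz: "w \<in> bidisc" "z \<in> bidisc"
  shows "(1 - cnj (fst w) * fst z) * ((1 - cnj (snd w) * snd z) * cinner (szego w x) (szego z x')) =
      cinner x x'"
proof -
  define l where "l w x = neg_part (down1 (szego w x))" for w and x :: 'x
  have l: "ell2_nth (l w x) m = (if w \<in> bidisc \<and> fst m = -1 then cnj (snd w) ^ snd m *\<^sub>C x else 0)"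
      for w m and x :: 'x
    by (auto simp: l_def shift_nth szego_nth)
  have "cinner (szego w x) (szego z x') = cinner (down1 (szego w x)) (down1 (szego z x'))"
      by (simp add: cinner_down1)
  also have "\<dots> = cinner (pos_part (down1 (szego w x)) + l w x) (pos_part (down1 (szego z x')) + l z x')"
    by (simp add: l_def pos_neg_split)
  also have "\<dots> = cnj (fst w) * fst z * cinner (szego w x) (szego z x') + cinner (l w x) (l z x')"
    unfolding cinner_add_left cinner_add_right by (simp add: l_def cinner_pos_neg)
      (simp add: szego_down1 cinner_scaleC_left cinner_scaleC_right)
  finally have 1: "(1 - cnj (fst w) * fst z) * cinner (szego w x) (szego z x') = cinner (l w x) (l z x')"
    by (simp add: algebra_simps)
  define e where "e x = ell2_single (-1 :: int, 0 :: nat) x" for x :: 'x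
  have l_split: "l w x = e x + cnj (snd w) *\<^sub>C up2 (l w x)" if "w \<in> bidisc" for w x
  proof (rule ell2_eqI)
    fix m :: "int \<times> nat"
    show "ell2_nth (l w x) m = ell2_nth (e x + cnj (snd w) *\<^sub>C up2 (l w x)) m"
      using that by (cases m, cases "snd m")
        (auto simp: l e_def shift_nth plus_ell2.rep_eq scaleC_ell2.rep_eq ell2_single.rep_eq
            scaleC_scaleC)
  qed
  have up_e: "cinner (up2 f) (e x) = 0" for f x
    by (simp add: e_def cinner_ell2_single shift_nth)
  then have e_up: "cinner (e x) (up2 f) = 0" for f x by (metis cinner_commute complex_cnj_zero)
  have "cinner (l w x) (l z x') = cinner (e x + cnj (snd w) *\<^sub>C up2 (l w x)) (e x' + cnj (snd z) *\<^sub>C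
      up2 (l z x'))"
    using l_split[OF wz(1), of x] l_split[OF wz(2), of x'] by simp
  also have "\<dots> = cinner x x' + cnj (snd w) * snd z * cinner (l w x) (l z x')"
    by (simp add: cinner_add_left cinner_add_right cinner_scaleC_left cinner_scaleC_right up_e e_up
        cinner_up2)
      (simp add: e_def cinner_ell2_single ell2_single.rep_eq)
  finally have 2: "(1 - cnj (snd w) * snd z) * cinner (l w x) (l z x') = cinner x x'"
    by (simp add: algebra_simps)
  show ?thesis by (subst mult.left_commute) (simp only: 1 2)
qed

text \<open>\<open>A\<close> is the adjoint of multiplication by the polynomial, \<open>R\<close>
  the form of \<open>1 - adj A A\<close>, \<open>Q1\<close> its Schur complement on the nonnegative
  frequencies and \<open>Q2\<close> what \<open>Q1\<close> leaves of the compressed form. At Szego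
  vectors \<open>Q1 + Q2\<close> is the wanted difference times the Szego kernel. Multiplying by
  both factors \<open>1 - cnj w * z\<close> removes that kernel, and the factor not spent on making
  \<open>Q1\<close> or \<open>Q2\<close> positive stands in front; hence \<open>\<kappa>1\<close>
  comes from \<open>Q2\<close> and \<open>\<kappa>2\<close> from \<open>Q1\<close>.\<close>

lemma bipoly_agler_pair:
  fixes c :: "nat \<Rightarrow> nat \<Rightarrow> 'y::chilbert_space \<Rightarrow>\<^sub>C\<^sub>L 'x::chilbert_space"
  assumes P: "\<And>z. cmod (fst z) \<le> 1 \<Longrightarrow> cmod (snd z) \<le> 1 \<Longrightarrow> norm (bipoly N c z) \<le> \<rho>" and \<rho>: "\<rho> < 1"
  shows "\<exists>\<kappa>1 \<kappa>2. agler_pair (bipoly N c) \<kappa>1 \<kappa>2"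
proof -
  have "norm (bipoly N c (0, 0)) \<le> \<rho>" by (rule P) simp_all
  then have \<rho>0: "0 \<le> \<rho>" by (rule order_trans[OF norm_ge_zero])
  have "\<exists>h :: 'y half_plane. ell2_nth h = conv_at N c (ell2_nth g) \<and> norm h \<le> \<rho> * norm g" for g
  proof (rule ell2_of_finite_sums[of "conv_at N c (ell2_nth g)" "\<rho> * norm g"])
    show "(\<Sum>m\<in>F. (norm (conv_at N c (ell2_nth g) m))\<^sup>2) \<le> (\<rho> * norm g)\<^sup>2" if "finite F" for F
      by (rule conv_at_contraction[OF P that])
  qed (use \<rho>0 in auto)
  then obtain a where a: "\<And>g. ell2_nth (a g :: 'y half_plane) = conv_at N c (ell2_nth g)" "\<And>g. norm
      (a g) \<le> \<rho> * norm g"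
    by metis
  obtain A :: "'x half_plane \<Rightarrow>\<^sub>C\<^sub>L 'y half_plane" where Aa: "\<And>g. A *\<^sub>V g = a g" and A_norm: "norm A \<le> \<rho>"
  proof (rule cblinfun_of_fun[of a \<rho>])
    show "a (f + g) = a f + a g" for f g
      by (rule ell2_eqI) (simp add: a plus_ell2.rep_eq conv_at_def cblinfun_add sum.distrib)
    show "a (r *\<^sub>C f) = r *\<^sub>C a f" for r f
      by (rule ell2_eqI) (simp add: a scaleC_ell2.rep_eq conv_at_def cblinfun_scaleC scaleC_sum_right)
  qed ((simp add: a \<rho>0; fail) | meson)+
  have A_nth: "ell2_nth (A *\<^sub>V g) m = conv_at N c (ell2_nth g) m" for g m by (simp add: Aa a)
  have A_le: "norm (A *\<^sub>V g) \<le> norm g" for g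
    using norm_cblinfun_le[OF A_norm, of g] \<rho> mult_right_mono[of \<rho> 1 "norm g"] by simp
  have A_down1: "A *\<^sub>V down1 g = down1 (A *\<^sub>V g)" for g
    by (rule ell2_eqI) (simp add: A_nth shift_nth conv_at_def algebra_simps)
  have A_down2: "A *\<^sub>V down2 g = down2 (A *\<^sub>V g)" for g
    by (rule ell2_eqI) (simp add: A_nth shift_nth conv_at_def)
  have A_neg: "pos_part (A *\<^sub>V u) = 0" if "neg_part u = u" for u
  proof (rule ell2_eqI)
    fix m
    have "ell2_nth u n = 0" if "0 \<le> fst n" for n
      using \<open>neg_part u = u\<close> that shift_nth(1)[of u n] by simp
    then show "ell2_nth (pos_part (A *\<^sub>V u)) m = ell2_nth 0 m"
      by (simp add: shift_nth A_nth conv_at_def zero_ell2.rep_eq)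
  qed
  have AA_le: "norm (neg_part (adj A *\<^sub>V (A *\<^sub>V f))) \<le> \<rho> * norm f" for f
  proof -
    have "norm (neg_part (adj A *\<^sub>V (A *\<^sub>V f))) \<le> norm A * norm (A *\<^sub>V f)"
      by (rule order_trans[OF shift_norm_le(1) norm_adj_le])
    also have "\<dots> \<le> \<rho> * norm f" by (intro mult_mono A_norm A_le \<rho>0 norm_ge_zero)
    finally show ?thesis .
  qed
  obtain W :: "'x half_plane \<Rightarrow>\<^sub>C\<^sub>L 'x half_plane"
    where W: "\<And>f. W *\<^sub>V f = neg_part (adj A *\<^sub>V (A *\<^sub>V f))" and W_norm: "norm W \<le> \<rho>"
    by (rule cblinfun_of_fun[of "\<lambda>f. neg_part (adj A *\<^sub>V (A *\<^sub>V f))" \<rho>])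
      (use AA_le \<rho>0 in \<open>auto simp: cblinfun_add cblinfun_scaleC shift_linear\<close>)
  obtain X where X: "\<And>b. X *\<^sub>V b = b + (W *\<^sub>V (X *\<^sub>V b))"
    by (rule Neumann_inverse[OF W_norm \<rho>]) (rule that, assumption)
  \<comment> \<open>Stationarity of \<open>R (x + u) (x + u)\<close> in the negative part
    \<open>u\<close> reads \<open>u = W (x + u)\<close>; \<open>y x\<close> is its solution and
    \<open>hat x\<close> the minimiser.\<close>
  define y where "y x = X *\<^sub>V (W *\<^sub>V x)" for x
  define hat where "hat x = x + y x" for x
  define R where "R f g = cinner f g - cinner (A *\<^sub>V f) (A *\<^sub>V g)" for f g
  have y_W: "y x = W *\<^sub>V hat x" for x
    using X[of "W *\<^sub>V x"] by (simp add: y_def hat_def cblinfun_add)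
  have y_neg: "neg_part (y x) = y x" for x
    unfolding y_W W by simp
  have hat_linear: "hat (f + g) = hat f + hat g" "hat (r *\<^sub>C f) = r *\<^sub>C hat f" for f g r
    by (simp_all add: hat_def y_def cblinfun_add cblinfun_scaleC scaleC_add_right algebra_simps)
  have R_sesq: "sesq R"
    by (simp add: sesq_def R_def cblinfun_add cblinfun_scaleC cinner_add_left cinner_add_right
        cinner_scaleC_left cinner_scaleC_right algebra_simps)
  have R_herm: "R g f = cnj (R f g)" for f g
    by (simp add: R_def flip: cinner_commute)
  have R_self: "Re (R f f) = (norm f)\<^sup>2 - (norm (A *\<^sub>V f))\<^sup>2" for f
    by (simp add: R_def cinner_self flip: of_real_power)
  have R_nonneg: "0 \<le> Re (R f f)" for f
    unfolding R_self using A_le[of f] by (simp add: power_mono)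
  \<comment> \<open>The minimiser is orthogonal for \<open>R\<close> to all negative frequencies,
    and Pythagoras then gives minimality.\<close>
  have orth: "R (hat x) u = 0" if "neg_part x = 0" "neg_part u = u" for x u
  proof -
    have "cinner x u = 0" using neg_part_cinner[of x u] that by simp
    moreover have "cinner (y x) u = cinner (A *\<^sub>V hat x) (A *\<^sub>V u)"
      using neg_part_cinner[of "adj A *\<^sub>V (A *\<^sub>V hat x)" u] that(2) by (simp add: y_W W cinner_adj')
    moreover have "cinner (hat x) u = cinner x u + cinner (y x) u" by (simp add: hat_def cinner_add_left)
    ultimately show ?thesis by (simp add: R_def)
  qed
  have min: "Re (R (hat x) (hat x)) \<le> Re (R (x + u) (x + u))" if x: "neg_part x = 0"
      and u: "neg_part u = u" for x u
  proof -
    define v where "v = u - y x"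
    have v: "neg_part v = v" by (simp add: v_def shift_linear u y_neg)
    have xu: "x + u = hat x + v" by (simp add: v_def hat_def)
    have "R v (hat x) = 0" using orth[OF x v] R_herm[of v "hat x"] by simp
    then have "R (x + u) (x + u) = R (hat x) (hat x) + R v v"
      unfolding xu sesqD(1,2)[OF R_sesq] using orth[OF x v] by simp
    then show ?thesis using R_nonneg[of v] by simp
  qed
  define Q1 where "Q1 f g = R (hat f) (hat g)" for f g
  define Q2 where "Q2 f g = cinner f g - cinner (pos_part (A *\<^sub>V f)) (pos_part (A *\<^sub>V g)) - Q1 f g" for f g
  have Q1_sesq: "sesq Q1"
    unfolding sesq_def Q1_def hat_linear using sesqD[OF R_sesq] by blast
  have Q2_sesq: "sesq Q2"
    unfolding sesq_def Q2_def using sesqD[OF Q1_sesq]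
    by (simp add: cblinfun_add cblinfun_scaleC shift_linear cinner_add_left cinner_add_right
        cinner_scaleC_left cinner_scaleC_right algebra_simps)
  have Q1_herm: "Q1 g f = cnj (Q1 f g)" for f g unfolding Q1_def by (rule R_herm)
  have Q2_herm: "Q2 g f = cnj (Q2 f g)" for f g
    using Q1_herm[of g f] by (simp add: Q2_def flip: cinner_commute)
  \<comment> \<open>\<open>down1\<close> preserves \<open>R\<close>, being unitary and commuting
    with \<open>A\<close>, and it sends \<open>hat x\<close> to a competitor in the minimum that
    defines \<open>Q1\<close> at the shifted vector.\<close>
  have Q1_shift: "Re (Q1 (pos_part (down1 x)) (pos_part (down1 x))) \<le> Re (Q1 x x)"
      if x: "neg_part x = 0" for x
  proof -
    define u where "u = neg_part (down1 x) + down1 (y x)"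
    have "neg_part (down1 (y x)) = down1 (y x)"
    proof (rule ell2_eqI)
      fix m
      have "ell2_nth (y x) n = 0" if "0 \<le> fst n" for n
        using y_neg[of x] that shift_nth(1)[of "y x" n] by simp
      then show "ell2_nth (neg_part (down1 (y x))) m = ell2_nth (down1 (y x)) m" by (simp add: shift_nth)
    qed
    then have u: "neg_part u = u" by (simp add: u_def shift_linear)
    have 0: "neg_part (pos_part (down1 x)) = 0"
      by (rule ell2_eqI) (simp add: shift_nth zero_ell2.rep_eq)
    have "pos_part (down1 x) + u = down1 (hat x)"
      by (simp add: u_def hat_def shift_linear pos_neg_split flip: add.assoc)
    then have "Re (Q1 (pos_part (down1 x)) (pos_part (down1 x))) \<le> Re (R (down1 (hat x)) (down1 (hat
        x)))"
      using min[OF 0 u] by (simp add: Q1_def)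
    also have "\<dots> = Re (Q1 x x)" by (simp add: R_self Q1_def A_down1 norm_shift)
    finally show ?thesis .
  qed
  \<comment> \<open>Subtracting \<open>R (x + u) (x + u)\<close> in place of the minimum
    \<open>Q1\<close> shows \<open>Q2 x x\<close> as the maximum over negative \<open>u\<close> of
    the right-hand side.\<close>
  have Q2_formula: "Re (cinner x x - cinner (pos_part (A *\<^sub>V x)) (pos_part (A *\<^sub>V x)) - R (x + u) (x + u))
      = (norm (neg_part (A *\<^sub>V (x + u))))\<^sup>2 - (norm u)\<^sup>2" if x: "neg_part x = 0" and u: "neg_part u =
          u" for x u
  proof -
    have "cinner x u = 0" using neg_part_cinner[of x u] x u by simp
    then have "(norm (x + u))\<^sup>2 = (norm x)\<^sup>2 + (norm u)\<^sup>2" by (rule norm_square_add_orthogonal)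
    moreover have "(norm (A *\<^sub>V (x + u)))\<^sup>2 = (norm (pos_part (A *\<^sub>V x)))\<^sup>2 + (norm (neg_part (A *\<^sub>V (x +
        u))))\<^sup>2"
      unfolding norm_square_split[of "A *\<^sub>V (x + u)"] by (simp add: cblinfun_add shift_linear A_neg[OF u])
    ultimately show ?thesis by (simp add: R_self cinner_self flip: of_real_power)
  qed
  have Q2_shift: "Re (Q2 (down2 x) (down2 x)) \<le> Re (Q2 x x)" if x: "neg_part x = 0" for x
  proof -
    have x2: "neg_part (down2 x) = 0"
    proof -
      have "ell2_nth x n = 0" if "fst n < 0" for n
        using x that shift_nth(1)[of x n] by (simp add: zero_ell2.rep_eq)
      then show ?thesis by (intro ell2_eqI) (simp add: shift_nth zero_ell2.rep_eq)
    qed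
    \<comment> \<open>Competitor for \<open>x\<close> in the maximum: the maximiser for
      \<open>down2 x\<close>, lifted by the isometry \<open>up2\<close>. Its norm is unchanged, and
      \<open>down2\<close> can only decrease the other term.\<close>
    define u where "u = up2 (y (down2 x))"
    have u: "neg_part u = u"
    proof (rule ell2_eqI)
      fix m
      have "ell2_nth (y (down2 x)) n = 0" if "0 \<le> fst n" for n
        using y_neg[of "down2 x"] that shift_nth(1)[of "y (down2 x)" n] by simp
      then show "ell2_nth (neg_part u) m = ell2_nth u m" by (simp add: u_def shift_nth)
    qed
    have "down2 (x + u) = hat (down2 x)"
      by (rule ell2_eqI) (simp add: u_def hat_def shift_nth plus_ell2.rep_eq)
    then have "neg_part (A *\<^sub>V hat (down2 x)) = down2 (neg_part (A *\<^sub>V (x + u)))"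
      by (intro ell2_eqI) (metis (no_types, lifting) A_down2 fst_conv shift_nth(1,4))
    then have le: "norm (neg_part (A *\<^sub>V hat (down2 x))) \<le> norm (neg_part (A *\<^sub>V (x + u)))"
      using shift_norm_le(3) by metis
    have "Re (Q2 (down2 x) (down2 x)) = (norm (neg_part (A *\<^sub>V hat (down2 x))))\<^sup>2 - (norm (y (down2 x)))\<^sup>2"
      unfolding Q2_def Q1_def using Q2_formula[OF x2 y_neg[of "down2 x"]] unfolding hat_def[symmetric] .
    also have "\<dots> \<le> (norm (neg_part (A *\<^sub>V (x + u))))\<^sup>2 - (norm u)\<^sup>2"
      using le by (simp add: u_def norm_shift power_mono)
    also have "\<dots> = Re (cinner x x - cinner (pos_part (A *\<^sub>V x)) (pos_part (A *\<^sub>V x)) - R (x + u) (x + u))"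
      by (rule Q2_formula[OF x u, symmetric])
    also have "\<dots> \<le> Re (Q2 x x)"
      using min[OF x u] by (simp add: Q2_def Q1_def)
    finally show ?thesis .
  qed
  have k_neg: "neg_part (szego w x) = 0" for w x
    by (rule ell2_eqI) (simp add: szego_nth shift_nth zero_ell2.rep_eq)
  have k_down2: "down2 (szego w x) = cnj (snd w) *\<^sub>C szego w x" for w x
    by (rule ell2_eqI) (auto simp: szego_nth shift_nth scaleC_ell2.rep_eq scaleC_scaleC ac_simps)
  have k_A: "pos_part (A *\<^sub>V szego w x) = szego w (adj (bipoly N c w) *\<^sub>V x)" for w x
  proof (rule ell2_eqI)
    fix m
    have adj_bp: "adj (bipoly N c w) *\<^sub>V x = (\<Sum>i<N. \<Sum>j<N. cnj (fst w ^ i * snd w ^ j) *\<^sub>C (adj (c i j)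
        *\<^sub>V x))"
      by (rule cinner_eqI_right) (simp add: bipoly_def cinner_sum_right cinner_sum_left
          cinner_scaleC_right
          cinner_scaleC_left cblinfun_sum_left cblinfun_scaleC_left flip: cinner_adj)
    show "ell2_nth (pos_part (A *\<^sub>V szego w x)) m = ell2_nth (szego w (adj (bipoly N c w) *\<^sub>V x)) m"
    proof (cases "w \<in> bidisc \<and> 0 \<le> fst m")
      case True
      then show ?thesis
        by (simp add: shift_nth A_nth conv_at_def szego_nth adj_bp scaleC_sum_right cblinfun_scaleC
            scaleC_scaleC
            nat_add_distrib power_add ac_simps)
    next
      case False
      then show ?thesis by (auto simp: shift_nth A_nth conv_at_def szego_nth)
    qed
  qed
  define \<kappa>1 where "\<kappa>1 w z x x' = (1 - cnj (snd w) * snd z) * Q2 (szego w x) (szego z x')" for w z x x'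
  define \<kappa>2 where "\<kappa>2 w z x x' = (1 - cnj (fst w) * fst z) * Q1 (szego w x) (szego z x')" for w z x x'
  have span_neg: "neg_part (\<Sum>i\<in>I. b i *\<^sub>C szego (fst i) (snd i)) = 0" for I b
    using linear_scaleC_sum[of neg_part b "\<lambda>i. szego (fst i) (snd i)" I]
        by (simp add: shift_linear k_neg)
  have span_down1: "pos_part (down1 (\<Sum>i\<in>I. b i *\<^sub>C szego (fst i) (snd i)))
      = (\<Sum>i\<in>I. b i *\<^sub>C (cnj (fst (fst i)) *\<^sub>C szego (fst i) (snd i)))" for I b
    using linear_scaleC_sum[of "\<lambda>f. pos_part (down1 f)" b "\<lambda>i. szego (fst i) (snd i)" I]
        by (simp add: shift_linear szego_down1)
  have span_down2: "down2 (\<Sum>i\<in>I. b i *\<^sub>C szego (fst i) (snd i))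
      = (\<Sum>i\<in>I. b i *\<^sub>C (cnj (snd (fst i)) *\<^sub>C szego (fst i) (snd i)))" for I b
    using linear_scaleC_sum[of down2 b "\<lambda>i. szego (fst i) (snd i)" I] by (simp add: shift_linear k_down2)
  have "pos_kernel \<kappa>1"
    unfolding pos_kernel_def
  proof (intro conjI allI impI)
    show "sesq (\<kappa>1 w z)" for w z
      unfolding sesq_def \<kappa>1_def szego_linear using sesqD[OF Q2_sesq] by (simp add: algebra_simps)
    fix I :: "((complex \<times> complex) \<times> 'x) set"
    show "psd I (\<lambda>i j. \<kappa>1 (fst i) (fst j) (snd i) (snd j))"
      unfolding \<kappa>1_def
      using psd_of_form_contraction[OF Q2_sesq Q2_herm, where I = I and s = "\<lambda>i. cnj (snd (fst i))"
          and k = "\<lambda>i. szego (fst i) (snd i)"]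
        Q2_shift[OF span_neg] by (simp add: span_down2)
  qed
  moreover have "pos_kernel \<kappa>2"
    unfolding pos_kernel_def
  proof (intro conjI allI impI)
    show "sesq (\<kappa>2 w z)" for w z
      unfolding sesq_def \<kappa>2_def szego_linear using sesqD[OF Q1_sesq] by (simp add: algebra_simps)
    fix I :: "((complex \<times> complex) \<times> 'x) set"
    show "psd I (\<lambda>i j. \<kappa>2 (fst i) (fst j) (snd i) (snd j))"
      unfolding \<kappa>2_def
      using psd_of_form_contraction[OF Q1_sesq Q1_herm, where I = I and s = "\<lambda>i. cnj (fst (fst i))"
          and k = "\<lambda>i. szego (fst i) (snd i)"]
        Q1_shift[OF span_neg] by (simp add: span_down1)
  qed
  moreover have "cinner x x' - cinner (adj (bipoly N c w) *\<^sub>V x) (adj (bipoly N c z) *\<^sub>V x') =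
      (1 - cnj (fst w) * fst z) * \<kappa>1 w z x x' + (1 - cnj (snd w) * snd z) * \<kappa>2 w z x x'"
    if wz: "w \<in> bidisc" "z \<in> bidisc" for w z x x'
  proof -
    define p q where "p = 1 - cnj (fst w) * fst z" and "q = 1 - cnj (snd w) * snd z"
    have "p * \<kappa>1 w z x x' + q * \<kappa>2 w z x x' = p * (q * (Q2 (szego w x) (szego z x') + Q1 (szego w x)
        (szego z x')))"
      unfolding \<kappa>1_def \<kappa>2_def p_def[symmetric] q_def[symmetric] by (simp add: algebra_simps)
    also have "\<dots> = p * (q * cinner (szego w x) (szego z x'))
        - p * (q * cinner (szego w (adj (bipoly N c w) *\<^sub>V x)) (szego z (adj (bipoly N c z) *\<^sub>V x')))"
      by (simp add: Q2_def k_A algebra_simps)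
    also have "\<dots> = cinner x x' - cinner (adj (bipoly N c w) *\<^sub>V x) (adj (bipoly N c z) *\<^sub>V x')"
      unfolding p_def q_def szego_cinner[OF wz] ..
    finally show ?thesis by (simp add: p_def q_def)
  qed
  ultimately have "agler_pair (bipoly N c) \<kappa>1 \<kappa>2" unfolding agler_pair_def by blast
  then show ?thesis by blast
qed

section \<open>Agler decomposition of contractive functions by approximation\<close>

lemma bounded_bilinear_cinner: "bounded_bilinear (cinner :: 'a::complex_inner \<Rightarrow> 'a \<Rightarrow> complex)"
proof
  show "\<exists>K. \<forall>x y :: 'a. cmod (cinner x y) \<le> norm x * norm y * K"
    by (rule exI[of _ 1]) (simp add: Cauchy_Schwarz_cinner)
qed (simp_all add: cinner_add_left cinner_add_right scaleR_scaleC cinner_scaleC_left cinner_scaleC_right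
    scaleC_complex_def)

lemmas tendsto_cinner = bounded_bilinear.tendsto[OF bounded_bilinear_cinner]

text \<open>A family may repeat a pair of point and vector, whereas \<open>pos_kernel\<close> tests
  sets; Gram vectors of the image set bridge the difference.\<close>

lemma pos_kernel_psd:
  fixes x :: "'i \<Rightarrow> 'x::complex_vector"
  assumes "pos_kernel \<kappa>" "finite I" "\<And>i. i \<in> I \<Longrightarrow> w i \<in> bidisc"
  shows "psd I (\<lambda>i j. \<kappa> (w i) (w j) (x i) (x j))"
proof -
  define e where "e i = (w i, x i)" for i
  have ps: "psd (e ` I) (\<lambda>i j. \<kappa> (fst i) (fst j) (snd i) (snd j))"
  proof -
    have "finite (e ` I)" "fst ` e ` I \<subseteq> bidisc" using assms(2,3) by (auto simp: e_def)
    then show ?thesis using assms(1) unfolding pos_kernel_def by blast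
  qed
  obtain g :: "(complex \<times> complex) \<times> 'x \<Rightarrow> ((complex \<times> complex) \<times> 'x, complex) ell2" where
    g: "\<And>i j. i \<in> e ` I \<Longrightarrow> j \<in> e ` I \<Longrightarrow> cinner (g i) (g j) = \<kappa> (fst i) (fst j) (snd i) (snd j)"
    by (rule psd_Gram[OF finite_imageI[OF assms(2)] ps]) (rule that, assumption)
  have "psd I (\<lambda>i j. cinner (g (e i)) (g (e j)))" by (rule psd_Gram_matrix)
  then show ?thesis
    by (rule psd_cong[THEN iffD1, rotated]) (simp add: g, simp add: e_def)
qed

lemma one_minus_square_pos: "w \<in> bidisc \<Longrightarrow> 0 < 1 - (cmod (fst w))\<^sup>2" "w \<in> bidisc \<Longrightarrow> 0 < 1 - (cmod (snd w))\<^sup>2"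
  by (auto simp: bidisc_def abs_square_less_1)

text \<open>On the diagonal the identity is a sum of two nonnegative terms that is at most the
  squared norm of \<open>x\<close>, so each kernel is bounded there, and Cauchy-Schwarz handles the
  rest. The bound does not involve \<open>S\<close>, hence is uniform along approximations.\<close>

lemma agler_pair_bound:
  assumes S: "agler_pair S \<kappa>1 \<kappa>2" and wz: "w \<in> bidisc" "z \<in> bidisc"
  shows "cmod (\<kappa>1 w z x y) \<le> 1 / sqrt (1 - (cmod (fst w))\<^sup>2) * (1 / sqrt (1 - (cmod (fst z))\<^sup>2)) *
      norm x * norm y"
    and "cmod (\<kappa>2 w z x y) \<le> 1 / sqrt (1 - (cmod (snd w))\<^sup>2) * (1 / sqrt (1 - (cmod (snd z))\<^sup>2)) *
        norm x * norm y"
proof -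
  have pk: "pos_kernel \<kappa>1" "pos_kernel \<kappa>2" using S by (auto simp: agler_pair_def)
  have nonneg: "0 \<le> Re (\<kappa> u u x x) \<and> Im (\<kappa> u u x x) = 0" if "pos_kernel \<kappa>" "u \<in> bidisc" for \<kappa> u x
  proof -
    have "psd {()} (\<lambda>i j. \<kappa> u u x x)" using pos_kernel_psd[OF that(1), of "{()}" "\<lambda>_. u" "\<lambda>_. x"]
        that(2) by simp
    from psd_diag[OF this, of "()"] show ?thesis by (simp add: complex_nonneg_Reals_iff)
  qed
  have diag: "Re (\<kappa>1 u u x x) \<le> (norm x)\<^sup>2 / (1 - (cmod (fst u))\<^sup>2)"
    "Re (\<kappa>2 u u x x) \<le> (norm x)\<^sup>2 / (1 - (cmod (snd u))\<^sup>2)" if u: "u \<in> bidisc" for u x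
  proof -
    have cnj_self: "cnj a * a = complex_of_real ((cmod a)\<^sup>2)" for a
      by (simp only: complex_norm_square mult.commute)
    have "cinner x x - cinner (adj (S u) *\<^sub>V x) (adj (S u) *\<^sub>V x) =
        (1 - cnj (fst u) * fst u) * \<kappa>1 u u x x + (1 - cnj (snd u) * snd u) * \<kappa>2 u u x x"
      using S u by (auto simp: agler_pair_def)
    then have "Re (complex_of_real ((norm x)\<^sup>2 - (norm (adj (S u) *\<^sub>V x))\<^sup>2)) =
        Re (complex_of_real (1 - (cmod (fst u))\<^sup>2) * \<kappa>1 u u x x + complex_of_real (1 - (cmod (snd
            u))\<^sup>2) * \<kappa>2 u u x x)"
      unfolding cinner_self cnj_self by (simp only: of_real_diff of_real_1)
    then have eq: "(norm x)\<^sup>2 - (norm (adj (S u) *\<^sub>V x))\<^sup>2 =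
        (1 - (cmod (fst u))\<^sup>2) * Re (\<kappa>1 u u x x) + (1 - (cmod (snd u))\<^sup>2) * Re (\<kappa>2 u u x x)"
      by (simp only: Re_complex_of_real plus_complex.sel times_complex.sel Im_complex_of_real
          mult_zero_left diff_zero)
    have "0 \<le> (1 - (cmod (fst u))\<^sup>2) * Re (\<kappa>1 u u x x)" "0 \<le> (1 - (cmod (snd u))\<^sup>2) * Re (\<kappa>2 u u x x)"
      using nonneg[OF pk(1) u, of x] nonneg[OF pk(2) u, of x] one_minus_square_pos[OF u]
      by (auto intro!: mult_nonneg_nonneg)
    then have "(1 - (cmod (fst u))\<^sup>2) * Re (\<kappa>1 u u x x) \<le> (norm x)\<^sup>2" "(1 - (cmod (snd u))\<^sup>2) * Re (\<kappa>2
        u u x x) \<le> (norm x)\<^sup>2"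
      using eq zero_le_power2[of "norm (adj (S u) *\<^sub>V x)"] by linarith+
    then show "Re (\<kappa>1 u u x x) \<le> (norm x)\<^sup>2 / (1 - (cmod (fst u))\<^sup>2)" "Re (\<kappa>2 u u x x) \<le> (norm x)\<^sup>2 /
        (1 - (cmod (snd u))\<^sup>2)"
      using one_minus_square_pos[OF u] by (simp_all add: pos_le_divide_eq mult.commute)
  qed
  have entry: "cmod (\<kappa> w z x y) \<le> sqrt (Re (\<kappa> w w x x)) * sqrt (Re (\<kappa> z z y y))" if "pos_kernel \<kappa>" for \<kappa>
  proof -
    have "psd {True, False} (\<lambda>i j. \<kappa> (if i then w else z) (if j then w else z) (if i then x else y)
        (if j then x else y))"
      using wz by (intro pos_kernel_psd[OF that]) auto
    from psd_entry_le[OF this, of True False] show ?thesis by simp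
  qed
  have sq: "sqrt ((norm v)\<^sup>2 / c) = 1 / sqrt c * norm v" for v :: 'b and c
    by (simp add: real_sqrt_divide)
  have "cmod (\<kappa>1 w z x y) \<le> sqrt ((norm x)\<^sup>2 / (1 - (cmod (fst w))\<^sup>2)) * sqrt ((norm y)\<^sup>2 / (1 - (cmod
      (fst z))\<^sup>2))"
    using nonneg[OF pk(1) wz(1), of x] nonneg[OF pk(1) wz(2), of y] one_minus_square_pos(1)[OF wz(1)]
    by (intro order_trans[OF entry[OF pk(1)]] mult_mono real_sqrt_le_mono diag wz)
      (simp_all add: less_imp_le)
  then show "cmod (\<kappa>1 w z x y) \<le> 1 / sqrt (1 - (cmod (fst w))\<^sup>2) * (1 / sqrt (1 - (cmod (fst z))\<^sup>2)) *
      norm x * norm y"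
    unfolding sq by (simp add: ac_simps)
  have "cmod (\<kappa>2 w z x y) \<le> sqrt ((norm x)\<^sup>2 / (1 - (cmod (snd w))\<^sup>2)) * sqrt ((norm y)\<^sup>2 / (1 - (cmod
      (snd z))\<^sup>2))"
    using nonneg[OF pk(2) wz(1), of x] nonneg[OF pk(2) wz(2), of y] one_minus_square_pos(2)[OF wz(1)]
    by (intro order_trans[OF entry[OF pk(2)]] mult_mono real_sqrt_le_mono diag wz)
      (simp_all add: less_imp_le)
  then show "cmod (\<kappa>2 w z x y) \<le> 1 / sqrt (1 - (cmod (snd w))\<^sup>2) * (1 / sqrt (1 - (cmod (snd z))\<^sup>2)) *
      norm x * norm y"
    unfolding sq by (simp add: ac_simps)
qed

lemma adj_diff_apply: "adj (f - g) *\<^sub>V x = (adj f *\<^sub>V x) - (adj g *\<^sub>V x)"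
  by (rule cinner_eqI_right) (simp add: cinner_diff_right cblinfun_diff_left cinner_diff_left flip:
      cinner_adj)

lemma bipoly_scale: "bipoly N (\<lambda>k l. a *\<^sub>C c k l) z = a *\<^sub>C bipoly N c z"
  by (simp add: bipoly_def scaleC_sum_right scaleC_scaleC mult.commute)

lemma H_infty_continuous:
  assumes "S \<in> H_infty" "z \<in> bidisc"
  shows "isCont S z"
  using assms unfolding H_infty_def by (auto intro: has_derivative_continuous)

text \<open>Dilate \<open>S\<close>, approximate the dilation by a polynomial within
  \<open>\<epsilon> n\<close>, then shrink it to norm at most \<open>1 - \<epsilon> n\<close>, as
  the polynomial case requires a strict contraction.\<close>

lemma H_infty_agler_limit:
  fixes S :: "complex \<times> complex \<Rightarrow> 'y::chilbert_space \<Rightarrow>\<^sub>C\<^sub>L 'x::chilbert_space"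
  assumes S: "S \<in> H_infty" "H_infty_norm S \<le> 1"
  obtains P \<kappa>1 \<kappa>2 where "\<And>n::nat. agler_pair (P n :: complex \<times> complex \<Rightarrow> 'y \<Rightarrow>\<^sub>C\<^sub>L 'x) (\<kappa>1 n) (\<kappa>2 n)"
    "\<And>z. z \<in> bidisc \<Longrightarrow> (\<lambda>n. P n z) \<longlonglongrightarrow> S z"
proof -
  define \<epsilon> where "\<epsilon> n = 1 / (real n + 2)" for n :: nat
  have \<epsilon>: "0 < \<epsilon> n" "\<epsilon> n < 1" for n by (auto simp: \<epsilon>_def)
  have \<epsilon>_lim: "\<epsilon> \<longlonglongrightarrow> 0"
    using LIMSEQ_ignore_initial_segment[OF lim_1_over_n[where 'a = real], of 2]
        by (simp add: \<epsilon>_def[abs_def] add.commute)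
  define q where "q n = 1 - \<epsilon> n" for n
  have q: "0 < q n" "q n < 1" for n using \<epsilon>[of n] by (auto simp: q_def)
  define S' where "S' n z = S (of_real ((q n)\<^sup>2) * fst z, of_real ((q n)\<^sup>2) * snd z)" for n z
  have "\<exists>N c. \<forall>z. cmod (fst z) \<le> 1 \<longrightarrow> cmod (snd z) \<le> 1 \<longrightarrow> norm (bipoly N c z - S' n z) \<le> \<epsilon> n" for n
    unfolding S'_def by (rule H_infty_bipoly_approx[OF S q \<epsilon>(1), of n]) blast
  then obtain N c where Nc: "\<And>n z. cmod (fst z) \<le> 1 \<Longrightarrow> cmod (snd z) \<le> 1 \<Longrightarrow>
      norm (bipoly (N n) (c n) z - S' n z) \<le> \<epsilon> n" by metis
  \<comment> \<open>The polynomial has norm at most \<open>1 + \<epsilon> n\<close>; this factor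
    brings it down to \<open>1 - \<epsilon> n\<close> and still tends to 1.\<close>
  define t where "t n = (1 - \<epsilon> n) / (1 + \<epsilon> n)" for n
  have t: "0 \<le> t n" "t n \<le> 1" for n using \<epsilon>[of n] by (auto simp: t_def)
  define P where "P n = bipoly (N n) (\<lambda>k l. complex_of_real (t n) *\<^sub>C c n k l)" for n
  have P_eq: "P n z = complex_of_real (t n) *\<^sub>C bipoly (N n) (c n) z" for n z
    by (simp add: P_def bipoly_scale)
  have S'_le: "norm (S' n z) \<le> 1" if "cmod (fst z) \<le> 1" "cmod (snd z) \<le> 1" for n z
  proof -
    have "(q n)\<^sup>2 < 1" using q[of n] by (simp add: power_less_one_iff)
    then have "(q n)\<^sup>2 * cmod u < 1" if "cmod u \<le> 1" for u
      using that mult_left_mono[OF that, of "(q n)\<^sup>2"] by simp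
    then have "(of_real ((q n)\<^sup>2) * fst z, of_real ((q n)\<^sup>2) * snd z) \<in> bidisc"
      using that by (simp add: bidisc_def norm_mult norm_power)
    then show ?thesis unfolding S'_def by (rule H_infty_norm_le[OF S])
  qed
  have P_le: "norm (P n z) \<le> 1 - \<epsilon> n" if z: "cmod (fst z) \<le> 1" "cmod (snd z) \<le> 1" for n z
  proof -
    have "norm (bipoly (N n) (c n) z) \<le> norm (bipoly (N n) (c n) z - S' n z) + norm (S' n z)"
      using norm_triangle_ineq[of "bipoly (N n) (c n) z - S' n z" "S' n z"] by simp
    also have "\<dots> \<le> \<epsilon> n + 1" by (intro add_mono Nc z S'_le)
    finally have "t n * norm (bipoly (N n) (c n) z) \<le> t n * (1 + \<epsilon> n)"
      using t by (intro mult_left_mono) auto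
    also have "\<dots> = 1 - \<epsilon> n" using \<epsilon>(1)[of n] by (simp add: t_def)
    finally show ?thesis using t(1)[of n] by (simp add: P_eq norm_scaleC)
  qed
  have "\<exists>\<kappa>1 \<kappa>2. agler_pair (P n) \<kappa>1 \<kappa>2" for n
    unfolding P_def by (rule bipoly_agler_pair[where \<rho> = "1 - \<epsilon> n"]) (use P_le \<epsilon>(1)[of n] in \<open>auto
        simp: P_def\<close>)
  then obtain \<kappa>1 \<kappa>2 where \<kappa>: "\<And>n. agler_pair (P n) (\<kappa>1 n) (\<kappa>2 n)" by metis
  have lim: "(\<lambda>n. P n z) \<longlonglongrightarrow> S z" if z: "z \<in> bidisc" for z
  proof -
    have z': "cmod (fst z) \<le> 1" "cmod (snd z) \<le> 1" using z by (auto simp: bidisc_def)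
    have q_lim: "q \<longlonglongrightarrow> 1 - 0" unfolding q_def[abs_def] by (intro tendsto_intros \<epsilon>_lim)
    have "(\<lambda>n. (of_real ((q n)\<^sup>2) * fst z, of_real ((q n)\<^sup>2) * snd z)) \<longlonglongrightarrow> (of_real ((1 - 0)\<^sup>2) * fst z,
        of_real ((1 - 0)\<^sup>2) * snd z)"
      by (intro tendsto_intros q_lim)
    then have "(\<lambda>n. (of_real ((q n)\<^sup>2) * fst z, of_real ((q n)\<^sup>2) * snd z)) \<longlonglongrightarrow> z" by simp
    from isCont_tendsto_compose[OF H_infty_continuous[OF S(1) z] this]
    have S'_lim: "(\<lambda>n. S' n z) \<longlonglongrightarrow> S z" unfolding S'_def .
    have "(\<lambda>n. \<epsilon> n + (1 - t n)) \<longlonglongrightarrow> 0 + (1 - (1 - 0) / (1 + 0))"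
      unfolding t_def[abs_def] by (intro tendsto_intros \<epsilon>_lim) simp
    then have e_lim: "(\<lambda>n. \<epsilon> n + (1 - t n)) \<longlonglongrightarrow> 0" by simp
    have "norm (P n z - S' n z) \<le> \<epsilon> n + (1 - t n)" for n
    proof -
      have "P n z - S' n z = complex_of_real (t n) *\<^sub>C (bipoly (N n) (c n) z - S' n z) -
          complex_of_real (1 - t n) *\<^sub>C S' n z"
        by (simp add: P_eq scaleC_diff_right scaleC_minus_left flip: scaleC_add_left)
          (simp add: algebra_simps flip: scaleC_add_left)
      also have "norm \<dots> \<le> t n * norm (bipoly (N n) (c n) z - S' n z) + (1 - t n) * norm (S' n z)"
        using t[of n] by (intro order_trans[OF norm_triangle_ineq4]) (simp add: norm_scaleC del:
            of_real_diff)
      also have "\<dots> \<le> 1 * \<epsilon> n + (1 - t n) * 1"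
        using t[of n] \<epsilon>[of n] by (intro add_mono mult_mono Nc z' S'_le) auto
      finally show ?thesis by simp
    qed
    then have "(\<lambda>n. P n z - S' n z) \<longlonglongrightarrow> 0"
      by (intro Lim_null_comparison[OF _ e_lim] always_eventually) blast
    from tendsto_add[OF this S'_lim] show ?thesis by simp
  qed
  show thesis by (rule that[OF \<kappa> lim])
qed

lemma sesq_tendsto:
  assumes U: "U \<noteq> bot" and B: "\<And>n. sesq (B n)" and lim: "\<And>x y. ((\<lambda>n. B n x y) \<longlongrightarrow> L x y) U"
  shows "sesq L"
  unfolding sesq_def
proof (intro conjI allI)
  show "L (x + y) z = L x z + L y z" for x y z
    by (rule tendsto_unique[OF U lim]) (simp add: sesqD[OF B] tendsto_add lim)
  show "L x (y + z) = L x y + L x z" for x y z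
    by (rule tendsto_unique[OF U lim]) (simp add: sesqD[OF B] tendsto_add lim)
  show "L (a *\<^sub>C x) y = a * L x y" for a x y
    by (rule tendsto_unique[OF U lim]) (simp add: sesqD[OF B] tendsto_mult_left lim)
  show "L x (a *\<^sub>C y) = cnj a * L x y" for a x y
    by (rule tendsto_unique[OF U lim]) (simp add: sesqD[OF B] tendsto_mult_left lim)
qed

lemma agler_decomposition:
  fixes S :: "complex \<times> complex \<Rightarrow> 'y::chilbert_space \<Rightarrow>\<^sub>C\<^sub>L 'x::chilbert_space"
  assumes S: "S \<in> H_infty" "H_infty_norm S \<le> 1"
  shows "\<exists>\<kappa>1 \<kappa>2. agler_pair S \<kappa>1 \<kappa>2"
proof -
  obtain P \<kappa>1 \<kappa>2 where \<kappa>: "\<And>n::nat. agler_pair (P n :: complex \<times> complex \<Rightarrow> 'y \<Rightarrow>\<^sub>C\<^sub>L 'x) (\<kappa>1 n) (\<kappa>2 n)"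
    and P: "\<And>z. z \<in> bidisc \<Longrightarrow> (\<lambda>n. P n z) \<longlonglongrightarrow> S z"
    by (rule H_infty_agler_limit[OF S]) (rule that, assumption+)
  define U where "U = ultrafilter_of (sequentially :: nat filter)"
  have U: "U \<noteq> bot" "U \<le> sequentially"
    unfolding U_def by (simp_all add: ultrafilter_of_neq_bot ultrafilter_of_le)
  \<comment> \<open>Off the bidisc the kernels are not controlled; the value 0 keeps the limit
    sesquilinear there.\<close>
  define L where "L \<kappa> w z x y = (if w \<in> bidisc \<and> z \<in> bidisc then Lim U (\<lambda>n. \<kappa> n w z x y) else 0)"
    for \<kappa> :: "nat \<Rightarrow> complex \<times> complex \<Rightarrow> complex \<times> complex \<Rightarrow> 'x \<Rightarrow> 'x \<Rightarrow> complex" and w z x y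
  have lim1: "((\<lambda>n. \<kappa>1 n w z x y) \<longlongrightarrow> L \<kappa>1 w z x y) U" if "w \<in> bidisc" "z \<in> bidisc" for w z x y
    unfolding U_def L_def using agler_pair_bound(1)[OF \<kappa> that] that
    by (auto intro!: tendsto_ultrafilter always_eventually)
  have lim2: "((\<lambda>n. \<kappa>2 n w z x y) \<longlongrightarrow> L \<kappa>2 w z x y) U" if "w \<in> bidisc" "z \<in> bidisc" for w z x y
    unfolding U_def L_def using agler_pair_bound(2)[OF \<kappa> that] that
    by (auto intro!: tendsto_ultrafilter always_eventually)
  have pos: "pos_kernel (L \<kappa>)" if pk: "\<And>n. pos_kernel (\<kappa> n)"
    and lim: "\<And>w z x y. w \<in> bidisc \<Longrightarrow> z \<in> bidisc \<Longrightarrow> ((\<lambda>n. \<kappa> n w z x y) \<longlongrightarrow> L \<kappa> w z x y) U" for \<kappa>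
    unfolding pos_kernel_def
  proof (intro conjI allI impI)
    fix w z
    show "sesq (L \<kappa> w z)"
    proof (cases "w \<in> bidisc \<and> z \<in> bidisc")
      case True
      then show ?thesis
        using sesq_tendsto[OF U(1), of "\<lambda>n. \<kappa> n w z" "L \<kappa> w z"] pk lim unfolding pos_kernel_def by blast
    next
      case False
      then have "L \<kappa> w z = (\<lambda>_ _. 0)" by (auto simp: L_def fun_eq_iff)
      then show ?thesis by (simp add: sesq_def)
    qed
  next
    fix I :: "((complex \<times> complex) \<times> 'x) set" assume I: "finite I" "fst ` I \<subseteq> bidisc"
    show "psd I (\<lambda>i j. L \<kappa> (fst i) (fst j) (snd i) (snd j))"
    proof (rule psd_tendsto[OF U(1), of _ "\<lambda>n i j. \<kappa> n (fst i) (fst j) (snd i) (snd j)"])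
      show "psd I (\<lambda>i j. \<kappa> n (fst i) (fst j) (snd i) (snd j))" for n
        using pk[of n] I unfolding pos_kernel_def by blast
      show "((\<lambda>n. \<kappa> n (fst i) (fst j) (snd i) (snd j)) \<longlongrightarrow> L \<kappa> (fst i) (fst j) (snd i) (snd j)) U"
        if "i \<in> I" "j \<in> I" for i j
        using that I(2) by (intro lim) blast+
    qed
  qed
  have "cinner x y - cinner (adj (S w) *\<^sub>V x) (adj (S z) *\<^sub>V y) =
      (1 - cnj (fst w) * fst z) * L \<kappa>1 w z x y + (1 - cnj (snd w) * snd z) * L \<kappa>2 w z x y"
    if wz: "w \<in> bidisc" "z \<in> bidisc" for w z x y
  proof -
    \<comment> \<open>Norm convergence of \<open>P n u\<close> gives convergence in norm of both
      adjoint vectors, which the inner product of the two requires; weak convergence suffices for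
      the kernels on the other side.\<close>
    have adj_lim: "((\<lambda>n. adj (P n u) *\<^sub>V x) \<longlongrightarrow> adj (S u) *\<^sub>V x) U" if u: "u \<in> bidisc" for u x
    proof -
      have "(\<lambda>n. norm (P n u - S u) * norm x) \<longlonglongrightarrow> norm (S u - S u) * norm x"
        by (intro tendsto_intros P u)
      then have "(\<lambda>n. norm (P n u - S u) * norm x) \<longlonglongrightarrow> 0" by simp
      then have "(\<lambda>n. (adj (P n u) *\<^sub>V x) - (adj (S u) *\<^sub>V x)) \<longlonglongrightarrow> 0"
        by (rule Lim_null_comparison[rotated])
          (auto simp: norm_adj_le simp flip: adj_diff_apply intro!: always_eventually)
      then have "(\<lambda>n. adj (P n u) *\<^sub>V x) \<longlonglongrightarrow> adj (S u) *\<^sub>V x" by (rule LIM_zero_cancel)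
      then show ?thesis using U(2) by (rule filterlim_mono[OF _ order_refl])
    qed
    have eq: "cinner x y - cinner (adj (P n w) *\<^sub>V x) (adj (P n z) *\<^sub>V y) =
        (1 - cnj (fst w) * fst z) * \<kappa>1 n w z x y + (1 - cnj (snd w) * snd z) * \<kappa>2 n w z x y" for n
      using \<kappa>[of n] wz unfolding agler_pair_def by blast
    have "((\<lambda>n. cinner x y - cinner (adj (P n w) *\<^sub>V x) (adj (P n z) *\<^sub>V y)) \<longlongrightarrow>
        cinner x y - cinner (adj (S w) *\<^sub>V x) (adj (S z) *\<^sub>V y)) U"
      by (intro tendsto_diff tendsto_const tendsto_cinner adj_lim wz)
    moreover have "((\<lambda>n. cinner x y - cinner (adj (P n w) *\<^sub>V x) (adj (P n z) *\<^sub>V y)) \<longlongrightarrow>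
        (1 - cnj (fst w) * fst z) * L \<kappa>1 w z x y + (1 - cnj (snd w) * snd z) * L \<kappa>2 w z x y) U"
      unfolding eq by (intro tendsto_add tendsto_mult_left lim1 lim2 wz)
    ultimately show ?thesis by (rule tendsto_unique[OF U(1)])
  qed
  moreover have "pos_kernel (L \<kappa>1)" "pos_kernel (L \<kappa>2)"
    using \<kappa> lim1 lim2 by (auto intro!: pos simp: agler_pair_def)
  ultimately have "agler_pair S (L \<kappa>1) (L \<kappa>2)" unfolding agler_pair_def by blast
  then show ?thesis by blast
qed

section \<open>Geometry of the pentablock\<close>

lemma norm_square_vec2: "(norm (x :: complex^2))\<^sup>2 = (cmod (x $ 1))\<^sup>2 + (cmod (x $ 2))\<^sup>2"
  by (simp add: norm_vec_def L2_set_def sum_2)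

definition mat2 :: "complex \<Rightarrow> complex \<Rightarrow> complex \<Rightarrow> complex \<Rightarrow> complex^2^2"
  where "mat2 a b c d = (\<chi> i j. if i = 1 then if j = 1 then a else b else if j = 1 then c else d)"

lemma mat2_nth [simp]: "mat2 a b c d $ 1 $ 1 = a" "mat2 a b c d $ 1 $ 2 = b"
    "mat2 a b c d $ 2 $ 1 = c" "mat2 a b c d $ 2 $ 2 = d"
  by (simp_all add: mat2_def)

lemma mat2_mult [simp]: "(mat2 a b c d *v x) $ 1 = a * x $ 1 + b * x $ 2" "(mat2 a b c d *v x) $ 2 =
    c * x $ 1 + d * x $ 2"
  by (simp_all add: matrix_vector_mult_def sum_2)

lemma pentablockI:
  assumes "\<And>x. (norm (mat2 a b c d *v x))\<^sup>2 \<le> r\<^sup>2 * (norm x)\<^sup>2" "0 \<le> r" "r < 1"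
  shows "(c, a + d, a * d - b * c) \<in> pentablock"
proof -
  have "norm (mat2 a b c d *v x) \<le> r * norm x" for x
    by (rule power2_le_imp_le) (use assms in \<open>simp_all add: power_mult_distrib\<close>)
  then have "onorm ((*v) (mat2 a b c d)) \<le> r" using assms(2) by (intro onorm_bound) auto
  then have "onorm ((*v) (mat2 a b c d)) < 1" using assms(3) by simp
  then show ?thesis
    unfolding pentablock_def by (intro CollectI exI[of _ "mat2 a b c d"]) (simp add: trace_def sum_2
        det_2)
qed

text \<open>If \<open>|p| < |a|^2\<close>, an antidiagonal matrix with entries
  \<open>- p / a\<close> and \<open>a\<close> has norm \<open>|a|\<close>. Otherwise take
  \<open>q\<close> times the unitary with rows \<open>(s, cnj t)\<close> and
  \<open>(t, - s)\<close>, where \<open>q^2 = - p\<close> and \<open>q t = a\<close>; it has trace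
  0, determinant \<open>p\<close> and norm \<open>|q|\<close>.\<close>

lemma zero_trace_in_pentablock:
  assumes a: "cmod a < 1" and p: "cmod p < 1"
  shows "(a, 0, p) \<in> pentablock"
proof (cases "cmod p < (cmod a)\<^sup>2")
  case True
  then have a0: "a \<noteq> 0" by auto
  have le: "cmod (p / a) \<le> cmod a" using True a0 by (simp add: norm_divide divide_le_eq power2_eq_square)
  have "(a, 0 + 0, 0 * 0 - (- (p / a)) * a) \<in> pentablock"
  proof (rule pentablockI)
    fix x :: "complex^2"
    have "(norm (mat2 0 (- (p / a)) a 0 *v x))\<^sup>2 = (cmod (p / a))\<^sup>2 * (cmod (x $ 2))\<^sup>2 + (cmod a)\<^sup>2 *
        (cmod (x $ 1))\<^sup>2"
      by (simp add: norm_square_vec2 norm_mult norm_divide power_mult_distrib power_divide)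
    also have "\<dots> \<le> (cmod a)\<^sup>2 * (cmod (x $ 2))\<^sup>2 + (cmod a)\<^sup>2 * (cmod (x $ 1))\<^sup>2"
      by (intro add_mono mult_right_mono power_mono le) auto
    finally show "(norm (mat2 0 (- (p / a)) a 0 *v x))\<^sup>2 \<le> (cmod a)\<^sup>2 * (norm x)\<^sup>2"
      by (simp add: norm_square_vec2 algebra_simps)
  qed (use a in auto)
  then show ?thesis using a0 by simp
next
  case False
  define q where "q = csqrt (- p)"
  have qq: "q * q = - p" using power2_csqrt[of "- p"] by (simp add: q_def power2_eq_square)
  have qp: "(cmod q)\<^sup>2 = cmod p"
    using arg_cong[OF qq, of cmod] by (simp add: norm_mult power2_eq_square)
  \<comment> \<open>If \<open>q = 0\<close>, then \<open>p\<close> and therefore \<open>a\<close>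
    vanish, and the convention for division by zero gives \<open>t = 0\<close>, as it
    should.\<close>
  define t where "t = a / q"
  have qt: "q * t = a"
    using False qq by (cases "q = 0") (auto simp: t_def)
  have t1: "(cmod t)\<^sup>2 \<le> 1"
    using False by (cases "q = 0") (auto simp: t_def norm_divide power_divide qp divide_le_eq)
  define s where "s = sqrt (1 - (cmod t)\<^sup>2)"
  have ss: "s\<^sup>2 = 1 - (cmod t)\<^sup>2" using t1 by (simp add: s_def)
  have cs: "complex_of_real s * complex_of_real s = 1 - t * cnj t"
  proof -
    have "complex_of_real s * complex_of_real s = complex_of_real (s\<^sup>2)" by (simp add: power2_eq_square)
    also have "\<dots> = 1 - t * cnj t" unfolding ss by (simp only: of_real_diff of_real_1 complex_norm_square)
    finally show ?thesis .
  qed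
  have "(q * t, q * complex_of_real s + - (q * complex_of_real s),
      q * complex_of_real s * - (q * complex_of_real s) - q * cnj t * (q * t)) \<in> pentablock"
  proof (rule pentablockI[where r = "cmod q"])
    fix x :: "complex^2"
    have id: "(cmod (complex_of_real s * u + cnj t * v))\<^sup>2 + (cmod (t * u - complex_of_real s * v))\<^sup>2
        = (cmod u)\<^sup>2 + (cmod v)\<^sup>2" for u v
    proof -
      have "complex_of_real ((cmod (complex_of_real s * u + cnj t * v))\<^sup>2 + (cmod (t * u -
          complex_of_real s * v))\<^sup>2)
          = (complex_of_real s * complex_of_real s + t * cnj t) * (u * cnj u + v * cnj v)"
        by (simp only: of_real_add complex_norm_square) (simp add: algebra_simps)
      also have "\<dots> = complex_of_real ((cmod u)\<^sup>2 + (cmod v)\<^sup>2)"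
        unfolding cs by (simp only: of_real_add complex_norm_square) simp
      finally show ?thesis by (simp only: of_real_eq_iff)
    qed
    have "(norm (mat2 (q * complex_of_real s) (q * cnj t) (q * t) (- (q * complex_of_real s)) *v x))\<^sup>2
        = (cmod (q * (complex_of_real s * x $ 1 + cnj t * x $ 2)))\<^sup>2 + (cmod (q * (t * x $ 1 -
            complex_of_real s * x $ 2)))\<^sup>2"
      by (simp add: norm_square_vec2 algebra_simps)
    also have "\<dots> = (cmod q)\<^sup>2 * (norm x)\<^sup>2"
      by (simp only: norm_mult power_mult_distrib distrib_left[symmetric] id norm_square_vec2)
    finally show "(norm (mat2 (q * complex_of_real s) (q * cnj t) (q * t) (- (q * complex_of_real
        s)) *v x))\<^sup>2 \<le> (cmod q)\<^sup>2 * (norm x)\<^sup>2"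
      by simp
  next
    show "cmod q < 1" using p by (simp flip: qp add: abs_square_less_1)
  qed simp
  also have "q * complex_of_real s * - (q * complex_of_real s) - q * cnj t * (q * t)
      = - (q * q) * (complex_of_real s * complex_of_real s + t * cnj t)"
    by (simp add: algebra_simps)
  also have "\<dots> = p" by (simp add: cs qq)
  finally show ?thesis by (simp add: qt)
qed

lemma pentablockE:
  assumes "z \<in> pentablock"
  obtains A :: "complex^2^2" where "onorm ((*v) A) < 1" "coord1 z = A $ 2 $ 1" "coord2 z = trace A"
      "coord3 z = det A"
  using assms unfolding pentablock_def by auto

lemma pentablock_denominators:
  assumes "z \<in> pentablock" "cmod \<alpha> \<le> 1"
  shows "1 - \<alpha> * coord2 z + \<alpha>\<^sup>2 * coord3 z \<noteq> 0" "cmod (coord2 z) < 2" "2 - \<alpha> * coord2 z \<noteq> 0"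
proof -
  from assms(1) obtain A :: "complex^2^2" where A: "onorm ((*v) A) < 1" "coord1 z = A $ 2 $ 1"
      "coord2 z = trace A" "coord3 z = det A"
    by (rule pentablockE)
  show "1 - \<alpha> * coord2 z + \<alpha>\<^sup>2 * coord3 z \<noteq> 0" unfolding A
      by (rule contraction_resolvent[OF A(1) assms(2)])
  show s: "cmod (coord2 z) < 2" unfolding A by (rule contraction_trace[OF A(1)])
  show "2 - \<alpha> * coord2 z \<noteq> 0"
  proof
    assume "2 - \<alpha> * coord2 z = 0"
    then have "cmod (\<alpha> * coord2 z) = cmod 2" by simp
    then have "cmod \<alpha> * cmod (coord2 z) = 2" by (simp add: norm_mult)
    moreover have "cmod \<alpha> * cmod (coord2 z) \<le> 1 * cmod (coord2 z)" using assms(2)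
        by (intro mult_right_mono) auto
    ultimately show False using s by simp
  qed
qed

text \<open>\<open>psi \<alpha>\<close> is the (2,1) entry of the Moebius transform \<open>(A - cnj \<alpha>) (1 - \<alpha> A)\<^sup>-\<^sup>1\<close> of the
  contraction \<open>A\<close>; the vector \<open>y\<close> is the first column of the adjugate of \<open>1 - \<alpha> A\<close>.\<close>

lemma psi_le_one:
  assumes z: "z \<in> pentablock" and \<alpha>: "cmod \<alpha> \<le> 1"
  shows "cmod (psi \<alpha> z) \<le> 1"
proof -
  from z obtain A :: "complex^2^2" where A: "onorm ((*v) A) < 1" "coord1 z = A $ 2 $ 1" "coord2 z =
      trace A" "coord3 z = det A"
    by (rule pentablockE)
  define y :: "complex^2" where "y = (\<chi> i. if i = 1 then 1 - \<alpha> * A $ 2 $ 2 else \<alpha> * A $ 2 $ 1)"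
  define D where "D = 1 - \<alpha> * trace A + \<alpha>\<^sup>2 * det A"
  define w where "w = A *v y"
  have y: "y $ 1 = 1 - \<alpha> * A $ 2 $ 2" "y $ 2 = \<alpha> * A $ 2 $ 1" by (simp_all add: y_def)
  have w: "w $ 1 = A $ 1 $ 1 * y $ 1 + A $ 1 $ 2 * y $ 2" "w $ 2 = A $ 2 $ 1 * y $ 1 + A $ 2 $ 2 * y $ 2"
    by (simp_all add: w_def matrix_vector_mult_def sum_2)
  have e: "y $ 1 - \<alpha> * w $ 1 = D" "y $ 2 - \<alpha> * w $ 2 = 0"
    by (simp_all add: w y D_def trace_def det_2 sum_2 power2_eq_square algebra_simps)
  have m: "w $ 2 - cnj \<alpha> * y $ 2 = (1 - complex_of_real ((cmod \<alpha>)\<^sup>2)) * A $ 2 $ 1"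
    unfolding complex_norm_square by (simp add: w y algebra_simps)
  \<comment> \<open>Moebius identity, used with \<open>u\<close> and \<open>v\<close> the
    coordinates of \<open>y\<close> and of \<open>A y\<close>; the sign of the summed right-hand
    sides is the contractivity of \<open>A\<close>.\<close>
  have id: "(cmod (u - \<alpha> * v))\<^sup>2 - (cmod (v - cnj \<alpha> * u))\<^sup>2 = (1 - (cmod \<alpha>)\<^sup>2) * ((cmod u)\<^sup>2 - (cmod
      v)\<^sup>2)" for u v
    by (simp only: cmod_power2) (simp add: power2_eq_square algebra_simps)
  have "norm w \<le> norm y"
    unfolding w_def using contraction_strict[OF A(1), of y] by (cases "y = 0") auto
  then have "(norm w)\<^sup>2 \<le> (norm y)\<^sup>2" by (simp add: power_mono)
  then have "0 \<le> (1 - (cmod \<alpha>)\<^sup>2) * ((norm y)\<^sup>2 - (norm w)\<^sup>2)"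
    using \<alpha> by (intro mult_nonneg_nonneg) (auto simp: power_le_one)
  also have "\<dots> = (cmod (y $ 1 - \<alpha> * w $ 1))\<^sup>2 - (cmod (w $ 1 - cnj \<alpha> * y $ 1))\<^sup>2
      + ((cmod (y $ 2 - \<alpha> * w $ 2))\<^sup>2 - (cmod (w $ 2 - cnj \<alpha> * y $ 2))\<^sup>2)"
    unfolding id norm_square_vec2 by (simp add: algebra_simps)
  also have "\<dots> = (cmod D)\<^sup>2 - (cmod (w $ 1 - cnj \<alpha> * y $ 1))\<^sup>2 - (cmod (w $ 2 - cnj \<alpha> * y $ 2))\<^sup>2"
    unfolding e by simp
  finally have "(cmod ((1 - complex_of_real ((cmod \<alpha>)\<^sup>2)) * A $ 2 $ 1))\<^sup>2 \<le> (cmod D)\<^sup>2"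
    unfolding m using zero_le_power2[of "cmod (w $ 1 - cnj \<alpha> * y $ 1)"] by linarith
  then have "cmod ((1 - complex_of_real ((cmod \<alpha>)\<^sup>2)) * A $ 2 $ 1) \<le> cmod D"
    by (rule power2_le_imp_le) simp
  moreover have "D \<noteq> 0" unfolding D_def by (rule contraction_resolvent[OF A(1) \<alpha>])
  ultimately show ?thesis by (simp add: psi_def A D_def[symmetric] norm_divide)
qed

text \<open>With the eigenvalues of \<open>A\<close> in the disc, \<open>\<bar>s - cnj s * p\<bar> \<le> 1 - \<bar>p\<bar>\<^sup>2\<close>.\<close>

lemma Phi_le_one:
  assumes z: "z \<in> pentablock" and \<alpha>: "cmod \<alpha> \<le> 1"
  shows "cmod (Phi \<alpha> (coord2 z) (coord3 z)) \<le> 1"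
proof -
  define s p where "s = coord2 z" and "p = coord3 z"
  define c where "c = csqrt (s\<^sup>2 - 4 * p)"
  have cc: "c * c = s * s - 4 * p" using power2_csqrt[of "s\<^sup>2 - 4 * p"]
      by (simp add: c_def power2_eq_square)
  define l m where "l = (s + c) / 2" and "m = (s - c) / 2"
  have lm: "l + m = s" "l * m = p"
    by (simp add: l_def m_def field_simps) (simp add: l_def m_def field_simps cc)
  \<comment> \<open>An eigenvalue \<open>l\<close> with \<open>|l| \<ge> 1\<close> would make the
    resolvent denominator vanish at \<open>\<alpha> = 1 / l\<close>.\<close>
  have root: "cmod l < 1" if lm: "l + m = s" "l * m = p" for l m
  proof (rule ccontr)
    assume "\<not> cmod l < 1"
    then have l: "l \<noteq> 0" "cmod (1 / l) \<le> 1" by (auto simp: norm_divide divide_le_eq)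
    have "1 - 1 / l * s + (1 / l)\<^sup>2 * p = 0"
      using l(1) by (simp add: lm[symmetric] field_simps power2_eq_square)
    then show False using pentablock_denominators(1)[OF z l(2)] by (simp add: s_def p_def)
  qed
  define X Y where "X = cmod l" and "Y = cmod m"
  have XY: "0 \<le> X" "X < 1" "0 \<le> Y" "Y < 1"
    using root[OF lm] root[of m l] lm by (simp_all add: X_def Y_def add.commute mult.commute)
  have pXY: "cmod p = X * Y" by (simp add: X_def Y_def norm_mult flip: lm(2))
  have "s - cnj s * p = l * (1 - complex_of_real (Y\<^sup>2)) + m * (1 - complex_of_real (X\<^sup>2))"
    unfolding X_def Y_def complex_norm_square by (simp add: lm[symmetric] algebra_simps)
  also have "cmod \<dots> \<le> X * (1 - Y\<^sup>2) + Y * (1 - X\<^sup>2)"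
  proof (intro norm_triangle_le add_mono)
    have n: "cmod (1 - complex_of_real (u\<^sup>2)) = 1 - u\<^sup>2" if "0 \<le> u" "u < 1" for u
    proof -
      have "1 - complex_of_real (u\<^sup>2) = complex_of_real (1 - u\<^sup>2)" by simp
      then have "cmod (1 - complex_of_real (u\<^sup>2)) = \<bar>1 - u\<^sup>2\<bar>" by (simp only: norm_of_real)
      also have "\<dots> = 1 - u\<^sup>2" using that by (simp add: power_le_one)
      finally show ?thesis .
    qed
    show "cmod (l * (1 - complex_of_real (Y\<^sup>2))) \<le> X * (1 - Y\<^sup>2)" "cmod (m * (1 - complex_of_real
        (X\<^sup>2))) \<le> Y * (1 - X\<^sup>2)"
      by (simp_all add: norm_mult n XY flip: X_def Y_def del: of_real_power)
  qed
  also have "\<dots> = 1 - (X * Y)\<^sup>2 - (1 - X) * (1 - Y) * (1 - X * Y)"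
    by (simp add: power2_eq_square algebra_simps)
  also have "\<dots> \<le> 1 - (X * Y)\<^sup>2"
  proof -
    have "X * Y \<le> 1 * 1" using XY by (intro mult_mono) auto
    then have "0 \<le> (1 - X) * (1 - Y) * (1 - X * Y)" using XY by simp
    then show ?thesis by simp
  qed
  finally have key: "cmod (s - cnj s * p) \<le> 1 - (cmod p)\<^sup>2" by (simp add: pXY)
  define t P where "t = cmod \<alpha>" and "P = (cmod p)\<^sup>2"
  have t: "0 \<le> t" "t \<le> 1" using \<alpha> by (auto simp: t_def)
  have P: "0 \<le> P" "P \<le> 1"
    using mult_mono[of X 1 Y 1] XY by (auto simp: P_def pXY power_le_one)
  have s_le: "(cmod s)\<^sup>2 \<le> 2 * (1 + P)"
  proof -
    have "cmod s \<le> X + Y" unfolding X_def Y_def lm(1)[symmetric] by (rule norm_triangle_ineq)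
    also have "\<dots> = 1 + X * Y - (1 - X) * (1 - Y)" by (simp add: algebra_simps)
    also have "\<dots> \<le> 1 + cmod p" using XY by (simp add: pXY)
    finally have "(cmod s)\<^sup>2 \<le> (1 + cmod p)\<^sup>2" by (intro power_mono) auto
    also have "\<dots> \<le> 2 * (1 + P)"
      using sum_squares_bound[of 1 "cmod p"] by (simp add: P_def power2_sum)
    finally show ?thesis .
  qed
  have "(cmod (2 - \<alpha> * s))\<^sup>2 - (cmod (2 * \<alpha> * p - s))\<^sup>2
      = 4 - (cmod s)\<^sup>2 - t\<^sup>2 * (4 * P - (cmod s)\<^sup>2) - 4 * Re (\<alpha> * (s - cnj s * p))"
    unfolding t_def P_def by (simp only: cmod_power2) (simp add: power2_eq_square algebra_simps)
  moreover have "Re (\<alpha> * (s - cnj s * p)) \<le> t * (1 - P)"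
  proof -
    have "Re (\<alpha> * (s - cnj s * p)) \<le> cmod (\<alpha> * (s - cnj s * p))" by (rule complex_Re_le_cmod)
    also have "\<dots> \<le> t * (1 - P)"
      unfolding norm_mult t_def P_def by (intro mult_left_mono key) simp
    finally show ?thesis .
  qed
  \<comment> \<open>Once the real part is bounded by \<open>key\<close>, a factor
    \<open>1 - t\<close> splits off; the other factor is nonnegative by \<open>s_le\<close>.\<close>
  moreover have "4 - (cmod s)\<^sup>2 - t\<^sup>2 * (4 * P - (cmod s)\<^sup>2) - 4 * (t * (1 - P)) = (1 - t) * (4 + 4 *
      (t * P) - (cmod s)\<^sup>2 * (1 + t))"
    by (simp add: power2_eq_square algebra_simps)
  moreover have "0 \<le> (1 - t) * (4 + 4 * (t * P) - (cmod s)\<^sup>2 * (1 + t))"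
  proof (rule mult_nonneg_nonneg)
    have "(cmod s)\<^sup>2 * (1 + t) \<le> 2 * (1 + P) * (1 + t)" using t by (intro mult_right_mono s_le) auto
    also have "\<dots> = 4 + 4 * (t * P) - 2 * ((1 - P) * (1 - t))" by (simp add: algebra_simps)
    also have "\<dots> \<le> 4 + 4 * (t * P)" using t P by simp
    finally show "0 \<le> 4 + 4 * (t * P) - (cmod s)\<^sup>2 * (1 + t)" by simp
  qed (use t in simp)
  ultimately have "(cmod (2 * \<alpha> * p - s))\<^sup>2 \<le> (cmod (2 - \<alpha> * s))\<^sup>2" by linarith
  then have "cmod (2 * \<alpha> * p - s) \<le> cmod (2 - \<alpha> * s)" by (rule power2_le_imp_le) simp
  moreover have "2 - \<alpha> * s \<noteq> 0" using pentablock_denominators(3)[OF z \<alpha>] by (simp add: s_def)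
  ultimately show ?thesis by (simp add: Phi_def norm_divide flip: s_def p_def)
qed

section \<open>The test functions on the bidisc\<close>

text \<open>With \<open>n = |\<alpha>|^2\<close> and denominators \<open>d\<close>,
  \<open>d'\<close>, the identity behind the three factors is that
  \<open>d d' - (1 - n)^2 a cnj a'\<close> equals
  \<open>(1 - a cnj a') (1 - n)^2 + (1 - p cnj p') n (1 - n)\<close> plus a rank-one term. As
  functions of \<open>\<alpha>\<close> they are continuous on the closed disc, so completely
  positive kernels can be applied to them.\<close>

definition psi_factor1 :: "complex \<Rightarrow> complex \<Rightarrow> complex"
  where "psi_factor1 p \<alpha> = complex_of_real (1 - (cmod \<alpha>)\<^sup>2) / (1 + \<alpha>\<^sup>2 * p)"

definition psi_factor2 :: "complex \<Rightarrow> complex \<Rightarrow> complex"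
  where "psi_factor2 p \<alpha> = complex_of_real (cmod \<alpha> * sqrt (1 - (cmod \<alpha>)\<^sup>2)) / (1 + \<alpha>\<^sup>2 * p)"

definition psi_factor3 :: "complex \<Rightarrow> complex \<Rightarrow> complex"
  where "psi_factor3 p \<alpha> = (cnj \<alpha> + \<alpha> * p) / (1 + \<alpha>\<^sup>2 * p)"

lemma psi_denominator:
  assumes "cmod p < 1" "cmod \<alpha> \<le> 1"
  shows "1 + \<alpha>\<^sup>2 * p \<noteq> 0"
proof
  assume "1 + \<alpha>\<^sup>2 * p = 0"
  then have "cmod (\<alpha>\<^sup>2 * p) = 1" by (metis add.commute eq_neg_iff_add_eq_0 norm_minus_cancel norm_one)
  moreover have "cmod (\<alpha>\<^sup>2 * p) \<le> 1 * cmod p"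
    unfolding norm_mult norm_power using assms(2) by (intro mult_right_mono power_le_one) auto
  ultimately show False using assms(1) by simp
qed

lemma psi_decomposition:
  assumes p: "cmod p < 1" "cmod p' < 1" and \<alpha>: "cmod \<alpha> \<le> 1"
  shows "1 - psi \<alpha> (a, 0, p) * cnj (psi \<alpha> (a', 0, p'))
    = (1 - a * cnj a') * (psi_factor1 p \<alpha> * cnj (psi_factor1 p' \<alpha>))
      + (1 - p * cnj p') * (psi_factor2 p \<alpha> * cnj (psi_factor2 p' \<alpha>)) + psi_factor3 p \<alpha> * cnj
          (psi_factor3 p' \<alpha>)"
proof -
  define d d' where "d = 1 + \<alpha>\<^sup>2 * p" and "d' = 1 + (cnj \<alpha>)\<^sup>2 * cnj p'"
  have d0: "d \<noteq> 0" unfolding d_def by (rule psi_denominator[OF p(1) \<alpha>])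
  have d': "cnj (1 + \<alpha>\<^sup>2 * p') = d'" by (simp add: d'_def)
  have d'0: "d' \<noteq> 0" using psi_denominator[OF p(2) \<alpha>] unfolding d'[symmetric]
      by (metis complex_cnj_zero_iff)
  define n where "n = \<alpha> * cnj \<alpha>"
  have n: "complex_of_real ((cmod \<alpha>)\<^sup>2) = n" by (simp only: n_def complex_norm_square)
  have sq: "complex_of_real (cmod \<alpha> * sqrt (1 - (cmod \<alpha>)\<^sup>2)) * complex_of_real (cmod \<alpha> * sqrt (1 -
      (cmod \<alpha>)\<^sup>2)) = n * (1 - n)"
  proof -
    have "(cmod \<alpha> * sqrt (1 - (cmod \<alpha>)\<^sup>2)) * (cmod \<alpha> * sqrt (1 - (cmod \<alpha>)\<^sup>2)) = (cmod \<alpha>)\<^sup>2 * (1 - (cmod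
        \<alpha>)\<^sup>2)"
      using \<alpha> by (simp add: power2_eq_square abs_square_le_1 mult_le_one algebra_simps)
    from arg_cong[OF this, of complex_of_real] show ?thesis
      by (simp only: n[symmetric] of_real_mult of_real_diff of_real_1)
  qed
  have cnj_n: "cnj n = n" by (simp add: n_def mult.commute)
  have f1: "psi_factor1 p \<alpha> * cnj (psi_factor1 p' \<alpha>) = (1 - n) * (1 - n) / (d * d')"
    by (simp add: psi_factor1_def d'[symmetric] d_def cnj_n n[symmetric] del: of_real_power)
  have f2: "psi_factor2 p \<alpha> * cnj (psi_factor2 p' \<alpha>) = n * (1 - n) / (d * d')"
    unfolding psi_factor2_def complex_cnj_divide complex_cnj_complex_of_real d'
        times_divide_times_eq sq d_def ..
  have f3: "psi_factor3 p \<alpha> * cnj (psi_factor3 p' \<alpha>) = (cnj \<alpha> + \<alpha> * p) * (\<alpha> + cnj \<alpha> * cnj p') / (d * d')"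
    unfolding psi_factor3_def complex_cnj_divide d' times_divide_times_eq d_def by simp
  have f0: "psi \<alpha> (a, 0, p) * cnj (psi \<alpha> (a', 0, p')) = (1 - n) * (1 - n) * (a * cnj a') / (d * d')"
    unfolding psi_def n by (simp add: d_def d'_def cnj_n)
  have "d * d' - (1 - n) * (1 - n) * (a * cnj a') = (1 - a * cnj a') * ((1 - n) * (1 - n))
      + (1 - p * cnj p') * (n * (1 - n)) + (cnj \<alpha> + \<alpha> * p) * (\<alpha> + cnj \<alpha> * cnj p')"
    by (simp add: d_def d'_def n_def power2_eq_square algebra_simps)
  then have "(d * d' - (1 - n) * (1 - n) * (a * cnj a')) / (d * d') = ((1 - a * cnj a') * ((1 - n) *
      (1 - n))
      + (1 - p * cnj p') * (n * (1 - n)) + (cnj \<alpha> + \<alpha> * p) * (\<alpha> + cnj \<alpha> * cnj p')) / (d * d')"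
    by simp
  then show ?thesis
    unfolding f0 f1 f2 f3 using d0 d'0 by (simp add: diff_divide_distrib add_divide_distrib)
qed

lemma Phi_decomposition:
  assumes \<alpha>: "cmod \<alpha> \<le> 1"
  shows "1 - Phi \<alpha> 0 p * cnj (Phi \<alpha> 0 p') = (1 - p * cnj p') * (\<alpha> * cnj \<alpha>)
    + complex_of_real (sqrt (1 - (cmod \<alpha>)\<^sup>2)) * cnj (complex_of_real (sqrt (1 - (cmod \<alpha>)\<^sup>2)))"
proof -
  have "complex_of_real (sqrt (1 - (cmod \<alpha>)\<^sup>2)) * cnj (complex_of_real (sqrt (1 - (cmod \<alpha>)\<^sup>2))) =
      complex_of_real (1 - (cmod \<alpha>)\<^sup>2)"
    using \<alpha> by (simp only: complex_cnj_complex_of_real of_real_mult[symmetric]) (simp add: power_le_one)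
  also have "\<dots> = 1 - \<alpha> * cnj \<alpha>" by (simp only: of_real_diff of_real_1 complex_norm_square)
  finally have "complex_of_real (sqrt (1 - (cmod \<alpha>)\<^sup>2)) * cnj (complex_of_real (sqrt (1 - (cmod
      \<alpha>)\<^sup>2))) = 1 - \<alpha> * cnj \<alpha>" .
  moreover have "Phi \<alpha> 0 q = \<alpha> * q" for q by (simp add: Phi_def)
  ultimately show ?thesis by (simp add: algebra_simps)
qed

text \<open>Averaging over \<open>\<alpha> = 1\<close> and \<open>\<alpha> = -1\<close> removes the cross terms.\<close>

lemma Phi_average:
  assumes z: "z \<in> pentablock" and w: "w \<in> pentablock"
  shows "1 - coord3 z * cnj (coord3 w) =
    (1 - coord2 z / 2) * cnj (1 - coord2 w / 2) / 2 *
      (1 - Phi 1 (coord2 z) (coord3 z) * cnj (Phi 1 (coord2 w) (coord3 w)))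
    + (1 + coord2 z / 2) * cnj (1 + coord2 w / 2) / 2 *
      (1 - Phi (-1) (coord2 z) (coord3 z) * cnj (Phi (-1) (coord2 w) (coord3 w)))"
proof -
  have P: "(1 - \<alpha> * coord2 u / 2) * Phi \<alpha> (coord2 u) (coord3 u) = \<alpha> * coord3 u - coord2 u / 2"
    if "u \<in> pentablock" "cmod \<alpha> \<le> 1" for u \<alpha>
    using pentablock_denominators(3)[OF that] by (simp add: Phi_def field_simps)
  have e: "a * cnj b / 2 * (1 - f * cnj g) = (a * cnj b - (a * f) * cnj (b * g)) / 2"
      for a b f g :: complex
    by (simp add: field_simps)
  have m: "1 + coord2 u / 2 = 1 - (- 1) * coord2 u / 2" "1 - coord2 u / 2 = 1 - 1 * coord2 u / 2" for u
    by simp_all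
  show ?thesis
    unfolding e unfolding m unfolding P[OF z, of 1, simplified] P[OF w, of 1, simplified]
      P[OF z, of "-1", simplified] P[OF w, of "-1", simplified]
    by (simp add: P[OF z, of 1, simplified] P[OF w, of 1, simplified]
      P[OF z, of "-1", simplified] P[OF w, of "-1", simplified]) (simp add: field_simps)
qed

section \<open>Operator kernels\<close>

text \<open>Scalar coefficients are absorbed into the vectors, and one swap of the double sum
  accounts for the exchanged indices.\<close>

lemma op_matrix_nonneg_iff_psd:
  "op_matrix_nonneg I M \<longleftrightarrow> (\<forall>v. psd I (\<lambda>i j. cinner (M j i *\<^sub>V v i) (v j)))"
proof
  assume M: "op_matrix_nonneg I M"
  show "\<forall>v. psd I (\<lambda>i j. cinner (M j i *\<^sub>V v i) (v j))"
    unfolding psd_def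
  proof (intro allI)
    fix v c
    have "(\<Sum>i\<in>I. \<Sum>j\<in>I. cinner (M j i *\<^sub>V v i) (v j) * (c i * cnj (c j)))
        = (\<Sum>i\<in>I. \<Sum>j\<in>I. cinner (M i j *\<^sub>V (c j *\<^sub>C v j)) (c i *\<^sub>C v i))"
      by (subst sum.swap) (simp add: cblinfun_scaleC cinner_scaleC_left cinner_scaleC_right ac_simps)
    then show "(\<Sum>i\<in>I. \<Sum>j\<in>I. cinner (M j i *\<^sub>V v i) (v j) * (c i * cnj (c j))) \<in> \<real>\<^sub>\<ge>\<^sub>0"
      using M[unfolded op_matrix_nonneg_def, rule_format, of "\<lambda>i. c i *\<^sub>C v i"] by simp
  qed
next
  assume *: "\<forall>v. psd I (\<lambda>i j. cinner (M j i *\<^sub>V v i) (v j))"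
  show "op_matrix_nonneg I M"
    unfolding op_matrix_nonneg_def
  proof
    fix v
    have "(\<Sum>i\<in>I. \<Sum>j\<in>I. cinner (M j i *\<^sub>V v i) (v j) * (1 * cnj 1)) \<in> \<real>\<^sub>\<ge>\<^sub>0"
      using *[rule_format, of v, unfolded psd_def, rule_format, of "\<lambda>_. 1"] .
    then show "(\<Sum>i\<in>I. \<Sum>j\<in>I. cinner (M i j *\<^sub>V v j) (v i)) \<in> \<real>\<^sub>\<ge>\<^sub>0"
      by (subst sum.swap) simp
  qed
qed

lemma psd_reindex:
  assumes h: "bij_betw h A I" and K: "psd A (\<lambda>a b. K (h a) (h b))"
  shows "psd I K"
  unfolding psd_def
proof
  fix c
  have "(\<Sum>i\<in>I. \<Sum>j\<in>I. K i j * (c i * cnj (c j))) = (\<Sum>a\<in>A. \<Sum>b\<in>A. K (h a) (h b) * (c (h a) * cnj (c (h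
      b))))"
    by (subst sum.reindex_bij_betw[OF h, symmetric], subst sum.reindex_bij_betw[OF h, symmetric])
        (rule refl)
  then show "(\<Sum>i\<in>I. \<Sum>j\<in>I. K i j * (c i * cnj (c j))) \<in> \<real>\<^sub>\<ge>\<^sub>0"
    using K[unfolded psd_def, rule_format, of "\<lambda>a. c (h a)"] by simp
qed

lemma weak_kernel_psd:
  assumes k: "weak_kernel k" and I: "finite I" and z: "\<And>i. i \<in> I \<Longrightarrow> z i \<in> pentablock"
  shows "psd I (\<lambda>i j. cinner (k (z j) (z i) *\<^sub>V v i) (v j))"
proof -
  obtain h where h: "bij_betw h {0..<card I} I" using ex_bij_betw_nat_finite[OF I] by blast
  then have h': "bij_betw h {..<card I} I" by (simp add: atLeast0LessThan)
  have "z (h a) \<in> pentablock" if "a < card I" for a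
    using bij_betw_apply[OF h', of a] that z by simp
  then have "op_matrix_nonneg {..<card I} (\<lambda>a b. k (z (h a)) (z (h b)))"
    using k[unfolded weak_kernel_def, rule_format, of "card I" "\<lambda>a. z (h a)"] by simp
  then show ?thesis
    using psd_reindex[OF h', of "\<lambda>i j. cinner (k (z j) (z i) *\<^sub>V v i) (v j)"]
    unfolding op_matrix_nonneg_iff_psd by simp
qed

lemma weak_kernelI:
  assumes "\<And>n (z :: nat \<Rightarrow> _) v. (\<And>i. i < n \<Longrightarrow> z i \<in> pentablock) \<Longrightarrow>
    psd {..<n} (\<lambda>i j. cinner (k (z j) (z i) *\<^sub>V v i) (v j))"
  shows "weak_kernel k"
  unfolding weak_kernel_def op_matrix_nonneg_iff_psd using assms by blast

lemma weak_kernel_add: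
  assumes "weak_kernel k" "weak_kernel l"
  shows "weak_kernel (\<lambda>z w. k z w + l z w)"
proof (rule weak_kernelI)
  fix n :: nat and z :: "nat \<Rightarrow> complex \<times> complex \<times> complex" and v :: "nat \<Rightarrow> 'a"
  assume "\<And>i. i < n \<Longrightarrow> z i \<in> pentablock"
  then show "psd {..<n} (\<lambda>i j. cinner ((k (z j) (z i) + l (z j) (z i)) *\<^sub>V v i) (v j))"
    unfolding cblinfun_add_left cinner_add_left by (intro psd_add weak_kernel_psd assms) auto
qed

lemma weak_kernel_scale:
  assumes "weak_kernel k"
  shows "weak_kernel (\<lambda>z w. (f z * cnj (f w)) *\<^sub>C k z w)"
proof (rule weak_kernelI)
  fix n :: nat and z :: "nat \<Rightarrow> complex \<times> complex \<times> complex" and v :: "nat \<Rightarrow> 'a"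
  assume z: "\<And>i. i < n \<Longrightarrow> z i \<in> pentablock"
  have "psd {..<n} (\<lambda>i j. cnj (f (z i)) * cnj (cnj (f (z j))) * cinner (k (z j) (z i) *\<^sub>V v i) (v j))"
    using z by (intro psd_scale weak_kernel_psd assms) auto
  then show "psd {..<n} (\<lambda>i j. cinner (((f (z j) * cnj (f (z i))) *\<^sub>C k (z j) (z i)) *\<^sub>V v i) (v j))"
    by (simp add: cblinfun_scaleC_left cinner_scaleC_left mult.commute)
qed

lemma op_matrix_nonneg_add:
  assumes "op_matrix_nonneg I M" "op_matrix_nonneg I N"
  shows "op_matrix_nonneg I (\<lambda>i j. M i j + N i j)"
  using assms unfolding op_matrix_nonneg_iff_psd cblinfun_add_left cinner_add_left by (simp add: psd_add)

lemma op_matrix_nonneg_cong: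
  assumes "\<And>i j. i \<in> I \<Longrightarrow> j \<in> I \<Longrightarrow> M i j = N i j"
  shows "op_matrix_nonneg I M \<longleftrightarrow> op_matrix_nonneg I N"
  unfolding op_matrix_nonneg_def using assms by (simp cong: sum.cong)

lemma tensor_vec_linear:
  "x \<otimes>\<^sub>v (y + y') = x \<otimes>\<^sub>v y + x \<otimes>\<^sub>v y'" "(x + x') \<otimes>\<^sub>v y = x \<otimes>\<^sub>v y + x' \<otimes>\<^sub>v y"
  "(a *\<^sub>C x) \<otimes>\<^sub>v y = a *\<^sub>C (x \<otimes>\<^sub>v y)" "x \<otimes>\<^sub>v (a *\<^sub>C y) = a *\<^sub>C (x \<otimes>\<^sub>v y)"
  unfolding tensor_vec_def to_completion_add[symmetric] to_completion_scaleC[symmetric]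
  by (rule arg_cong[where f = to_completion], simp add: form_of_inject[symmetric] alg_tensor_vec.rep_eq
      plus_alg_tensor.rep_eq scaleC_alg_tensor.rep_eq tensor_form_def fun_eq_iff cinner_add_left
      cinner_scaleC_left algebra_simps)+

lemma tensor_op_linear:
  "(A + B) \<otimes>\<^sub>o C = A \<otimes>\<^sub>o C + B \<otimes>\<^sub>o C" "(a *\<^sub>C A) \<otimes>\<^sub>o C = A \<otimes>\<^sub>o (a *\<^sub>C C)"
  by (rule hilbert_tensor_eqI, simp add: tensor_op_vec cblinfun_add_left cblinfun_scaleC_left
      tensor_vec_linear)+

lemma to_completion_tensor_sum:
  fixes F :: "('a::complex_inner, 'b::complex_inner) alg_tensor"
  shows "\<exists>m x y. to_completion F = (\<Sum>l<(m::nat). x l \<otimes>\<^sub>v y l)"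
proof (induction F rule: alg_tensor_induct)
  case 1
  have "to_completion (0 :: ('a, 'b) alg_tensor) = 0"
    using to_completion_scaleC[of 0 "0 :: ('a, 'b) alg_tensor"] by simp
  then show ?case by (intro exI[of _ 0]) simp
next
  case (2 a b F)
  then obtain m x y where F: "to_completion F = (\<Sum>l<(m::nat). x l \<otimes>\<^sub>v y l)" by blast
  have "to_completion (alg_tensor_vec a b + F) = (\<Sum>l<Suc m. (x(m := a)) l \<otimes>\<^sub>v (y(m := b)) l)"
    by (simp add: to_completion_add F tensor_vec_def[of a b, symmetric] add.commute)
  then show ?case by blast
qed

text \<open>The Schur product theorem on elementary tensors, extended by density.\<close>

lemma tensor_weak_kernel:
  fixes K :: "complex \<times> complex \<times> complex \<Rightarrow> complex \<times> complex \<times> complex \<Rightarrow> 'a::chilbert_space \<Rightarrow>\<^sub>C\<^sub>L 'a"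
    and k :: "complex \<times> complex \<times> complex \<Rightarrow> complex \<times> complex \<times> complex \<Rightarrow> 'b::chilbert_space \<Rightarrow>\<^sub>C\<^sub>L 'b"
  assumes K: "weak_kernel K" and k: "weak_kernel k" and F: "finite F" "F \<subseteq> pentablock"
  shows "op_matrix_nonneg F (\<lambda>z w. K z w \<otimes>\<^sub>o k z w)"
  unfolding op_matrix_nonneg_def
proof
  fix u :: "complex \<times> complex \<times> complex \<Rightarrow> ('a, 'b) hilbert_tensor"
  have alg: "(\<Sum>z\<in>F. \<Sum>w\<in>F. cinner ((K z w \<otimes>\<^sub>o k z w) *\<^sub>V to_completion (f w)) (to_completion (f z))) \<in>
      \<real>\<^sub>\<ge>\<^sub>0" for f
  proof -
    have "\<exists>t :: nat \<times> (nat \<Rightarrow> 'a) \<times> (nat \<Rightarrow> 'b). to_completion (f z) = (\<Sum>l<fst t. fst (snd t) l \<otimes>\<^sub>v snd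
        (snd t) l)" for z
    proof -
      obtain m x y where "to_completion (f z) = (\<Sum>l<(m::nat). x l \<otimes>\<^sub>v y l)"
        using to_completion_tensor_sum[of "f z"] by blast
      then show ?thesis by (intro exI[of _ "(m, x, y)"]) simp
    qed
    then obtain t :: "complex \<times> complex \<times> complex \<Rightarrow> nat \<times> (nat \<Rightarrow> 'a) \<times> (nat \<Rightarrow> 'b)"
      where t: "\<And>z. to_completion (f z) = (\<Sum>l<fst (t z). fst (snd (t z)) l \<otimes>\<^sub>v snd (snd (t z)) l)"
      by metis
    define m x y where "m z = fst (t z)" and "x z = fst (snd (t z))" and "y z = snd (snd (t z))" for z
    have f: "to_completion (f z) = (\<Sum>l<m z. x z l \<otimes>\<^sub>v y z l)" for z
      unfolding m_def x_def y_def by (rule t)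
    \<comment> \<open>One index for each point and each elementary tensor at that point; in these
      indices the sum is a pairing of two positive matrices.\<close>
    define I where "I = Sigma F (\<lambda>z. {..<m z})"
    have I: "finite I" using F by (simp add: I_def)
    have sig: "(\<Sum>w\<in>F. \<Sum>a<m w. h (w, a)) = (\<Sum>i\<in>I. h i)" for h :: "_ \<Rightarrow> complex"
      unfolding I_def using F by (simp add: sum.Sigma case_prod_unfold)
    have IP: "i \<in> I \<Longrightarrow> fst i \<in> pentablock" for i using F by (auto simp: I_def)
    define c where "c i j = cinner (K (fst j) (fst i) *\<^sub>V x (fst i) (snd i)) (x (fst j) (snd j))
      * cinner (k (fst j) (fst i) *\<^sub>V y (fst i) (snd i)) (y (fst j) (snd j))" for i j
    have "(\<Sum>z\<in>F. \<Sum>w\<in>F. cinner ((K z w \<otimes>\<^sub>o k z w) *\<^sub>V to_completion (f w)) (to_completion (f z)))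
        = (\<Sum>z\<in>F. \<Sum>w\<in>F. \<Sum>a<m w. \<Sum>b<m z. c (w, a) (z, b))"
      unfolding f cblinfun_sum unfolding cinner_sum_left
          unfolding cinner_sum_right tensor_op_vec cinner_tensor_vec
      by (simp add: c_def)
    also have "\<dots> = (\<Sum>w\<in>F. \<Sum>z\<in>F. \<Sum>a<m w. \<Sum>b<m z. c (w, a) (z, b))" by (rule sum.swap)
    also have "\<dots> = (\<Sum>w\<in>F. \<Sum>a<m w. \<Sum>z\<in>F. \<Sum>b<m z. c (w, a) (z, b))"
      by (intro sum.cong refl sum.swap)
    also have "\<dots> = (\<Sum>w\<in>F. \<Sum>a<m w. \<Sum>j\<in>I. c (w, a) j)"
      by (intro sum.cong refl sig)
    also have "\<dots> = (\<Sum>i\<in>I. \<Sum>j\<in>I. c i j)" by (rule sig)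
    also have "\<dots> \<in> \<real>\<^sub>\<ge>\<^sub>0"
      unfolding c_def
      using weak_kernel_psd[OF K I IP, where v = "\<lambda>i. x (fst i) (snd i)"] weak_kernel_psd[OF k I IP,
          where v = "\<lambda>i. y (fst i) (snd i)"]
      by (intro psd_sum_mult[OF I])
    finally show ?thesis .
  qed
  have "\<forall>z. \<exists>s. (\<lambda>n. to_completion (s n)) \<longlonglongrightarrow> u z"
    by (intro allI to_completion_dense)
  from choice[OF this] obtain s where "\<forall>z. (\<lambda>n. to_completion (s z n)) \<longlonglongrightarrow> u z" ..
  then have s: "(\<lambda>n. to_completion (s z n)) \<longlonglongrightarrow> u z" for z by blast
  have "(\<lambda>n. \<Sum>z\<in>F. \<Sum>w\<in>F. cinner ((K z w \<otimes>\<^sub>o k z w) *\<^sub>V to_completion (s w n)) (to_completion (s z n)))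
      \<longlonglongrightarrow> (\<Sum>z\<in>F. \<Sum>w\<in>F. cinner ((K z w \<otimes>\<^sub>o k z w) *\<^sub>V u w) (u z))"
    by (intro tendsto_sum tendsto_cinner bounded_linear.tendsto[OF cblinfun_bounded_linear] s)
  then show "(\<Sum>z\<in>F. \<Sum>w\<in>F. cinner ((K z w \<otimes>\<^sub>o k z w) *\<^sub>V u w) (u z)) \<in> \<real>\<^sub>\<ge>\<^sub>0"
    by (rule Lim_in_closed_set[OF closed_nonneg_Reals_complex _ sequentially_bot, rotated]) (simp
        add: alg)
qed

section \<open>From a factorization to the two kernel conditions\<close>

definition factor_gap :: "(complex \<times> complex \<Rightarrow> 'l1::chilbert_space \<Rightarrow>\<^sub>C\<^sub>L 'l2::chilbert_space) \<Rightarrow>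
    (complex \<times> complex \<Rightarrow> 'l3::chilbert_space \<Rightarrow>\<^sub>C\<^sub>L 'l2) \<Rightarrow> complex \<times> complex \<Rightarrow> complex \<times> complex \<Rightarrow> 'l2
        \<Rightarrow>\<^sub>C\<^sub>L 'l2"
  where "factor_gap A B z w = A z o\<^sub>C\<^sub>L adj (A w) - B z o\<^sub>C\<^sub>L adj (B w)"

lemma cinner_factor_gap: "cinner (factor_gap A B z w *\<^sub>V v) u =
    cinner (adj (A w) *\<^sub>V v) (adj (A z) *\<^sub>V u) - cinner (adj (B w) *\<^sub>V v) (adj (B z) *\<^sub>V u)"
  by (simp add: factor_gap_def cblinfun_diff_left cinner_diff_left cinner_adj)

text \<open>With \<open>B = A S\<close> the gap is \<open>A (1 - S adj S) adj A\<close>, so its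
  kernels are the Agler kernels of \<open>S\<close> conjugated by \<open>A\<close> and pulled back
  along \<open>coord13\<close>. They are bounded forms at each pair of points, hence
  operators.\<close>

lemma gap_decomposition:
  fixes A :: "complex \<times> complex \<Rightarrow> 'l1::chilbert_space \<Rightarrow>\<^sub>C\<^sub>L 'l2::chilbert_space"
    and B :: "complex \<times> complex \<Rightarrow> 'l3::chilbert_space \<Rightarrow>\<^sub>C\<^sub>L 'l2"
  assumes S: "S \<in> H_infty" "H_infty_norm S \<le> 1" and AS: "\<And>z. z \<in> bidisc \<Longrightarrow> A z o\<^sub>C\<^sub>L S z = B z"
  obtains K1 K2 where "weak_kernel K1" "weak_kernel K2"
    "\<And>z w. z \<in> pentablock \<Longrightarrow> w \<in> pentablock \<Longrightarrow> factor_gap A B (coord13 z) (coord13 w) =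
      (1 - coord1 z * cnj (coord1 w)) *\<^sub>C K1 z w + (1 - coord3 z * cnj (coord3 w)) *\<^sub>C K2 z w"
proof -
  obtain \<kappa>1 \<kappa>2 where \<kappa>: "agler_pair S \<kappa>1 \<kappa>2" using agler_decomposition[OF S] by blast
  have pk: "pos_kernel \<kappa>1" "pos_kernel \<kappa>2" using \<kappa> by (auto simp: agler_pair_def)
  define a where "a z = adj (A (coord13 z))" for z
  have ex: "\<exists>K. weak_kernel K \<and> (\<forall>z\<in>pentablock. \<forall>w\<in>pentablock. \<forall>v u.
      cinner (K z w *\<^sub>V v) u = \<kappa> (coord13 w) (coord13 z) (a w *\<^sub>V v) (a z *\<^sub>V u))"
    if pos: "pos_kernel \<kappa>" and bd: "\<And>w z. w \<in> bidisc \<Longrightarrow> z \<in> bidisc \<Longrightarrow> \<exists>C\<ge>0. \<forall>x y. cmod (\<kappa> w z x y) \<le> C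
        * norm x * norm y" for \<kappa>
  proof -
    have "\<exists>T :: 'l2 \<Rightarrow>\<^sub>C\<^sub>L 'l2. \<forall>v u. cinner (T *\<^sub>V v) u = \<kappa> (coord13 w) (coord13 z) (a w *\<^sub>V v) (a z *\<^sub>V u)"
      if zw: "z \<in> pentablock" "w \<in> pentablock" for z w
    proof -
      obtain C where C: "0 \<le> C" "\<And>x y. cmod (\<kappa> (coord13 w) (coord13 z) x y) \<le> C * norm x * norm y"
        using bd[OF coord13_bidisc[OF zw(2)] coord13_bidisc[OF zw(1)]] by blast
      have ses: "sesq (\<kappa> (coord13 w) (coord13 z))" using pos unfolding pos_kernel_def by blast
      define N where "N = norm (a w) * norm (a z)"
      obtain T :: "'l2 \<Rightarrow>\<^sub>C\<^sub>L 'l2" where "\<And>v u. cinner (T *\<^sub>V v) u = \<kappa> (coord13 w) (coord13 z) (a w *\<^sub>V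
          v) (a z *\<^sub>V u)"
      proof (rule cblinfun_of_form[of "\<lambda>v u. \<kappa> (coord13 w) (coord13 z) (a w *\<^sub>V v) (a z *\<^sub>V u)" "C * N"])
        fix v u
        have "cmod (\<kappa> (coord13 w) (coord13 z) (a w *\<^sub>V v) (a z *\<^sub>V u)) \<le> C * norm (a w *\<^sub>V v) * norm (a
            z *\<^sub>V u)"
          by (rule C(2))
        also have "\<dots> \<le> C * (norm (a w) * norm v) * (norm (a z) * norm u)"
          using C(1) by (intro mult_mono norm_cblinfun) auto
        finally show "cmod (\<kappa> (coord13 w) (coord13 z) (a w *\<^sub>V v) (a z *\<^sub>V u)) \<le> C * N * norm v * norm u"
          by (simp add: N_def ac_simps)
      qed ((simp add: sesqD[OF ses] cblinfun_add cblinfun_scaleC C(1) N_def; fail) | meson)+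
      then show ?thesis by blast
    qed
    then obtain K where K: "\<And>z w v u. z \<in> pentablock \<Longrightarrow> w \<in> pentablock \<Longrightarrow>
        cinner (K z w *\<^sub>V v) u = \<kappa> (coord13 w) (coord13 z) (a w *\<^sub>V v) (a z *\<^sub>V u)" by metis
    have "weak_kernel K"
    proof (rule weak_kernelI)
      fix n :: nat and z :: "nat \<Rightarrow> complex \<times> complex \<times> complex" and v :: "nat \<Rightarrow> 'l2"
      assume z: "\<And>i. i < n \<Longrightarrow> z i \<in> pentablock"
      have "psd {..<n} (\<lambda>i j. \<kappa> (coord13 (z i)) (coord13 (z j)) (a (z i) *\<^sub>V v i) (a (z j) *\<^sub>V v j))"
        by (rule pos_kernel_psd[OF pos]) (use z coord13_bidisc in auto)
      then show "psd {..<n} (\<lambda>i j. cinner (K (z j) (z i) *\<^sub>V v i) (v j))"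
        by (rule psd_cong[THEN iffD1, rotated]) (use z K in auto)
    qed
    with K show ?thesis by blast
  qed
  have bd1: "\<exists>C\<ge>0. \<forall>x y. cmod (\<kappa>1 w z x y) \<le> C * norm x * norm y" if "w \<in> bidisc" "z \<in> bidisc" for w z
    using agler_pair_bound(1)[OF \<kappa> that] one_minus_square_pos(1)[OF that(1)]
        one_minus_square_pos(1)[OF that(2)]
    by (intro exI[of _ "1 / sqrt (1 - (cmod (fst w))\<^sup>2) * (1 / sqrt (1 - (cmod (fst z))\<^sup>2))"]) auto
  have bd2: "\<exists>C\<ge>0. \<forall>x y. cmod (\<kappa>2 w z x y) \<le> C * norm x * norm y" if "w \<in> bidisc" "z \<in> bidisc" for w z
    using agler_pair_bound(2)[OF \<kappa> that] one_minus_square_pos(2)[OF that(1)]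
        one_minus_square_pos(2)[OF that(2)]
    by (intro exI[of _ "1 / sqrt (1 - (cmod (snd w))\<^sup>2) * (1 / sqrt (1 - (cmod (snd z))\<^sup>2))"]) auto
  obtain K1 where K1: "weak_kernel K1" "\<And>z w v u. z \<in> pentablock \<Longrightarrow> w \<in> pentablock \<Longrightarrow>
      cinner (K1 z w *\<^sub>V v) u = \<kappa>1 (coord13 w) (coord13 z) (a w *\<^sub>V v) (a z *\<^sub>V u)"
    using ex[OF pk(1) bd1] by blast
  obtain K2 where K2: "weak_kernel K2" "\<And>z w v u. z \<in> pentablock \<Longrightarrow> w \<in> pentablock \<Longrightarrow>
      cinner (K2 z w *\<^sub>V v) u = \<kappa>2 (coord13 w) (coord13 z) (a w *\<^sub>V v) (a z *\<^sub>V u)"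
    using ex[OF pk(2) bd2] by blast
  show thesis
  proof (rule that[OF K1(1) K2(1)])
    fix z w assume zw: "z \<in> pentablock" "w \<in> pentablock"
    have adjB: "adj (B y) *\<^sub>V v = adj (S y) *\<^sub>V (adj (A y) *\<^sub>V v)" if "y \<in> bidisc" for y v
      by (rule cinner_eqI_right) (simp add: AS[OF that, symmetric] flip: cinner_adj)
    have c: "coord13 z \<in> bidisc" "coord13 w \<in> bidisc" using zw by (simp_all add: coord13_bidisc)
    show "factor_gap A B (coord13 z) (coord13 w) =
      (1 - coord1 z * cnj (coord1 w)) *\<^sub>C K1 z w + (1 - coord3 z * cnj (coord3 w)) *\<^sub>C K2 z w"
    proof (rule cblinfun_eqI, rule cinner_eqI)
      fix v u
      have "cinner (factor_gap A B (coord13 z) (coord13 w) *\<^sub>V v) u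
        = cinner (a w *\<^sub>V v) (a z *\<^sub>V u) - cinner (adj (S (coord13 w)) *\<^sub>V (a w *\<^sub>V v)) (adj (S (coord13
            z)) *\<^sub>V (a z *\<^sub>V u))"
        by (simp add: cinner_factor_gap a_def adjB c)
      also have "\<dots> = (1 - cnj (fst (coord13 w)) * fst (coord13 z)) * \<kappa>1 (coord13 w) (coord13 z) (a w
          *\<^sub>V v) (a z *\<^sub>V u)
          + (1 - cnj (snd (coord13 w)) * snd (coord13 z)) * \<kappa>2 (coord13 w) (coord13 z) (a w *\<^sub>V v) (a
              z *\<^sub>V u)"
        using \<kappa> c unfolding agler_pair_def by blast
      finally show "cinner (factor_gap A B (coord13 z) (coord13 w) *\<^sub>V v) u =
          cinner (((1 - coord1 z * cnj (coord1 w)) *\<^sub>C K1 z w + (1 - coord3 z * cnj (coord3 w)) *\<^sub>C K2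
              z w) *\<^sub>V v) u"
        by (simp add: cblinfun_add_left cblinfun_scaleC_left cinner_add_left cinner_scaleC_left
            K1(2) K2(2) zw
            coord13_def mult.commute)
    qed
  qed
qed

lemma psi_zero: "psi 0 z = coord1 z"
  by (simp add: psi_def)

text \<open>A scalar weight may be moved from the first tensor factor to the second, where
  admissibility of \<open>k\<close> makes the weighted kernel positive. What remains is a sum of
  tensor products of weak kernels.\<close>

lemma kernel_condition_of_decomposition:
  assumes K: "weak_kernel K1" "weak_kernel K2"
    and eq: "\<And>z w. z \<in> pentablock \<Longrightarrow> w \<in> pentablock \<Longrightarrow> G z w =
      (1 - coord1 z * cnj (coord1 w)) *\<^sub>C K1 z w + (1 - coord3 z * cnj (coord3 w)) *\<^sub>C K2 z w"
    and k: "admissible_kernel k" and F: "finite F" "F \<subseteq> pentablock"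
  shows "op_matrix_nonneg F (\<lambda>z w. G z w \<otimes>\<^sub>o k z w)"
proof -
  \<comment> \<open>The 1/2 in \<open>Phi_average\<close> is shared as two factors
    \<open>1 / sqrt 2\<close>, so that the weight has the form \<open>f z * cnj (f w)\<close>;
    \<open>\<alpha> = 1\<close> and \<open>\<alpha> = -1\<close> give the two terms.\<close>
  define L where "L \<alpha> z w = ((1 - \<alpha> * coord2 z / 2) / complex_of_real (sqrt 2) * cnj ((1 - \<alpha> *
      coord2 w / 2) / complex_of_real (sqrt 2))) *\<^sub>C K2 z w"
    for \<alpha> z w
  have L: "weak_kernel (L \<alpha>)" for \<alpha> unfolding L_def by (rule weak_kernel_scale[OF K(2)])
  have s2: "complex_of_real (sqrt 2) * complex_of_real (sqrt 2) = 2" by (simp flip: of_real_mult)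
  define P where "P \<alpha> z w = 1 - Phi \<alpha> (coord2 z) (coord3 z) * cnj (Phi \<alpha> (coord2 w) (coord3 w))"
      for \<alpha> z w
  have G: "G z w = (1 - psi 0 z * cnj (psi 0 w)) *\<^sub>C K1 z w + P 1 z w *\<^sub>C L 1 z w + P (-1) z w *\<^sub>C L
      (-1) z w"
    if "z \<in> pentablock" "w \<in> pentablock" for z w
    unfolding eq[OF that] Phi_average[OF that] psi_zero
    by (simp add: L_def P_def scaleC_add_left scaleC_scaleC s2 ac_simps)
  have t: "op_matrix_nonneg F (\<lambda>z w. M z w \<otimes>\<^sub>o (f z w *\<^sub>C k z w))"
      if "weak_kernel M" "weak_kernel (\<lambda>z w. f z w *\<^sub>C k z w)" for M f
    by (rule tensor_weak_kernel[OF that F])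
  have adm: "weak_kernel (\<lambda>z w. P \<alpha> z w *\<^sub>C k z w)" "weak_kernel (\<lambda>z w. (1 - psi \<alpha> z * cnj (psi \<alpha> w))
      *\<^sub>C k z w)"
    if "cmod \<alpha> \<le> 1" for \<alpha>
    using k that unfolding admissible_kernel_def P_def by auto
  have "op_matrix_nonneg F (\<lambda>z w. K1 z w \<otimes>\<^sub>o ((1 - psi 0 z * cnj (psi 0 w)) *\<^sub>C k z w)
      + L 1 z w \<otimes>\<^sub>o (P 1 z w *\<^sub>C k z w) + L (-1) z w \<otimes>\<^sub>o (P (-1) z w *\<^sub>C k z w))"
    by (intro op_matrix_nonneg_add t K L adm) auto
  then show ?thesis
    by (rule op_matrix_nonneg_cong[THEN iffD1, rotated])
      (simp add: tensor_op_linear G subsetD[OF F(2)])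
qed

text \<open>Evaluation at \<open>a\<close> is multiplicative, so it sends
  \<open>h i * cnj (h j)\<close> to a rank-one matrix, which with \<open>f\<close> only rescales the
  positive kernel \<open>K\<close>.\<close>

lemma evaluation_kernel:
  fixes K :: "complex \<times> complex \<times> complex \<Rightarrow> complex \<times> complex \<times> complex \<Rightarrow> 'l::complex_inner \<Rightarrow>\<^sub>C\<^sub>L 'l"
  assumes K: "weak_kernel K"
  obtains \<xi> where "cp_kernel \<xi>" "\<And>z w h. \<xi> z w *\<^sub>V h = (apply_bcontfun h a * f z * cnj (f w)) *\<^sub>C K z w"
proof -
  have "\<exists>T :: (closed_disc \<Rightarrow>\<^sub>C complex) \<Rightarrow>\<^sub>C\<^sub>L ('l \<Rightarrow>\<^sub>C\<^sub>L 'l). \<forall>h. T *\<^sub>V h = (apply_bcontfun h a * f z * cnj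
      (f w)) *\<^sub>C K z w" for z w
  proof (rule cblinfun_of_fun[of "\<lambda>h. (apply_bcontfun h a * f z * cnj (f w)) *\<^sub>C K z w" "cmod (f z) *
      cmod (f w) * norm (K z w)"])
    fix h :: "closed_disc \<Rightarrow>\<^sub>C complex"
    have "cmod (apply_bcontfun h a) * (cmod (f z) * cmod (f w) * norm (K z w)) \<le> norm h * (cmod (f
        z) * cmod (f w) * norm (K z w))"
      by (intro mult_right_mono norm_bounded) auto
    then show "norm ((apply_bcontfun h a * f z * cnj (f w)) *\<^sub>C K z w) \<le> cmod (f z) * cmod (f w) *
        norm (K z w) * norm h"
      by (simp add: norm_scaleC norm_mult ac_simps)
  qed ((simp add: plus_bcontfun.rep_eq scaleC_bcontfun.rep_eq scaleC_complex_def distrib_right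
      scaleC_add_left
      scaleC_scaleC mult.assoc; fail) | blast)+
  then obtain \<xi> :: "_ \<Rightarrow> _ \<Rightarrow> (closed_disc \<Rightarrow>\<^sub>C complex) \<Rightarrow>\<^sub>C\<^sub>L ('l \<Rightarrow>\<^sub>C\<^sub>L 'l)"
    where \<xi>: "\<And>z w h. \<xi> z w *\<^sub>V h = (apply_bcontfun h a * f z * cnj (f w)) *\<^sub>C K z w" by metis
  have "cp_kernel \<xi>"
    unfolding cp_kernel_def op_matrix_nonneg_iff_psd
  proof (intro allI impI)
    fix n :: nat and z :: "nat \<Rightarrow> complex \<times> complex \<times> complex" and h v
    assume z: "\<forall>i<n. z i \<in> pentablock"
    define g where "g i = cnj (apply_bcontfun (h i) a * f (z i))" for i
    have "psd {..<n} (\<lambda>i j. g i * cnj (g j) * cinner (K (z j) (z i) *\<^sub>V v i) (v j))"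
      using z by (intro psd_scale weak_kernel_psd K) auto
    then show "psd {..<n} (\<lambda>i j. cinner ((\<xi> (z j) (z i) *\<^sub>V times_cnj (h j) (h i)) *\<^sub>V v i) (v j))"
      by (simp add: \<xi> g_def times_cnj.rep_eq cblinfun_scaleC_left cinner_scaleC_left ac_simps)
  qed
  then show thesis using that \<xi> by blast
qed

lemma cp_kernel_add:
  assumes "cp_kernel \<xi>" "cp_kernel \<eta>"
  shows "cp_kernel (\<lambda>z w. \<xi> z w + \<eta> z w)"
  unfolding cp_kernel_def cblinfun_add_left
proof (intro allI impI)
  fix n :: nat and z :: "nat \<Rightarrow> complex \<times> complex \<times> complex" and h
  assume z: "\<forall>i<n. z i \<in> pentablock"
  show "op_matrix_nonneg {..<n} (\<lambda>i j. \<xi> (z i) (z j) *\<^sub>V times_cnj (h i) (h j) + \<eta> (z i) (z j) *\<^sub>V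
      times_cnj (h i) (h j))"
    using assms z unfolding cp_kernel_def by (intro op_matrix_nonneg_add) simp_all
qed

text \<open>Evaluation at 0 extracts \<open>1 - z_1 cnj w_1\<close> from \<open>J_map\<close>;
  evaluations at 1 and -1 extract from \<open>j_map\<close> the two terms of the average. The
  witness for \<open>\<delta>\<close> is 0.\<close>

lemma cp_condition_of_decomposition:
  fixes K1 K2 :: "complex \<times> complex \<times> complex \<Rightarrow> complex \<times> complex \<times> complex \<Rightarrow> 'l::complex_inner \<Rightarrow>\<^sub>C\<^sub>L 'l"
  assumes K: "weak_kernel K1" "weak_kernel K2"
    and eq: "\<And>z w. z \<in> pentablock \<Longrightarrow> w \<in> pentablock \<Longrightarrow> G z w =
      (1 - coord1 z * cnj (coord1 w)) *\<^sub>C K1 z w + (1 - coord3 z * cnj (coord3 w)) *\<^sub>C K2 z w"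
  shows "\<exists>\<xi> \<eta> \<delta>. cp_kernel \<xi> \<and> cp_kernel \<eta> \<and> weak_kernel \<delta> \<and>
    (\<forall>z\<in>pentablock. \<forall>w\<in>pentablock. G z w =
      \<xi> z w *\<^sub>V (const_bcontfun 1 - times_cnj (J_map z) (J_map w))
      + \<eta> z w *\<^sub>V (const_bcontfun 1 - times_cnj (j_map z) (j_map w))
      + (1 - coord2 z * cnj (coord2 w) / 4) *\<^sub>C \<delta> z w)"
proof -
  have val: "disc_val (Closed_disc \<alpha>) = \<alpha>" if "cmod \<alpha> \<le> 1" for \<alpha>
    using that by (simp add: Closed_disc_inverse)
  define f where "f \<alpha> z = (1 - \<alpha> * coord2 z / 2) / complex_of_real (sqrt 2)" for \<alpha>
      and z :: "complex \<times> complex \<times> complex"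
  have s2: "complex_of_real (sqrt 2) * complex_of_real (sqrt 2) = 2" by (simp flip: of_real_mult)
  obtain \<xi> where \<xi>: "cp_kernel \<xi>" "\<And>z w h. \<xi> z w *\<^sub>V h = (apply_bcontfun h (Closed_disc 0) * 1 * cnj
      1) *\<^sub>C K1 z w"
    by (rule evaluation_kernel[OF K(1), of "Closed_disc 0" "\<lambda>_. 1"]) (rule that, assumption+)
  obtain \<eta>1 where \<eta>1: "cp_kernel \<eta>1" "\<And>z w h. \<eta>1 z w *\<^sub>V h = (apply_bcontfun h (Closed_disc 1) * f 1
      z * cnj (f 1 w)) *\<^sub>C K2 z w"
    by (rule evaluation_kernel[OF K(2), of "Closed_disc 1" "f 1"]) (rule that, assumption+)
  obtain \<eta>2 where \<eta>2: "cp_kernel \<eta>2" "\<And>z w h. \<eta>2 z w *\<^sub>V h = (apply_bcontfun h (Closed_disc (-1)) * f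
      (-1) z * cnj (f (-1) w)) *\<^sub>C K2 z w"
    by (rule evaluation_kernel[OF K(2), of "Closed_disc (-1)" "f (-1)"]) (rule that, assumption+)
  have 0: "weak_kernel (\<lambda>z w. 0 :: 'l \<Rightarrow>\<^sub>C\<^sub>L 'l)"
    by (rule weak_kernelI) (simp add: psd_def)
  have "G z w = \<xi> z w *\<^sub>V (const_bcontfun 1 - times_cnj (J_map z) (J_map w))
      + (\<eta>1 z w + \<eta>2 z w) *\<^sub>V (const_bcontfun 1 - times_cnj (j_map z) (j_map w))
      + (1 - coord2 z * cnj (coord2 w) / 4) *\<^sub>C 0" if zw: "z \<in> pentablock" "w \<in> pentablock" for z w
    unfolding eq[OF zw] Phi_average[OF zw]
    by (simp add: \<xi>(2) \<eta>1(2) \<eta>2(2) cblinfun_add_left minus_bcontfun.rep_eq times_cnj.rep_eq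
        const_bcontfun.rep_eq
        J_map_apply j_map_apply zw val psi_zero f_def scaleC_add_left s2 ac_simps)
  then show ?thesis
    by (intro exI[of _ \<xi>] exI[of _ "\<lambda>z w. \<eta>1 z w + \<eta>2 z w"] exI[of _ "\<lambda>_ _. 0"] conjI ballI \<xi>(1)
        cp_kernel_add[OF \<eta>1(1) \<eta>2(1)] 0)
qed

section \<open>Factorization from kernel conditions\<close>

text \<open>Paired with a vector \<open>v\<close>, the equation \<open>A z S z = B z\<close> becomes
  an interpolation condition at \<open>z\<close> with data \<open>adj (A z) v\<close> and
  \<open>adj (B z) v\<close>. All pairs \<open>(z, v)\<close> together recover it, and compactness
  reduces them to finite sets.\<close>

lemma factorization_of_interpolation:
  fixes A :: "complex \<times> complex \<Rightarrow> 'l1::chilbert_space \<Rightarrow>\<^sub>C\<^sub>L 'l2::chilbert_space"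
    and B :: "complex \<times> complex \<Rightarrow> 'l3::chilbert_space \<Rightarrow>\<^sub>C\<^sub>L 'l2"
  assumes fin: "\<And>I. finite I \<Longrightarrow> fst ` I \<subseteq> bidisc \<Longrightarrow>
    \<exists>(S :: complex \<times> complex \<Rightarrow> 'l3 \<Rightarrow>\<^sub>C\<^sub>L 'l1) D. schur_pair S D \<and>
      (\<forall>i\<in>I. \<forall>u. cinner (S (fst i) *\<^sub>V u) (adj (A (fst i)) *\<^sub>V snd i) = cinner u (adj (B (fst i)) *\<^sub>V
          snd i))"
  shows "\<exists>S :: complex \<times> complex \<Rightarrow> 'l3 \<Rightarrow>\<^sub>C\<^sub>L 'l1. S \<in> H_infty \<and> H_infty_norm S \<le> 1 \<and> (\<forall>z\<in>bidisc. A z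
      o\<^sub>C\<^sub>L S z = B z)"
proof -
  define J where "J = {i :: (complex \<times> complex) \<times> 'l2. fst i \<in> bidisc}"
  obtain S :: "complex \<times> complex \<Rightarrow> 'l3 \<Rightarrow>\<^sub>C\<^sub>L 'l1" where S: "S \<in> H_infty" "H_infty_norm S \<le> 1"
    and eq: "\<And>i u. i \<in> J \<Longrightarrow> cinner (S (fst i) *\<^sub>V u) (adj (A (fst i)) *\<^sub>V snd i) = cinner u (adj (B
        (fst i)) *\<^sub>V snd i)"
  proof (rule interpolation_compactness[of J fst "\<lambda>i. adj (A (fst i)) *\<^sub>V snd i" "\<lambda>i. adj (B (fst i))
      *\<^sub>V snd i"])
    show "\<exists>(S :: complex \<times> complex \<Rightarrow> 'l3 \<Rightarrow>\<^sub>C\<^sub>L 'l1) D. schur_pair S D \<and>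
      (\<forall>i\<in>I. \<forall>u. cinner (S (fst i) *\<^sub>V u) (adj (A (fst i)) *\<^sub>V snd i) = cinner u (adj (B (fst i)) *\<^sub>V
          snd i))"
      if "finite I" "I \<subseteq> J" for I
      using fin[OF that(1)] that(2) by (auto simp: J_def)
  qed (auto simp: J_def)
  have "A z o\<^sub>C\<^sub>L S z = B z" if "z \<in> bidisc" for z
  proof (rule cblinfun_eqI, rule cinner_eqI)
    fix u v
    show "cinner ((A z o\<^sub>C\<^sub>L S z) *\<^sub>V u) v = cinner (B z *\<^sub>V u) v"
      using eq[of "(z, v)" u] that by (simp add: J_def cinner_adj)
  qed
  with S show ?thesis by blast
qed

section \<open>Restriction to the trace-zero slice\<close>

definition zero_trace :: "complex \<times> complex \<Rightarrow> complex \<times> complex \<times> complex"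
  where "zero_trace p = (fst p, 0, snd p)"

lemma zero_trace_pentablock: "p \<in> bidisc \<Longrightarrow> zero_trace p \<in> pentablock"
  unfolding zero_trace_def by (rule zero_trace_in_pentablock) (auto simp: bidisc_def)

lemma zero_trace_coords [simp]: "coord13 (zero_trace p) = p" "coord1 (zero_trace p) = fst p"
    "coord2 (zero_trace p) = 0" "coord3 (zero_trace p) = snd p"
  by (simp_all add: zero_trace_def coord13_def)

definition disc_fun :: "(complex \<Rightarrow> complex) \<Rightarrow> closed_disc \<Rightarrow>\<^sub>C complex"
  where "disc_fun g = Bcontfun (\<lambda>\<alpha>. g (disc_val \<alpha>))"

lemma disc_fun_apply: "continuous_on (cball 0 1) g \<Longrightarrow> apply_bcontfun (disc_fun g) \<alpha> = g (disc_val \<alpha>)"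
  unfolding disc_fun_def by (simp add: Bcontfun_inverse bcontfun_disc)

lemma psi_factor_continuous:
  assumes "cmod p < 1"
  shows "continuous_on (cball 0 1) (psi_factor1 p)" "continuous_on (cball 0 1) (psi_factor2 p)"
    "continuous_on (cball 0 1) (psi_factor3 p)"
  unfolding psi_factor1_def[abs_def] psi_factor2_def[abs_def] psi_factor3_def[abs_def]
  using psi_denominator[OF assms] by (auto intro!: continuous_intros)

lemma weak_kernel_of_cp:
  assumes "cp_kernel \<xi>"
  shows "weak_kernel (\<lambda>z w. \<xi> z w *\<^sub>V times_cnj (g z) (g w))"
  using assms unfolding cp_kernel_def weak_kernel_def by simp

text \<open>On the slice \<open>1 - J cnj J\<close> and \<open>1 - j cnj j\<close> are sums of
  products \<open>g z * cnj (g w)\<close> with the weights \<open>1 - a cnj a'\<close>,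
  \<open>1 - p cnj p'\<close> and 1. Applying \<open>\<xi>\<close> and \<open>\<eta>\<close> and
  sorting by weight gives three weak kernels; \<open>\<delta>\<close> joins the third because
  \<open>coord2\<close> vanishes, and the third is the slack in
  \<open>schur_interpolation\<close>.\<close>

lemma factorization_of_cp_condition:
  fixes A :: "complex \<times> complex \<Rightarrow> 'l1::chilbert_space \<Rightarrow>\<^sub>C\<^sub>L 'l2::chilbert_space"
    and B :: "complex \<times> complex \<Rightarrow> 'l3::chilbert_space \<Rightarrow>\<^sub>C\<^sub>L 'l2"
  assumes \<xi>: "cp_kernel \<xi>" and \<eta>: "cp_kernel \<eta>" and \<delta>: "weak_kernel \<delta>"
    and eq: "\<And>z w. z \<in> pentablock \<Longrightarrow> w \<in> pentablock \<Longrightarrow> factor_gap A B (coord13 z) (coord13 w) =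
      \<xi> z w *\<^sub>V (const_bcontfun 1 - times_cnj (J_map z) (J_map w))
      + \<eta> z w *\<^sub>V (const_bcontfun 1 - times_cnj (j_map z) (j_map w))
      + (1 - coord2 z * cnj (coord2 w) / 4) *\<^sub>C \<delta> z w"
  shows "\<exists>S :: complex \<times> complex \<Rightarrow> 'l3 \<Rightarrow>\<^sub>C\<^sub>L 'l1. S \<in> H_infty \<and> H_infty_norm S \<le> 1 \<and> (\<forall>z\<in>bidisc. A z
      o\<^sub>C\<^sub>L S z = B z)"
proof (rule factorization_of_interpolation)
  fix I :: "((complex \<times> complex) \<times> 'l2) set" assume I: "finite I" "fst ` I \<subseteq> bidisc"
  define f1 f2 f3 where "f1 z = disc_fun (psi_factor1 (coord3 z))"
      and "f2 z = disc_fun (psi_factor2 (coord3 z))"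
    and "f3 z = disc_fun (psi_factor3 (coord3 z))" for z :: "complex \<times> complex \<times> complex"
  define g2 g3 where "g2 z = disc_fun (\<lambda>\<alpha>. \<alpha>)"
      and "g3 z = disc_fun (\<lambda>\<alpha>. complex_of_real (sqrt (1 - (cmod \<alpha>)\<^sup>2)))"
    for z :: "complex \<times> complex \<times> complex"
  define k1 where "k1 z w = \<xi> z w *\<^sub>V times_cnj (f1 z) (f1 w)" for z w
  define k2 where "k2 z w = \<xi> z w *\<^sub>V times_cnj (f2 z) (f2 w) + \<eta> z w *\<^sub>V times_cnj (g2 z) (g2 w)" for z w
  define k3 where "k3 z w = \<xi> z w *\<^sub>V times_cnj (f3 z) (f3 w) + \<eta> z w *\<^sub>V times_cnj (g3 z) (g3 w) + \<delta>
      z w" for z w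
  have k: "weak_kernel k1" "weak_kernel k2" "weak_kernel k3"
    unfolding k1_def[abs_def] k2_def[abs_def] k3_def[abs_def]
    by (intro weak_kernel_add weak_kernel_of_cp \<xi> \<eta> \<delta>)+
  have disc: "cmod (disc_val \<alpha>) \<le> 1" for \<alpha> using disc_val[of \<alpha>] by simp
  have gap: "factor_gap A B p q = (1 - fst p * cnj (fst q)) *\<^sub>C k1 (zero_trace p) (zero_trace q)
      + (1 - snd p * cnj (snd q)) *\<^sub>C k2 (zero_trace p) (zero_trace q) + k3 (zero_trace p) (zero_trace q)"
    if pq: "p \<in> bidisc" "q \<in> bidisc" for p q
  proof -
    define z w where "z = zero_trace p" and "w = zero_trace q"
    have zw: "z \<in> pentablock" "w \<in> pentablock" using pq
        by (simp_all add: z_def w_def zero_trace_pentablock)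
    have zc: "coord3 z = snd p" "coord3 w = snd q" by (simp_all add: z_def w_def)
    have pq1: "cmod (snd p) < 1" "cmod (snd q) < 1" using pq by (auto simp: bidisc_def)
    have J: "const_bcontfun 1 - times_cnj (J_map z) (J_map w) = (1 - fst p * cnj (fst q)) *\<^sub>C
        times_cnj (f1 z) (f1 w)
        + (1 - snd p * cnj (snd q)) *\<^sub>C times_cnj (f2 z) (f2 w) + times_cnj (f3 z) (f3 w)"
    proof (rule bcontfun_eqI)
      fix \<alpha>
      show "apply_bcontfun (const_bcontfun 1 - times_cnj (J_map z) (J_map w)) \<alpha> =
        apply_bcontfun ((1 - fst p * cnj (fst q)) *\<^sub>C times_cnj (f1 z) (f1 w)
        + (1 - snd p * cnj (snd q)) *\<^sub>C times_cnj (f2 z) (f2 w) + times_cnj (f3 z) (f3 w)) \<alpha>"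
        using psi_decomposition[OF pq1 disc, of \<alpha> "fst p" "fst q"]
        by (simp add: minus_bcontfun.rep_eq plus_bcontfun.rep_eq times_cnj.rep_eq
            const_bcontfun.rep_eq scaleC_bcontfun.rep_eq
          scaleC_complex_def J_map_apply zw f1_def f2_def f3_def disc_fun_apply
              psi_factor_continuous zc pq1)
          (simp add: z_def w_def zero_trace_def)
    qed
    have j: "const_bcontfun 1 - times_cnj (j_map z) (j_map w) =
        (1 - snd p * cnj (snd q)) *\<^sub>C times_cnj (g2 z) (g2 w) + times_cnj (g3 z) (g3 w)"
    proof (rule bcontfun_eqI)
      fix \<alpha>
      have c: "continuous_on (cball 0 1) (\<lambda>\<alpha>::complex. \<alpha>)" "continuous_on (cball 0 1) (\<lambda>\<alpha>.
          complex_of_real (sqrt (1 - (cmod \<alpha>)\<^sup>2)))"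
        by (intro continuous_intros)+
      show "apply_bcontfun (const_bcontfun 1 - times_cnj (j_map z) (j_map w)) \<alpha> =
        apply_bcontfun ((1 - snd p * cnj (snd q)) *\<^sub>C times_cnj (g2 z) (g2 w) + times_cnj (g3 z) (g3
            w)) \<alpha>"
        using Phi_decomposition[OF disc, of \<alpha> "snd p" "snd q"]
        by (simp add: minus_bcontfun.rep_eq plus_bcontfun.rep_eq times_cnj.rep_eq
            const_bcontfun.rep_eq scaleC_bcontfun.rep_eq
          scaleC_complex_def j_map_apply[OF zw(1)] j_map_apply[OF zw(2)] g2_def g3_def
              disc_fun_apply[OF c(1)] disc_fun_apply[OF c(2)])
          (simp add: z_def w_def)
    qed
    have "factor_gap A B p q = \<xi> z w *\<^sub>V (const_bcontfun 1 - times_cnj (J_map z) (J_map w))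
      + \<eta> z w *\<^sub>V (const_bcontfun 1 - times_cnj (j_map z) (j_map w)) + \<delta> z w"
      using eq[OF zw] by (simp add: z_def w_def)
    then show ?thesis
      unfolding J j k1_def k2_def k3_def z_def[symmetric] w_def[symmetric]
      by (simp add: cblinfun_add cblinfun_scaleC scaleC_add_right)
  qed
  obtain S D where "schur_pair (S :: complex \<times> complex \<Rightarrow> 'l3 \<Rightarrow>\<^sub>C\<^sub>L 'l1) D"
    "\<And>i u. i \<in> I \<Longrightarrow> cinner (S (fst i) *\<^sub>V u) (adj (A (fst i)) *\<^sub>V snd i) = cinner u (adj (B (fst i)) *\<^sub>V
        snd i)"
  proof (rule schur_interpolation[OF I(1), of fst
        "\<lambda>i j. cinner (k1 (zero_trace (fst j)) (zero_trace (fst i)) *\<^sub>V snd i) (snd j)"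
        "\<lambda>i j. cinner (k2 (zero_trace (fst j)) (zero_trace (fst i)) *\<^sub>V snd i) (snd j)"
        "\<lambda>i j. cinner (k3 (zero_trace (fst j)) (zero_trace (fst i)) *\<^sub>V snd i) (snd j)"
        "\<lambda>i. adj (A (fst i)) *\<^sub>V snd i" "\<lambda>i. adj (B (fst i)) *\<^sub>V snd i"])
    have zt: "zero_trace (fst i) \<in> pentablock" if "i \<in> I" for i using I(2) that
        by (auto intro: zero_trace_pentablock)
    show "psd I (\<lambda>i j. cinner (k1 (zero_trace (fst j)) (zero_trace (fst i)) *\<^sub>V snd i) (snd j))"
      "psd I (\<lambda>i j. cinner (k2 (zero_trace (fst j)) (zero_trace (fst i)) *\<^sub>V snd i) (snd j))"
      "psd I (\<lambda>i j. cinner (k3 (zero_trace (fst j)) (zero_trace (fst i)) *\<^sub>V snd i) (snd j))"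
      by (intro weak_kernel_psd[where z = "\<lambda>i. zero_trace (fst i)"] k I(1) zt; assumption)+
    fix i j assume "i \<in> I" "j \<in> I"
    then have ij: "fst i \<in> bidisc" "fst j \<in> bidisc" using I(2) by auto
    show "cinner (adj (A (fst i)) *\<^sub>V snd i) (adj (A (fst j)) *\<^sub>V snd j) - cinner (adj (B (fst i)) *\<^sub>V
        snd i) (adj (B (fst j)) *\<^sub>V snd j) =
      (1 - cnj (fst (fst i)) * fst (fst j)) * cinner (k1 (zero_trace (fst j)) (zero_trace (fst i))
          *\<^sub>V snd i) (snd j)
      + (1 - cnj (snd (fst i)) * snd (fst j)) * cinner (k2 (zero_trace (fst j)) (zero_trace (fst i))
          *\<^sub>V snd i) (snd j)
      + cinner (k3 (zero_trace (fst j)) (zero_trace (fst i)) *\<^sub>V snd i) (snd j)"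
      unfolding cinner_factor_gap[symmetric] gap[OF ij(2,1)]
      by (simp add: cblinfun_add_left cblinfun_scaleC_left cinner_add_left cinner_scaleC_left
          mult.commute)
  qed (use I(2) in blast)+
  then show "\<exists>(S :: complex \<times> complex \<Rightarrow> 'l3 \<Rightarrow>\<^sub>C\<^sub>L 'l1) D. schur_pair S D \<and>
      (\<forall>i\<in>I. \<forall>u. cinner (S (fst i) *\<^sub>V u) (adj (A (fst i)) *\<^sub>V snd i) = cinner u (adj (B (fst i)) *\<^sub>V
          snd i))"
    by blast
qed

section \<open>Admissible kernels separate the cone of decomposable kernels\<close>

type_synonym point = "complex \<times> complex \<times> complex"

text \<open>Turns a scalar matrix indexed by points and basis vectors into an operator kernel, with
  \<open>(w, l)\<close> as input and \<open>(z, k)\<close> as output index. The multiple of the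
  identity at \<open>z = w\<close> is what will make the kernel nonzero at every point.\<close>

lemma finite_rank_kernel:
  fixes e :: "nat \<Rightarrow> 'l::complex_inner" and \<kappa> :: "'p \<times> nat \<Rightarrow> 'p \<times> nat \<Rightarrow> complex"
  obtains T :: "'p \<Rightarrow> 'p \<Rightarrow> 'l \<Rightarrow>\<^sub>C\<^sub>L 'l" where
    "\<And>z w v. T z w *\<^sub>V v = (\<Sum>k<n. \<Sum>l<n. (\<kappa> (w, l) (z, k) * cinner v (e l)) *\<^sub>C e k) + (if z = w then c
        *\<^sub>C v else 0)"
proof -
  have "\<exists>T :: 'l \<Rightarrow>\<^sub>C\<^sub>L 'l. \<forall>v. T *\<^sub>V v =
      (\<Sum>k<n. \<Sum>l<n. (\<kappa> (w, l) (z, k) * cinner v (e l)) *\<^sub>C e k) + (if z = w then c *\<^sub>C v else 0)" for z w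
  proof (rule cblinfun_of_fun[of "\<lambda>v. (\<Sum>k<n. \<Sum>l<n. (\<kappa> (w, l) (z, k) * cinner v (e l)) *\<^sub>C e k) + (if
      z = w then c *\<^sub>C v else 0)"
        "(\<Sum>k<n. \<Sum>l<n. cmod (\<kappa> (w, l) (z, k)) * norm (e l) * norm (e k)) + cmod c"])
    fix u v :: 'l and a
    show "(\<Sum>k<n. \<Sum>l<n. (\<kappa> (w, l) (z, k) * cinner (u + v) (e l)) *\<^sub>C e k) + (if z = w then c *\<^sub>C (u +
        v) else 0) =
      (\<Sum>k<n. \<Sum>l<n. (\<kappa> (w, l) (z, k) * cinner u (e l)) *\<^sub>C e k) + (if z = w then c *\<^sub>C u else 0)
      + ((\<Sum>k<n. \<Sum>l<n. (\<kappa> (w, l) (z, k) * cinner v (e l)) *\<^sub>C e k) + (if z = w then c *\<^sub>C v else 0))"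
      by (simp add: cinner_add_left distrib_left scaleC_add_left scaleC_add_right sum.distrib)
    show "(\<Sum>k<n. \<Sum>l<n. (\<kappa> (w, l) (z, k) * cinner (a *\<^sub>C u) (e l)) *\<^sub>C e k) + (if z = w then c *\<^sub>C (a *\<^sub>C
        u) else 0) =
      a *\<^sub>C ((\<Sum>k<n. \<Sum>l<n. (\<kappa> (w, l) (z, k) * cinner u (e l)) *\<^sub>C e k) + (if z = w then c *\<^sub>C u else 0))"
      by (simp add: cinner_scaleC_left scaleC_add_right scaleC_sum_right scaleC_scaleC ac_simps)
    have "norm (\<Sum>k<n. \<Sum>l<n. (\<kappa> (w, l) (z, k) * cinner u (e l)) *\<^sub>C e k)
        \<le> (\<Sum>k<n. \<Sum>l<n. cmod (\<kappa> (w, l) (z, k)) * norm (e l) * norm (e k) * norm u)"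
    proof (intro norm_sum[THEN order_trans] sum_mono)
      fix k l
      have "cmod (\<kappa> (w, l) (z, k)) * norm (e k) * cmod (cinner u (e l)) \<le> cmod (\<kappa> (w, l) (z, k)) *
          norm (e k) * (norm u * norm (e l))"
        by (intro mult_left_mono Cauchy_Schwarz_cinner) simp
      then show "norm ((\<kappa> (w, l) (z, k) * cinner u (e l)) *\<^sub>C e k) \<le> cmod (\<kappa> (w, l) (z, k)) * norm (e
          l) * norm (e k) * norm u"
        by (simp add: norm_scaleC norm_mult ac_simps)
    qed
    moreover have "norm (if z = w then c *\<^sub>C u else 0) \<le> cmod c * norm u" by (simp add: norm_scaleC)
    ultimately show "norm ((\<Sum>k<n. \<Sum>l<n. (\<kappa> (w, l) (z, k) * cinner u (e l)) *\<^sub>C e k) + (if z = w then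
        c *\<^sub>C u else 0))
      \<le> ((\<Sum>k<n. \<Sum>l<n. cmod (\<kappa> (w, l) (z, k)) * norm (e l) * norm (e k)) + cmod c) * norm u"
      unfolding distrib_right sum_distrib_right by (intro norm_triangle_le add_mono)
  qed ((intro add_nonneg_nonneg sum_nonneg mult_nonneg_nonneg norm_ge_zero; fail) | meson)+
  then have "\<exists>T :: 'p \<Rightarrow> 'p \<Rightarrow> 'l \<Rightarrow>\<^sub>C\<^sub>L 'l. \<forall>z w v. T z w *\<^sub>V v =
      (\<Sum>k<n. \<Sum>l<n. (\<kappa> (w, l) (z, k) * cinner v (e l)) *\<^sub>C e k) + (if z = w then c *\<^sub>C v else 0)"
    by (intro choice allI)
  then show thesis by (elim exE) (rule that, elim allE, assumption)
qed

text \<open>The weighted kernel is a sum of two Gram matrices. The first comes from Gram vectors of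
  \<open>\<omega> \<kappa>\<close> on the finite set; the second stores each \<open>v i\<close> in
  the coordinate belonging to \<open>z i\<close>, so that different points are orthogonal and
  repeated points interact correctly.\<close>

lemma weak_kernel_finite_rank:
  fixes n :: nat and T :: "point \<Rightarrow> point \<Rightarrow> 'l::complex_inner \<Rightarrow>\<^sub>C\<^sub>L 'l"
  assumes T: "\<And>z w v. T z w *\<^sub>V v = (\<Sum>k<n. \<Sum>l<n. (\<kappa> (w, l) (z, k) * cinner v (e l)) *\<^sub>C e k)
      + (if z = w then complex_of_real \<epsilon> *\<^sub>C v else 0)"
    and \<epsilon>: "0 \<le> \<epsilon>" and F: "finite F" and supp: "\<And>z w k l. z \<notin> F \<or> w \<notin> F \<Longrightarrow> \<kappa> (z, k) (w, l) = 0"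
    and psd: "psd (F \<times> {..<n}) (\<lambda>i j. \<omega> (fst i) (fst j) * \<kappa> i j)"
    and pos: "\<And>z. z \<in> pentablock \<Longrightarrow> \<omega> z z \<in> \<real>\<^sub>\<ge>\<^sub>0"
  shows "weak_kernel (\<lambda>z w. \<omega> w z *\<^sub>C T z w)"
proof (rule weak_kernelI)
  fix N :: nat and z :: "nat \<Rightarrow> point" and v :: "nat \<Rightarrow> 'l" assume z: "\<And>i. i < N \<Longrightarrow> z i \<in> pentablock"
  have fin: "finite (F \<times> {..<n})" using F by simp
  obtain g :: "point \<times> nat \<Rightarrow> (point \<times> nat, complex) ell2"
    where g: "\<And>i j. i \<in> F \<times> {..<n} \<Longrightarrow> j \<in> F \<times> {..<n} \<Longrightarrow> cinner (g i) (g j) = \<omega> (fst i) (fst j) * \<kappa> i j"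
    using psd_Gram[OF fin psd] by blast
  define G where "G i = (if z i \<in> F then \<Sum>l<n. cinner (v i) (e l) *\<^sub>C g (z i, l) else 0)" for i
  define h where "h i = ell2_single (z i) (complex_of_real (sqrt (\<epsilon> * Re (\<omega> (z i) (z i)))) *\<^sub>C v i)" for i
  have rank: "cinner (\<Sum>k<n. \<Sum>l<n. (\<kappa> (z i, l) (z j, k) * cinner (v i) (e l)) *\<^sub>C e k) (v j)
      = (\<Sum>k<n. \<Sum>l<n. \<kappa> (z i, l) (z j, k) * cinner (v i) (e l) * cnj (cinner (v j) (e k)))" for i j
    unfolding cinner_sum_left cinner_scaleC_left by (subst cinner_commute[of "v j"]) simp
  have G: "cinner (G i) (G j) = \<omega> (z i) (z j) * cinner (\<Sum>k<n. \<Sum>l<n. (\<kappa> (z i, l) (z j, k) * cinner (v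
      i) (e l)) *\<^sub>C e k) (v j)" for i j
  proof (cases "z i \<in> F \<and> z j \<in> F")
    case True
    then have "cinner (G i) (G j) = (\<Sum>k<n. \<Sum>l<n. cnj (cinner (v j) (e k)) * (cinner (v i) (e l) *
        cinner (g (z i, l)) (g (z j, k))))"
      unfolding G_def by (simp add: cinner_sum_left cinner_sum_right cinner_scaleC_left
          cinner_scaleC_right sum_distrib_left)
    also have "\<dots> = (\<Sum>k<n. \<Sum>l<n. cnj (cinner (v j) (e k)) * (cinner (v i) (e l) * (\<omega> (z i) (z j) * \<kappa>
        (z i, l) (z j, k))))"
      using True by (intro sum.cong refl) (simp add: g)
    finally show ?thesis unfolding rank sum_distrib_left by (simp add: ac_simps)
  next
    case False
    then have "\<kappa> (z i, l) (z j, k) = 0" for k l using supp by blast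
    then show ?thesis using False by (auto simp: G_def)
  qed
  have h: "cinner (h i) (h j) = \<omega> (z i) (z j) * cinner (if z j = z i then complex_of_real \<epsilon> *\<^sub>C v i
      else 0) (v j)" if iN: "i < N" for i j
  proof (cases "z i = z j")
    case True
    obtain r where r: "\<omega> (z j) (z j) = complex_of_real r" "0 \<le> r" using pos[OF z[OF iN]] True
        by (auto elim: nonneg_Reals_cases)
    have s: "complex_of_real (sqrt (\<epsilon> * r)) * complex_of_real (sqrt (\<epsilon> * r)) = complex_of_real (\<epsilon> * r)"
      using \<epsilon> r(2) by (simp only: of_real_mult[symmetric]) simp
    have "cinner (h i) (h j) = complex_of_real (sqrt (\<epsilon> * r)) * complex_of_real (sqrt (\<epsilon> * r)) *
        cinner (v i) (v j)"
      unfolding h_def cinner_ell2_single by (simp add: ell2_single.rep_eq True r cinner_scaleC_left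
          cinner_scaleC_right)
    then show ?thesis unfolding s by (simp add: True r cinner_scaleC_left)
  next
    case False
    then show ?thesis by (simp add: h_def cinner_ell2_single ell2_single.rep_eq) 
  qed
  have "psd {..<N} (\<lambda>i j. cinner (G i) (G j) + cinner (h i) (h j))"
    by (intro psd_add psd_Gram_matrix)
  moreover have "cinner (G i) (G j) + cinner (h i) (h j) = cinner ((\<omega> (z i) (z j) *\<^sub>C T (z j) (z i))
      *\<^sub>V v i) (v j)" if "i < N" for i j
    unfolding G h[OF that] cblinfun_scaleC_left T cinner_scaleC_left cinner_add_left
        by (rule distrib_left[symmetric])
  ultimately show "psd {..<N} (\<lambda>i j. cinner ((\<omega> (z i) (z j) *\<^sub>C T (z j) (z i)) *\<^sub>V v i) (v j))"
    by (subst (asm) psd_cong) auto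
qed

text \<open>On the slice every test function decomposes into the three given positive weights, so
  positivity for all \<open>\<alpha>\<close> follows from three conditions. Off \<open>F\<close>
  only the diagonal term is left, and there it suffices that the test functions have modulus at most
  1 on the whole pentablock.\<close>

lemma admissible_finite_rank:
  fixes T :: "point \<Rightarrow> point \<Rightarrow> 'l::complex_inner \<Rightarrow>\<^sub>C\<^sub>L 'l"
  assumes T: "\<And>z w v. T z w *\<^sub>V v = (\<Sum>k<n. \<Sum>l<n. (\<kappa> (w, l) (z, k) * cinner v (e l)) *\<^sub>C e k)
      + (if z = w then complex_of_real \<epsilon> *\<^sub>C v else 0)"
    and e: "orthonormal n e" "0 < n"
    and \<epsilon>: "0 < \<epsilon>" and F: "finite F" "F \<subseteq> zero_trace ` bidisc"
    and supp: "\<And>z w k l. z \<notin> F \<or> w \<notin> F \<Longrightarrow> \<kappa> (z, k) (w, l) = 0"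
    and psd: "psd (F \<times> {..<n}) (\<lambda>i j. (1 - cnj (coord1 (fst i)) * coord1 (fst j)) * \<kappa> i j)"
      "psd (F \<times> {..<n}) (\<lambda>i j. (1 - cnj (coord3 (fst i)) * coord3 (fst j)) * \<kappa> i j)" "psd (F \<times> {..<n}) \<kappa>"
  shows "admissible_kernel T"
proof -
  have fin: "finite (F \<times> {..<n})" using F by simp
  have zt: "z = zero_trace (coord13 z)" "coord2 z = 0" "z = (coord1 z, 0, coord3 z)" "cmod (coord3
      z) < 1" if "z \<in> F" for z
    using that F(2) by (auto simp: zero_trace_def coord13_def bidisc_def)
  have weak: "weak_kernel (\<lambda>z w. \<omega> w z *\<^sub>C T z w)"
    if "psd (F \<times> {..<n}) (\<lambda>i j. \<omega> (fst i) (fst j) * \<kappa> i j)" "\<And>z. z \<in> pentablock \<Longrightarrow> \<omega> z z \<in> \<real>\<^sub>\<ge>\<^sub>0" for \<omega>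
    by (rule weak_kernel_finite_rank[OF T _ F(1) supp that]) (use \<epsilon> in auto)
  have pos: "1 - f * cnj f \<in> \<real>\<^sub>\<ge>\<^sub>0" if "cmod f \<le> 1" for f
  proof -
    have "1 - f * cnj f = complex_of_real (1 - (cmod f)\<^sup>2)"
        by (simp only: of_real_diff of_real_1 complex_norm_square)
    moreover have "0 \<le> 1 - (cmod f)\<^sup>2" using that by (simp add: power_le_one)
    ultimately show ?thesis by (simp only: nonneg_Reals_of_real_iff)
  qed
  have "weak_kernel (\<lambda>z w. 1 *\<^sub>C T z w)" by (rule weak) (use psd(3) in auto)
  moreover have "T z z \<noteq> 0" if "z \<in> pentablock" for z
  proof -
    have e0: "cinner (e l) (e k) = (if l = k then 1 else 0)" if "l < n" "k < n" for k l
      using e(1) that by (simp add: orthonormal_def)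
    have "cinner (T z z *\<^sub>V e 0) (e 0) = (\<Sum>k<n. \<Sum>l<n. if k = 0 \<and> l = 0 then \<kappa> (z, 0) (z, 0) else 0) +
        complex_of_real \<epsilon>"
      unfolding T cinner_add_left cinner_sum_left cinner_scaleC_left
      using e(2) by (intro arg_cong2[where f = plus] sum.cong refl) (auto simp: e0 cinner_scaleC_left)
    also have "(\<Sum>k<n. \<Sum>l<n. if k = 0 \<and> l = 0 then \<kappa> (z, 0) (z, 0) else 0) = (\<Sum>k<n. if k = 0 then \<kappa>
        (z, 0) (z, 0) else 0)"
      using e(2) by (intro sum.cong refl) simp
    also have "\<dots> = \<kappa> (z, 0) (z, 0)" using e(2) by simp
    finally have "cinner (T z z *\<^sub>V e 0) (e 0) = \<kappa> (z, 0) (z, 0) + complex_of_real \<epsilon>" .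
    moreover have "0 \<le> Re (\<kappa> (z, 0) (z, 0))"
    proof (cases "z \<in> F")
      case True
      then show ?thesis using psd_diag[OF psd(3) _ fin, of "(z, 0)"] e(2)
          by (auto elim: nonneg_Reals_cases)
    qed (simp add: supp)
    ultimately have "0 < Re (cinner (T z z *\<^sub>V e 0) (e 0))" using \<epsilon> by simp
    then show ?thesis by (intro notI) simp
  qed
  moreover have "weak_kernel (\<lambda>z w. (1 - coord2 z * cnj (coord2 w) / 4) *\<^sub>C T z w)"
  proof (rule weak)
    show "psd (F \<times> {..<n}) (\<lambda>i j. (1 - coord2 (fst j) * cnj (coord2 (fst i)) / 4) * \<kappa> i j)"
      using psd(3) by (subst psd_cong[where L = \<kappa>]) (simp_all add: mem_Times_iff zt(2))
    show "1 - coord2 z * cnj (coord2 z) / 4 \<in> \<real>\<^sub>\<ge>\<^sub>0" if "z \<in> pentablock" for z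
      using pos[of "coord2 z / 2"] pentablock_denominators(2)[OF that, of 0] by (simp add: norm_divide)
  qed
  moreover have "weak_kernel (\<lambda>z w. (1 - Phi \<alpha> (coord2 z) (coord3 z) * cnj (Phi \<alpha> (coord2 w) (coord3
      w))) *\<^sub>C T z w)"
    if \<alpha>: "cmod \<alpha> \<le> 1" for \<alpha>
  proof (rule weak)
    define s where "s = complex_of_real (sqrt (1 - (cmod \<alpha>)\<^sup>2))"
    have "psd (F \<times> {..<n}) (\<lambda>i j. \<alpha> * cnj \<alpha> * ((1 - cnj (coord3 (fst i)) * coord3 (fst j)) * \<kappa> i j)
        + s * cnj s * \<kappa> i j)"
      by (intro psd_add psd_scale psd)
    moreover have "\<alpha> * cnj \<alpha> * ((1 - cnj (coord3 z) * coord3 w) * c) + s * cnj s * c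
      = (1 - Phi \<alpha> (coord2 w) (coord3 w) * cnj (Phi \<alpha> (coord2 z) (coord3 z))) * c" if "z \<in> F" "w \<in>
          F" for z w c
      unfolding zt(2)[OF that(1)] zt(2)[OF that(2)] Phi_decomposition[OF \<alpha>] s_def[symmetric]
      by (simp add: algebra_simps)
    ultimately show "psd (F \<times> {..<n}) (\<lambda>i j. (1 - Phi \<alpha> (coord2 (fst j)) (coord3 (fst j)) *
      cnj (Phi \<alpha> (coord2 (fst i)) (coord3 (fst i)))) * \<kappa> i j)"
      by (subst (asm) psd_cong) (auto simp del: of_real_mult)
    show "1 - Phi \<alpha> (coord2 z) (coord3 z) * cnj (Phi \<alpha> (coord2 z) (coord3 z)) \<in> \<real>\<^sub>\<ge>\<^sub>0"
        if "z \<in> pentablock" for z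
      by (rule pos[OF Phi_le_one[OF that \<alpha>]])
  qed
  moreover have "weak_kernel (\<lambda>z w. (1 - psi \<alpha> z * cnj (psi \<alpha> w)) *\<^sub>C T z w)" if \<alpha>: "cmod \<alpha> \<le> 1" for \<alpha>
  proof (rule weak)
    define f1 f2 f3 where "f1 z = cnj (psi_factor1 (coord3 z) \<alpha>)"
        and "f2 z = cnj (psi_factor2 (coord3 z) \<alpha>)"
      and "f3 z = cnj (psi_factor3 (coord3 z) \<alpha>)" for z :: point
    have "psd (F \<times> {..<n}) (\<lambda>i j. f1 (fst i) * cnj (f1 (fst j)) * ((1 - cnj (coord1 (fst i)) *
        coord1 (fst j)) * \<kappa> i j)
      + f2 (fst i) * cnj (f2 (fst j)) * ((1 - cnj (coord3 (fst i)) * coord3 (fst j)) * \<kappa> i j)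
      + f3 (fst i) * cnj (f3 (fst j)) * \<kappa> i j)"
      by (intro psd_add psd_scale psd)
    moreover have "f1 z * cnj (f1 w) * ((1 - cnj (coord1 z) * coord1 w) * c)
      + f2 z * cnj (f2 w) * ((1 - cnj (coord3 z) * coord3 w) * c)
      + f3 z * cnj (f3 w) * c = (1 - psi \<alpha> w * cnj (psi \<alpha> z)) * c" if "z \<in> F" "w \<in> F" for z w c
    proof -
      have "psi \<alpha> z = psi \<alpha> (coord1 z, 0, coord3 z)" "psi \<alpha> w = psi \<alpha> (coord1 w, 0, coord3 w)"
        using zt(3)[OF that(1)] zt(3)[OF that(2)] by (auto intro: arg_cong)
      then have "1 - psi \<alpha> w * cnj (psi \<alpha> z) = (1 - coord1 w * cnj (coord1 z)) * (cnj (f1 w) * f1 z)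
          + (1 - coord3 w * cnj (coord3 z)) * (cnj (f2 w) * f2 z) + cnj (f3 w) * f3 z"
        using psi_decomposition[OF zt(4)[OF that(2)] zt(4)[OF that(1)] \<alpha>, of "coord1 w" "coord1 z"]
        unfolding f1_def f2_def f3_def complex_cnj_cnj by (simp only:)
      then show ?thesis by (simp only:) (simp add: algebra_simps)
    qed
    ultimately show "psd (F \<times> {..<n}) (\<lambda>i j. (1 - psi \<alpha> (fst j) * cnj (psi \<alpha> (fst i))) * \<kappa> i j)"
      by (subst (asm) psd_cong) auto
    show "1 - psi \<alpha> z * cnj (psi \<alpha> z) \<in> \<real>\<^sub>\<ge>\<^sub>0" if "z \<in> pentablock" for z
      by (rule pos[OF psi_le_one[OF that \<alpha>]])
  qed
  ultimately show ?thesis unfolding admissible_kernel_def by simp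
qed

text \<open>Admissible kernels built from \<open>\<kappa>\<close> test the Gram difference
  \<open>M\<close> against every \<open>\<kappa>\<close> in the dual cone.
  \<open>psd_cone_duality\<close> turns these inequalities into a decomposition of \<open>M\<close>,
  which is the input of \<open>schur_interpolation\<close>.\<close>

lemma factorization_of_kernel_condition:
  fixes A :: "complex \<times> complex \<Rightarrow> 'l1::chilbert_space \<Rightarrow>\<^sub>C\<^sub>L 'l2::chilbert_space"
    and B :: "complex \<times> complex \<Rightarrow> 'l3::chilbert_space \<Rightarrow>\<^sub>C\<^sub>L 'l2"
  assumes cond: "\<And>F (k :: point \<Rightarrow> point \<Rightarrow> 'l2 \<Rightarrow>\<^sub>C\<^sub>L 'l2). finite F \<Longrightarrow> F \<subseteq> pentablock \<Longrightarrow> admissible_kernel k \<Longrightarrow>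
    op_matrix_nonneg F (\<lambda>z w. factor_gap A B (coord13 z) (coord13 w) \<otimes>\<^sub>o k z w)"
  shows "\<exists>S :: complex \<times> complex \<Rightarrow> 'l3 \<Rightarrow>\<^sub>C\<^sub>L 'l1. S \<in> H_infty \<and> H_infty_norm S \<le> 1 \<and> (\<forall>z\<in>bidisc. A z
      o\<^sub>C\<^sub>L S z = B z)"
proof (rule factorization_of_interpolation)
  fix I :: "((complex \<times> complex) \<times> 'l2) set" assume I: "finite I" "fst ` I \<subseteq> bidisc"
  \<comment> \<open>Passing to an orthonormal basis of the span makes the problem one about scalar
    matrices indexed by points and basis vectors; the conditions at the original vectors follow by
    linearity.\<close>
  have "finite (snd ` I)" using I(1) by simp
  from Gram_Schmidt[OF this, of "\<lambda>v. v"] obtain n e where e: "orthonormal n e"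
    and span: "\<And>i. i \<in> I \<Longrightarrow> snd i = (\<Sum>k<n. cinner (snd i) (e k) *\<^sub>C e k)" by blast
  define F where "F = zero_trace ` fst ` I"
  define P where "P = F \<times> {..<n}"
  have F: "finite F" "F \<subseteq> zero_trace ` bidisc" using I by (auto simp: F_def)
  have Fp: "F \<subseteq> pentablock" using F(2) zero_trace_pentablock by blast
  have P: "finite P" using F(1) by (simp add: P_def)
  define x where "x i = adj (A (coord13 (fst i))) *\<^sub>V e (snd i)" for i :: "point \<times> nat"
  define y where "y i = adj (B (coord13 (fst i))) *\<^sub>V e (snd i)" for i :: "point \<times> nat"
  define M where "M i j = cinner (x i) (x j) - cinner (y i) (y j)" for i j
  \<comment> \<open>The constant third weight expresses that the kernel itself is positive; its part
    of the decomposition is the slack \<open>K3\<close>.\<close>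
  define w where "w t i j = (if t = 0 then 1 - cnj (coord1 (fst i)) * coord1 (fst j)
    else if t = 1 then 1 - cnj (coord3 (fst i)) * coord3 (fst j) else 1)" for t :: nat and i j ::
        "point \<times> nat"
  have bid: "coord13 (fst i) \<in> bidisc" if "i \<in> P" for i
    using that F(2) by (auto simp: P_def)
  have wsel: "w 0 i j = 1 - cnj (coord1 (fst i)) * coord1 (fst j)"
    "w 1 i j = 1 - cnj (coord3 (fst i)) * coord3 (fst j)" "w 2 i j = 1" for i j by (simp_all add: w_def)
  obtain K :: "nat \<Rightarrow> point \<times> nat \<Rightarrow> point \<times> nat \<Rightarrow> complex" where K: "\<And>t. psd P (K t)"
    and MK: "\<And>i j. i \<in> P \<Longrightarrow> j \<in> P \<Longrightarrow> M i j = (\<Sum>t\<in>{0,1,2}. w t i j * K t i j)"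
  proof (rule psd_cone_duality[of P "{0, 1, 2}" M w])
    show "M j i = cnj (M i j)" for i j
      by (simp add: M_def cinner_commute[of "x j"] cinner_commute[of "y j"])
    show "w t j i = cnj (w t i j)" for t i j
      by (simp add: w_def mult.commute)
    show "0 < Re (w t i i)" if "i \<in> P" for t i
    proof -
      have r: "Re (1 - cnj u * u) = 1 - (cmod u)\<^sup>2" for u
          by (simp add: cmod_power2 power2_eq_square[of "Re u"] power2_eq_square[of "Im u"])
      show ?thesis
        using one_minus_square_pos[OF bid[OF that]] unfolding coord13_def w_def
            by (simp add: r del: minus_complex.simps)
    qed
    fix \<kappa> assume psd: "\<And>t. t \<in> {0, 1, 2} \<Longrightarrow> psd P (\<lambda>i j. w t i j * \<kappa> i j)"
    show "0 \<le> Re (\<Sum>i\<in>P. \<Sum>j\<in>P. M i j * \<kappa> i j)"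
    proof (cases "n = 0")
      case True
      then show ?thesis by (simp add: P_def)
    next
      case False
      \<comment> \<open>Cut off outside \<open>P\<close>, so that the operator kernel built from it
        is supported on \<open>F\<close> apart from the diagonal perturbation.\<close>
      define \<kappa>' where "\<kappa>' i j = (if i \<in> P \<and> j \<in> P then \<kappa> i j else 0)" for i j
      have psd': "psd P (\<lambda>i j. w t i j * \<kappa>' i j)" if "t \<in> {0, 1, 2}" for t
        using psd[OF that] by (rule psd_cong[THEN iffD1, rotated]) (simp add: \<kappa>'_def)
      define c where "c = Re (\<Sum>i\<in>P. M i i)"
      have pert: "0 \<le> Re (\<Sum>i\<in>P. \<Sum>j\<in>P. M i j * \<kappa> i j) + \<epsilon> * c" if \<epsilon>: "0 < \<epsilon>" for \<epsilon>
      proof -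
        obtain T :: "point \<Rightarrow> point \<Rightarrow> 'l2 \<Rightarrow>\<^sub>C\<^sub>L 'l2" where T: "\<And>z w v. T z w *\<^sub>V v =
          (\<Sum>k<n. \<Sum>l<n. (\<kappa>' (w, l) (z, k) * cinner v (e l)) *\<^sub>C e k) + (if z = w then complex_of_real
              \<epsilon> *\<^sub>C v else 0)"
          by (rule finite_rank_kernel[where n = n and \<kappa> = \<kappa>' and e = e
              and c = "complex_of_real \<epsilon>"]) (rule that, assumption)
        have adm: "admissible_kernel T"
        proof (rule admissible_finite_rank[OF T e _ \<epsilon> F])
          show "\<kappa>' (z, k) (w, l) = 0" if "z \<notin> F \<or> w \<notin> F" for z w k l
            using that by (auto simp: \<kappa>'_def P_def)
          show "psd (F \<times> {..<n}) (\<lambda>i j. (1 - cnj (coord1 (fst i)) * coord1 (fst j)) * \<kappa>' i j)"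
            "psd (F \<times> {..<n}) (\<lambda>i j. (1 - cnj (coord3 (fst i)) * coord3 (fst j)) * \<kappa>' i j)"
            "psd (F \<times> {..<n}) \<kappa>'"
            using psd'[of 0] psd'[of 1] psd'[of 2] by (simp_all only: wsel P_def[symmetric]) simp_all
        qed (use False in simp)
        have e': "cinner (e l) (e k) = (if l = k then 1 else 0)" if "l < n" "k < n" for k l
          using e that by (simp add: orthonormal_def)
        have Tee: "cinner (T z w *\<^sub>V e l) (e k) = \<kappa>' (w, l) (z, k) + (if (w, l) = (z, k) then
            complex_of_real \<epsilon> else 0)"
          if kl: "k < n" "l < n" for z w k l
        proof -
          have "(\<Sum>l'<n. (\<kappa>' (w, l') (z, k') * cinner (e l) (e l')) *\<^sub>C e k') = \<kappa>' (w, l) (z, k') *\<^sub>C e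
              k'" for k'
          proof -
            have "(\<Sum>l'<n. (\<kappa>' (w, l') (z, k') * cinner (e l) (e l')) *\<^sub>C e k') = (\<Sum>l'<n. if l' = l
                then \<kappa>' (w, l) (z, k') *\<^sub>C e k' else 0)"
              using kl by (intro sum.cong refl) (auto simp: e')
            then show ?thesis using kl by simp
          qed
          then show ?thesis
            unfolding T cinner_add_left by (simp add: cinner_orthonormal_sum_left[OF e kl(1)]
                cinner_scaleC_left e' kl)
        qed
        have gap: "cinner (factor_gap A B (coord13 z) (coord13 w) *\<^sub>V e l) (e k) = M (w, l) (z, k)"
            for z w k l
          by (simp add: cinner_factor_gap M_def x_def y_def)
        \<comment> \<open>The same vector is placed at every point. Pairing with it multiplies
          matching entries of the two tensor factors and sums them, which is exactly the pairing of
          \<open>M\<close> with the perturbed \<open>\<kappa>\<close>.\<close>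
        define u where "u = (\<Sum>k<n. e k \<otimes>\<^sub>v e k)"
        have term_eq: "cinner ((factor_gap A B (coord13 z) (coord13 w) \<otimes>\<^sub>o T z w) *\<^sub>V u) u =
          (\<Sum>k<n. \<Sum>l<n. M (w, l) (z, k) * (\<kappa>' (w, l) (z, k) + (if (w, l) = (z, k) then
              complex_of_real \<epsilon> else 0)))" for z w
        proof -
          have "cinner ((factor_gap A B (coord13 z) (coord13 w) \<otimes>\<^sub>o T z w) *\<^sub>V u) u =
            (\<Sum>k<n. \<Sum>l<n. cinner (factor_gap A B (coord13 z) (coord13 w) *\<^sub>V e l) (e k) * cinner (T z
                w *\<^sub>V e l) (e k))"
            unfolding u_def cblinfun_sum tensor_op_vec cinner_sum_right
                unfolding cinner_sum_left cinner_tensor_vec ..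
          also have "\<dots> = (\<Sum>k<n. \<Sum>l<n. M (w, l) (z, k) * (\<kappa>' (w, l) (z, k) + (if (w, l) = (z, k) then
              complex_of_real \<epsilon> else 0)))"
            by (intro sum.cong refl arg_cong2[where f = times] gap Tee) auto
          finally show ?thesis .
        qed
        define Q where "Q i j = M i j * (\<kappa>' i j + (if i = j then complex_of_real \<epsilon> else 0))" for i j
        have pairs: "(\<Sum>i\<in>P. f i) = (\<Sum>z\<in>F. \<Sum>k<n. f (z, k))" for f :: "point \<times> nat \<Rightarrow> complex"
          unfolding P_def by (simp add: sum.cartesian_product)
        have "(\<Sum>z\<in>F. \<Sum>w\<in>F. cinner ((factor_gap A B (coord13 z) (coord13 w) \<otimes>\<^sub>o T z w) *\<^sub>V u) u)
          = (\<Sum>z\<in>F. \<Sum>w\<in>F. \<Sum>k<n. \<Sum>l<n. Q (w, l) (z, k))"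
          unfolding term_eq Q_def ..
        also have "\<dots> = (\<Sum>z\<in>F. \<Sum>k<n. \<Sum>w\<in>F. \<Sum>l<n. Q (w, l) (z, k))"
          by (intro sum.cong refl sum.swap)
        also have "\<dots> = (\<Sum>j\<in>P. \<Sum>i\<in>P. Q i j)" unfolding pairs ..
        also have "\<dots> = (\<Sum>i\<in>P. \<Sum>j\<in>P. Q i j)" by (rule sum.swap)
        also have "\<dots> = (\<Sum>i\<in>P. (\<Sum>j\<in>P. M i j * \<kappa> i j) + complex_of_real \<epsilon> * M i i)"
        proof (intro sum.cong refl)
          fix i assume i: "i \<in> P"
          have "(\<Sum>j\<in>P. Q i j) = (\<Sum>j\<in>P. M i j * \<kappa> i j + (if j = i then complex_of_real \<epsilon> * M i i else 0))"
            using i by (intro sum.cong refl) (auto simp: Q_def \<kappa>'_def distrib_left)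
          then show "(\<Sum>j\<in>P. Q i j) = (\<Sum>j\<in>P. M i j * \<kappa> i j) + complex_of_real \<epsilon> * M i i"
            using i P by (simp add: sum.distrib)
        qed
        also have "\<dots> = (\<Sum>i\<in>P. \<Sum>j\<in>P. M i j * \<kappa> i j) + complex_of_real \<epsilon> * (\<Sum>i\<in>P. M i i)"
          by (simp add: sum.distrib sum_distrib_left)
        finally have "(\<Sum>i\<in>P. \<Sum>j\<in>P. M i j * \<kappa> i j) + complex_of_real \<epsilon> * (\<Sum>i\<in>P. M i i) \<in> \<real>\<^sub>\<ge>\<^sub>0"
          using cond[OF F(1) Fp adm, unfolded op_matrix_nonneg_def, rule_format, of "\<lambda>_. u"] by simp
        then have "0 \<le> Re ((\<Sum>i\<in>P. \<Sum>j\<in>P. M i j * \<kappa> i j) + complex_of_real \<epsilon> * (\<Sum>i\<in>P. M i i))"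
          by (elim nonneg_Reals_cases) simp
        then show ?thesis by (simp add: c_def)
      qed
      show ?thesis
      proof (rule field_le_epsilon)
        fix \<eta> :: real assume \<eta>: "0 < \<eta>"
        \<comment> \<open>This choice of \<open>\<epsilon>\<close> makes the contribution of the
          diagonal perturbation at most \<open>\<eta>\<close>, whatever the sign of
          \<open>c\<close>.\<close>
        have "\<eta> / (\<bar>c\<bar> + 1) * c \<le> \<eta>"
          using \<eta> by (simp add: field_simps mult_mono) (smt (verit) mult_left_mono)
        then show "0 \<le> Re (\<Sum>i\<in>P. \<Sum>j\<in>P. M i j * \<kappa> i j) + \<eta>"
          using pert[of "\<eta> / (\<bar>c\<bar> + 1)"] \<eta> by (smt (verit) divide_pos_pos)
      qed
    qed
  qed ((rule P, simp; fail) | (rule P) | (simp; fail) | meson)+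
  obtain S :: "complex \<times> complex \<Rightarrow> 'l3 \<Rightarrow>\<^sub>C\<^sub>L 'l1" and D where S: "schur_pair S D"
    and Sx: "\<And>i u. i \<in> P \<Longrightarrow> cinner (S (coord13 (fst i)) *\<^sub>V u) (x i) = cinner u (y i)"
  proof (rule schur_interpolation[OF P bid K[of 0] K[of 1] K[of 2], where x = x and y = y])
    show "cinner (x i) (x j) - cinner (y i) (y j) =
      (1 - cnj (fst (coord13 (fst i))) * fst (coord13 (fst j))) * K 0 i j
      + (1 - cnj (snd (coord13 (fst i))) * snd (coord13 (fst j))) * K 1 i j + K 2 i j" if "i \<in> P" "j
          \<in> P" for i j
      using MK[OF that] wsel[of i j] by (simp add: M_def coord13_def)
  qed blast+
  have "cinner (S (fst i) *\<^sub>V u) (adj (A (fst i)) *\<^sub>V snd i) = cinner u (adj (B (fst i)) *\<^sub>V snd i)"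
      if i: "i \<in> I" for i u
  proof -
    have eq: "cinner (S (fst i) *\<^sub>V u) (adj (A (fst i)) *\<^sub>V e k) = cinner u (adj (B (fst i)) *\<^sub>V e k)"
        if "k < n" for k
      using Sx[of "(zero_trace (fst i), k)" u] i that by (simp add: P_def F_def x_def y_def)
    have lin: "cinner a (T *\<^sub>V snd i) = (\<Sum>k<n. cnj (cinner (snd i) (e k)) * cinner a (T *\<^sub>V e k))"
      for T :: "'l2 \<Rightarrow>\<^sub>C\<^sub>L 'b::complex_inner" and a
    proof -
      have "T *\<^sub>V snd i = (\<Sum>k<n. cinner (snd i) (e k) *\<^sub>C (T *\<^sub>V e k))"
        by (subst span[OF i]) (simp only: cblinfun_sum cblinfun_scaleC)
      then show ?thesis by (simp add: cinner_sum_right cinner_scaleC_right)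
    qed
    have "cinner (S (fst i) *\<^sub>V u) (adj (A (fst i)) *\<^sub>V snd i) = (\<Sum>k<n. cnj (cinner (snd i) (e k)) *
        cinner (S (fst i) *\<^sub>V u) (adj (A (fst i)) *\<^sub>V e k))"
      by (rule lin)
    also have "\<dots> = (\<Sum>k<n. cnj (cinner (snd i) (e k)) * cinner u (adj (B (fst i)) *\<^sub>V e k))"
      by (intro sum.cong refl) (simp add: eq)
    also have "\<dots> = cinner u (adj (B (fst i)) *\<^sub>V snd i)" by (rule lin[symmetric])
    finally show ?thesis .
  qed
  with S show "\<exists>(S :: complex \<times> complex \<Rightarrow> 'l3 \<Rightarrow>\<^sub>C\<^sub>L 'l1) D. schur_pair S D \<and>
      (\<forall>i\<in>I. \<forall>u. cinner (S (fst i) *\<^sub>V u) (adj (A (fst i)) *\<^sub>V snd i) = cinner u (adj (B (fst i)) *\<^sub>V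
          snd i))"
    by blast
qed

theorem theorem3p3:
  fixes \<Upsilon>\<^sub>1\<^sub>2 :: "complex \<times> complex \<Rightarrow> 'l1::chilbert_space \<Rightarrow>\<^sub>C\<^sub>L 'l2::chilbert_space"
    and \<Upsilon>\<^sub>3\<^sub>2 :: "complex \<times> complex \<Rightarrow> 'l3::chilbert_space \<Rightarrow>\<^sub>C\<^sub>L 'l2"
  assumes "separable_space (euclidean :: 'l1 topology)"
    and "separable_space (euclidean :: 'l2 topology)"
    and "separable_space (euclidean :: 'l3 topology)"
  shows
    "let
      cond1 = (\<exists>\<Upsilon>\<^sub>3\<^sub>1 :: complex \<times> complex \<Rightarrow> 'l3 \<Rightarrow>\<^sub>C\<^sub>L 'l1.
        \<Upsilon>\<^sub>3\<^sub>1 \<in> H_infty \<and> H_infty_norm \<Upsilon>\<^sub>3\<^sub>1 \<le> 1 \<and>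
        (\<forall>z\<in>bidisc. \<Upsilon>\<^sub>1\<^sub>2 z o\<^sub>C\<^sub>L \<Upsilon>\<^sub>3\<^sub>1 z = \<Upsilon>\<^sub>3\<^sub>2 z));
      cond2 = (\<forall>F. finite F \<and> F \<subseteq> pentablock \<longrightarrow>
        (\<forall>k :: complex \<times> complex \<times> complex \<Rightarrow> complex \<times> complex \<times> complex \<Rightarrow> 'l2 \<Rightarrow>\<^sub>C\<^sub>L 'l2.
          admissible_kernel k \<longrightarrow>
          op_matrix_nonneg F (\<lambda>z w.
            (\<Upsilon>\<^sub>1\<^sub>2 (coord13 z) o\<^sub>C\<^sub>L adj (\<Upsilon>\<^sub>1\<^sub>2 (coord13 w))
              - \<Upsilon>\<^sub>3\<^sub>2 (coord13 z) o\<^sub>C\<^sub>L adj (\<Upsilon>\<^sub>3\<^sub>2 (coord13 w))) \<otimes>\<^sub>o k z w)));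
      cond3 = (\<exists>\<xi> \<eta> \<delta>. cp_kernel \<xi> \<and> cp_kernel \<eta> \<and> weak_kernel \<delta> \<and>
        (\<forall>z\<in>pentablock. \<forall>w\<in>pentablock.
          \<Upsilon>\<^sub>1\<^sub>2 (coord13 z) o\<^sub>C\<^sub>L adj (\<Upsilon>\<^sub>1\<^sub>2 (coord13 w))
            - \<Upsilon>\<^sub>3\<^sub>2 (coord13 z) o\<^sub>C\<^sub>L adj (\<Upsilon>\<^sub>3\<^sub>2 (coord13 w))
          = \<xi> z w *\<^sub>V (const_bcontfun 1 - times_cnj (J_map z) (J_map w))
            + \<eta> z w *\<^sub>V (const_bcontfun 1 - times_cnj (j_map z) (j_map w))
            + (1 - coord2 z * cnj (coord2 w) / 4) *\<^sub>C \<delta> z w))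
    in (cond1 \<longleftrightarrow> cond2) \<and> (cond2 \<longleftrightarrow> cond3)"
proof -
  let ?fact = "\<exists>S :: complex \<times> complex \<Rightarrow> 'l3 \<Rightarrow>\<^sub>C\<^sub>L 'l1. S \<in> H_infty \<and> H_infty_norm S \<le> 1 \<and> (\<forall>z\<in>bidisc.
      \<Upsilon>\<^sub>1\<^sub>2 z o\<^sub>C\<^sub>L S z = \<Upsilon>\<^sub>3\<^sub>2 z)"
  let ?gap = "\<lambda>z w. factor_gap \<Upsilon>\<^sub>1\<^sub>2 \<Upsilon>\<^sub>3\<^sub>2 (coord13 z) (coord13 w)"
  let ?ker = "\<forall>F. finite F \<and> F \<subseteq> pentablock \<longrightarrow> (\<forall>k :: point \<Rightarrow> point \<Rightarrow> 'l2 \<Rightarrow>\<^sub>C\<^sub>L 'l2.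
    admissible_kernel k \<longrightarrow> op_matrix_nonneg F (\<lambda>z w. ?gap z w \<otimes>\<^sub>o k z w))"
  let ?cp = "\<exists>\<xi> \<eta> \<delta>. cp_kernel \<xi> \<and> cp_kernel \<eta> \<and> weak_kernel \<delta> \<and>
    (\<forall>z\<in>pentablock. \<forall>w\<in>pentablock. ?gap z w = \<xi> z w *\<^sub>V (const_bcontfun 1 - times_cnj (J_map z) (J_map w))
      + \<eta> z w *\<^sub>V (const_bcontfun 1 - times_cnj (j_map z) (j_map w)) + (1 - coord2 z * cnj (coord2 w)
          / 4) *\<^sub>C \<delta> z w)"
  \<comment> \<open>A single decomposition with \<open>K1\<close> and \<open>K2\<close> yields both
    kernel conditions; each of them separately leads back to a factorization.\<close>
  have "?ker \<and> ?cp" if fact: ?fact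
  proof -
    obtain S :: "complex \<times> complex \<Rightarrow> 'l3 \<Rightarrow>\<^sub>C\<^sub>L 'l1" where S: "S \<in> H_infty" "H_infty_norm S \<le> 1"
      "\<And>z. z \<in> bidisc \<Longrightarrow> \<Upsilon>\<^sub>1\<^sub>2 z o\<^sub>C\<^sub>L S z = \<Upsilon>\<^sub>3\<^sub>2 z" using fact by blast
    obtain K1 K2 :: "point \<Rightarrow> point \<Rightarrow> 'l2 \<Rightarrow>\<^sub>C\<^sub>L 'l2" where K: "weak_kernel K1" "weak_kernel K2"
      "\<And>z w. z \<in> pentablock \<Longrightarrow> w \<in> pentablock \<Longrightarrow> ?gap z w =
        (1 - coord1 z * cnj (coord1 w)) *\<^sub>C K1 z w + (1 - coord3 z * cnj (coord3 w)) *\<^sub>C K2 z w"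
      by (rule gap_decomposition[OF S]) (assumption, rule that)
    show ?thesis
    proof (intro conjI allI impI)
      show "op_matrix_nonneg F (\<lambda>z w. ?gap z w \<otimes>\<^sub>o k z w)"
          if "finite F \<and> F \<subseteq> pentablock" "admissible_kernel k"
        for F and k :: "point \<Rightarrow> point \<Rightarrow> 'l2 \<Rightarrow>\<^sub>C\<^sub>L 'l2"
        by (rule kernel_condition_of_decomposition[OF K that(2)]) (use that(1) in auto)
      show ?cp by (rule cp_condition_of_decomposition[OF K])
    qed
  qed
  moreover have ?fact if ?ker
    by (rule factorization_of_kernel_condition) (use that in blast)
  moreover have ?fact if ?cp
    using that by (elim exE conjE) (rule factorization_of_cp_condition, assumption+, blast)
  ultimately have "(?fact \<longleftrightarrow> ?ker) \<and> (?ker \<longleftrightarrow> ?cp)" by argo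
  then show ?thesis unfolding Let_def factor_gap_def .
qed

end
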